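(* Let $s\ge 0$ be real, and let $\varphi\in H^s(\mathbb{R}^d)$ and $\widetilde\varphi\in H^{-s}(\mathbb{R}^d)$ have compact supports. Then for every $j\in\mathbb{Z}$ the quasi-projection operator $$Q_j(f)=\sum_{k\in\mathbb{Z}^d}\langle f,\widetilde\varphi_{jk}\rangle\,\varphi_{jk}$$ is well-defined for functions $f\in H^s(\mathbb{R}^d)$ (the series converges unconditionally in $H^s(\mathbb{R}^d)$). If, moreover, for some $n\ge s$ there are constants $C_{\varphi,\widetilde\varphi},C_\varphi>0$ such that for all $\xi\in\mathbb{T}^d$ $$\left|1-\overline{\widehat{\widetilde\varphi}(\xi)}\,\widehat\varphi(\xi)\right|\le C_{\varphi,\widetilde\varphi}|\xi|^n,\qquad \sum_{k\in\mathbb{Z}^d,\,k\neq\mathbf{0}}(1+|\xi+k|^2)^s\,|\widehat\varphi(\xi+k)|^2\le C_\varphi|\xi|^{2n},$$ then for any $f\in H^n(\mathbb{R}^d)$, any $0\le r\le s$ and any $j\in\mathbb{Z}$ $$\left|f-\sum_{k\in\mathbb{Z}^d}\langle f,\widetilde\varphi_{jk}\rangle\varphi_{jk}\right|_{H^r}^2\le C\,\|M^{*j}\|^{2r}\,\|M^{*-j}\|^{2n}\,|f|_{H^n}^2,$$ where $C$ does not depend on $j$ and $f$.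
   Context: $M\in\mathbb{Z}^{d\times d}$ is a fixed dilation matrix, i.e. all its eigenvalues are greater than 1 in modulus; $m=|\det M|$; $M^*$ is its (conjugate) transpose, $M^{*j}=(M^* )^j$, $M^{*-j}=(M^* )^{-j}$, and $\|\cdot\|$ is the operator norm of matrices induced by the Euclidean norm $|\cdot|$. $\mathbf{0}$ is the origin of $\mathbb{R}^d$ and $\mathbb{T}^d=[-\frac12,\frac12)^d$. For a function (or tempered distribution) $g$ on $\mathbb{R}^d$, $g_{jk}(x)=m^{j/2}g(M^jx+k)$, $j\in\mathbb{Z}$, $k\in\mathbb{Z}^d$. The Fourier transform is $\widehat f(\xi)=\int_{\mathbb{R}^d}f(x)e^{-2\pi i(x,\xi)}dx$, extended to tempered distributions. For real $s$, $H^s(\mathbb{R}^d)$ is the space of tempered distributions $f$ with $\|f\|_{H^s}^2=\int_{\mathbb{R}^d}|\widehat f(\xi)|^2(1+|\xi|^2)^s\,d\xi<\infty$. For $f\in H^s(\mathbb{R}^d)$, $g\in H^{-s}(\mathbb{R}^d)$ the pairing is $\langle f,g\rangle=\int_{\mathbb{R}^d}\widehat f(\xi)\overline{\widehat g(\xi)}\,d\xi$. The seminorm is $|f|_{H^r}^2=\int_{\mathbb{R}^d}|\xi|^{2r}|\widehat f(\xi)|^2d\xi$. *)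

theory Defs
  imports "HOL-Analysis.Analysis"
begin

section \<open>Integer dilation matrices\<close>

definition rmat :: "int^'d^'d \<Rightarrow> real^'d^'d" where
  "rmat M = (\<chi> i j. real_of_int (M $ i $ j))"

definition cmat :: "int^'d^'d \<Rightarrow> complex^'d^'d" where
  "cmat M = (\<chi> i j. complex_of_int (M $ i $ j))"

definition rvec :: "int^'d \<Rightarrow> real^'d" where
  "rvec k = (\<chi> i. real_of_int (k $ i))"

definition dilation_matrix :: "int^'d^'d \<Rightarrow> bool" where
  "dilation_matrix M \<longleftrightarrow>
     (\<forall>c v. v \<noteq> 0 \<and> cmat M *v v = c *s v \<longrightarrow> cmod c > 1)"

text \<open>The class power on vectors is componentwise, hence a separate matrix power.\<close>

primrec mat_pow :: "real^'d^'d \<Rightarrow> nat \<Rightarrow> real^'d^'d" where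
  "mat_pow A 0 = mat 1"
| "mat_pow A (Suc n) = A ** mat_pow A n"

definition mat_powi :: "real^'d^'d \<Rightarrow> int \<Rightarrow> real^'d^'d" where
  "mat_powi A j = (if j \<ge> 0 then mat_pow A (nat j) else mat_pow (matrix_inv A) (nat (- j)))"

definition mat_opnorm :: "real^'d^'d \<Rightarrow> real" where
  "mat_opnorm A = onorm (\<lambda>x. A *v x)"

text \<open>Real powers of a nonnegative base with \<open>x\<^sup>0 = 1\<close> also for \<open>x = 0\<close>, whereas \<open>0 powr 0 = 0\<close>.\<close>

definition rpow :: "real \<Rightarrow> real \<Rightarrow> real" where
  "rpow x a = (if a = 0 then 1 else x powr a)"

definition torus :: "(real^'d) set" where
  "torus = {\<xi>. \<forall>i. - 1/2 \<le> \<xi> $ i \<and> \<xi> $ i < 1/2}"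

section \<open>Schwartz functions\<close>

definition pdiff :: "'d \<Rightarrow> (real^'d \<Rightarrow> complex) \<Rightarrow> real^'d \<Rightarrow> complex" where
  "pdiff i f = (\<lambda>x. frechet_derivative f (at x) (axis i 1))"

definition pdiffs :: "'d list \<Rightarrow> (real^'d \<Rightarrow> complex) \<Rightarrow> real^'d \<Rightarrow> complex" where
  "pdiffs is f = foldr pdiff is f"

definition smooth :: "(real^'d \<Rightarrow> complex) \<Rightarrow> bool" where
  "smooth f \<longleftrightarrow> (\<forall>is x. pdiffs is f differentiable (at x))"

definition schwartz :: "(real^'d \<Rightarrow> complex) \<Rightarrow> bool" where
  "schwartz f \<longleftrightarrow>
     smooth f \<and> (\<forall>is N. bounded (range (\<lambda>x. (1 + norm x) ^ N *\<^sub>R pdiffs is f x)))"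

text \<open>Only meant for Schwartz functions, where the supremum is that of a bounded set.\<close>

definition schwartz_norm :: "nat \<Rightarrow> (real^'d \<Rightarrow> complex) \<Rightarrow> real" where
  "schwartz_norm N f =
     (SUP (is, x) \<in> {is. length is \<le> N} \<times> UNIV. (1 + norm x) ^ N * cmod (pdiffs is f x))"

definition fourier :: "(real^'d \<Rightarrow> complex) \<Rightarrow> real^'d \<Rightarrow> complex" where
  "fourier f \<xi> = (LINT x|lborel. f x * exp (- 2 * pi * \<i> * complex_of_real (x \<bullet> \<xi>)))"

section \<open>Tempered distributions\<close>

text \<open>
  A tempered distribution is a continuous linear functional on the Schwartz functions. It is
  represented by its extension by 0 to all functions, so that equality of distributions is
  equality in HOL.
\<close>

type_synonym 'd distribution = "(real^'d \<Rightarrow> complex) \<Rightarrow> complex"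

definition tempered :: "('d::finite) distribution \<Rightarrow> bool" where
  "tempered T \<longleftrightarrow>
     (\<forall>\<psi>. \<not> schwartz \<psi> \<longrightarrow> T \<psi> = 0) \<and>
     (\<forall>\<psi> \<eta>. schwartz \<psi> \<longrightarrow> schwartz \<eta> \<longrightarrow> T (\<lambda>x. \<psi> x + \<eta> x) = T \<psi> + T \<eta>) \<and>
     (\<forall>c \<psi>. schwartz \<psi> \<longrightarrow> T (\<lambda>x. c * \<psi> x) = c * T \<psi>) \<and>
     (\<exists>C N. \<forall>\<psi>. schwartz \<psi> \<longrightarrow> cmod (T \<psi>) \<le> C * schwartz_norm N \<psi>)"

text \<open>
  The support is the complement of the union of all open sets on which the distribution
  vanishes.
\<close>

definition dist_support :: "('d::finite) distribution \<Rightarrow> (real^'d) set" where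
  "dist_support T =
     - \<Union>{U. open U \<and>
          (\<forall>\<psi>. smooth \<psi> \<and> compact (closure {x. \<psi> x \<noteq> 0}) \<and> closure {x. \<psi> x \<noteq> 0} \<subseteq> U
               \<longrightarrow> T \<psi> = 0)}"

definition fourier_dist :: "('d::finite) distribution \<Rightarrow> 'd distribution" where
  "fourier_dist T = (\<lambda>\<psi>. if schwartz \<psi> then T (fourier \<psi>) else 0)"

text \<open>
  The distribution \<open>g\<^sub>j\<^sub>k(x) = m\<^sup>j\<^sup>/\<^sup>2 g(M\<^sup>jx + k)\<close>: the change of variables \<open>y = M\<^sup>jx + k\<close> in
  \<open>\<integral>g\<^sub>j\<^sub>k(x) \<psi>(x) dx\<close> contributes the factor \<open>m\<^sup>-\<^sup>j\<close>, so \<open>m\<^sup>j\<^sup>/\<^sup>2 m\<^sup>-\<^sup>j = m\<^sup>-\<^sup>j\<^sup>/\<^sup>2\<close> remains.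
\<close>

definition dilate :: "int^'d^'d \<Rightarrow> 'd distribution \<Rightarrow> int \<Rightarrow> int^'d \<Rightarrow> 'd distribution" where
  "dilate M T j k =
     (\<lambda>\<psi>. if schwartz \<psi>
          then complex_of_real (real_of_int \<bar>det M\<bar> powr (- real_of_int j / 2)) *
               T (\<lambda>y. \<psi> (mat_powi (rmat M) (- j) *v (y - rvec k)))
          else 0)"

section \<open>Sobolev spaces\<close>

text \<open>The distribution \<open>T\<close> is given by integration against the function \<open>g\<close>.\<close>

definition is_function :: "('d::finite) distribution \<Rightarrow> (real^'d \<Rightarrow> complex) \<Rightarrow> bool" where
  "is_function T g \<longleftrightarrow>
     g \<in> borel_measurable borel \<and>
     (\<forall>\<psi>. schwartz \<psi> \<longrightarrow>
        integrable lborel (\<lambda>x. g x * \<psi> x) \<and> T \<psi> = (LINT x|lborel. g x * \<psi> x))"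

text \<open>
  The Fourier transform of \<open>T\<close> as a function. It is determined almost everywhere only; if there
  is a continuous representative, as for compactly supported \<open>T\<close>, then that one is taken, which
  gives the values at individual points their usual meaning.
\<close>

definition fhat :: "('d::finite) distribution \<Rightarrow> real^'d \<Rightarrow> complex" where
  "fhat T =
     (SOME g. is_function (fourier_dist T) g \<and>
        ((\<exists>h. is_function (fourier_dist T) h \<and> continuous_on UNIV h) \<longrightarrow> continuous_on UNIV g))"

definition Hs_norm2 :: "real \<Rightarrow> ('d::finite) distribution \<Rightarrow> ennreal" where
  "Hs_norm2 s T = (\<integral>\<^sup>+ \<xi>. ennreal ((cmod (fhat T \<xi>))\<^sup>2 * (1 + (norm \<xi>)\<^sup>2) powr s) \<partial>lborel)"

definition Hs_seminorm2 :: "real \<Rightarrow> ('d::finite) distribution \<Rightarrow> ennreal" where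
  "Hs_seminorm2 r T = (\<integral>\<^sup>+ \<xi>. ennreal (rpow (norm \<xi>) (2 * r) * (cmod (fhat T \<xi>))\<^sup>2) \<partial>lborel)"

definition Hs :: "real \<Rightarrow> ('d::finite) distribution set" where
  "Hs s = {T. tempered T \<and> (\<exists>g. is_function (fourier_dist T) g) \<and> Hs_norm2 s T < \<infinity>}"

definition pairing :: "('d::finite) distribution \<Rightarrow> 'd distribution \<Rightarrow> complex" where
  "pairing f g = (LINT \<xi>|lborel. fhat f \<xi> * cnj (fhat g \<xi>))"

text \<open>Unconditional convergence in \<open>H\<^sup>s\<close>, over the net of finite sets as in \<^const>\<open>has_sum\<close>.\<close>

definition Hs_has_sum :: "real \<Rightarrow> ('k \<Rightarrow> ('d::finite) distribution) \<Rightarrow> 'd distribution \<Rightarrow> bool" where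
  "Hs_has_sum s a S \<longleftrightarrow>
     (\<forall>k. a k \<in> Hs s) \<and> S \<in> Hs s \<and>
     ((\<lambda>F. Hs_norm2 s (\<lambda>\<psi>. S \<psi> - (\<Sum>k\<in>F. a k \<psi>))) \<longlongrightarrow> 0) (finite_subsets_at_top UNIV)"

definition quasi_proj_term ::
    "int^'d^'d \<Rightarrow> 'd distribution \<Rightarrow> 'd distribution \<Rightarrow> int \<Rightarrow> 'd distribution \<Rightarrow> int^'d \<Rightarrow> 'd distribution" where
  "quasi_proj_term M \<phi> \<phi>' j f k = (\<lambda>\<psi>. pairing f (dilate M \<phi>' j k) * dilate M \<phi> j k \<psi>)"

text \<open>\<open>Q\<^sub>j(f)\<close>, with the sum taken in \<open>H\<^sup>s\<close>.\<close>

definition quasi_proj ::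
    "real \<Rightarrow> int^'d^'d \<Rightarrow> 'd distribution \<Rightarrow> 'd distribution \<Rightarrow> int \<Rightarrow> 'd distribution \<Rightarrow> 'd distribution" where
  "quasi_proj s M \<phi> \<phi>' j f = (THE S. Hs_has_sum s (quasi_proj_term M \<phi> \<phi>' j f) S)"

end

theory Submission
  imports Defs "HOL-Probability.Probability"
begin

text \<open>
  On the Fourier side a distribution in \<open>H\<^sup>s\<close> is a function \<open>g\<close> that is square integrable with weight
  \<open>(1 + |\<xi>|\<^sup>2)\<^sup>s\<close>. Compact support of \<open>\<phi>\<close> makes \<open>\<phi>\<close> invariant under multiplication by a cutoff, so its
  transform \<open>p\<close> is a convolution with a Schwartz function. This bounds the bracket
  \<open>\<Sum>\<^sub>k |p(\<xi> + k)|\<^sup>2 (1 + |\<xi> + k|\<^sup>2)\<^sup>s\<close> essentially uniformly in \<open>\<xi>\<close>, and likewise with \<open>- s\<close> for the transform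
  \<open>q\<close> of \<open>\<phi>'\<close>.

  After the change of variables \<open>\<eta> = M\<^sup>*\<^sup>-\<^sup>j \<xi>\<close>, with \<open>F(\<eta>)\<close> the transform of \<open>f\<close> at \<open>M\<^sup>*\<^sup>j \<eta>\<close>, the pairings of
  \<open>f\<close> with the dilates of \<open>\<phi>'\<close> are the Fourier coefficients of the periodization \<open>G\<close> of \<open>F q\<^sup>-\<close>, where
  \<open>q\<^sup>-\<close> is the conjugate of \<open>q\<close>. By Cauchy-Schwarz and the bracket of \<open>q\<close>, \<open>G\<close> is square integrable on the
  torus, and the bracket of \<open>p\<close> turns the \<open>L\<^sup>2\<close> convergence of its Fourier series into the
  unconditional convergence of the quasi-projection to the distribution with transform \<open>p G\<close>.

  For the error \<open>F - p G\<close> at \<open>\<eta> + l\<close>, \<open>\<eta>\<close> in the torus: if \<open>l = 0\<close>, replacing \<open>G\<close> by \<open>F q\<^sup>-\<close> leaves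
  \<open>F (1 - q\<^sup>- p)\<close>, controlled by the first hypothesis; if \<open>l \<noteq> 0\<close>, the term \<open>p G\<close> is controlled by the second one.
  All remaining terms involve \<open>F(\<eta> + k)\<close> with \<open>k \<noteq> 0\<close> only, where \<open>|\<eta> + k| \<ge> 1/2\<close>, so that every weight of order at
  most \<open>2n\<close> is bounded by a constant times \<open>|\<eta> + k|\<^sup>2\<^sup>n\<close>.
\<close>

subsection \<open>Integration on Euclidean space\<close>

lemma Basis_vec_eq_range: "(Basis :: (real^'d) set) = range (\<lambda>i. axis i 1)"
  by (auto simp: Basis_vec_def)

lemma
  fixes f :: "'d::finite \<Rightarrow> real \<Rightarrow> complex"
  assumes f: "\<And>i. integrable lborel (f i)"
  shows integrable_lborel_prod: "integrable lborel (\<lambda>x::real^'d. \<Prod>i\<in>UNIV. f i (x $ i))"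
    and integral_lborel_prod: "(LINT x|lborel. (\<Prod>i\<in>UNIV. f i (x $ i))) = (\<Prod>i\<in>UNIV. (LINT x|lborel. f i x))"
proof -
  let ?a = "\<lambda>i. axis i 1 :: real^'d"
  have inj: "inj ?a" by (auto simp: inj_def axis_eq_axis)
  define h where "h b = f (inv ?a b)" for b
  have h: "h (?a i) = f i" for i by (simp add: h_def inv_f_f[OF inj])
  have [measurable]: "f i \<in> borel_measurable borel" for i
    using borel_measurable_integrable[OF f[of i]] by simp
  interpret product_sigma_finite "\<lambda>_::real^'d. lborel :: real measure"
    by standard
  let ?P = "\<Pi>\<^sub>M b\<in>(Basis :: (real^'d) set). (lborel :: real measure)"
  let ?S = "\<lambda>g. \<Sum>b\<in>(Basis :: (real^'d) set). g b *\<^sub>R b"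
  have comp: "(\<Prod>i\<in>UNIV. f i (?S g $ i)) = (\<Prod>b\<in>Basis. h b (g b))" for g
  proof -
    have "?S g $ i = g (?a i)" for i
      by (simp add: cart_eq_inner_axis inner_sum_left_Basis)
    then show ?thesis
      unfolding Basis_vec_eq_range using inj by (simp add: prod.reindex h)
  qed
  have hint: "integrable lborel (h b)" for b
    using f by (simp add: h_def)
  have eq: "(lborel :: (real^'d) measure) = distr ?P borel ?S" by (rule lborel_eq)
  have S[measurable]: "?S \<in> measurable ?P borel" by measurable
  show "integrable lborel (\<lambda>x::real^'d. \<Prod>i\<in>UNIV. f i (x $ i))"
  proof -
    have "integrable ?P (\<lambda>g. \<Prod>i\<in>UNIV. f i (?S g $ i))"
      unfolding comp by (intro product_integrable_prod hint) auto
    then show ?thesis unfolding eq by (subst integrable_distr_eq) auto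
  qed
  have "(LINT x|lborel. (\<Prod>i\<in>UNIV. f i (x $ i))) = (LINT g|?P. (\<Prod>b\<in>Basis. h b (g b)))"
    unfolding eq comp[symmetric] by (subst integral_distr) auto
  also have "\<dots> = (\<Prod>b\<in>Basis. (LINT x|lborel. h b x))"
    by (rule product_integral_prod) (auto intro: hint)
  also have "\<dots> = (\<Prod>i\<in>UNIV. (LINT x|lborel. f i x))"
    unfolding Basis_vec_eq_range using inj by (simp add: prod.reindex h)
  finally show "(LINT x|lborel. (\<Prod>i\<in>UNIV. f i (x $ i))) = (\<Prod>i\<in>UNIV. (LINT x|lborel. f i x))" .
qed

lemma integrable_decay:
  "integrable lborel (\<lambda>x::real^'d. 1 / (1 + norm x) ^ (2 * CARD('d)))"
proof -
  have "integrable lborel (\<lambda>x::real. inverse (1 + x^2))"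
    using integrable_inverse_1_plus_square by (simp add: set_integrable_def)
  then have i1: "integrable lborel (\<lambda>x::real. complex_of_real (inverse (1 + x^2)))"
    by (rule integrable_of_real)
  have "integrable lborel (\<lambda>x::real^'d. \<Prod>i\<in>UNIV. complex_of_real (inverse (1 + (x$i)^2)))"
    by (rule integrable_lborel_prod) (rule i1)
  then have "integrable lborel (\<lambda>x::real^'d. complex_of_real (\<Prod>i\<in>UNIV. inverse (1 + (x$i)^2)))"
    by (simp only: of_real_prod)
  then have i2: "integrable lborel (\<lambda>x::real^'d. \<Prod>i\<in>UNIV. inverse (1 + (x$i)^2))"
    by (simp only: complex_of_real_integrable_eq)
  show ?thesis
  proof (rule Bochner_Integration.integrable_bound[OF i2])
    have "(\<Prod>i\<in>UNIV. (1 + (x$i)^2)) \<le> (1 + norm x) ^ (2 * CARD('d))" for x :: "real^'d"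
    proof -
      have "(\<Prod>i\<in>(UNIV::'d set). (1 + (x$i)^2)) \<le> (\<Prod>i\<in>(UNIV::'d set). (1 + norm x)^2)"
      proof (intro prod_mono conjI)
        fix i :: 'd
        have "(x$i)^2 \<le> norm x ^ 2"
          using component_le_norm_cart[of x i] by (simp add: abs_le_square_iff[symmetric])
        also have "1 + \<dots> \<le> (1 + norm x)^2" by (simp add: power2_sum)
        finally show "1 + (x$i)^2 \<le> (1 + norm x)^2" by simp
      qed simp
      also have "\<dots> = (1 + norm x) ^ (2 * CARD('d))"
        by (simp add: power_mult)
      finally show ?thesis .
    qed
    moreover have "0 < (\<Prod>i\<in>UNIV. (1 + (x$i)^2))" for x :: "real^'d"
      by (intro prod_pos) (auto intro: add_pos_nonneg)
    moreover have "(\<Prod>i\<in>UNIV. inverse (1 + (x$i)^2)) = inverse (\<Prod>i\<in>UNIV. (1 + (x$i)^2))" for x :: "real^'d"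
      using prod_inversef[of "\<lambda>i. 1 + (x$i)^2" UNIV] by (simp add: comp_def)
    ultimately show "AE x::real^'d in lborel. norm (1 / (1 + norm x) ^ (2 * CARD('d))) \<le> norm (\<Prod>i\<in>UNIV. inverse (1 + (x$i)^2))"
      by (intro AE_I2) (simp add: divide_inverse le_imp_inverse_le abs_of_pos)
  qed measurable
qed

lemma integrable_bounded_decay:
  fixes f :: "real^'d \<Rightarrow> 'b::{banach, second_countable_topology}"
  assumes [measurable]: "f \<in> borel_measurable borel"
    and b: "\<And>x. norm (f x) \<le> C / (1 + norm x) ^ (2 * CARD('d))"
  shows "integrable lborel f"
proof (rule Bochner_Integration.integrable_bound)
  show "integrable lborel (\<lambda>x::real^'d. C * (1 / (1 + norm x) ^ (2 * CARD('d))))"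
    by (intro integrable_mult_right integrable_decay)
  show "AE x in lborel. norm (f x) \<le> norm (C * (1 / (1 + norm x) ^ (2 * CARD('d))))"
  proof (intro AE_I2)
    fix x
    have "norm (f x) \<le> C * (1 / (1 + norm x) ^ (2 * CARD('d)))" using b[of x] by simp
    also have "\<dots> \<le> norm \<dots>" unfolding real_norm_def by (rule abs_ge_self)
    finally show "norm (f x) \<le> norm (C * (1 / (1 + norm x) ^ (2 * CARD('d))))" .
  qed
qed measurable

lemma borel_measurable_matrix_vector_mult [measurable]:
  fixes B :: "real^'d^'d"
  assumes [measurable]: "f \<in> borel_measurable M"
  shows "(\<lambda>x. B *v f x) \<in> borel_measurable M"
proof -
  have "(\<lambda>y. B *v y) \<in> borel_measurable borel"
    by (intro borel_measurable_continuous_onI linear_continuous_on linear_linear[THEN iffD2] matrix_vector_mul_linear)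
  from measurable_compose[OF assms this] show ?thesis .
qed

lemma
  assumes "invertible A"
  shows matrix_inv_right: "A ** matrix_inv A = mat 1"
    and matrix_inv_left: "matrix_inv A ** A = mat 1"
proof -
  have "A ** matrix_inv A = mat 1 \<and> matrix_inv A ** A = mat 1"
    using assms unfolding invertible_def matrix_inv_def by (rule someI_ex)
  then show "A ** matrix_inv A = mat 1" "matrix_inv A ** A = mat 1" by auto
qed

lemma measure_shear:
  fixes S :: "(real^'d) set"
  assumes mn: "m \<noteq> n" and S: "S \<in> lmeasurable"
  defines "h \<equiv> \<lambda>v::real^'d. \<chi> i. if i = m then v $ m + v $ n else v $ i"
  shows "h ` S \<in> lmeasurable \<and> measure lebesgue (h ` S) = measure lebesgue S"
proof -
  have lin: "linear h"
    unfolding h_def by (rule linearI) (auto simp: algebra_simps plus_vec_def scaleR_vec_def vec_eq_iff)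
  have "measure lebesgue (h ` cbox a b) = 1 * measure lebesgue (cbox a b)" for a b
  proof (cases "cbox a b = {}")
    case False
    define w where "w = (a $ n) *\<^sub>R (axis n 1 :: real^'d)"
    have sh: "cbox a b = (+) w ` cbox (a - w) (b - w)"
      by (simp add: cbox_translation [symmetric])
    then have ne: "cbox (a - w) (b - w) \<noteq> {}" using False by auto
    have "h ` cbox a b = (+) (h w) ` (h ` cbox (a - w) (b - w))"
      unfolding sh image_image by (simp add: linear_add[OF lin])
    then have "measure lebesgue (h ` cbox a b) = measure lebesgue (h ` cbox (a - w) (b - w))"
      by (simp add: measure_translation)
    also have "\<dots> = measure lebesgue (cbox (a - w) (b - w))"
      unfolding h_def by (rule measure_shear_interval[OF mn ne]) (simp add: w_def)
    also have "\<dots> = measure lebesgue (cbox a b)"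
      unfolding sh by (simp add: measure_translation)
    finally show ?thesis by simp
  qed simp
  from measure_linear_sufficient[OF lin S this] show ?thesis by simp
qed

lemma measure_swap:
  fixes S :: "(real^'d) set" and m n :: 'd
  assumes S: "S \<in> lmeasurable"
  defines "h \<equiv> \<lambda>v::real^'d. \<chi> i. v $ Transposition.transpose m n i"
  shows "h ` S \<in> lmeasurable \<and> measure lebesgue (h ` S) = measure lebesgue S"
proof -
  have lin: "linear h"
    unfolding h_def by (rule linearI) (auto simp: algebra_simps plus_vec_def scaleR_vec_def vec_eq_iff)
  have hh: "h (h v) = v" for v by (simp add: h_def vec_eq_iff)
  have "measure lebesgue (h ` cbox a b) = 1 * measure lebesgue (cbox a b)" for a b
  proof (cases "cbox a b = {}")
    case False
    have *: "h v \<in> cbox (h a) (h b)" if "v \<in> cbox a b" for v a b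
      using that by (simp add: h_def mem_box_cart)
    have eq: "h ` cbox a b = cbox (h a) (h b)"
    proof (intro set_eqI iffI)
      fix v assume "v \<in> cbox (h a) (h b)"
      from *[OF this] have "h v \<in> cbox a b" by (simp add: hh)
      then show "v \<in> h ` cbox a b" using hh[of v] by (metis imageI)
    qed (use * in auto)
    have ne: "cbox (h a) (h b) \<noteq> {}" using False eq by auto
    have "(\<Prod>i\<in>UNIV. h b $ i - h a $ i) = (\<Prod>i\<in>UNIV. b $ i - a $ i)"
      unfolding h_def vec_lambda_beta
      by (rule prod.reindex_bij_betw[where g="\<lambda>i. b $ i - a $ i"]) simp
    then show ?thesis
      using ne False by (simp add: eq content_cbox_cart)
  qed simp
  from measure_linear_sufficient[OF lin S this] show ?thesis by simp
qed

lemma measure_matrix_image: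
  fixes B :: "real^'d^'d"
  assumes "det B \<noteq> 0" "S \<in> lmeasurable"
  shows "(*v) B ` S \<in> lmeasurable \<and> measure lebesgue ((*v) B ` S) = \<bar>det B\<bar> * measure lebesgue S"
  using assms
proof (induction B arbitrary: S rule: induct_matrix_elementary_alt)
  case (1 A B)
  have "det A \<noteq> 0" "det B \<noteq> 0" using 1 by (auto simp: det_mul)
  have "(*v) (A ** B) ` S = (*v) A ` ((*v) B ` S)"
    by (simp add: image_image matrix_vector_mul_assoc)
  moreover have "(*v) B ` S \<in> lmeasurable \<and> measure lebesgue ((*v) B ` S) = \<bar>det B\<bar> * measure lebesgue S"
    by (rule 1) fact+
  ultimately show ?case
    using 1(1)[OF \<open>det A \<noteq> 0\<close>, of "(*v) B ` S"] by (simp add: det_mul abs_mult)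
next
  case (2 A i)
  then show ?case by (simp add: det_zero_row(2))
next
  case (3 A)
  have "(\<chi> k. A $ k $ k * x $ k) = A *v x" for x
  proof -
    have "(\<Sum>j\<in>UNIV. A $ k $ j * x $ j) = (\<Sum>j\<in>UNIV. if j = k then A $ k $ k * x $ k else 0)" for k
      by (rule sum.cong) (auto simp: 3(1))
    then show ?thesis by (simp add: vec_eq_iff matrix_vector_mult_def)
  qed
  moreover have "det A = (\<Prod>i\<in>UNIV. A $ i $ i)"
    by (rule det_diagonal) (rule 3)
  ultimately show ?case
    using measurable_stretch[OF 3(3), of "\<lambda>k. A $ k $ k"] measure_stretch[OF 3(3), of "\<lambda>k. A $ k $ k"] by simp
next
  case (4 m n)
  let ?A = "\<chi> i j. mat 1 $ i $ Transposition.transpose m n j :: real^'d^'d"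
  have "?A *v x = (\<chi> i. x $ Transposition.transpose m n i)" for x
  proof -
    have "(\<Sum>j\<in>UNIV. (mat 1 :: real^'d^'d) $ i $ Transposition.transpose m n j * x $ j)
       = (\<Sum>j\<in>UNIV. if j = Transposition.transpose m n i then x $ Transposition.transpose m n i else 0)" for i
      by (rule sum.cong) (auto simp: mat_def)
    then show ?thesis by (simp add: vec_eq_iff matrix_vector_mult_def)
  qed
  moreover have "\<bar>det ?A\<bar> = 1"
    using 4 by (simp add: det_permute_columns permutes_swap_id sign_swap_id abs_mult)
  ultimately show ?case using measure_swap[OF 4(3), of m n] by simp
next
  case (5 m n)
  let ?A = "\<chi> i j. of_bool (i = m \<and> j = n \<or> i = j) :: real^'d^'d"
  have "?A *v x = (\<chi> i. if i = m then x $ m + x $ n else x $ i)" for x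
  proof -
    have "(\<Sum>j\<in>UNIV. of_bool (i = m \<and> j = n \<or> i = j) * x $ j)
       = (\<Sum>j\<in>UNIV. (if j = i then x $ i else 0) + (if j = n then (if i = m then x $ n else 0) else 0))" for i
      using 5(1) by (intro sum.cong) auto
    then show ?thesis by (auto simp add: vec_eq_iff matrix_vector_mult_def sum.distrib)
  qed
  moreover have "?A = (\<chi> k. if k = m then row m (mat 1) + 1 *s row n (mat 1) else row k (mat 1))"
    using 5(1) by (auto simp: vec_eq_iff row_def mat_def)
  then have "det ?A = 1" using det_row_operation[OF 5(1), of "mat 1" 1] by simp
  ultimately show ?case using measure_shear[OF 5(1) 5(3)] by simp
qed

lemma lborel_distr_matrix:
  fixes B :: "real^'d^'d"
  assumes "invertible B"
  shows "distr lborel borel (\<lambda>x. B *v x) = density lborel (\<lambda>_. ennreal (1 / \<bar>det B\<bar>))"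
proof -
  have d0: "det B \<noteq> 0" using assms invertible_det_nz by blast
  let ?D = "distr lborel borel (\<lambda>x. B *v x)"
  let ?I = "matrix_inv B"
  have I1: "B ** ?I = mat 1" and I2: "?I ** B = mat 1"
    using assms by (simp_all add: matrix_inv_right matrix_inv_left)
  have dI: "det ?I = 1 / det B"
    using I1 d0 by (metis det_I det_mul nonzero_mult_div_cancel_left)
  have "lborel = density ?D (\<lambda>_. ennreal \<bar>det B\<bar>)"
  proof (rule lborel_eqI)
    fix l u :: "real^'d" assume lu: "\<And>b. b \<in> Basis \<Longrightarrow> l \<bullet> b \<le> u \<bullet> b"
    have img: "(\<lambda>x. B *v x) -` box l u = (\<lambda>x. ?I *v x) ` box l u"
    proof (intro set_eqI iffI)
      fix x assume "x \<in> (\<lambda>x. B *v x) -` box l u"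
      then have "B *v x \<in> box l u" by simp
      moreover have "x = ?I *v (B *v x)" by (simp add: matrix_vector_mul_assoc I2)
      ultimately show "x \<in> (\<lambda>x. ?I *v x) ` box l u" by blast
    next
      fix y assume "y \<in> (\<lambda>x. ?I *v x) ` box l u" then show "y \<in> (\<lambda>x. B *v x) -` box l u"
        by (auto simp add: matrix_vector_mul_assoc I1)
    qed
    have lm: "box l u \<in> lmeasurable" by simp
    have "measure lebesgue ((\<lambda>x. ?I *v x) ` box l u) = \<bar>det ?I\<bar> * measure lebesgue (box l u)"
      "(\<lambda>x. ?I *v x) ` box l u \<in> lmeasurable"
      using measure_matrix_image[OF _ lm, of ?I] d0 by (auto simp: dI)
    then have "emeasure lebesgue ((\<lambda>x. ?I *v x) ` box l u) = ennreal (\<bar>det ?I\<bar> * measure lebesgue (box l u))"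
      by (simp add: emeasure_eq_measure2)
    moreover have bs: "(\<lambda>x. B *v x) -` box l u \<in> sets borel"
      using measurable_sets_borel[of "\<lambda>x. B *v x" borel "box l u"] by simp
    ultimately have e: "emeasure lborel ((\<lambda>x. B *v x) -` box l u) = ennreal (1/\<bar>det B\<bar> * measure lborel (box l u))"
      unfolding img by (simp add: emeasure_completion dI measure_completion)
    have "emeasure (density ?D (\<lambda>_. ennreal \<bar>det B\<bar>)) (box l u) = ennreal \<bar>det B\<bar> * emeasure lborel ((\<lambda>x. B *v x) -` box l u)"
      using bs by (simp add: emeasure_density emeasure_distr nn_integral_cmult_indicator)
    also have "\<dots> = ennreal (measure lborel (box l u))"
      unfolding e using d0 by (simp add: ennreal_mult[symmetric])
    also have "\<dots> = ennreal (\<Prod>b\<in>Basis. (u - l) \<bullet> b)"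
      using lu by (simp add: measure_def inner_diff_left prod_nonneg)
    finally show "emeasure (density ?D (\<lambda>_. ennreal \<bar>det B\<bar>)) (box l u) = ennreal (\<Prod>b\<in>Basis. (u - l) \<bullet> b)" .
  qed simp
  then have "density lborel (\<lambda>_. ennreal (1 / \<bar>det B\<bar>)) =
     density (density ?D (\<lambda>_. ennreal \<bar>det B\<bar>)) (\<lambda>_. ennreal (1 / \<bar>det B\<bar>))"
    by simp
  also have "\<dots> = density ?D (\<lambda>_. ennreal \<bar>det B\<bar> * ennreal (1 / \<bar>det B\<bar>))"
    by (subst density_density_eq) auto
  also have "\<dots> = ?D"
    using d0 by (simp add: ennreal_mult[symmetric] density_1)
  finally show ?thesis by simp
qed

lemma nn_integral_matrix:
  fixes B :: "real^'d^'d"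
  assumes "invertible B" and [measurable]: "f \<in> borel_measurable borel"
  shows "(\<integral>\<^sup>+x. f (B *v x) \<partial>lborel) = ennreal (1 / \<bar>det B\<bar>) * (\<integral>\<^sup>+x. f x \<partial>lborel)"
proof -
  have "(\<integral>\<^sup>+x. f (B *v x) \<partial>lborel) = (\<integral>\<^sup>+x. f x \<partial>distr lborel borel (\<lambda>x. B *v x))"
    by (subst nn_integral_distr) auto
  also have "\<dots> = ennreal (1 / \<bar>det B\<bar>) * (\<integral>\<^sup>+x. f x \<partial>lborel)"
    unfolding lborel_distr_matrix[OF assms(1)]
    by (subst nn_integral_density) (auto simp: nn_integral_cmult)
  finally show ?thesis .
qed

lemma
  fixes B :: "real^'d^'d" and f :: "real^'d \<Rightarrow> complex"
  assumes "invertible B" and [measurable]: "f \<in> borel_measurable borel"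
  shows integral_matrix: "(LINT x|lborel. f (B *v x)) = (1 / \<bar>det B\<bar>) *\<^sub>R (LINT x|lborel. f x)"
    and integrable_matrix: "integrable lborel (\<lambda>x. f (B *v x)) \<longleftrightarrow> integrable lborel f"
proof -
  have d0: "det B \<noteq> 0" using assms invertible_det_nz by blast
  have "(LINT x|lborel. f (B *v x)) = (LINT x|distr lborel borel (\<lambda>x. B *v x). f x)"
    by (subst integral_distr) auto
  also have "\<dots> = (1 / \<bar>det B\<bar>) *\<^sub>R (LINT x|lborel. f x)"
    unfolding lborel_distr_matrix[OF assms(1)]
    by (subst integral_density) auto
  finally show "(LINT x|lborel. f (B *v x)) = (1 / \<bar>det B\<bar>) *\<^sub>R (LINT x|lborel. f x)" .
  have "integrable lborel (\<lambda>x. f (B *v x)) \<longleftrightarrow> integrable (distr lborel borel (\<lambda>x. B *v x)) f"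
    by (subst integrable_distr_eq) auto
  also have "\<dots> \<longleftrightarrow> integrable lborel f"
  proof -
    have "integrable lborel f" if "integrable lborel (\<lambda>x. (1 / \<bar>det B\<bar>) *\<^sub>R f x)"
      using integrable_scaleR_right[OF that, of "\<bar>det B\<bar>"] d0 by simp
    then show ?thesis unfolding lborel_distr_matrix[OF assms(1)] by (subst integrable_density) auto
  qed
  finally show "integrable lborel (\<lambda>x. f (B *v x)) \<longleftrightarrow> integrable lborel f" .
qed

lemma nn_integral_translate:
  fixes c :: "real^'d"
  assumes [measurable]: "f \<in> borel_measurable borel"
  shows "(\<integral>\<^sup>+x. f (c + x) \<partial>lborel) = (\<integral>\<^sup>+x. f x \<partial>lborel)"
  by (subst (2) lborel_distr_plus[of c, symmetric]) (simp add: nn_integral_distr)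

lemma
  fixes c :: "real^'d" and f :: "real^'d \<Rightarrow> complex"
  assumes [measurable]: "f \<in> borel_measurable borel"
  shows integral_translate: "(LINT x|lborel. f (c + x)) = (LINT x|lborel. f x)"
    and integrable_translate: "integrable lborel (\<lambda>x. f (c + x)) \<longleftrightarrow> integrable lborel f"
  by (subst (2) lborel_distr_plus[of c, symmetric], simp add: integral_distr integrable_distr_eq)+

lemma uminus_matrix_vector_mult: "(- A) *v x = - (A *v x)" for A :: "real^'d^'d"
  using matrix_vector_mult_diff_rdistrib[of 0 A x] by simp

lemma det_uminus_mat_1: "\<bar>det (- mat 1 :: real^'d^'d)\<bar> = 1"
proof -
  have "(- mat 1 :: real^'d^'d) ** (- mat 1) = mat 1"
    by (simp add: matrix_eq matrix_vector_mul_assoc [symmetric] uminus_matrix_vector_mult)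
  then have "det (- mat 1 :: real^'d^'d) ^ 2 = 1"
    by (metis det_I det_mul power2_eq_square)
  then show ?thesis
    by (metis abs_1 abs_square_eq_1)
qed

lemma integral_reflect:
  fixes f :: "real^'d \<Rightarrow> complex"
  assumes [measurable]: "f \<in> borel_measurable borel"
  shows "(LINT x|lborel. f (- x)) = (LINT x|lborel. f x)"
proof -
  have i: "invertible (- mat 1 :: real^'d^'d)"
    using det_uminus_mat_1[where 'd='d] by (auto simp: invertible_det_nz)
  have m: "(- mat 1 :: real^'d^'d) *v x = - x" for x by (simp add: uminus_matrix_vector_mult)
  show ?thesis
    using integral_matrix[OF i, of f] by (simp add: m det_uminus_mat_1)
qed

subsection \<open>Partial derivatives, smooth and Schwartz functions\<close>

lemma pdiff_eqI: "(f has_derivative D) (at x) \<Longrightarrow> pdiff i f x = D (axis i 1)"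
  unfolding pdiff_def using frechet_derivative_at by metis

lemma pdiffs_Nil [simp]: "pdiffs [] f = f"
  and pdiffs_Cons: "pdiffs (i # js) f = pdiff i (pdiffs js f)"
  and pdiffs_append: "pdiffs (is @ js) f = pdiffs is (pdiffs js f)"
  by (simp_all add: pdiffs_def)

lemma pdiffs_snoc: "pdiffs (is @ [i]) f = pdiffs is (pdiff i f)"
  by (simp add: pdiffs_append pdiffs_Cons)

text \<open>A class of differentiable functions closed under partial derivatives consists of smooth
  functions; smoothness is always proved by exhibiting such a class.\<close>

lemma pdiffs_class:
  assumes "P f" "\<And>g i. P g \<Longrightarrow> P (pdiff i g)"
  shows "P (pdiffs is f)"
  by (induction "is") (auto simp: pdiffs_Cons assms)

lemma smooth_class:
  assumes "P f" "\<And>g x. P g \<Longrightarrow> g differentiable (at x)" "\<And>g i. P g \<Longrightarrow> P (pdiff i g)"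
  shows "smooth f"
  unfolding smooth_def using pdiffs_class[of P, OF assms(1,3)] assms(2) by blast

lemma smooth_pdiff: "smooth f \<Longrightarrow> smooth (pdiff i f)"
  unfolding smooth_def by (metis pdiffs_snoc)

lemma smooth_pdiffs: "smooth f \<Longrightarrow> smooth (pdiffs is f)"
  by (rule pdiffs_class[of smooth]) (auto intro: smooth_pdiff)

lemma smooth_differentiable: "smooth f \<Longrightarrow> f differentiable (at x)"
  unfolding smooth_def by (metis pdiffs_Nil)

lemma smooth_has_derivative: "smooth f \<Longrightarrow> (f has_derivative frechet_derivative f (at x)) (at x)"
  using smooth_differentiable frechet_derivative_works by blast

lemma smooth_continuous: "smooth f \<Longrightarrow> continuous_on UNIV f"
  by (meson differentiable_imp_continuous_within differentiable_on_def smooth_differentiable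
      continuous_at_imp_continuous_on)

lemma smooth_borel [measurable_dest]: "smooth f \<Longrightarrow> f \<in> borel_measurable borel"
  by (intro borel_measurable_continuous_onI smooth_continuous)

lemma frechet_derivative_sum_pdiff:
  fixes f :: "real^'d \<Rightarrow> complex"
  assumes "f differentiable (at x)"
  shows "frechet_derivative f (at x) v = (\<Sum>l\<in>UNIV. of_real (v $ l) * pdiff l f x)"
proof -
  have lin: "linear (frechet_derivative f (at x))" using assms by (rule linear_frechet_derivative)
  have "frechet_derivative f (at x) v = frechet_derivative f (at x) (\<Sum>l\<in>UNIV. (v $ l) *\<^sub>R axis l 1)"
    by (simp add: basis_expansion flip: scalar_mult_eq_scaleR)
  also have "\<dots> = (\<Sum>l\<in>UNIV. (v $ l) *\<^sub>R frechet_derivative f (at x) (axis l 1))"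
    by (simp add: linear_sum[OF lin] linear_scale[OF lin])
  finally show ?thesis by (simp add: pdiff_def scaleR_conv_of_real)
qed

lemma pdiff_add:
  assumes "\<And>x. f differentiable (at x)" "\<And>x. g differentiable (at x)"
  shows "pdiff i (\<lambda>x. f x + g x) = (\<lambda>x. pdiff i f x + pdiff i g x)"
proof
  fix x
  from assms[of x] obtain f' g' where "(f has_derivative f') (at x)" "(g has_derivative g') (at x)"
    by (auto simp: differentiable_def)
  then show "pdiff i (\<lambda>x. f x + g x) x = pdiff i f x + pdiff i g x"
    by (simp add: pdiff_eqI has_derivative_add pdiff_eqI[OF has_derivative_add])
qed

lemma pdiff_mult:
  fixes f g :: "real^'d \<Rightarrow> complex"
  assumes "\<And>x. f differentiable (at x)" "\<And>x. g differentiable (at x)"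
  shows "pdiff i (\<lambda>x. f x * g x) = (\<lambda>x. pdiff i f x * g x + f x * pdiff i g x)"
proof
  fix x
  from assms[of x] obtain f' g' where "(f has_derivative f') (at x)" "(g has_derivative g') (at x)"
    by (auto simp: differentiable_def)
  then show "pdiff i (\<lambda>x. f x * g x) x = pdiff i f x * g x + f x * pdiff i g x"
    by (simp add: pdiff_eqI pdiff_eqI[OF has_derivative_mult])
qed

lemma pdiff_const [simp]: "pdiff i (\<lambda>x. c) = (\<lambda>x. 0)"
  by (rule ext) (rule pdiff_eqI[OF has_derivative_const, THEN trans], simp)

lemma pdiff_cmult:
  fixes f :: "real^'d \<Rightarrow> complex"
  assumes "\<And>x. f differentiable (at x)"
  shows "pdiff i (\<lambda>x. c * f x) = (\<lambda>x. c * pdiff i f x)"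
  using pdiff_mult[of "\<lambda>_. c" f i] assms by simp

lemma smooth_const: "smooth (\<lambda>x. c)"
  by (rule smooth_class[of "\<lambda>f. \<exists>c. f = (\<lambda>x. c)"]) auto

lemma smooth_add:
  assumes "smooth f" "smooth g"
  shows "smooth (\<lambda>x. f x + g x)"
proof (rule smooth_class[of "\<lambda>h. \<exists>f g. smooth f \<and> smooth g \<and> h = (\<lambda>x. f x + g x)"])
  fix h i assume "\<exists>f g. smooth f \<and> smooth g \<and> h = (\<lambda>x. f x + g x)"
  then obtain f g where "smooth f" "smooth g" and h: "h = (\<lambda>x. f x + g x)" by blast
  then show "\<exists>f g. smooth f \<and> smooth g \<and> pdiff i h = (\<lambda>x. f x + g x)"
    unfolding h by (intro exI[of _ "pdiff i f"] exI[of _ "pdiff i g"])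
      (simp add: pdiff_add smooth_differentiable smooth_pdiff)
next
  show "\<exists>f' g'. smooth f' \<and> smooth g' \<and> (\<lambda>x. f x + g x) = (\<lambda>x. f' x + g' x)"
    using assms by blast
next
  fix h x assume "\<exists>f g. smooth f \<and> smooth g \<and> h = (\<lambda>x. f x + g x)"
  then show "h differentiable (at x)" by (auto simp: differentiable_add smooth_differentiable)
qed

lemma pdiffs_add:
  assumes "smooth f" "smooth g"
  shows "pdiffs is (\<lambda>x. f x + g x) = (\<lambda>x. pdiffs is f x + pdiffs is g x)"
proof (induction "is")
  case (Cons i js)
  then show ?case
    using assms by (simp add: pdiffs_Cons pdiff_add smooth_differentiable smooth_pdiffs)
qed simp

inductive sprod :: "(real^'d \<Rightarrow> complex) \<Rightarrow> bool" where
  mult: "smooth f \<Longrightarrow> smooth g \<Longrightarrow> sprod (\<lambda>x. f x * g x)"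
| add: "sprod u \<Longrightarrow> sprod v \<Longrightarrow> sprod (\<lambda>x. u x + v x)"

lemma sprod_differentiable: "sprod u \<Longrightarrow> u differentiable (at x)"
  by (induction rule: sprod.induct) (simp_all add: differentiable_add differentiable_mult smooth_differentiable)

lemma sprod_pdiff: "sprod u \<Longrightarrow> sprod (pdiff i u)"
proof (induction rule: sprod.induct)
  case (mult f g)
  have "sprod (\<lambda>x. pdiff i f x * g x + f x * pdiff i g x)"
    by (intro sprod.intros smooth_pdiff mult)
  then show ?case using mult by (simp add: pdiff_mult smooth_differentiable)
next
  case (add u v)
  then show ?case by (simp add: pdiff_add sprod_differentiable sprod.add)
qed

lemma smooth_mult: "smooth f \<Longrightarrow> smooth g \<Longrightarrow> smooth (\<lambda>x. f x * g x)"
  by (rule smooth_class[of sprod, OF sprod.mult]) (auto intro: sprod_differentiable sprod_pdiff)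

lemma smooth_cmult: "smooth f \<Longrightarrow> smooth (\<lambda>x. c * f x)"
  by (intro smooth_mult smooth_const)

lemma pdiffs_cmult: "smooth f \<Longrightarrow> pdiffs is (\<lambda>x. c * f x) = (\<lambda>x. c * pdiffs is f x)"
proof (induction "is")
  case (Cons i js)
  then show ?case
    by (simp add: pdiffs_Cons pdiff_cmult smooth_differentiable smooth_pdiffs)
qed simp

definition dsum :: "nat \<Rightarrow> (real^'d \<Rightarrow> complex) \<Rightarrow> real^'d \<Rightarrow> real" where
  "dsum n f x = (\<Sum>js | length js \<le> n. cmod (pdiffs js f x))"

lemma finite_lists_le: "finite {js :: 'd::finite list. length js \<le> n}"
  using finite_lists_length_le[OF finite, of UNIV n] by simp

lemma dsum_nonneg: "0 \<le> dsum n f x"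
  unfolding dsum_def by (intro sum_nonneg) auto

lemma dsum_mono: "m \<le> n \<Longrightarrow> dsum m f x \<le> dsum n f x"
  unfolding dsum_def by (intro sum_mono2 finite_lists_le) auto

lemma pdiffs_le_dsum: "length js \<le> n \<Longrightarrow> cmod (pdiffs js f x) \<le> dsum n f x"
  unfolding dsum_def by (intro member_le_sum finite_lists_le) auto

lemma dsum_pdiff: "dsum n (pdiff i f) x \<le> dsum (Suc n) f x"
proof -
  have inj: "inj_on (\<lambda>js. js @ [i]) {js. length js \<le> n}" by (auto simp: inj_on_def)
  have "dsum n (pdiff i f) x = (\<Sum>js \<in> (\<lambda>js. js @ [i]) ` {js. length js \<le> n}. cmod (pdiffs js f x))"
    unfolding dsum_def by (simp add: sum.reindex[OF inj] pdiffs_snoc)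
  also have "\<dots> \<le> dsum (Suc n) f x"
    unfolding dsum_def by (intro sum_mono2 finite_lists_le) auto
  finally show ?thesis .
qed

lemma pdiffs_mult_bound:
  fixes f g :: "real^'d \<Rightarrow> complex"
  assumes "smooth f" "smooth g"
  shows "cmod (pdiffs is (\<lambda>x. f x * g x) x) \<le> 2 ^ length is * dsum (length is) f x * dsum (length is) g x"
  using assms
proof (induction "is" arbitrary: f g rule: rev_induct)
  case Nil
  then show ?case
    by (auto simp: norm_mult dsum_nonneg intro!: mult_mono pdiffs_le_dsum[of "[]", simplified])
next
  case (snoc i "is")
  let ?n = "length is"
  have "pdiffs (is @ [i]) (\<lambda>x. f x * g x) x
      = pdiffs is (\<lambda>x. pdiff i f x * g x) x + pdiffs is (\<lambda>x. f x * pdiff i g x) x"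
    unfolding pdiffs_snoc using snoc.prems
    by (simp add: pdiff_mult smooth_differentiable pdiffs_add smooth_mult smooth_pdiff)
  also have "cmod \<dots> \<le> 2 ^ ?n * dsum ?n (pdiff i f) x * dsum ?n g x + 2 ^ ?n * dsum ?n f x * dsum ?n (pdiff i g) x"
    by (intro norm_triangle_le add_mono snoc.IH snoc.prems smooth_pdiff)
  also have "\<dots> \<le> 2 ^ ?n * dsum (Suc ?n) f x * dsum (Suc ?n) g x + 2 ^ ?n * dsum (Suc ?n) f x * dsum (Suc ?n) g x"
    by (intro add_mono mult_mono dsum_pdiff dsum_mono mult_nonneg_nonneg dsum_nonneg) auto
  also have "\<dots> = 2 ^ length (is @ [i]) * dsum (length (is @ [i])) f x * dsum (length (is @ [i])) g x"
    by simp
  finally show ?case .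
qed

lemma schwartz_iff:
  "schwartz f \<longleftrightarrow> smooth f \<and> (\<forall>is N. \<exists>C. \<forall>x. (1 + norm x) ^ N * cmod (pdiffs is f x) \<le> C)"
  unfolding schwartz_def bounded_iff by (auto simp: abs_mult)

lemma schwartz_smooth: "schwartz f \<Longrightarrow> smooth f" by (simp add: schwartz_def)

lemma schwartz_pdiff: "schwartz f \<Longrightarrow> schwartz (pdiff i f)"
  unfolding schwartz_iff by (metis pdiffs_snoc smooth_pdiff)

lemma schwartz_pdiffs: "schwartz f \<Longrightarrow> schwartz (pdiffs is f)"
  by (rule pdiffs_class[of schwartz]) (auto intro: schwartz_pdiff)

lemma schwartz_class:
  assumes "P f" "\<And>g x. P g \<Longrightarrow> g differentiable (at x)" "\<And>g i. P g \<Longrightarrow> P (pdiff i g)"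
    "\<And>g N. P g \<Longrightarrow> \<exists>C. \<forall>x. (1 + norm x) ^ N * cmod (g x) \<le> C"
  shows "schwartz f"
  unfolding schwartz_iff using smooth_class[of P, OF assms(1-3)] assms(4) pdiffs_class[of P, OF assms(1,3)]
  by blast

lemma schwartz_decay: "schwartz f \<Longrightarrow> \<exists>C. \<forall>x. (1 + norm x) ^ N * cmod (f x) \<le> C"
  unfolding schwartz_iff by (metis pdiffs_Nil)

lemma schwartz_decay':
  assumes "schwartz f"
  obtains C where "C > 0" "\<And>x. cmod (f x) \<le> C / (1 + norm x) ^ N"
proof -
  from schwartz_decay[OF assms, of N] obtain C where C: "\<And>x. (1 + norm x) ^ N * cmod (f x) \<le> C" by blast
  have p: "0 < (1 + norm x) ^ N" for x :: "real^'a"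
    by (simp add: add_pos_nonneg)
  have "cmod (f x) \<le> max C 1 / (1 + norm x) ^ N" for x
    using C[of x] p[of x] by (simp add: pos_le_divide_eq mult.commute)
  then show ?thesis using that[of "max C 1"] by auto
qed

lemma schwartz_dsum:
  assumes "schwartz f"
  shows "\<exists>C>0. \<forall>x. (1 + norm x) ^ N * dsum n f x \<le> C"
proof -
  have "\<forall>js. \<exists>C. \<forall>x. (1 + norm x) ^ N * cmod (pdiffs js f x) \<le> C"
    using assms by (auto simp: schwartz_iff)
  then obtain C where C: "\<And>js x. (1 + norm x) ^ N * cmod (pdiffs js f x) \<le> C js" by metis
  have "(1 + norm x) ^ N * dsum n f x \<le> (\<Sum>js | length js \<le> n. C js)" for x
    unfolding dsum_def sum_distrib_left by (intro sum_mono C)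
  then have "(1 + norm x) ^ N * dsum n f x \<le> max 1 (\<Sum>js | length js \<le> n. C js)" for x
    by (simp add: max.coboundedI2)
  then show ?thesis by (intro exI[of _ "max 1 (\<Sum>js | length js \<le> n. C js)"]) auto
qed

definition slow :: "(real^'d \<Rightarrow> complex) \<Rightarrow> bool" where
  "slow p \<longleftrightarrow> smooth p \<and> (\<forall>is. \<exists>C N. \<forall>x. cmod (pdiffs is p x) \<le> C * (1 + norm x) ^ N)"

lemma slow_class:
  assumes "P f" "\<And>g x. P g \<Longrightarrow> g differentiable (at x)" "\<And>g i. P g \<Longrightarrow> P (pdiff i g)"
    "\<And>g. P g \<Longrightarrow> \<exists>C N. \<forall>x. cmod (g x) \<le> C * (1 + norm x) ^ N"
  shows "slow f"
  unfolding slow_def using smooth_class[of P, OF assms(1-3)] assms(4) pdiffs_class[of P, OF assms(1,3)]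
  by blast

lemma slow_dsum:
  assumes "slow p"
  shows "\<exists>C N. \<forall>x. dsum n p x \<le> C * (1 + norm x) ^ N"
proof -
  have "\<forall>js. \<exists>C N. \<forall>x. cmod (pdiffs js p x) \<le> C * (1 + norm x) ^ N"
    using assms by (auto simp: slow_def)
  then obtain C N where C: "\<And>js x. cmod (pdiffs js p x) \<le> C js * (1 + norm x) ^ N js" by metis
  define K where "K = (\<Sum>js | length js \<le> n. N js)"
  have "dsum n p x \<le> (\<Sum>js | length js \<le> n. \<bar>C js\<bar>) * (1 + norm x) ^ K" for x
    unfolding dsum_def sum_distrib_right
  proof (intro sum_mono)
    fix js :: "'a list" assume "js \<in> {js. length js \<le> n}"
    then have "N js \<le> K" unfolding K_def by (intro member_le_sum finite_lists_le) auto
    have "cmod (pdiffs js p x) \<le> C js * (1 + norm x) ^ N js" by (rule C)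
    also have "\<dots> \<le> \<bar>C js\<bar> * (1 + norm x) ^ K"
      using \<open>N js \<le> K\<close> by (intro mult_mono power_increasing) auto
    finally show "cmod (pdiffs js p x) \<le> \<bar>C js\<bar> * (1 + norm x) ^ K" .
  qed
  then show ?thesis by blast
qed

lemma schwartz_slow_mult:
  assumes "slow p" "schwartz f"
  shows "schwartz (\<lambda>x. p x * f x)"
  unfolding schwartz_iff
proof (intro conjI allI)
  have sm: "smooth p" "smooth f" using assms by (auto simp: slow_def schwartz_def)
  then show "smooth (\<lambda>x. p x * f x)" by (rule smooth_mult)
  fix "is" :: "'a list" and N
  let ?n = "length is"
  obtain C K where C: "\<And>x. dsum ?n p x \<le> C * (1 + norm x) ^ K" using slow_dsum[OF assms(1)] by blast
  obtain D where D: "D > 0" "\<And>x. (1 + norm x) ^ (N + K) * dsum ?n f x \<le> D"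
    using schwartz_dsum[OF assms(2)] by blast
  have "(1 + norm x) ^ N * cmod (pdiffs is (\<lambda>x. p x * f x) x) \<le> 2 ^ ?n * (\<bar>C\<bar> * D)" for x
  proof -
    have "(1 + norm x) ^ N * cmod (pdiffs is (\<lambda>x. p x * f x) x)
        \<le> (1 + norm x) ^ N * (2 ^ ?n * dsum ?n p x * dsum ?n f x)"
      by (intro mult_left_mono pdiffs_mult_bound sm) auto
    also have "\<dots> \<le> (1 + norm x) ^ N * (2 ^ ?n * (\<bar>C\<bar> * (1 + norm x) ^ K) * dsum ?n f x)"
      by (intro mult_left_mono mult_right_mono dsum_nonneg order.trans[OF C]) auto
    also have "\<dots> = 2 ^ ?n * (\<bar>C\<bar> * ((1 + norm x) ^ (N + K) * dsum ?n f x))"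
      by (simp add: power_add)
    also have "\<dots> \<le> 2 ^ ?n * (\<bar>C\<bar> * D)"
      by (intro mult_left_mono D) auto
    finally show ?thesis .
  qed
  then show "\<exists>C. \<forall>x. (1 + norm x) ^ N * cmod (pdiffs is (\<lambda>x. p x * f x) x) \<le> C" by blast
qed

lemma schwartz_slow: 
  assumes "schwartz f" shows "slow f"
  unfolding slow_def
proof (intro conjI allI)
  show "smooth f" using assms by (rule schwartz_smooth)
  fix "is"
  obtain C where "\<And>x. cmod (pdiffs is f x) \<le> C / (1 + norm x) ^ 0"
    using schwartz_decay'[OF schwartz_pdiffs[OF assms]] by metis
  then show "\<exists>C N. \<forall>x. cmod (pdiffs is f x) \<le> C * (1 + norm x) ^ N"
    by (intro exI[of _ C] exI[of _ 0]) simp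
qed

lemma slow_const: "slow (\<lambda>x. c)"
  by (rule slow_class[of "\<lambda>f. \<exists>c. f = (\<lambda>x. c)"])
    (auto, metis mult.right_neutral order_refl power_0)

lemma schwartz_mult: "schwartz f \<Longrightarrow> schwartz g \<Longrightarrow> schwartz (\<lambda>x. f x * g x)"
  by (intro schwartz_slow_mult schwartz_slow)

lemma schwartz_cmult: "schwartz f \<Longrightarrow> schwartz (\<lambda>x. c * f x)"
  by (intro schwartz_slow_mult slow_const)

lemma schwartz_add:
  assumes "schwartz f" "schwartz g"
  shows "schwartz (\<lambda>x. f x + g x)"
  unfolding schwartz_iff
proof (intro conjI allI)
  have sm: "smooth f" "smooth g" using assms by (auto simp: schwartz_def)
  then show "smooth (\<lambda>x. f x + g x)" by (rule smooth_add)
  fix "is" :: "'a list" and N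
  obtain C D where C: "\<And>x. (1 + norm x) ^ N * cmod (pdiffs is f x) \<le> C" 
    "\<And>x. (1 + norm x) ^ N * cmod (pdiffs is g x) \<le> D"
    using assms unfolding schwartz_iff by metis
  have "(1 + norm x) ^ N * cmod (pdiffs is (\<lambda>x. f x + g x) x) \<le> C + D" for x
  proof -
    have "(1 + norm x) ^ N * cmod (pdiffs is (\<lambda>x. f x + g x) x)
      \<le> (1 + norm x) ^ N * (cmod (pdiffs is f x) + cmod (pdiffs is g x))"
      unfolding pdiffs_add[OF sm] by (intro mult_left_mono norm_triangle_ineq) auto
    also have "\<dots> \<le> C + D" using C[of x] by (simp add: algebra_simps)
    finally show ?thesis .
  qed
  then show "\<exists>C. \<forall>x. (1 + norm x) ^ N * cmod (pdiffs is (\<lambda>x. f x + g x) x) \<le> C" by blast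
qed

lemma schwartz_0: "schwartz (\<lambda>x. 0)"
  by (rule schwartz_class[of "\<lambda>f. f = (\<lambda>x. 0)"]) auto

lemma schwartz_sum: "(\<And>i. i \<in> A \<Longrightarrow> schwartz (f i)) \<Longrightarrow> schwartz (\<lambda>x. \<Sum>i\<in>A. f i x)"
  by (induction A rule: infinite_finite_induct) (auto simp: schwartz_0 schwartz_add)

lemma schwartz_borel [measurable_dest]: "schwartz f \<Longrightarrow> f \<in> borel_measurable borel"
  by (intro smooth_borel schwartz_smooth)

lemma schwartz_integrable:
  fixes f :: "real^'d \<Rightarrow> complex"
  assumes "schwartz f" shows "integrable lborel f"
proof -
  obtain C where "\<And>x. cmod (f x) \<le> C / (1 + norm x) ^ (2 * CARD('d))"
    using schwartz_decay'[OF assms] by metis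
  then show ?thesis by (intro integrable_bounded_decay schwartz_borel assms)
qed

definition ee :: "real \<Rightarrow> complex" where "ee t = exp (2 * pi * \<i> * complex_of_real t)"

lemma ee_add: "ee (a + b) = ee a * ee b"
  by (simp add: ee_def distrib_left exp_add)

lemma ee_0 [simp]: "ee 0 = 1" by (simp add: ee_def)

lemma ee_eq_cis: "ee t = cis (2 * pi * t)"
  unfolding ee_def cis_conv_exp by (simp add: mult_ac)

lemma cmod_ee [simp]: "cmod (ee t) = 1" by (simp add: ee_eq_cis)

lemma cnj_ee: "cnj (ee t) = ee (- t)" by (simp add: ee_eq_cis cis_cnj)

lemma ee_int [simp]: "ee (of_int k) = 1"
  using exp_integer_2pi[of "of_int k"] by (simp add: ee_def mult_ac)

lemma continuous_on_ee [continuous_intros]: "continuous_on S f \<Longrightarrow> continuous_on S (\<lambda>x. ee (f x))"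
  unfolding ee_def by (intro continuous_intros)

lemma borel_measurable_ee [measurable]: "f \<in> borel_measurable M \<Longrightarrow> (\<lambda>x. ee (f x)) \<in> borel_measurable M"
  unfolding ee_def by measurable

lemma fourier_ee: "fourier f \<xi> = (LINT x|lborel. f x * ee (- (x \<bullet> \<xi>)))"
  by (simp add: fourier_def ee_def)

lemma has_derivative_ee:
  fixes b :: "real^'d"
  shows "((\<lambda>x. c * ee (x \<bullet> b)) has_derivative (\<lambda>h. c * (2 * pi * \<i> * of_real (h \<bullet> b) * ee (x \<bullet> b)))) (at x)"
proof -
  have 1: "((\<lambda>x. 2 * pi * \<i> * complex_of_real (x \<bullet> b)) has_derivative (\<lambda>h. 2 * pi * \<i> * of_real (h \<bullet> b))) (at x)"
    by (intro has_derivative_mult_right has_derivative_of_real has_derivative_inner_left has_derivative_ident)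
  from has_derivative_mult_right[OF diff_chain_at[OF 1 DERIV_exp[unfolded has_field_derivative_def]], of c]
  show ?thesis by (simp add: o_def ee_def mult_ac)
qed

lemma slow_ee: "slow (\<lambda>x::real^'d. ee (x \<bullet> b))"
proof (rule slow_class[of "\<lambda>f. \<exists>c. f = (\<lambda>x. c * ee (x \<bullet> b))"])
  fix g :: "real^'d \<Rightarrow> complex" and i :: 'd and x :: "real^'d"
  assume "\<exists>c. g = (\<lambda>x. c * ee (x \<bullet> b))"
  then obtain c where c: "g = (\<lambda>x. c * ee (x \<bullet> b))" by blast
  show "g differentiable (at x)" unfolding c differentiable_def using has_derivative_ee by blast
  have "pdiff i g = (\<lambda>x. (c * (2 * pi * \<i> * of_real (axis i 1 \<bullet> b))) * ee (x \<bullet> b))"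
    unfolding c by (rule ext, subst pdiff_eqI[OF has_derivative_ee]) simp
  then show "\<exists>c. pdiff i g = (\<lambda>x. c * ee (x \<bullet> b))" by blast
  show "\<exists>C N. \<forall>x. cmod (g x) \<le> C * (1 + norm x) ^ N"
    unfolding c by (intro exI[of _ "cmod c"] exI[of _ 0]) (simp add: norm_mult)
qed (auto intro: exI[of _ 1])

lemma has_derivative_coord: "((\<lambda>x::real^'d. complex_of_real (x $ i)) has_derivative (\<lambda>h. of_real (h $ i))) (at x)"
  by (auto intro!: derivative_eq_intros bounded_linear.has_derivative[OF bounded_linear_vec_nth])

lemma slow_coord: "slow (\<lambda>x::real^'d. complex_of_real (x $ l))"
proof (rule slow_class[of "\<lambda>f. f = (\<lambda>x. complex_of_real (x $ l)) \<or> (\<exists>c. f = (\<lambda>x. c))"])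
  fix g :: "real^'d \<Rightarrow> complex" and i :: 'd and x :: "real^'d"
  assume g: "g = (\<lambda>x. complex_of_real (x $ l)) \<or> (\<exists>c. g = (\<lambda>x. c))"
  then show "g differentiable (at x)" unfolding differentiable_def
    using has_derivative_coord has_derivative_const by metis
  from g show "pdiff i g = (\<lambda>x. complex_of_real (x $ l)) \<or> (\<exists>c. pdiff i g = (\<lambda>x. c))"
  proof
    assume g: "g = (\<lambda>x. complex_of_real (x $ l))"
    have "pdiff i g = (\<lambda>x. of_real (axis i 1 $ l))"
      unfolding g by (rule ext, subst pdiff_eqI[OF has_derivative_coord]) simp
    then show ?thesis by blast
  qed auto
  from g show "\<exists>C N. \<forall>x. cmod (g x) \<le> C * (1 + norm x) ^ N"
  proof
    assume "g = (\<lambda>x. complex_of_real (x $ l))"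
    then show ?thesis
      by (intro exI[of _ 1]) (auto intro!: order.trans[OF component_le_norm_cart])
  next
    assume "\<exists>c. g = (\<lambda>x. c)"
    then obtain c where "g = (\<lambda>x. c)" by blast
    then show ?thesis by (intro exI[of _ "cmod c"] exI[of _ 0]) simp
  qed
qed auto

inductive affclass :: "real^'d^'d \<Rightarrow> real^'d \<Rightarrow> (real^'d \<Rightarrow> complex) \<Rightarrow> bool" for B b where
  base: "schwartz g \<Longrightarrow> affclass B b (\<lambda>x. c * g (B *v x + b))"
| add: "affclass B b u \<Longrightarrow> affclass B b v \<Longrightarrow> affclass B b (\<lambda>x. u x + v x)"

lemma has_derivative_affine_comp:
  assumes "schwartz g"
  shows "((\<lambda>x. c * g (B *v x + b)) has_derivative (\<lambda>h. c * frechet_derivative g (at (B *v x + b)) (B *v h))) (at x)"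
proof -
  have 1: "((\<lambda>x. B *v x + b) has_derivative (\<lambda>h. B *v h)) (at x)"
    by (auto intro!: derivative_eq_intros bounded_linear.has_derivative[OF matrix_vector_mul_bounded_linear])
  have "(g has_derivative frechet_derivative g (at (B *v x + b))) (at (B *v x + b))"
    using assms by (intro smooth_has_derivative schwartz_smooth)
  from has_derivative_mult_right[OF diff_chain_at[OF 1 this], of c] show ?thesis by (simp add: o_def)
qed

lemma affclass_sum: "finite A \<Longrightarrow> (\<And>i. i \<in> A \<Longrightarrow> affclass B b (f i)) \<Longrightarrow> affclass B b (\<lambda>x. \<Sum>i\<in>A. f i x)"
proof (induction A rule: finite_induct)
  case empty
  then show ?case using affclass.base[OF schwartz_0, of B b 0] by simp
next
  case (insert i A)
  then show ?case by (simp add: affclass.add)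
qed

lemma schwartz_affine:
  fixes B :: "real^'d^'d"
  assumes "schwartz f" and inv: "invertible B"
  shows "schwartz (\<lambda>x. f (B *v x + b))"
proof (rule schwartz_class[of "affclass B b"])
  show "affclass B b (\<lambda>x. f (B *v x + b))"
    using affclass.base[OF assms(1), of B b 1] by simp
next
  fix g x assume "affclass B b g"
  then show "g differentiable (at x)"
  proof (induction rule: affclass.induct)
    case (base g c)
    then show ?case using has_derivative_affine_comp differentiable_def by blast
  qed (auto intro!: differentiable_add)
next
  fix g i assume "affclass B b g"
  then have "(\<forall>x. g differentiable (at x)) \<and> affclass B b (pdiff i g)"
  proof (induction rule: affclass.induct)
    case (base g c)
    have "pdiff i (\<lambda>x. c * g (B *v x + b)) = (\<lambda>x. \<Sum>l\<in>UNIV. (c * of_real ((B *v axis i 1) $ l)) * pdiff l g (B *v x + b))"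
    proof
      fix x
      show "pdiff i (\<lambda>x. c * g (B *v x + b)) x = (\<Sum>l\<in>UNIV. (c * of_real ((B *v axis i 1) $ l)) * pdiff l g (B *v x + b))"
        by (subst pdiff_eqI[OF has_derivative_affine_comp[OF base]], subst frechet_derivative_sum_pdiff)
          (auto simp: sum_distrib_left mult_ac intro!: smooth_differentiable schwartz_smooth base)
    qed
    moreover have "affclass B b (\<lambda>x. \<Sum>l\<in>UNIV. (c * of_real ((B *v axis i 1) $ l)) * pdiff l g (B *v x + b))"
      by (intro affclass_sum affclass.base schwartz_pdiff base) auto
    moreover have "(\<lambda>x. c * g (B *v x + b)) differentiable (at x)" for x
      using has_derivative_affine_comp[OF base] unfolding differentiable_def by blast
    ultimately show ?case by simp
  next
    case (add u v)
    then show ?case by (simp add: pdiff_add affclass.add)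
  qed
  then show "affclass B b (pdiff i g)" by simp
next
  fix g N assume "affclass B b g"
  then show "\<exists>C. \<forall>x. (1 + norm x) ^ N * cmod (g x) \<le> C"
  proof (induction rule: affclass.induct)
    case (base g c)
    obtain C where C: "\<And>x. (1 + norm x) ^ N * cmod (g x) \<le> C" using schwartz_decay[OF base] by blast
    define o' where "o' = onorm ((*v) (matrix_inv B))"
    have o': "0 \<le> o'" unfolding o'_def by (rule onorm_pos_le) simp
    define K where "K = 1 + o' * (1 + norm b)"
    have K: "1 + norm x \<le> K * (1 + norm (B *v x + b))" for x
    proof -
      have "norm x = norm (matrix_inv B *v ((B *v x + b) - b))"
        by (simp add: matrix_vector_mul_assoc matrix_inv_left[OF inv])
      also have "\<dots> \<le> o' * norm ((B *v x + b) - b)"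
        unfolding o'_def by (rule onorm) simp
      also have "\<dots> \<le> o' * (norm (B *v x + b) + norm b)"
        by (intro mult_left_mono norm_triangle_ineq4 o')
      also have "\<dots> \<le> o' * ((1 + norm b) * (1 + norm (B *v x + b)))"
        by (intro mult_left_mono o') (simp add: algebra_simps)
      finally have "1 + norm x \<le> 1 + o' * (1 + norm b) * (1 + norm (B *v x + b))" by (simp add: mult_ac)
      also have "\<dots> \<le> K * (1 + norm (B *v x + b))" unfolding K_def by (simp add: algebra_simps)
      finally show ?thesis .
    qed
    have "(1 + norm x) ^ N * cmod (c * g (B *v x + b)) \<le> cmod c * (K ^ N * C)" for x
    proof -
      have "(1 + norm x) ^ N * cmod (g (B *v x + b)) \<le> (K * (1 + norm (B *v x + b))) ^ N * cmod (g (B *v x + b))"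
        by (intro mult_right_mono power_mono K) auto
      also have "\<dots> \<le> K ^ N * C"
        unfolding power_mult_distrib mult.assoc using C[of "B *v x + b"] o' K_def
        by (intro mult_left_mono) auto
      finally have "cmod c * ((1 + norm x) ^ N * cmod (g (B *v x + b))) \<le> cmod c * (K ^ N * C)"
        by (rule mult_left_mono) simp
      then show ?thesis by (simp add: norm_mult mult_ac)
    qed
    then show ?case by blast
  next
    case (add u v)
    then obtain C D where "\<And>x. (1 + norm x) ^ N * cmod (u x) \<le> C" "\<And>x. (1 + norm x) ^ N * cmod (v x) \<le> D"
      by blast
    then have "(1 + norm x) ^ N * cmod (u x + v x) \<le> C + D" for x
      by (smt (verit) distrib_left mult_left_mono norm_ge_zero norm_triangle_ineq zero_le_power)
    then show ?case by blast
  qed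
qed

lemma schwartz_reflect: "schwartz f \<Longrightarrow> schwartz (\<lambda>x::real^'d. f (- x))"
  using schwartz_affine[of f "- mat 1" 0] det_uminus_mat_1[where 'd='d]
  by (auto simp: invertible_det_nz uminus_matrix_vector_mult)

definition deriv_seq :: "(nat \<Rightarrow> real \<Rightarrow> real) \<Rightarrow> bool" where
  "deriv_seq u \<longleftrightarrow> (\<forall>n t. (u n has_real_derivative u (Suc n) t) (at t))"

definition sprodfun :: "('d \<Rightarrow> nat \<Rightarrow> real \<Rightarrow> real) \<Rightarrow> ('d \<Rightarrow> nat) \<Rightarrow> real^'d \<Rightarrow> complex" where
  "sprodfun U n x = complex_of_real (\<Prod>i\<in>UNIV. U i (n i) (x $ i))"

lemma has_derivative_sprodfun:
  fixes U :: "'d::finite \<Rightarrow> nat \<Rightarrow> real \<Rightarrow> real"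
  assumes U: "\<And>i. deriv_seq (U i)"
  shows "(sprodfun U n has_derivative
    (\<lambda>h. of_real (\<Sum>i\<in>UNIV. U i (Suc (n i)) (x $ i) * h $ i * (\<Prod>j\<in>UNIV - {i}. U j (n j) (x $ j))))) (at x)"
proof -
  have d: "((\<lambda>x. U i (n i) (x $ i)) has_derivative (\<lambda>h. U i (Suc (n i)) (x $ i) * h $ i)) (at x)" for i
  proof -
    have 1: "((\<lambda>x. x $ i) has_derivative (\<lambda>h. h $ i)) (at x)"
      by (rule bounded_linear.has_derivative[OF bounded_linear_vec_nth has_derivative_ident])
    have 2: "(U i (n i) has_derivative (\<lambda>h. U i (Suc (n i)) (x $ i) * h)) (at (x $ i))"
      using U by (simp add: deriv_seq_def has_field_derivative_def)
    from diff_chain_at[OF 1 2] show ?thesis by (simp add: o_def)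
  qed
  have "((\<lambda>x. \<Prod>i\<in>UNIV. U i (n i) (x $ i)) has_derivative
    (\<lambda>h. \<Sum>i\<in>UNIV. U i (Suc (n i)) (x $ i) * h $ i * (\<Prod>j\<in>UNIV - {i}. U j (n j) (x $ j)))) (at x)"
    by (rule has_derivative_prod) (rule d)
  from has_derivative_of_real[OF this] show ?thesis
    unfolding sprodfun_def[abs_def] .
qed

lemma pdiff_sprodfun:
  fixes U :: "'d::finite \<Rightarrow> nat \<Rightarrow> real \<Rightarrow> real"
  assumes U: "\<And>i. deriv_seq (U i)"
  shows "pdiff l (sprodfun U n) = sprodfun U (n(l := Suc (n l)))"
proof
  fix x
  have "pdiff l (sprodfun U n) x = of_real (\<Sum>i\<in>UNIV. if i = l then U l (Suc (n l)) (x $ l) * (\<Prod>j\<in>UNIV - {l}. U j (n j) (x $ j)) else 0)"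
    unfolding pdiff_eqI[OF has_derivative_sprodfun[of U, OF U]]
    by (rule arg_cong[of _ _ of_real], rule sum.cong) (auto simp: axis_def)
  also have "\<dots> = of_real (U l (Suc (n l)) (x $ l) * (\<Prod>j\<in>UNIV - {l}. U j (n j) (x $ j)))" by simp
  also have "\<dots> = sprodfun U (n(l := Suc (n l))) x"
    unfolding sprodfun_def by (subst prod.remove[of UNIV l]) (auto intro!: prod.cong)
  finally show "pdiff l (sprodfun U n) x = sprodfun U (n(l := Suc (n l))) x" .
qed

lemma smooth_sprodfun:
  fixes U :: "'d::finite \<Rightarrow> nat \<Rightarrow> real \<Rightarrow> real"
  assumes U: "\<And>i. deriv_seq (U i)"
  shows "smooth (sprodfun U n)"
proof (rule smooth_class[of "\<lambda>f. \<exists>n. f = sprodfun U n"])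
  fix g x assume "\<exists>n. g = sprodfun U n"
  then show "g differentiable (at x)"
    unfolding differentiable_def using has_derivative_sprodfun[of U, OF U] by blast
qed (auto simp: pdiff_sprodfun[of U, OF U])

lemma pdiffs_sprodfun:
  fixes U :: "'d::finite \<Rightarrow> nat \<Rightarrow> real \<Rightarrow> real"
  assumes U: "\<And>i. deriv_seq (U i)"
  shows "pdiffs is (sprodfun U n) = sprodfun U (\<lambda>i. n i + count_list is i)"
  by (induction "is") (auto simp: pdiffs_Cons pdiff_sprodfun[of U, OF U] intro!: arg_cong[of _ _ "sprodfun U"])

subsection \<open>The Fourier transform on Schwartz functions\<close>

lemma one_plus_norm_shift:
  assumes "norm (y - x) \<le> 1"
  shows "1 / (1 + norm y) ^ N \<le> 2 ^ N / (1 + norm (x::'a::real_normed_vector)) ^ N"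
proof -
  have "1 + norm x \<le> 2 * (1 + norm y)"
    using norm_triangle_sub[of x y] assms norm_minus_commute[of x y] norm_ge_zero[of y]
    unfolding distrib_left by linarith
  then have "(1 + norm x) ^ N \<le> 2 ^ N * (1 + norm y) ^ N"
    unfolding power_mult_distrib[symmetric] by (intro power_mono) auto
  moreover have "0 < (1 + norm x) ^ N" "0 < (1 + norm y) ^ N" by (auto intro!: zero_less_power add_pos_nonneg)
  ultimately show ?thesis by (simp add: field_simps)
qed

lemma pdiff_increment_bound:
  fixes h :: "real^'d \<Rightarrow> complex"
  assumes h: "\<And>x. h differentiable (at x)" and B: "\<And>s. s \<in> {0..t} \<Longrightarrow> cmod (pdiff i h (x + s *\<^sub>R axis i 1)) \<le> B" and t: "0 \<le> t"
  shows "cmod (h (x + t *\<^sub>R axis i 1) - h x) \<le> B * t"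
proof -
  let ?g = "\<lambda>s::real. h (x + s *\<^sub>R axis i 1)"
  have d: "(?g has_derivative (\<lambda>r. r *\<^sub>R pdiff i h (x + s *\<^sub>R axis i 1))) (at s)" for s
  proof -
    let ?D = "frechet_derivative h (at (x + s *\<^sub>R axis i 1))"
    have 1: "((\<lambda>s::real. x + s *\<^sub>R axis i 1) has_derivative (\<lambda>r. r *\<^sub>R axis i 1)) (at s)"
      by (auto intro!: derivative_eq_intros)
    have 2: "(h has_derivative ?D) (at (x + s *\<^sub>R axis i 1))"
      using h frechet_derivative_works by blast
    have "linear ?D" using h by (rule linear_frechet_derivative)
    then show ?thesis using diff_chain_at[OF 1 2] by (simp add: o_def pdiff_def linear_scale)
  qed
  have "norm (?g t - ?g 0) \<le> B * norm (t - 0)"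
  proof (rule differentiable_bound[where S="{0..t}"])
    fix s assume s: "s \<in> {0..t}"
    show "(?g has_derivative (\<lambda>r. r *\<^sub>R pdiff i h (x + s *\<^sub>R axis i 1))) (at s within {0..t})"
      using d has_derivative_at_withinI by blast
    show "onorm (\<lambda>r. r *\<^sub>R pdiff i h (x + s *\<^sub>R axis i 1)) \<le> B"
      using B[OF s] by (intro onorm_le) (simp add: mult.commute[of B] mult_left_mono)
  qed (use t in auto)
  then show ?thesis using t by simp
qed

lemma integral_pdiff_eq_0:
  fixes h :: "real^'d \<Rightarrow> complex"
  assumes h: "schwartz h"
  shows "(LINT x|lborel. pdiff i h x) = 0"
proof -
  let ?a = "axis i 1 :: real^'d"
  let ?N = "2 * CARD('d)"
  define q where "q n x = of_real (real (Suc n)) * (h ((1 / Suc n) *\<^sub>R ?a + x) - h x)" for n x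
  have [measurable]: "h \<in> borel_measurable borel" "pdiff i h \<in> borel_measurable borel"
    using h by (auto intro: schwartz_borel schwartz_pdiff)
  have hd: "h differentiable (at x)" for x using h by (intro smooth_differentiable schwartz_smooth)
  have ih: "integrable lborel h" using h by (rule schwartz_integrable)
  have q0: "(LINT x|lborel. q n x) = 0" for n
    unfolding q_def using ih
    by (simp add: integrable_translate integral_translate Bochner_Integration.integral_diff)
  obtain C where C: "\<And>x. cmod (pdiff i h x) \<le> C / (1 + norm x) ^ ?N" and C0: "C > 0"
    using schwartz_decay'[OF schwartz_pdiff[OF h]] by metis
  have "(\<lambda>n. LINT x|lborel. q n x) \<longlonglongrightarrow> (LINT x|lborel. pdiff i h x)"
  proof (rule integral_dominated_convergence[where w="\<lambda>x. (C * 2 ^ ?N) * (1 / (1 + norm x) ^ ?N)"])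
    show "integrable lborel (\<lambda>x::real^'d. (C * 2 ^ ?N) * (1 / (1 + norm x) ^ ?N))"
      by (intro integrable_mult_right integrable_decay)
    show "AE x in lborel. (\<lambda>n. q n x) \<longlonglongrightarrow> pdiff i h x"
    proof (intro AE_I2)
      fix x
      let ?D = "frechet_derivative h (at x)"
      have D: "(h has_derivative ?D) (at x)" using hd frechet_derivative_works by blast
      have lin: "linear ?D" using hd by (rule linear_frechet_derivative)
      have lim: "(\<lambda>v. norm (h (x + v) - h x - ?D v) / norm v) \<midarrow>0\<rightarrow> 0"
        using D unfolding has_derivative_at by blast
      have "filterlim (\<lambda>n. (1 / Suc n) *\<^sub>R ?a) (at 0) sequentially"
      proof (rule filterlim_atI)
        have "(\<lambda>n. (1 / Suc n) *\<^sub>R ?a) \<longlonglongrightarrow> 0 *\<^sub>R ?a"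
          by (intro tendsto_scaleR tendsto_const LIMSEQ_Suc[OF lim_const_over_n[of 1]])
        then show "(\<lambda>n. (1 / Suc n) *\<^sub>R ?a) \<longlonglongrightarrow> 0" by simp
      qed (auto simp: axis_eq_0_iff)
      from filterlim_compose[OF lim this]
      have "(\<lambda>n. norm (h (x + (1 / Suc n) *\<^sub>R ?a) - h x - ?D ((1 / Suc n) *\<^sub>R ?a)) / norm ((1 / Suc n) *\<^sub>R ?a)) \<longlonglongrightarrow> 0" .
      also have "(\<lambda>n. norm (h (x + (1 / Suc n) *\<^sub>R ?a) - h x - ?D ((1 / Suc n) *\<^sub>R ?a)) / norm ((1 / Suc n) *\<^sub>R ?a))
        = (\<lambda>n. norm (q n x - pdiff i h x))"
      proof
        fix n
        have "q n x - pdiff i h x = of_real (real (Suc n)) * (h (x + (1 / Suc n) *\<^sub>R ?a) - h x - ?D ((1 / Suc n) *\<^sub>R ?a))"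
          unfolding q_def pdiff_def linear_scale[OF lin] scaleR_conv_of_real[of _ "?D ?a"] right_diff_distrib mult.assoc[symmetric]
            of_real_mult[symmetric] by (simp add: add.commute del: of_nat_Suc)
        then have "norm (q n x - pdiff i h x) = real (Suc n) * norm (h (x + (1 / Suc n) *\<^sub>R ?a) - h x - ?D ((1 / Suc n) *\<^sub>R ?a))"
          by (simp only: norm_mult norm_of_real abs_of_nat)
        then show "norm (h (x + (1 / Suc n) *\<^sub>R ?a) - h x - ?D ((1 / Suc n) *\<^sub>R ?a)) / norm ((1 / Suc n) *\<^sub>R ?a) = norm (q n x - pdiff i h x)"
          by simp
      qed
      finally show "(\<lambda>n. q n x) \<longlonglongrightarrow> pdiff i h x"
        by (simp add: tendsto_norm_zero_iff LIM_zero_iff)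
    qed
    fix n
    show "AE x in lborel. norm (q n x) \<le> (C * 2 ^ ?N) * (1 / (1 + norm x) ^ ?N)"
    proof (intro AE_I2)
      fix x
      have "cmod (h (x + (1 / Suc n) *\<^sub>R ?a) - h x) \<le> (C * 2 ^ ?N / (1 + norm x) ^ ?N) * (1 / Suc n)"
      proof (rule pdiff_increment_bound[OF hd])
        fix s :: real assume s: "s \<in> {0..1 / real (Suc n)}"
        then have "s \<le> 1" by (auto intro: order.trans)
        then have "norm (x + s *\<^sub>R ?a - x) \<le> 1" using s by simp
        from mult_left_mono[OF one_plus_norm_shift[OF this, of ?N], of C] C0
        show "cmod (pdiff i h (x + s *\<^sub>R ?a)) \<le> C * 2 ^ ?N / (1 + norm x) ^ ?N"
          by (intro order.trans[OF C]) simp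
      qed simp
      from mult_left_mono[OF this, of "real (Suc n)"]
      show "norm (q n x) \<le> (C * 2 ^ ?N) * (1 / (1 + norm x) ^ ?N)"
        unfolding q_def norm_mult norm_of_real by (simp add: add.commute del: of_nat_Suc)
    qed
  qed (simp_all add: q_def)
  then show ?thesis unfolding q0 by (simp add: LIMSEQ_const_iff)
qed

lemma integrable_mult_ee:
  fixes g :: "'a::topological_space \<Rightarrow> real"
  assumes "integrable M f" and [measurable]: "g \<in> borel_measurable M"
  shows "integrable M (\<lambda>x. f x * ee (g x))"
proof (rule Bochner_Integration.integrable_bound[OF assms(1)])
  show "(\<lambda>x. f x * ee (g x)) \<in> borel_measurable M" using borel_measurable_integrable[OF assms(1)] by measurable
qed (auto simp: norm_mult)

lemma schwartz_mult_ee: "schwartz f \<Longrightarrow> schwartz (\<lambda>x. f x * ee (x \<bullet> b))"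
  using schwartz_slow_mult[OF slow_ee] by (simp add: mult.commute)

lemma fourier_pdiff:
  fixes f :: "real^'d \<Rightarrow> complex"
  assumes f: "schwartz f"
  shows "fourier (pdiff i f) \<xi> = 2 * pi * \<i> * of_real (\<xi> $ i) * fourier f \<xi>"
proof -
  let ?e = "\<lambda>x. 1 * ee (x \<bullet> (- \<xi>))"
  have ed: "?e differentiable (at x)" for x
    unfolding differentiable_def using has_derivative_ee by blast
  have pe: "pdiff i ?e x = 2 * pi * \<i> * of_real (- \<xi> $ i) * ee (x \<bullet> (- \<xi>))" for x
    unfolding pdiff_eqI[OF has_derivative_ee] by (simp add: inner_axis_axis inner_axis')
  have fd: "f differentiable (at x)" for x using f by (intro smooth_differentiable schwartz_smooth)
  have s: "schwartz (\<lambda>x. f x * ?e x)" using schwartz_mult_ee[OF f, of "- \<xi>"] by simp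
  have i1: "integrable lborel (\<lambda>x. pdiff i f x * ee (- (x \<bullet> \<xi>)))"
    by (intro integrable_mult_ee schwartz_integrable schwartz_pdiff f) simp
  have i2: "integrable lborel (\<lambda>x. f x * ee (- (x \<bullet> \<xi>)))"
    by (intro integrable_mult_ee schwartz_integrable f) simp
  have "0 = (LINT x|lborel. pdiff i (\<lambda>x. f x * ?e x) x)"
    using integral_pdiff_eq_0[OF s] by simp
  also have "\<dots> = (LINT x|lborel. pdiff i f x * ee (- (x \<bullet> \<xi>)) - (2 * pi * \<i> * of_real (\<xi> $ i)) * (f x * ee (- (x \<bullet> \<xi>))))"
    unfolding pdiff_mult[OF fd ed] pe by (simp add: algebra_simps)
  also have "\<dots> = fourier (pdiff i f) \<xi> - (2 * pi * \<i> * of_real (\<xi> $ i)) * fourier f \<xi>"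
    unfolding fourier_ee using i1 i2 by (subst Bochner_Integration.integral_diff) auto
  finally show ?thesis by simp
qed

lemma fourier_pdiffs_replicate:
  assumes "schwartz f"
  shows "fourier (pdiffs (replicate p i) f) \<xi> = (2 * pi * \<i> * of_real (\<xi> $ i)) ^ p * fourier f \<xi>"
  by (induction p) (auto simp: pdiffs_Cons fourier_pdiff schwartz_pdiffs assms)

lemma cmod_fourier_le:
  assumes "integrable lborel f"
  shows "cmod (fourier f \<xi>) \<le> (LINT x|lborel. cmod (f x))"
proof -
  have "cmod (fourier f \<xi>) \<le> (LINT x|lborel. cmod (f x * ee (- (x \<bullet> \<xi>))))"
    unfolding fourier_ee by (rule integral_norm_bound)
  then show ?thesis by (simp add: norm_mult)
qed

lemma schwartz_norm_ge:
  fixes f :: "real^'d \<Rightarrow> complex"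
  assumes f: "schwartz f" and "length js \<le> N"
  shows "(1 + norm x) ^ N * cmod (pdiffs js f x) \<le> schwartz_norm N f"
proof -
  obtain C where C: "\<And>x. (1 + norm x) ^ N * dsum N f x \<le> C" using schwartz_dsum[OF f] by blast
  have "(1 + norm x) ^ N * cmod (pdiffs js f x) \<le> C" if "length js \<le> N" for js x
    using pdiffs_le_dsum[OF that, of f x] by (intro order.trans[OF mult_left_mono C]) auto
  then show ?thesis unfolding schwartz_norm_def using assms(2)
    by (intro cSUP_upper2[where x="(js, x)"] bdd_aboveI[where M=C]) auto
qed

lemma schwartz_norm_le:
  fixes f :: "real^'d \<Rightarrow> complex"
  assumes "\<And>js x. length js \<le> N \<Longrightarrow> (1 + norm x) ^ N * cmod (pdiffs js f x) \<le> C"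
  shows "schwartz_norm N f \<le> C"
  unfolding schwartz_norm_def using assms by (intro cSUP_least) (auto intro: exI[of _ "[]"])

text \<open>Multiplication by monomials of the frequency is differentiation, so that finitely many \<open>L\<^sup>1\<close>
  norms of derivatives control the decay.\<close>

lemma fourier_decay:
  fixes p :: nat
  obtains K N where "K \<ge> 0" "\<And>(f :: real^'d \<Rightarrow> complex) \<xi>. schwartz f \<Longrightarrow> (1 + norm \<xi>) ^ p * cmod (fourier f \<xi>) \<le> K * schwartz_norm N f"
proof -
  let ?d = "CARD('d)"
  define I0 where "I0 = (LINT x|lborel. 1 / (1 + norm (x::real^'d)) ^ (2 * ?d))"
  define N where "N = max p (2 * ?d)"
  have I0: "I0 \<ge> 0" unfolding I0_def by (intro integral_nonneg_AE) auto
  have bd: "(1 + norm \<xi>) ^ p * cmod (fourier f \<xi>) \<le> (1 + real ?d) ^ p * I0 * schwartz_norm N f"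
    if f: "schwartz f" for f :: "real^'d \<Rightarrow> complex" and \<xi>
  proof -
    have I: "(LINT x|lborel. cmod (pdiffs js f x)) \<le> I0 * schwartz_norm N f" if "length js \<le> N" for js
    proof -
      have "(LINT x|lborel. cmod (pdiffs js f x)) \<le> (LINT x|lborel. schwartz_norm N f * (1 / (1 + norm (x::real^'d)) ^ (2 * ?d)))"
      proof (rule integral_mono)
        show "integrable lborel (\<lambda>x. cmod (pdiffs js f x))"
          by (intro integrable_norm schwartz_integrable schwartz_pdiffs f)
        show "integrable lborel (\<lambda>x::real^'d. schwartz_norm N f * (1 / (1 + norm x) ^ (2 * ?d)))"
          by (intro integrable_mult_right integrable_decay)
        fix x :: "real^'d"
        have "(1 + norm x) ^ (2 * ?d) * cmod (pdiffs js f x) \<le> (1 + norm x) ^ N * cmod (pdiffs js f x)"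
          by (intro mult_right_mono power_increasing) (auto simp: N_def)
        also have "\<dots> \<le> schwartz_norm N f" by (rule schwartz_norm_ge[OF f that])
        finally show "cmod (pdiffs js f x) \<le> schwartz_norm N f * (1 / (1 + norm x) ^ (2 * ?d))"
          by (simp add: pos_le_divide_eq add_pos_nonneg mult.commute)
      qed
      also have "\<dots> = I0 * schwartz_norm N f"
        unfolding I0_def by (subst integral_mult_right_zero) (rule mult.commute)
      finally show ?thesis .
    qed
    obtain i where i: "\<And>j. \<bar>\<xi> $ j\<bar> \<le> \<bar>\<xi> $ i\<bar>"
    proof -
      have "Max (range (\<lambda>j. \<bar>\<xi> $ j\<bar>)) \<in> range (\<lambda>j. \<bar>\<xi> $ j\<bar>)" by (rule Max_in) auto
      then obtain i where "Max (range (\<lambda>j. \<bar>\<xi> $ j\<bar>)) = \<bar>\<xi> $ i\<bar>" by (rule imageE)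
      then have "\<bar>\<xi> $ j\<bar> \<le> \<bar>\<xi> $ i\<bar>" for j
        using Max_ge[of "range (\<lambda>j. \<bar>\<xi> $ j\<bar>)" "\<bar>\<xi> $ j\<bar>"] by auto
      then show ?thesis using that by blast
    qed
    have n: "norm \<xi> \<le> real ?d * \<bar>\<xi> $ i\<bar>"
    proof -
      have "norm \<xi> \<le> (\<Sum>j\<in>UNIV. \<bar>\<xi> $ j\<bar>)" by (rule norm_le_l1_cart)
      also have "\<dots> \<le> (\<Sum>j\<in>(UNIV::'d set). \<bar>\<xi> $ i\<bar>)" by (intro sum_mono i)
      finally show ?thesis by simp
    qed
    define k where "k = (if \<bar>\<xi> $ i\<bar> \<le> 1 then 0 else p)"
    have "(1 + norm \<xi>) ^ p \<le> (1 + real ?d) ^ p * \<bar>\<xi> $ i\<bar> ^ k"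
    proof (cases "\<bar>\<xi> $ i\<bar> \<le> 1")
      case True
      then have "real ?d * \<bar>\<xi> $ i\<bar> \<le> real ?d * 1" by (intro mult_left_mono) auto
      then have "1 + norm \<xi> \<le> 1 + real ?d" using n by linarith
      then show ?thesis using True by (simp add: k_def power_mono)
    next
      case False
      then have "1 + norm \<xi> \<le> (1 + real ?d) * \<bar>\<xi> $ i\<bar>" using n by (simp add: algebra_simps)
      then have "(1 + norm \<xi>) ^ p \<le> ((1 + real ?d) * \<bar>\<xi> $ i\<bar>) ^ p" by (intro power_mono) auto
      then show ?thesis using False by (simp add: k_def power_mult_distrib)
    qed
    also have "\<dots> \<le> (1 + real ?d) ^ p * cmod ((2 * pi * \<i> * of_real (\<xi> $ i)) ^ k)"
    proof (intro mult_left_mono)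
      have "1 \<le> 2 * pi" using pi_ge_two by linarith
      then have "1 * \<bar>\<xi> $ i\<bar> \<le> 2 * pi * \<bar>\<xi> $ i\<bar>" by (intro mult_right_mono) auto
      then show "\<bar>\<xi> $ i\<bar> ^ k \<le> cmod ((2 * pi * \<i> * of_real (\<xi> $ i)) ^ k)"
        by (simp add: norm_power norm_mult power_mono)
    qed simp
    finally have "(1 + norm \<xi>) ^ p * cmod (fourier f \<xi>) \<le> (1 + real ?d) ^ p * cmod ((2 * pi * \<i> * of_real (\<xi> $ i)) ^ k) * cmod (fourier f \<xi>)"
      by (rule mult_right_mono) simp
    also have "\<dots> = (1 + real ?d) ^ p * cmod (fourier (pdiffs (replicate k i) f) \<xi>)"
      by (simp add: fourier_pdiffs_replicate[OF f] norm_mult)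
    also have "\<dots> \<le> (1 + real ?d) ^ p * (I0 * schwartz_norm N f)"
    proof (intro mult_left_mono order.trans[OF cmod_fourier_le])
      show "integrable lborel (pdiffs (replicate k i) f)" by (intro schwartz_integrable schwartz_pdiffs f)
      show "(LINT x|lborel. cmod (pdiffs (replicate k i) f x)) \<le> I0 * schwartz_norm N f"
        by (rule I) (auto simp: k_def N_def)
    qed simp
    finally show ?thesis by (simp add: mult.assoc)
  qed
  show ?thesis by (rule that[OF _ bd]) (auto simp: I0)
qed

lemma cmod_ee_taylor: "cmod (ee t - 1 - 2 * pi * \<i> * of_real t) \<le> 2 * pi^2 * t^2"
proof -
  have "ee t = iexp (2 * pi * t)" by (simp add: ee_def mult_ac)
  moreover have "(\<Sum>k\<le>1. (\<i> * complex_of_real (2 * pi * t)) ^ k / fact k) = 1 + 2 * pi * \<i> * of_real t"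
    by (simp add: mult_ac)
  moreover have "\<bar>2 * pi * t\<bar> ^ Suc 1 / fact (Suc 1) = 2 * pi^2 * t^2"
    by (simp add: power2_eq_square abs_mult)
  ultimately show ?thesis using iexp_approx1[of "2 * pi * t" 1] by (simp add: algebra_simps)
qed

lemma has_derivative_fourier:
  fixes f :: "real^'d \<Rightarrow> complex"
  assumes f: "schwartz f"
  shows "(fourier f has_derivative
     (\<lambda>h. \<Sum>l\<in>UNIV. of_real (h $ l) * fourier (\<lambda>x. (- 2 * pi * \<i>) * (of_real (x $ l) * f x)) \<xi>)) (at \<xi>)"
    (is "(_ has_derivative ?D) _")
  unfolding has_derivative_at
proof
  show "bounded_linear ?D"
    by (intro bounded_linear_sum bounded_linear_mult_const bounded_linear_of_real
      bounded_linear_compose[OF bounded_linear_of_real] bounded_linear_vec_nth)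
  have s2: "schwartz (\<lambda>x. of_real (x $ l) * f x)" for l by (intro schwartz_slow_mult slow_coord f)
  have s: "schwartz (\<lambda>x. (- 2 * pi * \<i>) * (of_real (x $ l) * f x))" for l by (intro schwartz_cmult s2)
  have s3: "schwartz (\<lambda>x. of_real (x $ l) * (of_real (x $ l) * f x))" for l by (intro schwartz_slow_mult slow_coord f)
  define C where "C = 2 * pi^2 * (LINT x|lborel. (norm x)^2 * cmod (f x))"
  have i2: "integrable lborel (\<lambda>x. (norm x)^2 * cmod (f x))"
  proof -
    have "integrable lborel (\<lambda>x. \<Sum>l\<in>UNIV. cmod (of_real (x $ l) * (of_real (x $ l) * f x)))"
      by (intro Bochner_Integration.integrable_sum integrable_norm schwartz_integrable s3)
    also have "(\<lambda>x. \<Sum>l\<in>UNIV. cmod (of_real (x $ l) * (of_real (x $ l) * f x))) = (\<lambda>x. (norm x)^2 * cmod (f x))"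
      by (simp add: fun_eq_iff norm_mult power2_norm_eq_inner inner_vec_def sum_distrib_right flip: mult.assoc abs_mult)
    finally show ?thesis .
  qed
  have est: "norm (fourier f (\<xi> + h) - fourier f \<xi> - ?D h) \<le> C * norm h ^ 2" for h
  proof -
    let ?e = "\<lambda>x. ee (- (x \<bullet> \<xi>))"
    have D: "?D h = (LINT x|lborel. (- 2 * pi * \<i> * of_real (x \<bullet> h)) * f x * ?e x)"
    proof -
      have "?D h = (LINT x|lborel. (\<Sum>l\<in>UNIV. of_real (h $ l) * ((- 2 * pi * \<i>) * (of_real (x $ l) * f x) * ?e x)))"
        unfolding fourier_ee
        by (subst Bochner_Integration.integral_sum)
          (intro integrable_mult_right integrable_mult_ee schwartz_integrable s, simp, simp only: integral_mult_right_zero mult.assoc)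
      also have "\<dots> = (LINT x|lborel. (- 2 * pi * \<i> * of_real (x \<bullet> h)) * f x * ?e x)"
        by (intro Bochner_Integration.integral_cong refl)
          (simp add: inner_vec_def sum_distrib_left sum_distrib_right sum_negf mult_ac)
      finally show ?thesis .
    qed
    have iD: "integrable lborel (\<lambda>x. (- 2 * pi * \<i> * of_real (x \<bullet> h)) * f x * ?e x)"
    proof -
      have "integrable lborel (\<lambda>x. (\<Sum>l\<in>UNIV. of_real (h $ l) * ((- 2 * pi * \<i>) * (of_real (x $ l) * f x) * ?e x)))"
        by (intro Bochner_Integration.integrable_sum integrable_mult_right integrable_mult_ee schwartz_integrable s) simp
      also have "(\<lambda>x. (\<Sum>l\<in>UNIV. of_real (h $ l) * ((- 2 * pi * \<i>) * (of_real (x $ l) * f x) * ?e x)))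
          = (\<lambda>x. (- 2 * pi * \<i> * of_real (x \<bullet> h)) * f x * ?e x)"
        by (simp add: inner_vec_def sum_distrib_left sum_distrib_right sum_negf mult_ac fun_eq_iff)
      finally show ?thesis .
    qed
    have i1: "integrable lborel (\<lambda>x. f x * ee (- (x \<bullet> \<zeta>)))" for \<zeta>
      by (intro integrable_mult_ee schwartz_integrable f) simp
    have "fourier f (\<xi> + h) - fourier f \<xi> - ?D h
       = (LINT x|lborel. f x * ee (- (x \<bullet> (\<xi> + h))) - f x * ?e x - (- 2 * pi * \<i> * of_real (x \<bullet> h)) * f x * ?e x)"
      unfolding D unfolding fourier_ee using i1 iD by (simp add: Bochner_Integration.integral_diff)
    also have "\<dots> = (LINT x|lborel. f x * ?e x * (ee (- (x \<bullet> h)) - 1 - 2 * pi * \<i> * of_real (- (x \<bullet> h))))"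
      by (intro Bochner_Integration.integral_cong refl) (simp add: inner_add_right ee_add[of "- (x \<bullet> \<xi>)" "- (x \<bullet> h)" for x, simplified] algebra_simps)
    finally have "norm (fourier f (\<xi> + h) - fourier f \<xi> - ?D h) 
      \<le> (LINT x|lborel. cmod (f x * ?e x * (ee (- (x \<bullet> h)) - 1 - 2 * pi * \<i> * of_real (- (x \<bullet> h)))))"
      by (simp only: integral_norm_bound)
    also have "\<dots> \<le> (LINT x|lborel. (2 * pi^2 * norm h ^ 2) * ((norm x)^2 * cmod (f x)))"
    proof (rule integral_mono')
      show "integrable lborel (\<lambda>x. (2 * pi^2 * norm h ^ 2) * ((norm x)^2 * cmod (f x)))"
        by (intro integrable_mult_right i2)
      fix x
      have "(x \<bullet> h)^2 \<le> (norm x * norm h)^2"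
        using Cauchy_Schwarz_ineq2[of x h] by (simp add: abs_le_square_iff[symmetric])
      then have "2 * pi^2 * (- (x \<bullet> h))^2 \<le> 2 * pi^2 * (norm x * norm h)^2"
        by (intro mult_left_mono) auto
      then have "cmod (ee (- (x \<bullet> h)) - 1 - 2 * pi * \<i> * of_real (- (x \<bullet> h))) \<le> 2 * pi^2 * (norm x * norm h)^2"
        using cmod_ee_taylor[of "- (x \<bullet> h)"] by linarith
      from mult_left_mono[OF this norm_ge_zero[of "f x"]]
      show "cmod (f x * ?e x * (ee (- (x \<bullet> h)) - 1 - 2 * pi * \<i> * of_real (- (x \<bullet> h)))) \<le> (2 * pi^2 * norm h ^ 2) * ((norm x)^2 * cmod (f x))"
        unfolding norm_mult cmod_ee by (simp add: power_mult_distrib mult_ac)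
    qed auto
    also have "\<dots> = C * norm h ^ 2" by (simp add: C_def)
    finally show ?thesis .
  qed
  show "(\<lambda>h. norm (fourier f (\<xi> + h) - fourier f \<xi> - ?D h) / norm h) \<midarrow>0\<rightarrow> 0"
  proof (rule tendsto_sandwich[of "\<lambda>_. 0" _ _ "\<lambda>h. C * norm h"])
    show "\<forall>\<^sub>F h in at 0. norm (fourier f (\<xi> + h) - fourier f \<xi> - ?D h) / norm h \<le> C * norm h"
    proof (intro always_eventually allI)
      fix h :: "real^'d"
      show "norm (fourier f (\<xi> + h) - fourier f \<xi> - ?D h) / norm h \<le> C * norm h"
        using est[of h] by (cases "h = 0") (auto simp: pos_divide_le_eq power2_eq_square mult_ac)
    qed
    show "((\<lambda>h. C * norm h) \<longlongrightarrow> 0) (at (0::real^'d))"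
      by (intro tendsto_mult_right_zero tendsto_norm_zero tendsto_ident_at)
  qed auto
qed

lemma pdiff_fourier:
  fixes f :: "real^'d \<Rightarrow> complex"
  assumes "schwartz f"
  shows "pdiff i (fourier f) = fourier (\<lambda>x. (- 2 * pi * \<i>) * (of_real (x $ i) * f x))"
proof
  fix \<xi> :: "real^'d"
  have "pdiff i (fourier f) \<xi> = (\<Sum>l\<in>UNIV. if l = i then fourier (\<lambda>x. (- 2 * pi * \<i>) * (of_real (x $ l) * f x)) \<xi> else 0)"
    unfolding pdiff_eqI[OF has_derivative_fourier[OF assms]] by (rule sum.cong) (auto simp: axis_def)
  then show "pdiff i (fourier f) \<xi> = fourier (\<lambda>x. (- 2 * pi * \<i>) * (of_real (x $ i) * f x)) \<xi>" by simp
qed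

lemma schwartz_fourier:
  fixes f :: "real^'d \<Rightarrow> complex"
  assumes "schwartz f"
  shows "schwartz (fourier f)"
proof (rule schwartz_class[of "\<lambda>g. \<exists>f. schwartz f \<and> g = fourier f"])
  fix g :: "real^'d \<Rightarrow> complex" and x i N
  assume "\<exists>f. schwartz f \<and> g = fourier f"
  then obtain f where f: "schwartz f" and g: "g = fourier f" by blast
  show "g differentiable (at x)" unfolding g differentiable_def using has_derivative_fourier[OF f] by blast
  show "\<exists>f. schwartz f \<and> pdiff i g = fourier f"
    unfolding g pdiff_fourier[OF f]
    by (intro exI[of _ "\<lambda>x. (- 2 * pi * \<i>) * (of_real (x $ i) * f x)"] conjI refl schwartz_cmult schwartz_slow_mult slow_coord f)
  show "\<exists>C. \<forall>x. (1 + norm x) ^ N * cmod (g x) \<le> C"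
    unfolding g using fourier_decay[of N] f by metis
qed (use assms in auto)

lemma Fubini_bounded_kernel:
  fixes f g :: "real^'d \<Rightarrow> complex"
  assumes f: "integrable lborel f" and g: "integrable lborel g"
    and k[measurable]: "(\<lambda>(x, y). k x y) \<in> borel_measurable (borel \<Otimes>\<^sub>M borel)" and k1: "\<And>x y. cmod (k x y) \<le> 1"
  shows "(LINT x|lborel. f x * (LINT y|lborel. g y * k x y)) = (LINT y|lborel. g y * (LINT x|lborel. f x * k x y))"
proof -
  have [measurable]: "f \<in> borel_measurable borel" "g \<in> borel_measurable borel"
    using f g by (auto dest: borel_measurable_integrable)
  have le: "cmod (f x * g y * k x y) \<le> cmod (f x) * cmod (g y)" for x y
    using mult_left_mono[OF k1[of x y], of "cmod (f x) * cmod (g y)"] by (simp add: norm_mult)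
  have ig: "integrable lborel (\<lambda>y. f x * g y * k x y)" for x
    by (rule Bochner_Integration.integrable_bound[of _ "\<lambda>y. cmod (f x) * cmod (g y)"])
      (use g le in \<open>auto simp: abs_mult\<close>)
  have int: "integrable (lborel \<Otimes>\<^sub>M lborel) (\<lambda>(x, y). f x * g y * k x y)"
  proof (rule lborel_pair.Fubini_integrable)
    show "integrable lborel (\<lambda>x. LINT y|lborel. cmod (case (x, y) of (x, y) \<Rightarrow> f x * g y * k x y))"
    proof (rule Bochner_Integration.integrable_bound)
      show "integrable lborel (\<lambda>x. cmod (f x) * (LINT y|lborel. cmod (g y)))"
        using f by simp
      have "(LINT y|lborel. cmod (f x * g y * k x y)) \<le> (LINT y|lborel. cmod (f x) * cmod (g y))" for x
        using g le by (intro integral_mono integrable_norm ig) auto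
      then show "AE x in lborel. norm (LINT y|lborel. cmod (case (x, y) of (x, y) \<Rightarrow> f x * g y * k x y))
          \<le> norm (cmod (f x) * (LINT y|lborel. cmod (g y)))"
        by (simp add: abs_of_nonneg)
    qed measurable
  qed (use ig in auto)
  have "(LINT x|lborel. f x * (LINT y|lborel. g y * k x y)) = (LINT x|lborel. LINT y|lborel. f x * g y * k x y)"
    by (simp add: mult.assoc)
  also have "\<dots> = (LINT y|lborel. LINT x|lborel. f x * g y * k x y)"
    using lborel_pair.Fubini_integral[OF int] by simp
  also have "\<dots> = (LINT y|lborel. g y * (LINT x|lborel. f x * k x y))"
  proof -
    have "(LINT x|lborel. f x * g y * k x y) = (LINT x|lborel. g y * (f x * k x y))" for y
      by (simp add: mult_ac)
    then show ?thesis by simp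
  qed
  finally show ?thesis .
qed


lemma char_std_normal_ee:
  "(LINT t|lborel. complex_of_real (std_normal_density t) * ee (- (t * u))) = of_real (sqrt (2 * pi) * std_normal_density (2 * pi * u))"
proof -
  have "(LINT t|lborel. complex_of_real (std_normal_density t) * ee (- (t * u)))
     = (LINT t|lborel. std_normal_density t *\<^sub>R iexp ((- 2 * pi * u) * t))"
    by (intro Bochner_Integration.integral_cong refl) (simp add: scaleR_conv_of_real ee_def mult_ac)
  also have "\<dots> = char std_normal_distribution (- 2 * pi * u)"
    unfolding char_def by (subst integral_density) auto
  also have "\<dots> = of_real (exp (- ((- 2 * pi * u)\<^sup>2) / 2))"
    by (simp add: char_std_normal_distribution)
  finally show ?thesis by (simp add: std_normal_density_def)
qed

lemma
  fixes f :: "real^'d \<Rightarrow> complex"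
  assumes c: "c \<noteq> 0" and f: "f \<in> borel_measurable borel"
  shows integral_scale: "(LINT x|lborel. f (c *\<^sub>R x)) = (1 / \<bar>c\<bar> ^ CARD('d)) *\<^sub>R (LINT x|lborel. f x)"
    and integrable_scale: "integrable lborel (\<lambda>x. f (c *\<^sub>R x)) \<longleftrightarrow> integrable lborel f"
proof -
  let ?B = "c *\<^sub>R mat 1 :: real^'d^'d"
  have B: "?B *v x = c *\<^sub>R x" for x by (simp add: scaleR_matrix_vector_assoc[symmetric])
  have d: "det ?B = c ^ CARD('d)"
    by (subst det_diagonal) (auto simp: mat_def)
  have i: "invertible ?B" using c by (simp add: invertible_det_nz d)
  show "(LINT x|lborel. f (c *\<^sub>R x)) = (1 / \<bar>c\<bar> ^ CARD('d)) *\<^sub>R (LINT x|lborel. f x)"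
    using integral_matrix[OF i f] by (simp add: B d power_abs)
  show "integrable lborel (\<lambda>x. f (c *\<^sub>R x)) \<longleftrightarrow> integrable lborel f"
    using integrable_matrix[OF i f] by (simp add: B)
qed

lemma schwartz_scale:
  fixes f :: "real^'d \<Rightarrow> complex"
  assumes "schwartz f" "c \<noteq> 0"
  shows "schwartz (\<lambda>x. f (c *\<^sub>R x))"
proof -
  let ?B = "c *\<^sub>R mat 1 :: real^'d^'d"
  have B: "?B *v x = c *\<^sub>R x" for x by (simp add: scaleR_matrix_vector_assoc[symmetric])
  have "det ?B = c ^ CARD('d)"
    by (subst det_diagonal) (auto simp: mat_def)
  then have "invertible ?B" using assms(2) by (simp add: invertible_det_nz)
  from schwartz_affine[OF assms(1) this, of 0] show ?thesis by (simp add: B)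
qed

lemma fourier_scale:
  fixes f :: "real^'d \<Rightarrow> complex"
  assumes "schwartz f" "c > 0"
  shows "fourier (\<lambda>x. f (c *\<^sub>R x)) \<xi> = (1 / c ^ CARD('d)) *\<^sub>R fourier f ((1 / c) *\<^sub>R \<xi>)"
proof -
  have [measurable]: "f \<in> borel_measurable borel" using assms by (intro schwartz_borel)
  show ?thesis
    unfolding fourier_ee using assms(2)
      integral_scale[of c "\<lambda>x. f x * ee (- (x \<bullet> (1 / c) *\<^sub>R \<xi>))"] by simp
qed

lemma fourier_gauss_mult:
  fixes f :: "real^'d \<Rightarrow> complex"
  defines "\<gamma> \<equiv> \<lambda>x::real^'d. \<Prod>i\<in>UNIV. complex_of_real (std_normal_density (x $ i))"
  assumes f: "schwartz f"
  shows "(LINT \<xi>|lborel. fourier f \<xi> * \<gamma> \<xi>) = of_real (sqrt (2 * pi) ^ CARD('d)) * (LINT x|lborel. f x * \<gamma> ((2 * pi) *\<^sub>R x))"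
proof -
  have i1: "integrable lborel (\<lambda>t. complex_of_real (std_normal_density t))" by (intro integrable_of_real) auto
  have ig: "integrable lborel \<gamma>" unfolding \<gamma>_def by (rule integrable_lborel_prod[OF i1])
  have g: "(LINT \<xi>|lborel. \<gamma> \<xi> * ee (- (x \<bullet> \<xi>))) = of_real (sqrt (2 * pi) ^ CARD('d)) * \<gamma> ((2 * pi) *\<^sub>R x)" for x
  proof -
    have e: "ee (- (x \<bullet> \<xi>)) = (\<Prod>i\<in>UNIV. ee (- (\<xi> $ i * x $ i)))" for \<xi>
    proof -
      have "ee (\<Sum>i\<in>A. a i) = (\<Prod>i\<in>A. ee (a i))" if "finite A" for a and A :: "'d set"
        using that by (induction A rule: finite_induct) (auto simp: ee_add)
      from this[of UNIV "\<lambda>i. - (\<xi> $ i * x $ i)"] show ?thesis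
        by (simp add: inner_vec_def sum_negf mult.commute)
    qed
    have "(LINT \<xi>|lborel. \<gamma> \<xi> * ee (- (x \<bullet> \<xi>)))
      = (LINT \<xi>|lborel. (\<Prod>i\<in>UNIV. complex_of_real (std_normal_density (\<xi> $ i)) * ee (- (\<xi> $ i * x $ i))))"
      unfolding \<gamma>_def e prod.distrib ..
    also have "\<dots> = (\<Prod>i\<in>UNIV. (LINT t|lborel. complex_of_real (std_normal_density t) * ee (- (t * x $ i))))"
      by (rule integral_lborel_prod, rule integrable_mult_ee[OF i1]) auto
    also have "\<dots> = of_real (sqrt (2 * pi) ^ CARD('d)) * \<gamma> ((2 * pi) *\<^sub>R x)"
      unfolding char_std_normal_ee \<gamma>_def by (simp add: prod.distrib)
    finally show ?thesis .
  qed
  have "(LINT \<xi>|lborel. fourier f \<xi> * \<gamma> \<xi>) = (LINT \<xi>|lborel. \<gamma> \<xi> * (LINT x|lborel. f x * ee (- (x \<bullet> \<xi>))))"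
    unfolding fourier_ee by (simp add: mult.commute)
  also have "\<dots> = (LINT x|lborel. f x * (LINT \<xi>|lborel. \<gamma> \<xi> * ee (- (x \<bullet> \<xi>))))"
    by (rule Fubini_bounded_kernel) (use ig schwartz_integrable[OF f] in auto)
  also have "\<dots> = of_real (sqrt (2 * pi) ^ CARD('d)) * (LINT x|lborel. f x * \<gamma> ((2 * pi) *\<^sub>R x))"
    unfolding g by (simp only: mult.left_commute[of "f _"] integral_mult_right_zero)
  finally show ?thesis .
qed

lemma fourier_inversion_0:
  fixes f :: "real^'d \<Rightarrow> complex"
  assumes f: "schwartz f"
  shows "(LINT \<xi>|lborel. fourier f \<xi>) = f 0"
proof -
  let ?d = "CARD('d)"
  define \<gamma> where "\<gamma> = (\<lambda>x::real^'d. \<Prod>i\<in>UNIV. complex_of_real (std_normal_density (x $ i)))"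
  define a where "a = complex_of_real (sqrt (2 * pi) ^ ?d)"
  have a0: "a \<noteq> 0" by (simp add: a_def)
  have i1: "integrable lborel (\<lambda>t. complex_of_real (std_normal_density t))" by (intro integrable_of_real) auto
  have ig: "integrable lborel \<gamma>" unfolding \<gamma>_def by (rule integrable_lborel_prod[OF i1])
  have [measurable]: "f \<in> borel_measurable borel" "fourier f \<in> borel_measurable borel" "\<gamma> \<in> borel_measurable borel"
    using f borel_measurable_integrable[OF ig] by (auto intro: schwartz_borel schwartz_fourier)
  have \<gamma>0: "\<gamma> 0 = 1 / a"
    by (simp add: \<gamma>_def a_def std_normal_density_def power_divide)
  have \<gamma>le: "cmod (\<gamma> x) \<le> 1" for x
  proof -
    have s: "1 \<le> sqrt (2 * pi)" using pi_ge_two by (intro real_le_rsqrt) auto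
    have "std_normal_density t \<le> 1" for t
    proof -
      have "1 / sqrt (2 * pi) * exp (- t\<^sup>2 / 2) \<le> 1 * 1"
        using s by (intro mult_mono) auto
      then show ?thesis by (simp add: std_normal_density_def)
    qed
    then have "0 \<le> std_normal_density (x $ i) \<and> std_normal_density (x $ i) \<le> 1" for i
      by (simp add: normal_density_nonneg)
    then show ?thesis unfolding \<gamma>_def prod_norm[symmetric] by (intro prod_le_1) auto
  qed
  have i\<gamma>: "(LINT x|lborel. \<gamma> ((2 * pi) *\<^sub>R x)) = 1 / a / a"
  proof -
    have "(LINT x|lborel. \<gamma> ((2 * pi) *\<^sub>R x)) = (1 / (2 * pi) ^ ?d) *\<^sub>R (LINT x|lborel. \<gamma> x)"
      by (subst integral_scale) auto
    also have "(LINT x|lborel. \<gamma> x) = 1"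
      unfolding \<gamma>_def by (subst integral_lborel_prod[OF i1]) simp
    also have "(1 / (2 * pi) ^ ?d) *\<^sub>R (1::complex) = 1 / a / a"
    proof -
      have "a * a = of_real ((2 * pi) ^ ?d)"
        unfolding a_def of_real_mult[symmetric] power_mult_distrib[symmetric] by simp
      then show ?thesis by (simp add: scaleR_conv_of_real)
    qed
    finally show ?thesis .
  qed
  define c where "c n = 1 / real (Suc n)" for n
  have c0: "c n > 0" for n by (simp add: c_def)
  have c_lim: "c \<longlonglongrightarrow> 0" unfolding c_def by (rule LIMSEQ_Suc[OF lim_const_over_n[of 1]])
  have cx: "(\<lambda>n. c n *\<^sub>R x) \<longlonglongrightarrow> 0" for x :: "real^'d"
    using tendsto_scaleR[OF c_lim tendsto_const, of x] by simp
  have sf: "schwartz (\<lambda>x. f (c n *\<^sub>R x))" for n by (rule schwartz_scale[OF f]) (use c0[of n] in simp)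
  have key: "(LINT \<xi>|lborel. fourier f \<xi> * \<gamma> (c n *\<^sub>R \<xi>)) = a * (LINT x|lborel. f (c n *\<^sub>R x) * \<gamma> ((2 * pi) *\<^sub>R x))" for n
  proof -
    define g where "g \<xi> = fourier f \<xi> * \<gamma> (c n *\<^sub>R \<xi>)" for \<xi>
    have [measurable]: "g \<in> borel_measurable borel" unfolding g_def by measurable
    have "a * (LINT x|lborel. f (c n *\<^sub>R x) * \<gamma> ((2 * pi) *\<^sub>R x)) = (LINT \<xi>|lborel. fourier (\<lambda>x. f (c n *\<^sub>R x)) \<xi> * \<gamma> \<xi>)"
      unfolding \<gamma>_def a_def by (rule fourier_gauss_mult[OF sf, symmetric])
    also have "\<dots> = (LINT \<xi>|lborel. (1 / c n ^ ?d) *\<^sub>R g ((1 / c n) *\<^sub>R \<xi>))"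
      unfolding fourier_scale[OF f c0] g_def using c0[of n] by simp
    also have "\<dots> = (LINT \<xi>|lborel. g \<xi>)"
      using c0[of n] by (simp add: integral_scale power_one_over)
    finally show ?thesis by (simp add: g_def)
  qed
  have g_cont: "continuous_on UNIV \<gamma>"
    unfolding \<gamma>_def std_normal_density_def by (intro continuous_intros) auto
  have L: "(\<lambda>n. LINT \<xi>|lborel. fourier f \<xi> * \<gamma> (c n *\<^sub>R \<xi>)) \<longlonglongrightarrow> (LINT \<xi>|lborel. fourier f \<xi> * \<gamma> 0)"
  proof (rule integral_dominated_convergence[where w="\<lambda>\<xi>. cmod (fourier f \<xi>)"])
    show "integrable lborel (\<lambda>\<xi>. cmod (fourier f \<xi>))"
      by (intro integrable_norm schwartz_integrable schwartz_fourier f)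
    show "AE \<xi> in lborel. (\<lambda>n. fourier f \<xi> * \<gamma> (c n *\<^sub>R \<xi>)) \<longlonglongrightarrow> fourier f \<xi> * \<gamma> 0"
      by (intro AE_I2 tendsto_mult tendsto_const continuous_on_tendsto_compose[OF g_cont cx]) auto
    show "AE \<xi> in lborel. norm (fourier f \<xi> * \<gamma> (c n *\<^sub>R \<xi>)) \<le> cmod (fourier f \<xi>)" for n
      using \<gamma>le by (auto simp: norm_mult intro!: AE_I2 mult_left_le)
  qed auto
  obtain B where B: "\<And>x. cmod (f x) \<le> B / (1 + norm x) ^ 0" using schwartz_decay'[OF f] by metis
  have R: "(\<lambda>n. LINT x|lborel. f (c n *\<^sub>R x) * \<gamma> ((2 * pi) *\<^sub>R x)) \<longlonglongrightarrow> (LINT x|lborel. f 0 * \<gamma> ((2 * pi) *\<^sub>R x))"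
  proof (rule integral_dominated_convergence[where w="\<lambda>x. B * cmod (\<gamma> ((2 * pi) *\<^sub>R x))"])
    show "integrable lborel (\<lambda>x. B * cmod (\<gamma> ((2 * pi) *\<^sub>R x)))"
      by (intro integrable_mult_right integrable_norm) (simp add: integrable_scale ig)
    show "AE x in lborel. (\<lambda>n. f (c n *\<^sub>R x) * \<gamma> ((2 * pi) *\<^sub>R x)) \<longlonglongrightarrow> f 0 * \<gamma> ((2 * pi) *\<^sub>R x)"
      by (intro AE_I2 tendsto_mult tendsto_const continuous_on_tendsto_compose[OF smooth_continuous[OF schwartz_smooth[OF f]] cx]) auto
    show "AE x in lborel. norm (f (c n *\<^sub>R x) * \<gamma> ((2 * pi) *\<^sub>R x)) \<le> B * cmod (\<gamma> ((2 * pi) *\<^sub>R x))" for n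
      using B by (auto simp: norm_mult intro!: AE_I2 mult_right_mono)
  qed auto
  have "(LINT \<xi>|lborel. fourier f \<xi> * \<gamma> 0) = a * (LINT x|lborel. f 0 * \<gamma> ((2 * pi) *\<^sub>R x))"
    by (rule LIMSEQ_unique[OF L]) (unfold key, intro tendsto_mult tendsto_const R)
  then have "(LINT \<xi>|lborel. fourier f \<xi>) * (1 / a) = a * (f 0 * (1 / a / a))"
    by (simp only: integral_mult_left_zero integral_mult_right_zero i\<gamma> \<gamma>0)
  then show ?thesis using a0 by (simp add: field_simps)
qed

lemma fourier_translate:
  assumes [measurable]: "f \<in> borel_measurable borel"
  shows "fourier (\<lambda>y. f (x + y)) \<xi> = ee (x \<bullet> \<xi>) * fourier f \<xi>"
proof -
  have "fourier (\<lambda>y. f (x + y)) \<xi> = (LINT y|lborel. (\<lambda>z. f z * ee (x \<bullet> \<xi>) * ee (- (z \<bullet> \<xi>))) (x + y))"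
    unfolding fourier_ee by (intro Bochner_Integration.integral_cong refl)
      (simp add: inner_add_left ee_add[symmetric] mult.assoc)
  also have "\<dots> = (LINT z|lborel. ee (x \<bullet> \<xi>) * (f z * ee (- (z \<bullet> \<xi>))))"
    by (subst integral_translate) (auto simp: mult_ac)
  finally show ?thesis by (simp add: fourier_ee)
qed

lemma fourier_fourier:
  fixes f :: "real^'d \<Rightarrow> complex"
  assumes f: "schwartz f"
  shows "fourier (fourier f) x = f (- x)"
proof -
  have s: "schwartz (\<lambda>y. f (- x + y))"
    using schwartz_affine[OF f, of "mat 1" "- x"] by (simp add: add.commute invertible_det_nz)
  have "f (- x) = (LINT \<xi>|lborel. fourier (\<lambda>y. f (- x + y)) \<xi>)"
    by (subst fourier_inversion_0[OF s]) simp
  also have "\<dots> = fourier (fourier f) x"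
    unfolding fourier_translate[OF schwartz_borel[OF f]] fourier_ee[of "fourier f"]
    by (simp add: mult.commute inner_commute)
  finally show ?thesis by simp
qed

definition ifourier :: "(real^'d \<Rightarrow> complex) \<Rightarrow> real^'d \<Rightarrow> complex" where
  "ifourier f \<xi> = fourier f (- \<xi>)"

lemma schwartz_ifourier: "schwartz f \<Longrightarrow> schwartz (ifourier f)"
  unfolding ifourier_def[abs_def] by (intro schwartz_reflect schwartz_fourier)

lemma ifourier_fourier: "schwartz f \<Longrightarrow> ifourier (fourier f) = f"
  by (rule ext) (simp add: ifourier_def fourier_fourier)

lemma fourier_ifourier:
  assumes "schwartz f" shows "fourier (ifourier f) = f"
proof
  fix x
  have "fourier (ifourier f) x = (LINT y|lborel. (\<lambda>z. fourier f z * ee (- (z \<bullet> (- x)))) (- y))"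
    unfolding fourier_ee[of "ifourier f"] by (simp add: ifourier_def)
  also have "\<dots> = fourier (fourier f) (- x)"
    unfolding fourier_ee[of "fourier f"]
    by (intro integral_reflect borel_measurable_times borel_measurable_ee schwartz_borel schwartz_fourier assms) measurable
  finally show "fourier (ifourier f) x = f x" using fourier_fourier[OF assms, of "- x"] by simp
qed

lemma fourier_add: "schwartz f \<Longrightarrow> schwartz g \<Longrightarrow> fourier (\<lambda>x. f x + g x) = (\<lambda>x. fourier f x + fourier g x)"
  unfolding fourier_ee[abs_def] distrib_right
  by (intro ext Bochner_Integration.integral_add integrable_mult_ee schwartz_integrable) auto

lemma fourier_cmult: "fourier (\<lambda>x. c * f x) = (\<lambda>x. c * fourier f x)"
  unfolding fourier_ee[abs_def] by (simp add: mult.assoc)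

subsection \<open>Smooth functions of one variable and bump functions\<close>

definition smooth1 :: "(real \<Rightarrow> real) \<Rightarrow> bool" where
  "smooth1 u \<longleftrightarrow> (\<exists>U. deriv_seq U \<and> U 0 = u)"

lemma smooth1_class:
  assumes "P u" "\<And>v. P v \<Longrightarrow> \<exists>v'. P v' \<and> (\<forall>t. (v has_real_derivative v' t) (at t))"
  shows "smooth1 u"
proof -
  from assms(2) obtain D where D: "\<And>v. P v \<Longrightarrow> P (D v) \<and> (\<forall>t. (v has_real_derivative D v t) (at t))" by metis
  have "P ((D ^^ n) u)" for n by (induction n) (auto simp: assms(1) D)
  then have "deriv_seq (\<lambda>n. (D ^^ n) u)" unfolding deriv_seq_def using D by simp
  then show ?thesis unfolding smooth1_def by (intro exI[of _ "\<lambda>n. (D ^^ n) u"]) simp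
qed

lemma smooth1_derivative:
  assumes "smooth1 u"
  obtains u' where "smooth1 u'" "\<And>t. (u has_real_derivative u' t) (at t)"
proof -
  obtain U where U: "deriv_seq U" "U 0 = u" using assms by (auto simp: smooth1_def)
  have "deriv_seq (\<lambda>n. U (Suc n))" using U(1) by (simp add: deriv_seq_def)
  then have "smooth1 (U 1)" unfolding smooth1_def by (intro exI[of _ "\<lambda>n. U (Suc n)"]) simp
  then show ?thesis using that[of "U 1"] U by (auto simp: deriv_seq_def)
qed

lemma smooth1_affine:
  assumes "smooth1 u" shows "smooth1 (\<lambda>t. u (a * t + b))"
proof -
  obtain U where U: "deriv_seq U" "U 0 = u" using assms by (auto simp: smooth1_def)
  have "((\<lambda>t. a ^ n * U n (a * t + b)) has_real_derivative a ^ Suc n * U (Suc n) (a * t + b)) (at t)" for n t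
  proof -
    have "(U n has_real_derivative U (Suc n) (a * t + b)) (at (a * t + b))" using U by (simp add: deriv_seq_def)
    then have "((\<lambda>t. U n (a * t + b)) has_real_derivative U (Suc n) (a * t + b) * a) (at t)"
      by (rule DERIV_chain2) (auto intro!: derivative_eq_intros)
    from DERIV_cmult[OF this, of "a ^ n"] show ?thesis by (simp add: mult_ac)
  qed
  then show ?thesis unfolding smooth1_def deriv_seq_def using U
    by (intro exI[of _ "\<lambda>n t. a ^ n * U n (a * t + b)"]) auto
qed

lemma smooth1_add:
  assumes "smooth1 u" "smooth1 v" shows "smooth1 (\<lambda>t. u t + v t)"
proof -
  obtain U V where "deriv_seq U" "U 0 = u" "deriv_seq V" "V 0 = v" using assms by (auto simp: smooth1_def)
  then show ?thesis unfolding smooth1_def deriv_seq_def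
    by (intro exI[of _ "\<lambda>n t. U n t + V n t"]) (auto intro: DERIV_add)
qed

inductive sprod1 :: "(real \<Rightarrow> real) \<Rightarrow> bool" where
  mult: "smooth1 f \<Longrightarrow> smooth1 g \<Longrightarrow> sprod1 (\<lambda>x. f x * g x)"
| add: "sprod1 u \<Longrightarrow> sprod1 v \<Longrightarrow> sprod1 (\<lambda>x. u x + v x)"

lemma smooth1_mult:
  assumes "smooth1 u" "smooth1 v" shows "smooth1 (\<lambda>t. u t * v t)"
proof (rule smooth1_class[of sprod1])
  fix w assume "sprod1 w"
  then show "\<exists>w'. sprod1 w' \<and> (\<forall>t. (w has_real_derivative w' t) (at t))"
  proof induction
    case (mult f g)
    obtain f' where f': "smooth1 f'" "\<And>t. (f has_real_derivative f' t) (at t)" using smooth1_derivative[OF mult(1)] by metis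
    obtain g' where g': "smooth1 g'" "\<And>t. (g has_real_derivative g' t) (at t)" using smooth1_derivative[OF mult(2)] by metis
    have "sprod1 (\<lambda>x. f' x * g x + f x * g' x)" by (intro sprod1.intros mult f' g')
    moreover have "((\<lambda>x. f x * g x) has_real_derivative f' t * g t + f t * g' t) (at t)" for t
      using DERIV_mult[OF f'(2) g'(2)] by (simp add: mult.commute)
    ultimately show ?case by blast
  next
    case (add u v)
    then obtain u' v' where "sprod1 u'" "sprod1 v'" "\<And>t. (u has_real_derivative u' t) (at t)"
      "\<And>t. (v has_real_derivative v' t) (at t)" by blast
    then show ?case by (intro exI[of _ "\<lambda>t. u' t + v' t"]) (auto intro: DERIV_add sprod1.add)
  qed
qed (use assms in \<open>auto intro: sprod1.mult\<close>)

lemma smooth1_const: "smooth1 (\<lambda>t. c)"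
proof (rule smooth1_class[of "\<lambda>v. \<exists>c. v = (\<lambda>t. c)"])
  fix v :: "real \<Rightarrow> real" assume "\<exists>c. v = (\<lambda>t. c)"
  then show "\<exists>v'. (\<exists>c. v' = (\<lambda>t. c)) \<and> (\<forall>t. (v has_real_derivative v' t) (at t))"
    by (intro exI[of _ "\<lambda>t. 0"]) auto
qed auto

inductive sinv1 :: "(real \<Rightarrow> real) \<Rightarrow> (real \<Rightarrow> real) \<Rightarrow> bool" for u where
  base: "smooth1 f \<Longrightarrow> sinv1 u (\<lambda>x. f x * (1 / u x) ^ k)"
| add: "sinv1 u v \<Longrightarrow> sinv1 u w \<Longrightarrow> sinv1 u (\<lambda>x. v x + w x)"

lemma smooth1_inverse:
  assumes u: "smooth1 u" and nz: "\<And>t. u t \<noteq> 0" shows "smooth1 (\<lambda>t. 1 / u t)"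
proof (rule smooth1_class[of "sinv1 u"])
  show "sinv1 u (\<lambda>t. 1 / u t)" using sinv1.base[OF smooth1_const, of u 1 1] by simp
  obtain u' where u': "smooth1 u'" "\<And>t. (u has_real_derivative u' t) (at t)" using smooth1_derivative[OF u] by metis
  fix w assume "sinv1 u w"
  then show "\<exists>w'. sinv1 u w' \<and> (\<forall>t. (w has_real_derivative w' t) (at t))"
  proof induction
    case (base f k)
    obtain f' where f': "smooth1 f'" "\<And>t. (f has_real_derivative f' t) (at t)" using smooth1_derivative[OF base] by metis
    have "sinv1 u (\<lambda>x. f' x * (1 / u x) ^ k + (- real k * (f x * u' x)) * (1 / u x) ^ Suc k)"
      by (intro sinv1.intros f' smooth1_mult smooth1_const base u')
    moreover have "((\<lambda>x. f x * (1 / u x) ^ k) has_real_derivative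
        f' t * (1 / u t) ^ k + (- real k * (f t * u' t)) * (1 / u t) ^ Suc k) (at t)" for t
    proof (cases k)
      case 0 then show ?thesis using f' by simp
    next
      case (Suc n)
      have "((\<lambda>t. 1 / u t) has_real_derivative - u' t * (1 / u t) ^ 2) (at t)"
        using DERIV_inverse_fun[OF u'(2) nz, of t] by (simp add: divide_inverse power2_eq_square mult_ac)
      from DERIV_mult[OF f'(2) DERIV_power[OF this, of k]] show ?thesis
        by (rule DERIV_cong) (simp add: Suc power2_eq_square algebra_simps add_divide_distrib)
    qed
    ultimately show ?case by blast
  next
    case (add v w)
    then obtain v' w' where "sinv1 u v'" "sinv1 u w'" "\<And>t. (v has_real_derivative v' t) (at t)"
      "\<And>t. (w has_real_derivative w' t) (at t)" by blast
    then show ?case by (intro exI[of _ "\<lambda>t. v' t + w' t"]) (auto intro: DERIV_add sinv1.add)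
  qed
qed

text \<open>Polynomials in \<open>1/t\<close> are allowed so that the class is closed under differentiation.\<close>

definition expinv :: "real poly \<Rightarrow> real \<Rightarrow> real" where
  "expinv p t = (if t > 0 then poly p (1 / t) * exp (- (1 / t)) else 0)"

lemma poly_exp_tendsto_0: "((\<lambda>x::real. x ^ k * poly p x * exp (- x)) \<longlongrightarrow> 0) at_top"
proof (induction p arbitrary: k)
  case (pCons a p)
  have "((\<lambda>x::real. a * (x ^ k / exp x) + x ^ Suc k * poly p x * exp (- x)) \<longlongrightarrow> a * 0 + 0) at_top"
    by (intro tendsto_add tendsto_mult tendsto_const tendsto_power_div_exp_0 pCons.IH)
  then show ?case by (simp add: algebra_simps exp_minus divide_inverse)
qed simp

lemma has_derivative_expinv:
  "(expinv p has_real_derivative expinv ([:0, 0, 1:] * (p - pderiv p)) t) (at t)"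
proof -
  consider "t < 0" | "t = 0" | "t > 0" by linarith
  then show ?thesis
  proof cases
    case 1
    then show ?thesis
      by (rule_tac has_field_derivative_transform_within_open[where S="{..<0}" and f="\<lambda>_. 0"])
        (auto simp: expinv_def)
  next
    case 3
    have "((\<lambda>t. poly p (1 / t) * exp (- (1 / t))) has_real_derivative
       expinv ([:0, 0, 1:] * (p - pderiv p)) t) (at t)"
    proof -
      have i: "((\<lambda>t. 1 / t) has_real_derivative - (1 / t)\<^sup>2) (at t)"
        using DERIV_inverse[of t] 3 by (simp add: divide_inverse power2_eq_square)
      show ?thesis
        by (rule DERIV_cong[OF DERIV_mult[OF DERIV_chain2[OF poly_DERIV i] DERIV_chain2[OF DERIV_exp DERIV_minus[OF i]]]])
          (use 3 in \<open>simp add: expinv_def algebra_simps power2_eq_square\<close>)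
    qed
    then show ?thesis using 3
      by (elim has_field_derivative_transform_within_open[where S="{0<..}"]) (auto simp: expinv_def)
  next
    case 2
    have "((\<lambda>h. expinv p h / h) \<longlongrightarrow> 0) (at_right 0)"
      unfolding filterlim_at_right_to_top
    proof (rule Lim_transform_eventually[OF poly_exp_tendsto_0[of 1 p]])
      show "\<forall>\<^sub>F x in at_top. x ^ 1 * poly p x * exp (- x) = expinv p (inverse x) / inverse x"
        using eventually_gt_at_top[of 0] by eventually_elim (simp add: expinv_def field_simps)
    qed
    moreover have "((\<lambda>h. expinv p h / h) \<longlongrightarrow> 0) (at_left 0)"
    proof (rule Lim_transform_eventually[OF tendsto_const])
      show "\<forall>\<^sub>F x in at_left 0. 0 = expinv p x / x"
        by (simp add: eventually_at_filter expinv_def)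
    qed
    ultimately have "((\<lambda>h. expinv p h / h) \<longlongrightarrow> 0) (at 0)" using filterlim_split_at by blast
    then show ?thesis using 2 by (simp add: DERIV_def expinv_def)
  qed
qed

lemma smooth1_expinv: "smooth1 (expinv p)"
  by (rule smooth1_class[of "\<lambda>v. \<exists>p. v = expinv p"]) (use has_derivative_expinv in blast)+

definition step :: "real \<Rightarrow> real" where
  "step t = expinv 1 t / (expinv 1 t + expinv 1 (1 - t))"

lemma expinv_1_pos: "t > 0 \<Longrightarrow> expinv 1 t > 0" and expinv_1_nonneg: "expinv 1 t \<ge> 0"
  by (auto simp: expinv_def)

lemma step_denom_pos: "expinv 1 t + expinv 1 (1 - t) > 0"
  using expinv_1_pos[of t] expinv_1_pos[of "1 - t"] expinv_1_nonneg[of t] expinv_1_nonneg[of "1 - t"]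
  by (cases "t > 0") auto

lemma smooth1_step: "smooth1 step"
proof -
  have "smooth1 (\<lambda>t. expinv 1 t + expinv 1 ((-1) * t + 1))"
    by (intro smooth1_add smooth1_affine smooth1_expinv)
  then have "smooth1 (\<lambda>t. expinv 1 t + expinv 1 (1 - t))" by (simp add: algebra_simps)
  then have "smooth1 (\<lambda>t. expinv 1 t * (1 / (expinv 1 t + expinv 1 (1 - t))))"
    using step_denom_pos by (intro smooth1_mult smooth1_expinv smooth1_inverse) (auto simp: less_imp_neq[symmetric])
  then show ?thesis by (simp add: step_def[abs_def])
qed

lemma step_eq_0 [simp]: "t \<le> 0 \<Longrightarrow> step t = 0"
  by (simp add: step_def expinv_def)

lemma step_eq_1 [simp]: "t \<ge> 1 \<Longrightarrow> step t = 1"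
  using step_denom_pos[of t] by (simp add: step_def expinv_def split: if_splits)

lemma step_nonneg [simp]: "step t \<ge> 0"
  using step_denom_pos[of t] expinv_1_nonneg[of t] by (simp add: step_def)

lemma step_le_1 [simp]: "step t \<le> 1"
  using step_denom_pos[of t] expinv_1_nonneg[of "1 - t"] by (simp add: step_def)

lemma deriv_seq_const_on:
  assumes U: "deriv_seq U" and S: "open S" and c: "\<And>t. t \<in> S \<Longrightarrow> U 0 t = c" and t: "t \<in> S"
  shows "U (Suc n) t = 0"
  using t
proof (induction n arbitrary: t)
  case 0
  have "(U 0 has_real_derivative 0) (at t)"
    using c 0 S by (rule_tac has_field_derivative_transform_within_open[where S=S and f="\<lambda>_. c"]) auto
  moreover have "(U 0 has_real_derivative U (Suc 0) t) (at t)" using U by (simp add: deriv_seq_def)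
  ultimately show ?case using DERIV_unique by metis
next
  case (Suc n)
  have "(U (Suc n) has_real_derivative 0) (at t)"
    using Suc S by (rule_tac has_field_derivative_transform_within_open[where S=S and f="\<lambda>_. 0"]) auto
  moreover have "(U (Suc n) has_real_derivative U (Suc (Suc n)) t) (at t)" using U by (simp add: deriv_seq_def)
  ultimately show ?case using DERIV_unique by metis
qed

lemma deriv_seq_continuous: "deriv_seq U \<Longrightarrow> continuous_on A (U n)"
  unfolding deriv_seq_def by (meson DERIV_continuous_on has_field_derivative_at_within)

lemma step_deriv_seq:
  obtains U where "deriv_seq U" "U 0 = step" "\<And>n. \<exists>B. \<forall>t. \<bar>U n t\<bar> \<le> B"
proof -
  obtain U where U: "deriv_seq U" "U 0 = step" using smooth1_step by (auto simp: smooth1_def)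
  have "\<exists>B. \<forall>t. \<bar>U n t\<bar> \<le> B" for n
  proof (cases n)
    case 0 then show ?thesis using U by (intro exI[of _ 1]) (auto simp: abs_le_iff intro: order.trans[of _ 0])
  next
    case (Suc m)
    have "compact (U n ` {0..1})" by (intro compact_continuous_image deriv_seq_continuous U) auto
    then have "bounded (U n ` {0..1})" by (rule compact_imp_bounded)
    then obtain B where "\<forall>y \<in> U n ` {0..1}. norm y \<le> B"
      unfolding bounded_iff by blast
    then have B: "\<bar>U n t\<bar> \<le> B" if "t \<in> {0..1}" for t
      using that by simp
    have z: "U n t = 0" if "t \<notin> {0..1}" for t
      using that deriv_seq_const_on[OF U(1), of "{..<0}" 0 t] deriv_seq_const_on[OF U(1), of "{1<..}" 1 t]
      by (auto simp: Suc U(2) not_le)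
    have "0 \<le> B" using B[of 0] abs_ge_zero[of "U n 0"] by force
    then show ?thesis using B z by (metis abs_zero)
  qed
  then show ?thesis using that U by blast
qed

lemma smooth_prod1:
  fixes u :: "'d::finite \<Rightarrow> real \<Rightarrow> real"
  assumes "\<And>i. smooth1 (u i)"
  shows "smooth (\<lambda>x::real^'d. complex_of_real (\<Prod>i\<in>UNIV. u i (x $ i)))"
proof -
  from assms obtain U where U: "\<And>i. deriv_seq (U i)" "\<And>i. U i 0 = u i" unfolding smooth1_def by metis
  from smooth_sprodfun[of U, OF U(1), of "\<lambda>_. 0"] show ?thesis by (simp add: sprodfun_def[abs_def] U(2))
qed

lemma pdiffs_eq_0:
  fixes f :: "real^'d \<Rightarrow> complex"
  assumes "open S" "\<And>x. x \<in> S \<Longrightarrow> f x = 0" "x \<in> S"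
  shows "pdiffs is f x = 0"
  using assms(3)
proof (induction "is" arbitrary: x)
  case (Cons i js)
  have "(pdiffs js f has_derivative (\<lambda>h. 0)) (at x)"
    using Cons assms(1) by (rule_tac has_derivative_transform_within_open[where s=S and f="\<lambda>_. 0"]) auto
  then show ?case by (simp add: pdiffs_Cons pdiff_eqI)
qed (use assms in auto)

lemma schwartz_compact_support:
  fixes f :: "real^'d \<Rightarrow> complex"
  assumes f: "smooth f" and z: "\<And>x. norm x > R \<Longrightarrow> f x = 0"
  shows "schwartz f"
  unfolding schwartz_iff
proof (intro conjI allI f)
  fix "is" :: "'d list" and N
  have z': "pdiffs is f x = 0" if "norm x > R" for x
    by (rule pdiffs_eq_0[of "- cball 0 R"]) (use z that in \<open>auto simp: dist_norm\<close>)
  have "continuous_on (cball 0 R) (\<lambda>x. (1 + norm x) ^ N * cmod (pdiffs is f x))"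
    by (intro continuous_intros continuous_on_subset[OF smooth_continuous[OF smooth_pdiffs[OF f]]]) auto
  then have "compact ((\<lambda>x. (1 + norm x) ^ N * cmod (pdiffs is f x)) ` cball 0 R)"
    by (intro compact_continuous_image) auto
  then have "bounded ((\<lambda>x. (1 + norm x) ^ N * cmod (pdiffs is f x)) ` cball 0 R)" by (rule compact_imp_bounded)
  then obtain B where B: "\<And>x. x \<in> cball 0 R \<Longrightarrow> norm ((1 + norm x) ^ N * cmod (pdiffs is f x)) \<le> B"
    unfolding bounded_iff by blast
  have "(1 + norm x) ^ N * cmod (pdiffs is f x) \<le> \<bar>B\<bar>" for x
  proof (cases "norm x \<le> R")
    case True
    then show ?thesis using B[of x] by (auto simp: dist_norm)
  qed (use z' in auto)
  then show "\<exists>C. \<forall>x. (1 + norm x) ^ N * cmod (pdiffs is f x) \<le> C" by blast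
qed

definition cutoff :: "nat \<Rightarrow> real^'d \<Rightarrow> complex" where
  "cutoff m x = complex_of_real (\<Prod>i\<in>UNIV. step (x $ i + m + 1) - step (x $ i - m))"

lemma step_diff_smooth1: "smooth1 (\<lambda>t. step (t + a) - step (t - b))"
proof -
  have "smooth1 (\<lambda>t. step (1 * t + a) + (-1) * step (1 * t + (- b)))"
    by (intro smooth1_add smooth1_mult smooth1_const smooth1_affine smooth1_step)
  then show ?thesis by simp
qed

lemma smooth_cutoff: "smooth (cutoff m)"
  unfolding cutoff_def[abs_def] using step_diff_smooth1[of "real m + 1" "real m"]
  by (intro smooth_prod1) (simp add: add.assoc)

lemma cutoff_eq_1:
  assumes "norm x \<le> real m" shows "cutoff m x = 1"
proof -
  have "step (x $ i + m + 1) - step (x $ i - m) = 1" for i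
    using component_le_norm_cart[of x i] assms by (simp add: abs_le_iff)
  then show ?thesis by (simp add: cutoff_def)
qed

lemma cutoff_eq_0:
  assumes "\<bar>x $ i\<bar> \<ge> real m + 1" shows "cutoff m x = 0"
proof -
  have "step (x $ i + m + 1) - step (x $ i - m) = 0"
    using assms by (cases "x $ i \<ge> 0") auto
  then show ?thesis unfolding cutoff_def by (metis (no_types, lifting) UNIV_I finite of_real_0 prod_zero)
qed

lemma norm_gt_component:
  fixes x :: "real^'d"
  assumes "norm x > real CARD('d) * R"
  obtains i where "\<bar>x $ i\<bar> > R"
proof -
  have "\<not> (\<forall>i. \<bar>x $ i\<bar> \<le> R)"
  proof
    assume "\<forall>i. \<bar>x $ i\<bar> \<le> R"
    then have "(\<Sum>i\<in>UNIV. \<bar>x $ i\<bar>) \<le> (\<Sum>i\<in>(UNIV::'d set). R)" by (intro sum_mono) auto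
    then show False using norm_le_l1_cart[of x] assms by simp
  qed
  then obtain i where "\<not> \<bar>x $ i\<bar> \<le> R" by blast
  then show ?thesis using that[of i] by simp
qed

lemma schwartz_cutoff: "schwartz (cutoff m :: real^'d \<Rightarrow> complex)"
proof (rule schwartz_compact_support[OF smooth_cutoff, of "real CARD('d) * (real m + 1)"])
  fix x :: "real^'d" assume "norm x > real CARD('d) * (real m + 1)"
  from norm_gt_component[OF this] show "cutoff m x = 0" using cutoff_eq_0 by (metis less_imp_le)
qed

lemma cutoff_dsum_bound: "\<exists>B. \<forall>m (x::real^'d). dsum n (cutoff m) x \<le> B"
proof -
  obtain U where U: "deriv_seq U" "U 0 = step" "\<And>n. \<exists>B. \<forall>t. \<bar>U n t\<bar> \<le> B"
    using step_deriv_seq by metis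
  from U(3) obtain B where B: "\<And>n t. \<bar>U n t\<bar> \<le> B n" by metis
  have *: "cmod (pdiffs is (cutoff m) x) \<le> (\<Prod>i\<in>UNIV. 2 * B (count_list is i))" for "is" m and x :: "real^'d"
  proof -
    define V where "V = (\<lambda>(i::'d) n (t::real). U n (t + m + 1) - U n (t - real m))"
    have dV: "deriv_seq (V i)" for i
      unfolding deriv_seq_def
    proof (intro allI)
      fix n and t :: real
      have u: "(U n has_real_derivative U (Suc n) s) (at s)" for s using U(1) by (simp add: deriv_seq_def)
      have "((\<lambda>t. U n (t + m + 1) - U n (t - real m)) has_real_derivative U (Suc n) (t + m + 1) * 1 - U (Suc n) (t - real m) * 1) (at t)"
        by (intro DERIV_diff DERIV_chain2[OF u]) (auto intro!: derivative_eq_intros)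
      then show "(V i n has_real_derivative V i (Suc n) t) (at t)" by (simp add: V_def)
    qed
    have c: "cutoff m = sprodfun V (\<lambda>_. 0)" by (rule ext) (simp add: cutoff_def sprodfun_def V_def U)
    have "cmod (pdiffs is (cutoff m) x) = (\<Prod>i\<in>UNIV. \<bar>V i (count_list is i) (x $ i)\<bar>)"
      unfolding c pdiffs_sprodfun[of V, OF dV] by (simp add: sprodfun_def abs_prod del: of_real_prod)
    also have "\<dots> \<le> (\<Prod>i\<in>UNIV. 2 * B (count_list is i))"
    proof (intro prod_mono conjI)
      fix i
      show "\<bar>V i (count_list is i) (x $ i)\<bar> \<le> 2 * B (count_list is i)"
        unfolding V_def using B[of "count_list is i" "x $ i + m + 1"] B[of "count_list is i" "x $ i - m"] by linarith
    qed auto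
    finally show ?thesis .
  qed
  have "dsum n (cutoff m) x \<le> (\<Sum>js :: 'd list | length js \<le> n. \<Prod>i\<in>UNIV. 2 * B (count_list js i))" for m and x :: "real^'d"
    unfolding dsum_def by (intro sum_mono *)
  then show ?thesis by blast
qed

subsection \<open>Uniqueness of the function representing a distribution\<close>

lemma AE_eq_0_if_set_integrals_0:
  fixes v :: "'a \<Rightarrow> complex"
  assumes v: "integrable M v" and z: "\<And>A. A \<in> sets M \<Longrightarrow> (LINT x|M. indicator A x *\<^sub>R v x) = 0"
  shows "AE x in M. v x = 0"
proof -
  have r: "AE x in M. w x = 0" if w: "integrable M w" and zw: "\<And>A. A \<in> sets M \<Longrightarrow> (LINT x|M. indicator A x * w x) = 0"
    for w :: "'a \<Rightarrow> real"
  proof -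
    have [measurable]: "w \<in> borel_measurable M" using w by auto
    have p: "AE x in M. indicator A x * w' x = 0" if "A \<in> sets M" "integrable M w'" "\<And>x. x \<in> A \<Longrightarrow> w' x \<ge> 0"
      "(LINT x|M. indicator A x * w' x) = 0" for A and w' :: "'a \<Rightarrow> real"
    proof -
      have "integrable M (\<lambda>x. indicator A x * w' x)"
        using integrable_mult_indicator[OF that(1,2)] by simp
      from integral_nonneg_eq_0_iff_AE[OF this] that show ?thesis by (auto simp: indicator_def)
    qed
    let ?A = "{x \<in> space M. w x \<ge> 0}" and ?B = "{x \<in> space M. w x \<le> 0}"
    have "AE x in M. indicator ?A x * w x = 0" by (rule p[OF _ w]) (auto intro!: zw)
    moreover have "AE x in M. indicator ?B x * (- w x) = 0"
      using zw[of ?B] w by (intro p) auto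
    ultimately show ?thesis using AE_space
    proof eventually_elim
      case (elim x)
      then show ?case by (cases "w x \<ge> 0") auto
    qed
  qed
  have "AE x in M. Re (v x) = 0"
  proof (rule r)
    show "(LINT x|M. indicator A x * Re (v x)) = 0" if "A \<in> sets M" for A
      using arg_cong[OF z[OF that], of Re] integral_Re[of M "\<lambda>x. indicator A x *\<^sub>R v x"] integrable_mult_indicator[OF that v] by simp
  qed (use v in auto)
  moreover have "AE x in M. Im (v x) = 0"
  proof (rule r)
    show "(LINT x|M. indicator A x * Im (v x)) = 0" if "A \<in> sets M" for A
      using arg_cong[OF z[OF that], of Im] integral_Im[of M "\<lambda>x. indicator A x *\<^sub>R v x"] integrable_mult_indicator[OF that v] by simp
  qed (use v in auto)
  ultimately show ?thesis by eventually_elim (simp add: complex_eq_iff)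
qed

lemma set_integral_0_Dynkin:
  fixes v :: "'a \<Rightarrow> complex"
  assumes v: "integrable M v" and G: "Int_stable G" "G \<subseteq> Pow (space M)" "sets M = sigma_sets (space M) G"
    and z: "\<And>A. A \<in> G \<Longrightarrow> (LINT x|M. indicator A x *\<^sub>R v x) = 0" and v0: "(LINT x|M. v x) = 0"
    and A: "A \<in> sets M"
  shows "(LINT x|M. indicator A x *\<^sub>R v x) = 0"
  using G(1,2) A[unfolded G(3)]
proof (induction A rule: sigma_sets_induct_disjoint)
  case (compl A)
  have A: "A \<in> sets M" using compl G by simp
  have "(LINT x|M. indicator (space M - A) x *\<^sub>R v x) = (LINT x|M. v x - indicator A x *\<^sub>R v x)"
    by (intro Bochner_Integration.integral_cong) (auto simp: indicator_def)
  also have "\<dots> = 0" using integrable_mult_indicator[OF A v] v compl v0 by simp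
  finally show ?case .
next
  case (union A)
  have A: "A i \<in> sets M" for i using union G by auto
  have "(LINT x:(\<Union>i. A i)|M. v x) = (\<Sum>i. (LINT x:(A i)|M. v x))"
    using union(1) A v by (intro lebesgue_integral_countable_add)
      (auto simp: disjoint_family_on_def set_integrable_def intro!: integrable_mult_indicator)
  then show ?case using union by (simp add: set_lebesgue_integral_def)
qed (use z in auto)

lemma step_scaled_tendsto: "(\<lambda>n. step (real n * t)) \<longlonglongrightarrow> indicator {0<..} t"
proof (cases "t > 0")
  case True
  obtain N where N: "1 / t < real N" using reals_Archimedean2 by blast
  have "\<forall>\<^sub>F n in sequentially. step (real n * t) = 1"
    using eventually_ge_at_top[of N]
  proof eventually_elim
    case (elim n)
    then have "1 \<le> real n * t" using N True by (simp add: field_simps) (smt (verit) mult_left_mono of_nat_mono)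
    then show ?case by simp
  qed
  then show ?thesis using True by (simp add: tendsto_eventually)
next
  case False
  then have "step (real n * t) = 0" for n by (simp add: mult_nonneg_nonpos)
  then show ?thesis using False by simp
qed

lemma AE_eq_0_if_schwartz_integrals_0:
  fixes u :: "real^'d \<Rightarrow> complex"
  assumes [measurable]: "u \<in> borel_measurable borel"
    and i: "\<And>\<psi>. schwartz \<psi> \<Longrightarrow> integrable lborel (\<lambda>x. u x * \<psi> x)"
    and z: "\<And>\<psi>. schwartz \<psi> \<Longrightarrow> (LINT x|lborel. u x * \<psi> x) = 0"
  shows "AE x in lborel. u x = 0"
proof -
  have box0: "(LINT x|lborel. indicator (box a b) x *\<^sub>R u x) = 0" and boxi: "integrable lborel (\<lambda>x. indicator (box a b) x *\<^sub>R u x)" for a b :: "real^'d"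
  proof -

    obtain R where R: "\<And>x. x \<in> box a b \<Longrightarrow> norm x \<le> R" using bounded_box[of a b] unfolding bounded_iff by blast
    obtain m :: nat where m: "R \<le> real m" using real_arch_simple by blast
    have c1: "cutoff m x = 1" if "x \<in> box a b" for x by (rule cutoff_eq_1) (use R[OF that] m in simp)
    define w where "w n i t = step (real n * (t - a $ i)) * step (real n * (b $ i - t))" for n i t
    define \<psi> where "\<psi> n x = complex_of_real (\<Prod>i\<in>UNIV. w n i (x $ i))" for n and x :: "real^'d"
    have w01: "0 \<le> w n i t" "w n i t \<le> 1" for n i t
      unfolding w_def by (auto intro: mult_le_one)
    have \<psi>0: "\<psi> n x = 0" if "x \<notin> box a b" for n x
    proof -
      from that obtain i where "x $ i \<le> a $ i \<or> b $ i \<le> x $ i" by (auto simp: mem_box_cart not_less)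
      then have "w n i (x $ i) = 0" by (auto simp: w_def mult_nonneg_nonpos)
      then show ?thesis unfolding \<psi>_def by (metis (no_types, lifting) UNIV_I finite of_real_0 prod_zero)
    qed
    have \<psi>1: "cmod (\<psi> n x) \<le> 1" for n x
      unfolding \<psi>_def norm_of_real abs_prod by (intro prod_le_1) (auto simp: w01)
    have \<psi>le: "cmod (u x * \<psi> n x) \<le> cmod (u x * cutoff m x)" for n x
      using \<psi>0[of x n] \<psi>1[of n x] c1[of x] by (cases "x \<in> box a b") (auto simp: norm_mult mult_left_le)
    have \<psi>s: "schwartz (\<psi> n)" for n
    proof (rule schwartz_compact_support[where R=R])
      have "smooth1 (\<lambda>t. step (real n * t + (- real n * a $ i)) * step ((- real n) * t + real n * b $ i))" for i
        by (intro smooth1_mult smooth1_affine smooth1_step)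
      then have "smooth1 (w n i)" for i unfolding w_def[abs_def] by (simp add: algebra_simps)
      then show "smooth (\<psi> n)" unfolding \<psi>_def[abs_def] by (rule smooth_prod1)
    qed (use R \<psi>0 in force)
    have \<psi>lim: "(\<lambda>n. \<psi> n x) \<longlonglongrightarrow> indicator (box a b) x" for x
    proof -
      have "(\<lambda>n. \<psi> n x) \<longlonglongrightarrow> complex_of_real (\<Prod>i\<in>UNIV. indicator {0<..} (x $ i - a $ i) * indicator {0<..} (b $ i - x $ i))"
        unfolding \<psi>_def w_def by (intro tendsto_of_real tendsto_prod tendsto_mult step_scaled_tendsto)
      also have "complex_of_real (\<Prod>i\<in>UNIV. indicator {0<..} (x $ i - a $ i) * indicator {0<..} (b $ i - x $ i)) = indicator (box a b) x"
      proof (cases "x \<in> box a b")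
        case True
        then have "\<And>i. indicator {0<..} (x $ i - a $ i) * indicator {0<..} (b $ i - x $ i) = (1::real)" by (auto simp: mem_box_cart)
        then show ?thesis using True by simp
      next
        case False
        then obtain i where "x $ i \<le> a $ i \<or> b $ i \<le> x $ i" by (auto simp: mem_box_cart not_less)
        then have "indicator {0<..} (x $ i - a $ i) * indicator {0<..} (b $ i - x $ i) = (0::real)" by auto
        then show ?thesis using False by (metis (no_types, lifting) UNIV_I finite of_real_0 prod_zero indicator_simps(2))
      qed
      finally show ?thesis .
    qed
    have iu: "integrable lborel (\<lambda>x. cmod (u x * cutoff m x))" by (intro integrable_norm i schwartz_cutoff)
    have AE: "AE x in lborel. (\<lambda>n. u x * \<psi> n x) \<longlonglongrightarrow> indicator (box a b) x *\<^sub>R u x"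
    proof (intro AE_I2)
      fix x
      show "(\<lambda>n. u x * \<psi> n x) \<longlonglongrightarrow> indicator (box a b) x *\<^sub>R u x"
        using tendsto_mult[OF tendsto_const \<psi>lim, of "u x" x]
        by (cases "x \<in> box a b") auto
    qed
    have [measurable]: "\<psi> n \<in> borel_measurable borel" for n using \<psi>s by (rule schwartz_borel)
    have AE2: "AE x in lborel. norm (u x * \<psi> n x) \<le> cmod (u x * cutoff m x)" for n
      using \<psi>le by auto
    have "(\<lambda>n. LINT x|lborel. u x * \<psi> n x) \<longlonglongrightarrow> (LINT x|lborel. indicator (box a b) x *\<^sub>R u x)"
      by (rule integral_dominated_convergence[OF _ _ iu AE AE2]) auto
    then show "(LINT x|lborel. indicator (box a b) x *\<^sub>R u x) = 0"
      by (simp add: z[OF \<psi>s] LIMSEQ_const_iff)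
    show "integrable lborel (\<lambda>x. indicator (box a b) x *\<^sub>R u x)"
      by (rule integrable_dominated_convergence[OF _ _ iu AE AE2]) auto
  qed
  have "AE x in lborel. indicator (box (- (\<chi> i. real m)) (\<chi> i. real m)) x *\<^sub>R u x = 0" for m :: nat
  proof (rule AE_eq_0_if_set_integrals_0[OF boxi])
    let ?B = "box (- (\<chi> i. real m)) (\<chi> i. real m) :: (real^'d) set"
    fix A :: "(real^'d) set" assume A: "A \<in> sets lborel"
    show "(LINT x|lborel. indicator A x *\<^sub>R (indicator ?B x *\<^sub>R u x)) = 0"
    proof (rule set_integral_0_Dynkin[OF boxi _ _ _ _ box0 A])
      let ?G = "range (\<lambda>(a, b). box a b :: (real^'d) set)"
      show "Int_stable ?G" by (auto simp: Int_stable_def box_Int_box)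
      show "?G \<subseteq> Pow (space lborel)" by auto
      show "sets lborel = sigma_sets (space lborel) ?G" by (simp add: borel_eq_box)
      fix A assume "A \<in> ?G"
      then obtain a b where "A = box a b" by auto
      then obtain c d where "A \<inter> ?B = box c d" using box_Int_box[of a b] by blast
      then have "(indicator A x::real) *\<^sub>R (indicator ?B x :: real) *\<^sub>R u x = (indicator (box c d) x :: real) *\<^sub>R u x" for x
        by (auto simp: indicator_def)
      then show "(LINT x|lborel. indicator A x *\<^sub>R (indicator ?B x *\<^sub>R u x)) = 0"
        by (simp only: box0)
    qed
  qed
  then have "AE x in lborel. \<forall>m. indicator (box (- (\<chi> i. real m)) (\<chi> i. real m)) x *\<^sub>R u x = 0"
    unfolding AE_all_countable by blast
  then show ?thesis
  proof eventually_elim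
    case (elim x)
    obtain m :: nat where m: "norm x < real m" using reals_Archimedean2 by blast
    have "x \<in> box (- (\<chi> i. real m)) (\<chi> i. real m)"
      using component_le_norm_cart[of x] m by (auto simp: mem_box_cart abs_le_iff) (smt (verit))+
    then show ?case using elim[rule_format, of m] by simp
  qed
qed

subsection \<open>Distributions with square integrable Fourier transform\<close>

definition wt :: "real \<Rightarrow> real^'d \<Rightarrow> real" where
  "wt s \<xi> = (1 + (norm \<xi>)\<^sup>2) powr s"

lemma wt_pos [simp]: "wt s \<xi> > 0"
  unfolding wt_def by (smt (verit) powr_gt_zero zero_le_power2)

lemma wt_nonneg [simp]: "wt s \<xi> \<ge> 0" by (rule less_imp_le) simp

lemma wt_borel [measurable]: "wt s \<in> borel_measurable borel"
  unfolding wt_def by measurable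

lemma wt_add: "wt (a + b) \<xi> = wt a \<xi> * wt b \<xi>"
  by (simp add: wt_def powr_add)

lemma wt_0 [simp]: "wt 0 \<xi> = 1"
  unfolding wt_def by (smt (verit) powr_zero_eq_one zero_le_power2)

lemma wt_mono: "a \<le> b \<Longrightarrow> wt a \<xi> \<le> wt b \<xi>"
  unfolding wt_def by (intro powr_mono) auto

lemma wt_le_power: "wt s \<xi> \<le> (1 + norm \<xi>) ^ (2 * nat \<lceil>\<bar>s\<bar>\<rceil>)"
proof -
  let ?n = "nat \<lceil>\<bar>s\<bar>\<rceil>"
  have "wt s \<xi> \<le> wt (real ?n) \<xi>" by (rule wt_mono) linarith
  also have "\<dots> = (1 + (norm \<xi>)\<^sup>2) ^ ?n" unfolding wt_def by (intro powr_realpow) (smt (verit) zero_le_power2)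
  also have "\<dots> \<le> ((1 + norm \<xi>)\<^sup>2) ^ ?n" by (intro power_mono) (auto simp: power2_sum)
  finally show ?thesis by (simp add: power_mult)
qed

definition Wn :: "real \<Rightarrow> (real^'d \<Rightarrow> complex) \<Rightarrow> ennreal" where
  "Wn s g = (\<integral>\<^sup>+ \<xi>. ennreal ((cmod (g \<xi>))\<^sup>2 * wt s \<xi>) \<partial>lborel)"

definition wL2 :: "real \<Rightarrow> (real^'d \<Rightarrow> complex) \<Rightarrow> bool" where
  "wL2 s g \<longleftrightarrow> g \<in> borel_measurable borel \<and> Wn s g < \<infinity>"

lemma wL2_borel [measurable_dest]: "wL2 s g \<Longrightarrow> g \<in> borel_measurable borel"
  by (simp add: wL2_def)

lemma Wn_cong_AE: "AE x in lborel. cmod (g x) = cmod (h x) \<Longrightarrow> Wn s g = Wn s h"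
  unfolding Wn_def by (intro nn_integral_cong_AE) auto

lemma Cauchy_Schwarz_wL2:
  assumes [measurable]: "f \<in> borel_measurable borel" "g \<in> borel_measurable borel"
  shows "(\<integral>\<^sup>+ \<xi>. ennreal (cmod (f \<xi> * g \<xi>)) \<partial>lborel)\<^sup>2 \<le> Wn s f * Wn (- s) g"
proof -
  have "ennreal (cmod (f \<xi> * g \<xi>)) = ennreal (cmod (f \<xi>) * wt (s/2) \<xi>) * ennreal (cmod (g \<xi>) * wt (- s/2) \<xi>)" for \<xi>
  proof -
    have "wt (s/2) \<xi> * wt (- s/2) \<xi> = 1" by (simp flip: wt_add)
    then have "cmod (f \<xi> * g \<xi>) = (cmod (f \<xi>) * wt (s/2) \<xi>) * (cmod (g \<xi>) * wt (- s/2) \<xi>)"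
      by (simp add: norm_mult algebra_simps)
    then show ?thesis by (simp add: ennreal_mult)
  qed
  moreover have *: "ennreal (cmod (h \<xi>) * wt (r/2) \<xi>) ^ 2 = ennreal ((cmod (h \<xi>))\<^sup>2 * wt r \<xi>)" for h :: "real^'a \<Rightarrow> complex" and r \<xi>
    by (simp add: ennreal_power power_mult_distrib power2_eq_square[of "wt _ _"] flip: wt_add)
  moreover have "(\<integral>\<^sup>+ \<xi>. ennreal (cmod (f \<xi>) * wt (s/2) \<xi>) * ennreal (cmod (g \<xi>) * wt (- s/2) \<xi>) \<partial>lborel)\<^sup>2
     \<le> (\<integral>\<^sup>+ \<xi>. ennreal (cmod (f \<xi>) * wt (s/2) \<xi>) ^ 2 \<partial>lborel) * (\<integral>\<^sup>+ \<xi>. ennreal (cmod (g \<xi>) * wt (- s/2) \<xi>) ^ 2 \<partial>lborel)"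
    by (rule Cauchy_Schwarz_nn_integral) auto
  ultimately show ?thesis
    unfolding * Wn_def by presburger
qed

lemma integrable_wL2_mult:
  assumes "wL2 s f" "wL2 (- s) g"
  shows "integrable lborel (\<lambda>\<xi>. f \<xi> * g \<xi>)"
proof (rule integrableI_bounded)
  have m[measurable]: "f \<in> borel_measurable borel" "g \<in> borel_measurable borel" using assms by (auto simp: wL2_def)
  show "(\<lambda>\<xi>. f \<xi> * g \<xi>) \<in> borel_measurable lborel" by measurable
  have "(\<integral>\<^sup>+ \<xi>. ennreal (cmod (f \<xi> * g \<xi>)) \<partial>lborel)\<^sup>2 < \<infinity>"
    using Cauchy_Schwarz_wL2[OF m, of s] assms by (auto simp: wL2_def ennreal_mult_less_top elim!: order.strict_trans1)
  then show "(\<integral>\<^sup>+ \<xi>. ennreal (norm (f \<xi> * g \<xi>)) \<partial>lborel) < \<infinity>"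
    by (simp add: power_less_top_ennreal)
qed

lemma wL2_bounded_decay:
  fixes g :: "real^'d \<Rightarrow> complex"
  assumes [measurable]: "g \<in> borel_measurable borel"
    and g: "\<And>\<xi>. cmod (g \<xi>) \<le> C / (1 + norm \<xi>) ^ (CARD('d) + nat \<lceil>\<bar>s\<bar>\<rceil>)"
  shows "wL2 s g"
  unfolding wL2_def
proof
  let ?d = "CARD('d)" and ?n = "nat \<lceil>\<bar>s\<bar>\<rceil>"
  have le: "(cmod (g \<xi>))\<^sup>2 * wt s \<xi> \<le> C^2 * (1 / (1 + norm \<xi>) ^ (2 * ?d))" for \<xi>
  proof -
    have p: "0 < 1 + norm \<xi>" by (simp add: add_pos_nonneg)
    have "(cmod (g \<xi>))\<^sup>2 * wt s \<xi> \<le> (C / (1 + norm \<xi>) ^ (?d + ?n))\<^sup>2 * (1 + norm \<xi>) ^ (2 * ?n)"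
      by (intro mult_mono power_mono g wt_le_power) auto
    also have "\<dots> = C^2 * (1 / (1 + norm \<xi>) ^ (2 * ?d))"
      using p by (simp add: power_divide power_add power_mult_distrib flip: power_mult) (simp add: mult.commute)
    finally show ?thesis .
  qed
  have "Wn s g \<le> (\<integral>\<^sup>+ \<xi>. ennreal (C^2 * (1 / (1 + norm (\<xi>::real^'d)) ^ (2 * ?d))) \<partial>lborel)"
    unfolding Wn_def by (intro nn_integral_mono ennreal_leI le)
  also have "\<dots> < \<infinity>"
    using integrable_mult_right[OF integrable_decay[where 'd='d], of "C^2"]
    by (subst (asm) integrable_iff_bounded) (simp add: abs_mult)
  finally show "Wn s g < \<infinity>" .
qed fact

lemma schwartz_wL2:
  fixes \<psi> :: "real^'d \<Rightarrow> complex"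
  assumes "schwartz \<psi>" shows "wL2 s \<psi>"
proof -
  obtain C where "\<And>x. cmod (\<psi> x) \<le> C / (1 + norm x) ^ (CARD('d) + nat \<lceil>\<bar>s\<bar>\<rceil>)"
    using schwartz_decay'[OF assms] by metis
  then show ?thesis by (intro wL2_bounded_decay schwartz_borel assms)
qed

lemma Wn_add_le:
  assumes [measurable]: "g \<in> borel_measurable borel" "h \<in> borel_measurable borel"
  shows "Wn s (\<lambda>\<xi>. g \<xi> + h \<xi>) \<le> 2 * Wn s g + 2 * Wn s h"
proof -
  have "(cmod (g \<xi> + h \<xi>))\<^sup>2 * wt s \<xi> \<le> 2 * ((cmod (g \<xi>))\<^sup>2 * wt s \<xi>) + 2 * ((cmod (h \<xi>))\<^sup>2 * wt s \<xi>)" for \<xi>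
  proof -
    have "(cmod (g \<xi> + h \<xi>))\<^sup>2 \<le> (cmod (g \<xi>) + cmod (h \<xi>))\<^sup>2" by (intro power_mono norm_triangle_ineq) auto
    also have "\<dots> \<le> 2 * (cmod (g \<xi>))\<^sup>2 + 2 * (cmod (h \<xi>))\<^sup>2"
      using sum_squares_bound[of "cmod (g \<xi>)" "cmod (h \<xi>)"] by (simp add: power2_sum)
    finally have "(cmod (g \<xi> + h \<xi>))\<^sup>2 * wt s \<xi> \<le> (2 * (cmod (g \<xi>))\<^sup>2 + 2 * (cmod (h \<xi>))\<^sup>2) * wt s \<xi>"
      by (rule mult_right_mono) simp
    then show ?thesis by (simp add: algebra_simps)
  qed
  then have "Wn s (\<lambda>\<xi>. g \<xi> + h \<xi>) \<le> (\<integral>\<^sup>+ \<xi>. ennreal (2 * ((cmod (g \<xi>))\<^sup>2 * wt s \<xi>) + 2 * ((cmod (h \<xi>))\<^sup>2 * wt s \<xi>)) \<partial>lborel)"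
    unfolding Wn_def by (intro nn_integral_mono ennreal_leI)
  also have "\<dots> = (\<integral>\<^sup>+ \<xi>. 2 * ennreal ((cmod (g \<xi>))\<^sup>2 * wt s \<xi>) + 2 * ennreal ((cmod (h \<xi>))\<^sup>2 * wt s \<xi>) \<partial>lborel)"
    by (intro nn_integral_cong) (simp add: ennreal_plus ennreal_mult')
  also have "\<dots> = 2 * Wn s g + 2 * Wn s h"
    unfolding Wn_def by (simp add: nn_integral_add nn_integral_cmult)
  finally show ?thesis .
qed

lemma Wn_cmult: "g \<in> borel_measurable borel \<Longrightarrow> Wn s (\<lambda>\<xi>. c * g \<xi>) = ennreal ((cmod c)\<^sup>2) * Wn s g"
  unfolding Wn_def by (simp add: norm_mult power_mult_distrib mult.assoc ennreal_mult' nn_integral_cmult)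

lemma wL2_add: "wL2 s g \<Longrightarrow> wL2 s h \<Longrightarrow> wL2 s (\<lambda>\<xi>. g \<xi> + h \<xi>)"
  unfolding wL2_def using Wn_add_le[of g h s]
  by (auto simp: ennreal_mult_less_top elim!: order.strict_trans1)

lemma wL2_cmult: "wL2 s g \<Longrightarrow> wL2 s (\<lambda>\<xi>. c * g \<xi>)"
  unfolding wL2_def by (auto simp: Wn_cmult ennreal_mult_less_top)

lemma wL2_diff: "wL2 s g \<Longrightarrow> wL2 s h \<Longrightarrow> wL2 s (\<lambda>\<xi>. g \<xi> - h \<xi>)"
  using wL2_add[of s g "\<lambda>\<xi>. -1 * h \<xi>"] wL2_cmult[of s h "-1"] by simp

lemma wL2_0: "wL2 s (\<lambda>\<xi>. 0)" by (simp add: wL2_def Wn_def)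

lemma wL2_sum: "(\<And>i. i \<in> A \<Longrightarrow> wL2 s (g i)) \<Longrightarrow> wL2 s (\<lambda>\<xi>. \<Sum>i\<in>A. g i \<xi>)"
  by (induction A rule: infinite_finite_induct) (auto simp: wL2_0 wL2_add)

definition of_hat :: "(real^'d \<Rightarrow> complex) \<Rightarrow> ('d::finite) distribution" where
  "of_hat g = (\<lambda>\<psi>. if schwartz \<psi> then LINT \<xi>|lborel. g \<xi> * ifourier \<psi> \<xi> else 0)"

lemma integrable_of_hat: "wL2 s g \<Longrightarrow> schwartz \<psi> \<Longrightarrow> integrable lborel (\<lambda>\<xi>. g \<xi> * ifourier \<psi> \<xi>)"
  by (rule integrable_wL2_mult[of s]) (auto intro: schwartz_wL2 schwartz_ifourier)

lemma ifourier_add: "schwartz f \<Longrightarrow> schwartz g \<Longrightarrow> ifourier (\<lambda>x. f x + g x) = (\<lambda>x. ifourier f x + ifourier g x)"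
  unfolding ifourier_def[abs_def] by (simp add: fourier_add)

lemma ifourier_cmult: "ifourier (\<lambda>x. c * f x) = (\<lambda>x. c * ifourier f x)"
  unfolding ifourier_def[abs_def] by (simp add: fourier_cmult)

lemma tempered_of_hat:
  fixes g :: "real^'d \<Rightarrow> complex"
  assumes g: "wL2 s g"
  shows "tempered (of_hat g)"
  unfolding tempered_def
proof (intro conjI allI impI)
  show "of_hat g \<psi> = 0" if "\<not> schwartz \<psi>" for \<psi> using that by (simp add: of_hat_def)
  show "of_hat g (\<lambda>x. \<psi> x + \<eta> x) = of_hat g \<psi> + of_hat g \<eta>" if "schwartz \<psi>" "schwartz \<eta>" for \<psi> \<eta>
    using that integrable_of_hat[OF g] by (simp add: of_hat_def schwartz_add ifourier_add distrib_left)
  show "of_hat g (\<lambda>x. c * \<psi> x) = c * of_hat g \<psi>" if "schwartz \<psi>" for c \<psi>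
    using that by (simp add: of_hat_def schwartz_cmult ifourier_cmult mult.left_commute[of _ c])
  let ?p = "CARD('d) + nat \<lceil>\<bar>- s\<bar>\<rceil>"
  obtain K N where K: "K \<ge> 0" "\<And>(\<psi> :: real^'d \<Rightarrow> complex) \<xi>. schwartz \<psi> \<Longrightarrow> (1 + norm \<xi>) ^ ?p * cmod (fourier \<psi> \<xi>) \<le> K * schwartz_norm N \<psi>"
    using fourier_decay[of ?p] by metis
  let ?w = "\<lambda>\<xi>::real^'d. complex_of_real (1 / (1 + norm \<xi>) ^ ?p)"
  have "integrable lborel (\<lambda>\<xi>. g \<xi> * ?w \<xi>)"
    by (intro integrable_wL2_mult[OF g] wL2_bounded_decay[where C=1]) (measurable, simp only: norm_of_real, simp)
  then have ig: "integrable lborel (\<lambda>\<xi>. cmod (g \<xi> * ?w \<xi>))" by (rule integrable_norm)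
  show "\<exists>C N. \<forall>\<psi>. schwartz \<psi> \<longrightarrow> cmod (of_hat g \<psi>) \<le> C * schwartz_norm N \<psi>"
  proof (intro exI allI impI)
    fix \<psi> :: "real^'d \<Rightarrow> complex" assume \<psi>: "schwartz \<psi>"
    note ioh = integrable_of_hat[OF g \<psi>]
    have "cmod (of_hat g \<psi>) \<le> (LINT \<xi>|lborel. cmod (g \<xi> * ifourier \<psi> \<xi>))"
      using \<psi> by (simp add: of_hat_def integral_norm_bound)
    also have "\<dots> \<le> (LINT \<xi>|lborel. cmod (g \<xi> * ?w \<xi>) * (K * schwartz_norm N \<psi>))"
    proof (intro integral_mono)
      show "integrable lborel (\<lambda>\<xi>. cmod (g \<xi> * ifourier \<psi> \<xi>))" by (intro integrable_norm ioh)
      show "integrable lborel (\<lambda>\<xi>. cmod (g \<xi> * ?w \<xi>) * (K * schwartz_norm N \<psi>))" by (intro integrable_mult_left ig)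
      fix \<xi> :: "real^'d"
      have "(1 + norm \<xi>) ^ ?p * cmod (ifourier \<psi> \<xi>) \<le> K * schwartz_norm N \<psi>"
        using K(2)[OF \<psi>, of "- \<xi>"] by (simp add: ifourier_def)
      moreover have p: "(1 + norm \<xi>) ^ ?p > 0" by (simp add: add_pos_nonneg)
      ultimately have "cmod (ifourier \<psi> \<xi>) \<le> cmod (?w \<xi>) * (K * schwartz_norm N \<psi>)"
        by (simp only: norm_of_real) (simp add: pos_le_divide_eq mult.commute)
      from mult_left_mono[OF this, of "cmod (g \<xi>)"]
      show "cmod (g \<xi> * ifourier \<psi> \<xi>) \<le> cmod (g \<xi> * ?w \<xi>) * (K * schwartz_norm N \<psi>)"
        by (simp only: norm_mult mult.assoc norm_ge_zero simp_thms)
    qed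
    also have "\<dots> = ((LINT \<xi>|lborel. cmod (g \<xi> * ?w \<xi>)) * K) * schwartz_norm N \<psi>" 
      by (simp only: integral_mult_left_zero mult.assoc)
    finally show "cmod (of_hat g \<psi>) \<le> ((LINT \<xi>|lborel. cmod (g \<xi> * ?w \<xi>)) * K) * schwartz_norm N \<psi>" .
  qed
qed

lemma is_function_of_hat:
  assumes g: "wL2 s g"
  shows "is_function (fourier_dist (of_hat g)) g"
  unfolding is_function_def
proof (intro conjI allI impI)
  fix \<psi> :: "real^'a \<Rightarrow> complex" assume \<psi>: "schwartz \<psi>"
  show "integrable lborel (\<lambda>x. g x * \<psi> x)" by (intro integrable_wL2_mult[OF g] schwartz_wL2 \<psi>)
  show "fourier_dist (of_hat g) \<psi> = (LINT x|lborel. g x * \<psi> x)"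
    using \<psi> by (simp add: fourier_dist_def of_hat_def schwartz_fourier ifourier_fourier)
qed (use g in \<open>simp add: wL2_def\<close>)

lemma is_function_unique:
  assumes "is_function T g" "is_function T h"
  shows "AE x in lborel. g x = h x"
proof -
  have "AE x in lborel. g x - h x = 0"
    using assms by (intro AE_eq_0_if_schwartz_integrals_0) (auto simp: is_function_def left_diff_distrib)
  then show ?thesis by simp
qed

lemma is_function_fhat:
  assumes "is_function (fourier_dist T) g"
  shows "is_function (fourier_dist T) (fhat T)"
proof -
  have "\<exists>g. is_function (fourier_dist T) g \<and>
        ((\<exists>h. is_function (fourier_dist T) h \<and> continuous_on UNIV h) \<longrightarrow> continuous_on UNIV g)"
    using assms by blast
  from someI_ex[OF this] show ?thesis unfolding fhat_def by blast
qed

lemma fhat_of_hat: "wL2 s g \<Longrightarrow> AE \<xi> in lborel. fhat (of_hat g) \<xi> = g \<xi>"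
  using is_function_of_hat is_function_fhat is_function_unique by metis

lemma of_hat_eqI:
  assumes "tempered T" "is_function (fourier_dist T) g"
  shows "T = of_hat g"
proof
  fix \<psi>
  show "T \<psi> = of_hat g \<psi>"
  proof (cases "schwartz \<psi>")
    case True
    then have "T \<psi> = fourier_dist T (ifourier \<psi>)" by (simp add: fourier_dist_def schwartz_ifourier fourier_ifourier)
    then show ?thesis using True assms(2) schwartz_ifourier by (auto simp: is_function_def of_hat_def)
  qed (use assms in \<open>simp add: tempered_def of_hat_def\<close>)
qed

lemma Hs_norm2_eq_Wn: "Hs_norm2 s T = Wn s (fhat T)"
  by (simp add: Hs_norm2_def Wn_def wt_def)

lemma HsD:
  assumes "T \<in> Hs s"
  shows "wL2 s (fhat T)" "T = of_hat (fhat T)"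
proof -
  have T: "tempered T" "Wn s (fhat T) < \<infinity>" "is_function (fourier_dist T) (fhat T)"
    using assms is_function_fhat by (auto simp: Hs_def Hs_norm2_eq_Wn)
  then show "T = of_hat (fhat T)" by (intro of_hat_eqI)
  show "wL2 s (fhat T)" using T by (simp add: wL2_def is_function_def)
qed

lemma Hs_norm2_of_hat: "wL2 s g \<Longrightarrow> Hs_norm2 t (of_hat g) = Wn t g"
  unfolding Hs_norm2_eq_Wn by (intro Wn_cong_AE) (use fhat_of_hat in fastforce)

lemma of_hat_Hs: "wL2 s g \<Longrightarrow> of_hat g \<in> Hs s"
  unfolding Hs_def using tempered_of_hat[of s g] is_function_of_hat[of s g] Hs_norm2_of_hat[of s g s] wL2_def[of s g] by auto

lemma of_hat_cong_AE:
  assumes "AE \<xi> in lborel. g \<xi> = h \<xi>" "g \<in> borel_measurable borel" "h \<in> borel_measurable borel"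
  shows "of_hat g = of_hat h"
proof
  fix \<psi> show "of_hat g \<psi> = of_hat h \<psi>"
  proof (cases "schwartz \<psi>")
    case True
    have [measurable]: "ifourier \<psi> \<in> borel_measurable borel" by (intro schwartz_borel schwartz_ifourier True)
    have "(LINT \<xi>|lborel. g \<xi> * ifourier \<psi> \<xi>) = (LINT \<xi>|lborel. h \<xi> * ifourier \<psi> \<xi>)"
      using assms by (intro integral_cong_AE) auto
    then show ?thesis by (simp add: of_hat_def)
  qed (simp add: of_hat_def)
qed

lemma of_hat_diff:
  assumes "wL2 s g" "wL2 s h"
  shows "(\<lambda>\<psi>. of_hat g \<psi> - of_hat h \<psi>) = of_hat (\<lambda>\<xi>. g \<xi> - h \<xi>)"
  using integrable_of_hat[OF assms(1)] integrable_of_hat[OF assms(2)]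
  by (auto simp: of_hat_def fun_eq_iff left_diff_distrib)

lemma of_hat_cmult: "(\<lambda>\<psi>. c * of_hat g \<psi>) = of_hat (\<lambda>\<xi>. c * g \<xi>)"
  by (auto simp: of_hat_def fun_eq_iff mult.assoc)

lemma of_hat_sum:
  assumes "\<And>i. i \<in> A \<Longrightarrow> wL2 s (g i)"
  shows "(\<lambda>\<psi>. \<Sum>i\<in>A. of_hat (g i) \<psi>) = of_hat (\<lambda>\<xi>. \<Sum>i\<in>A. g i \<xi>)"
proof
  fix \<psi> show "(\<Sum>i\<in>A. of_hat (g i) \<psi>) = of_hat (\<lambda>\<xi>. \<Sum>i\<in>A. g i \<xi>) \<psi>"
    using integrable_of_hat[OF assms] by (simp add: of_hat_def sum_distrib_right)
qed

subsection \<open>Dilates\<close>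

lemma wt_matrix:
  fixes B :: "real^'d^'d"
  assumes "invertible B"
  shows "\<exists>C>0. \<forall>\<xi>. wt s (B *v \<xi>) \<le> C * wt s \<xi>"
proof -
  have *: "1 + (norm (D *v \<xi>))\<^sup>2 \<le> (1 + (onorm ((*v) D))\<^sup>2) * (1 + (norm \<xi>)\<^sup>2)" for D :: "real^'d^'d" and \<xi>
  proof -
    have "norm (D *v \<xi>) \<le> onorm ((*v) D) * norm \<xi>" by (rule onorm) simp
    then have "(norm (D *v \<xi>))\<^sup>2 \<le> (onorm ((*v) D) * norm \<xi>)\<^sup>2" by (intro power_mono) auto
    then show ?thesis using zero_le_power2[of "norm \<xi>"] zero_le_power2[of "onorm ((*v) D)"]
      unfolding power_mult_distrib distrib_left distrib_right by linarith
  qed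
  have p: "1 + x\<^sup>2 > 0" for x :: real by (simp add: add_pos_nonneg)
  show ?thesis
  proof (cases "s \<ge> 0")
    case True
    show ?thesis
    proof (intro exI[of _ "(1 + (onorm ((*v) B))\<^sup>2) powr s"] conjI allI)
      fix \<xi>
      have "wt s (B *v \<xi>) \<le> ((1 + (onorm ((*v) B))\<^sup>2) * (1 + (norm \<xi>)\<^sup>2)) powr s"
        unfolding wt_def using True p by (intro powr_mono2 *) (auto simp: less_imp_le)
      then show "wt s (B *v \<xi>) \<le> (1 + (onorm ((*v) B))\<^sup>2) powr s * wt s \<xi>" by (simp add: wt_def powr_mult)
    qed (use p[of "onorm ((*v) B)"] in simp)
  next
    case False
    let ?I = "matrix_inv B"
    show ?thesis
    proof (intro exI[of _ "(1 + (onorm ((*v) ?I))\<^sup>2) powr - s"] conjI allI)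
      fix \<xi>
      have e: "?I *v (B *v \<xi>) = \<xi>" by (simp add: matrix_vector_mul_assoc matrix_inv_left[OF assms])
      have "((1 + (onorm ((*v) ?I))\<^sup>2) * (1 + (norm (B *v \<xi>))\<^sup>2)) powr s \<le> wt s \<xi>"
        unfolding wt_def using False p by (intro powr_mono2') (use *[of ?I "B *v \<xi>"] e in auto)
      then have "(1 + (onorm ((*v) ?I))\<^sup>2) powr s * wt s (B *v \<xi>) \<le> wt s \<xi>" by (simp add: wt_def powr_mult)
      then have "(1 + (onorm ((*v) ?I))\<^sup>2) powr -s * ((1 + (onorm ((*v) ?I))\<^sup>2) powr s * wt s (B *v \<xi>)) \<le> (1 + (onorm ((*v) ?I))\<^sup>2) powr -s * wt s \<xi>"
        by (rule mult_left_mono) simp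
      then show "wt s (B *v \<xi>) \<le> (1 + (onorm ((*v) ?I))\<^sup>2) powr -s * wt s \<xi>"
        using p[of "onorm ((*v) ?I)"] by (simp add: powr_minus mult.assoc[symmetric])
    qed (use p[of "onorm ((*v) ?I)"] in simp)
  qed
qed

lemma Wn_matrix:
  fixes B :: "real^'d^'d"
  assumes B: "invertible B"
  shows "\<exists>C::real. \<forall>g \<in> borel_measurable borel. Wn s (\<lambda>\<xi>. g (B *v \<xi>)) \<le> ennreal C * Wn s g"
proof -
  have inv: "invertible (matrix_inv B)"
    using B matrix_inv_left matrix_inv_right unfolding invertible_def by blast
  obtain C where C: "C > 0" "\<And>\<xi>. wt s (matrix_inv B *v \<xi>) \<le> C * wt s \<xi>" using wt_matrix[OF inv] by blast
  have e: "matrix_inv B *v (B *v \<xi>) = \<xi>" for \<xi> by (simp add: matrix_vector_mul_assoc matrix_inv_left[OF B])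
  show ?thesis
  proof (intro exI ballI)
    fix g :: "real^'d \<Rightarrow> complex" assume [measurable]: "g \<in> borel_measurable borel"
    have "Wn s (\<lambda>\<xi>. g (B *v \<xi>)) = (\<integral>\<^sup>+ \<xi>. (\<lambda>\<eta>. ennreal ((cmod (g \<eta>))\<^sup>2 * wt s (matrix_inv B *v \<eta>))) (B *v \<xi>) \<partial>lborel)"
      unfolding Wn_def by (simp add: e)
    also have "\<dots> = ennreal (1 / \<bar>det B\<bar>) * (\<integral>\<^sup>+ \<eta>. ennreal ((cmod (g \<eta>))\<^sup>2 * wt s (matrix_inv B *v \<eta>)) \<partial>lborel)"
      by (rule nn_integral_matrix[OF B]) measurable
    also have "\<dots> \<le> ennreal (1 / \<bar>det B\<bar>) * (\<integral>\<^sup>+ \<eta>. ennreal C * ennreal ((cmod (g \<eta>))\<^sup>2 * wt s \<eta>) \<partial>lborel)"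
    proof (intro mult_left_mono nn_integral_mono)
      fix \<eta>
      have "(cmod (g \<eta>))\<^sup>2 * wt s (matrix_inv B *v \<eta>) \<le> C * ((cmod (g \<eta>))\<^sup>2 * wt s \<eta>)"
        using mult_left_mono[OF C(2), of "(cmod (g \<eta>))\<^sup>2" \<eta>] by (simp add: mult_ac)
      then show "ennreal ((cmod (g \<eta>))\<^sup>2 * wt s (matrix_inv B *v \<eta>)) \<le> ennreal C * ennreal ((cmod (g \<eta>))\<^sup>2 * wt s \<eta>)"
        using C by (simp add: ennreal_mult[symmetric] ennreal_leI)
    qed simp
    also have "\<dots> = ennreal (1 / \<bar>det B\<bar>) * (ennreal C * Wn s g)"
      unfolding Wn_def by (subst nn_integral_cmult) auto
    also have "\<dots> = ennreal (1 / \<bar>det B\<bar> * C) * Wn s g"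
      by (subst ennreal_mult') (simp_all only: mult.assoc zero_le_divide_1_iff abs_ge_zero)
    finally show "Wn s (\<lambda>\<xi>. g (B *v \<xi>)) \<le> ennreal (1 / \<bar>det B\<bar> * C) * Wn s g" .
  qed
qed

lemma wL2_matrix:
  fixes B :: "real^'d^'d"
  assumes B: "invertible B" and g: "wL2 s g"
  shows "wL2 s (\<lambda>\<xi>. g (B *v \<xi>))"
proof -
  have [measurable]: "g \<in> borel_measurable borel" using g by (simp add: wL2_def)
  obtain C :: real where C: "\<forall>g \<in> borel_measurable borel. Wn s (\<lambda>\<xi>. g (B *v \<xi>)) \<le> ennreal C * Wn s g"
    using Wn_matrix[OF B, of s] by (rule exE)
  have "Wn s (\<lambda>\<xi>. g (B *v \<xi>)) \<le> ennreal C * Wn s g" by (rule bspec[OF C]) measurable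
  also have "\<dots> < \<infinity>" using g by (simp add: wL2_def ennreal_mult_less_top)
  finally show ?thesis by (simp add: wL2_def)
qed

lemma inner_matrix_vector: "(B *v x) \<bullet> y = x \<bullet> (transpose B *v y)" for B :: "real^'d^'d"
  by (metis dot_lmul_matrix inner_commute transpose_matrix_vector transpose_transpose)

declare transpose_matrix_vector [simp del]

lemma ifourier_ee: "ifourier f \<xi> = (LINT x|lborel. f x * ee (x \<bullet> \<xi>))"
  by (simp add: ifourier_def fourier_ee)

lemma ifourier_affine:
  fixes P :: "real^'d^'d" and f :: "real^'d \<Rightarrow> complex"
  assumes f[measurable]: "f \<in> borel_measurable borel" and P: "invertible P"
  shows "ifourier (\<lambda>y. f (P *v (y - b))) (transpose P *v \<eta>) = (1 / \<bar>det P\<bar>) *\<^sub>R (ee (b \<bullet> (transpose P *v \<eta>)) * ifourier f \<eta>)"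
proof -
  let ?\<xi> = "transpose P *v \<eta>"
  have "ifourier (\<lambda>y. f (P *v (y - b))) ?\<xi> = (LINT y|lborel. (\<lambda>y. f (P *v (y - b)) * ee (y \<bullet> ?\<xi>)) (b + y))"
    unfolding ifourier_ee by (rule integral_translate[symmetric]) measurable
  also have "\<dots> = (LINT y|lborel. (\<lambda>z. ee (b \<bullet> ?\<xi>) * (f z * ee (z \<bullet> \<eta>))) (P *v y))"
    by (intro Bochner_Integration.integral_cong refl) (simp add: inner_add_left ee_add inner_matrix_vector)
  also have "\<dots> = (1 / \<bar>det P\<bar>) *\<^sub>R (LINT z|lborel. ee (b \<bullet> ?\<xi>) * (f z * ee (z \<bullet> \<eta>)))"
    by (rule integral_matrix[OF P]) measurable
  finally show ?thesis by (simp add: ifourier_ee)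
qed

lemma of_hat_affine:
  fixes P :: "real^'d^'d" and g :: "real^'d \<Rightarrow> complex"
  assumes [measurable]: "g \<in> borel_measurable borel" and P: "invertible P" and \<psi>: "schwartz \<psi>"
  shows "of_hat g (\<lambda>y. \<psi> (P *v (y - b))) = of_hat (\<lambda>\<eta>. ee (b \<bullet> (transpose P *v \<eta>)) * g (transpose P *v \<eta>)) \<psi>"
proof -
  have s: "schwartz (\<lambda>y. \<psi> (P *v (y - b)))"
    using schwartz_affine[OF \<psi> P, of "- (P *v b)"] by (simp add: matrix_vector_mult_diff_distrib)
  have T: "invertible (transpose P)" using P by (rule transpose_invertible)
  have d0: "det P \<noteq> 0" using P by (simp add: invertible_det_nz)
  have [measurable]: "ifourier (\<lambda>y. \<psi> (P *v (y - b))) \<in> borel_measurable borel"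
    by (intro schwartz_borel schwartz_ifourier s)
  have [measurable]: "\<psi> \<in> borel_measurable borel" by (intro schwartz_borel \<psi>)
  have "(LINT \<xi>|lborel. g \<xi> * ifourier (\<lambda>y. \<psi> (P *v (y - b))) \<xi>)
     = \<bar>det P\<bar> *\<^sub>R (LINT \<eta>|lborel. (\<lambda>\<xi>. g \<xi> * ifourier (\<lambda>y. \<psi> (P *v (y - b))) \<xi>) (transpose P *v \<eta>))"
    using d0 by (subst integral_matrix[OF T]) auto
  also have "\<dots> = \<bar>det P\<bar> *\<^sub>R (LINT \<eta>|lborel. (1 / \<bar>det P\<bar>) *\<^sub>R (ee (b \<bullet> (transpose P *v \<eta>)) * g (transpose P *v \<eta>) * ifourier \<psi> \<eta>))"
    by (simp add: ifourier_affine[OF _ P] mult_ac)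
  also have "\<dots> = (LINT \<eta>|lborel. ee (b \<bullet> (transpose P *v \<eta>)) * g (transpose P *v \<eta>) * ifourier \<psi> \<eta>)"
    using d0 by simp
  finally show ?thesis using s \<psi> by (simp add: of_hat_def)
qed

lemma mat_pow_comm: "mat_pow A n ** A = A ** mat_pow A n"
  by (induction n) (auto simp flip: matrix_mul_assoc)

lemma transpose_mat_pow: "transpose (mat_pow A n) = mat_pow (transpose A) n"
  by (induction n) (auto simp: matrix_transpose_mul mat_pow_comm transpose_mat)

lemma mat_pow_inverse:
  assumes "A ** B = mat 1" shows "mat_pow A n ** mat_pow B n = mat 1"
proof (induction n)
  case (Suc n)
  have "mat_pow A (Suc n) ** mat_pow B (Suc n) = A ** (mat_pow A n ** mat_pow B n) ** B"
    by (simp add: mat_pow_comm[of B n, symmetric] matrix_mul_assoc)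
  then show ?case by (simp add: Suc assms)
qed simp

lemma det_mat_pow: "det (mat_pow A n) = det A ^ n"
  by (induction n) (auto simp: det_mul)

lemma transpose_matrix_inv:
  fixes A :: "real^'d^'d"
  assumes "invertible A"
  shows "transpose (matrix_inv A) = matrix_inv (transpose A)"
proof -
  have T: "invertible (transpose A)" using assms by (rule transpose_invertible)
  have "transpose (matrix_inv A) ** transpose A = mat 1"
    by (simp add: matrix_transpose_mul[symmetric] matrix_inv_right[OF assms] transpose_mat)
  then have "transpose (matrix_inv A) ** (transpose A ** matrix_inv (transpose A)) = matrix_inv (transpose A)"
    by (simp add: matrix_mul_assoc)
  then show ?thesis by (simp add: matrix_inv_right[OF T])
qed

lemma transpose_mat_powi:
  "invertible A \<Longrightarrow> transpose (mat_powi A j) = mat_powi (transpose A) j"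
  by (simp add: mat_powi_def transpose_mat_pow transpose_matrix_inv)

lemma mat_powi_inverse:
  assumes "invertible A" shows "mat_powi A j ** mat_powi A (- j) = mat 1"
  using assms
  by (cases "j = 0") (auto simp: mat_powi_def intro!: mat_pow_inverse matrix_inv_left matrix_inv_right)

lemma invertible_mat_powi: "invertible A \<Longrightarrow> invertible (mat_powi A j)"
  using mat_powi_inverse[of A j] mat_powi_inverse[of A "-j"] unfolding invertible_def by auto

lemma det_mat_powi:
  assumes "invertible A"
  shows "\<bar>det (mat_powi A j)\<bar> = \<bar>det A\<bar> powr of_int j"
proof -
  have d0: "det A \<noteq> 0" using assms by (simp add: invertible_det_nz)
  have dI: "det (matrix_inv A) = 1 / det A"
    using matrix_inv_right[OF assms] d0 by (metis det_I det_mul nonzero_mult_div_cancel_left)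
  show ?thesis
  proof (cases "j \<ge> 0")
    case True
    then have "of_int j = real (nat j)" by simp
    then show ?thesis using d0 True by (simp add: mat_powi_def det_mat_pow power_abs powr_realpow del: of_nat_nat)
  next
    case False
    then have "of_int j = - real (nat (- j))" by simp
    then show ?thesis using d0 False
      by (simp add: mat_powi_def det_mat_pow power_abs powr_minus powr_realpow dI power_divide divide_inverse power_inverse del: of_nat_nat)
  qed
qed

lemma det_rmat: "det (rmat M) = of_int (det M)"
  by (simp add: det_def rmat_def of_int_sum of_int_prod)

lemma det_cmat: "det (cmat M) = of_int (det M)"
  by (simp add: det_def cmat_def of_int_sum of_int_prod)

lemma dilation_invertible:
  assumes "dilation_matrix M" shows "invertible (rmat M)"
proof -
  have "v = 0" if "cmat M *v v = 0" for v
    using assms that unfolding dilation_matrix_def by (metis norm_zero not_one_less_zero vector_smult_lzero)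
  then have "\<exists>B. B ** cmat M = mat 1" using matrix_left_invertible_ker by blast
  then have "det (cmat M) \<noteq> 0" by (metis det_I det_mul mult_zero_right zero_neq_one)
  then show ?thesis by (simp add: invertible_det_nz det_rmat det_cmat)
qed

definition dil_hat :: "int^'d^'d \<Rightarrow> (real^'d \<Rightarrow> complex) \<Rightarrow> int \<Rightarrow> int^'d \<Rightarrow> real^'d \<Rightarrow> complex" where
  "dil_hat M g j k \<xi> = of_real (real_of_int \<bar>det M\<bar> powr (- real_of_int j / 2)) *
     (ee (rvec k \<bullet> (mat_powi (transpose (rmat M)) (- j) *v \<xi>)) * g (mat_powi (transpose (rmat M)) (- j) *v \<xi>))"

lemma wL2_mult_bounded:
  assumes g: "wL2 s g" and [measurable]: "e \<in> borel_measurable borel" and e: "\<And>\<xi>. cmod (e \<xi>) = 1"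
  shows "wL2 s (\<lambda>\<xi>. e \<xi> * g \<xi>)"
proof -
  have "Wn s (\<lambda>\<xi>. e \<xi> * g \<xi>) = Wn s g" by (intro Wn_cong_AE) (simp add: norm_mult e)
  then show ?thesis using g by (auto simp: wL2_def)
qed

lemma wL2_dil_hat:
  assumes M: "invertible (rmat M)" and g: "wL2 s g"
  shows "wL2 s (dil_hat M g j k)"
  unfolding dil_hat_def[abs_def]
  by (intro wL2_cmult wL2_mult_bounded wL2_matrix invertible_mat_powi transpose_invertible M g) auto

lemma dilate_of_hat:
  assumes M: "invertible (rmat M)" and g: "wL2 s g"
  shows "dilate M (of_hat g) j k = of_hat (dil_hat M g j k)"
proof
  fix \<psi>
  have [measurable]: "g \<in> borel_measurable borel" using g by (simp add: wL2_def)
  show "dilate M (of_hat g) j k \<psi> = of_hat (dil_hat M g j k) \<psi>"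
  proof (cases "schwartz \<psi>")
    case True
    then show ?thesis
      unfolding dilate_def dil_hat_def[abs_def] of_hat_cmult[symmetric]
      by (simp add: of_hat_affine[OF _ invertible_mat_powi[OF M] True] transpose_mat_powi[OF M])
  qed (simp add: dilate_def of_hat_def)
qed

subsection \<open>Localising distributions with compact support\<close>

lemma tempered_sum:
  assumes T: "tempered T" and "finite A" and s: "\<And>i. i \<in> A \<Longrightarrow> schwartz (f i)"
  shows "T (\<lambda>x. \<Sum>i\<in>A. f i x) = (\<Sum>i\<in>A. T (f i))"
  using \<open>finite A\<close> s
proof (induction A rule: finite_induct)
  case empty
  have "T (\<lambda>x. 0 * (0::complex)) = 0 * T (\<lambda>x. 0)"
    using T schwartz_0 unfolding tempered_def by blast
  then show ?case by simp
next
  case (insert i A)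
  have "T (\<lambda>x. f i x + (\<Sum>i\<in>A. f i x)) = T (f i) + T (\<lambda>x. \<Sum>i\<in>A. f i x)"
    using T insert schwartz_sum[of A f] unfolding tempered_def by blast
  then show ?case using insert by simp
qed

lemma tempered_0: "tempered T \<Longrightarrow> T (\<lambda>x. 0) = 0"
  using tempered_sum[of T "{}"] by simp

lemma sum_step_diff: "(\<Sum>k\<in>{- int L..int L}. step (t - of_int k + 1) - step (t - of_int k)) = step (t + L + 1) - step (t - L)"
proof (induction L)
  case (Suc L)
  have "{- int (Suc L)..int (Suc L)} = insert (- int (Suc L)) (insert (int (Suc L)) {- int L..int L})" by auto
  then show ?case using Suc by (simp add: algebra_simps)
qed simp

text \<open>A smooth partition of unity subordinate to a fine grid localises the test function.\<close>

lemma distribution_vanishes_off_support: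
  fixes \<psi> :: "real^'d \<Rightarrow> complex"
  assumes T: "tempered T" and \<psi>: "smooth \<psi>" and R: "\<And>x. norm x > R \<Longrightarrow> \<psi> x = 0"
    and disj: "closure {x. \<psi> x \<noteq> 0} \<inter> dist_support T = {}"
  shows "T \<psi> = 0"
proof (cases "{x. \<psi> x \<noteq> 0} = {}")
  case True
  then have "\<psi> = (\<lambda>x. 0)" by auto
  then show ?thesis using tempered_0[OF T] by simp
next
  case False
  define S where "S = closure {x. \<psi> x \<noteq> 0}"
  define \<C> where "\<C> = {U. open U \<and> (\<forall>\<psi>. smooth \<psi> \<and> compact (closure {x. \<psi> x \<noteq> 0}) \<and> closure {x. \<psi> x \<noteq> 0} \<subseteq> U \<longrightarrow> T \<psi> = 0)}"
  have "{x. \<psi> x \<noteq> 0} \<subseteq> cball 0 R" using R by (force simp: dist_norm)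
  then have bS: "bounded {x. \<psi> x \<noteq> 0}" by (rule bounded_subset[OF bounded_cball])
  then have cS: "compact S" unfolding S_def using compact_closure by blast
  have SC: "S \<subseteq> \<Union>\<C>" using disj unfolding S_def dist_support_def \<C>_def by auto
  have "S \<noteq> {}" using False by (simp add: S_def)
  then have "\<C> \<noteq> {}" using SC by auto
  obtain \<delta> where \<delta>: "\<delta> > 0" "\<And>A. A \<subseteq> S \<Longrightarrow> diameter A < \<delta> \<Longrightarrow> \<exists>B\<in>\<C>. A \<subseteq> B"
    using Lebesgue_number_lemma[OF cS \<open>\<C> \<noteq> {}\<close> SC] \<C>_def by blast
  let ?d = "real CARD('d)"
  obtain N :: nat where N: "2 * ?d / \<delta> < real N" using reals_Archimedean2 by blast
  have N0: "0 < real N" using N \<delta>(1) by (smt (verit) divide_nonneg_pos of_nat_0_le_iff)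
  obtain L :: nat where L: "real N * \<bar>R\<bar> \<le> real L" using real_arch_simple by blast
  define b where "b k t = step (real N * t - of_int k + 1) - step (real N * t - of_int k)" for k :: int and t
  define p where "p g x = complex_of_real (\<Prod>i\<in>UNIV. b (g i) (x $ i))" for g :: "'d \<Rightarrow> int" and x :: "real^'d"
  let ?G = "PiE (UNIV :: 'd set) (\<lambda>_. {- int L..int L})"
  have fG: "finite ?G" by (intro finite_PiE) auto
  have b0: "b k t = 0" if "\<bar>real N * t - of_int k\<bar> > 1" for k t
    using that by (cases "real N * t - of_int k > 0") (auto simp: b_def)
  have sp: "smooth (p g)" for g
  proof -
    have "smooth1 (\<lambda>t. step (real N * t + (1 - of_int k)) + (-1) * step (real N * t + (- of_int k)))" for k
      by (intro smooth1_add smooth1_mult smooth1_const smooth1_affine smooth1_step)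
    then have "smooth1 (b k)" for k unfolding b_def[abs_def] by (simp add: algebra_simps)
    then show ?thesis unfolding p_def[abs_def] by (intro smooth_prod1)
  qed
  have ss: "schwartz (\<lambda>x. p g x * \<psi> x)" for g
    by (rule schwartz_compact_support[where R=R]) (auto intro!: smooth_mult sp \<psi> simp: R)
  have dec: "\<psi> = (\<lambda>x. \<Sum>g\<in>?G. p g x * \<psi> x)"
  proof
    fix x
    show "\<psi> x = (\<Sum>g\<in>?G. p g x * \<psi> x)"
    proof (cases "norm x > R")
      case False
      have "(\<Sum>k\<in>{- int L..int L}. b k (x $ i)) = 1" for i
      proof -
        have "\<bar>x $ i\<bar> \<le> \<bar>R\<bar>" using component_le_norm_cart[of x i] False by linarith
        then have "\<bar>real N * x $ i\<bar> \<le> real N * \<bar>R\<bar>" using N0 by (simp add: abs_mult)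
        then have "\<bar>real N * x $ i\<bar> \<le> real L" using L by linarith
        then show ?thesis unfolding b_def sum_step_diff by (simp add: abs_le_iff)
      qed
      then have "(\<Prod>i\<in>UNIV. \<Sum>k\<in>{- int L..int L}. b k (x $ i)) = 1" by simp
      then have "(\<Sum>g\<in>?G. \<Prod>i\<in>UNIV. b (g i) (x $ i)) = 1" by (subst (asm) prod_sum_PiE) auto
      then have "(\<Sum>g\<in>?G. p g x) = 1" unfolding p_def of_real_sum[symmetric] by simp
      then show ?thesis by (simp flip: sum_distrib_right)
    qed (simp add: R)
  qed
  have "T (\<lambda>x. p g x * \<psi> x) = 0" for g
  proof (cases "{x. p g x * \<psi> x \<noteq> 0} = {}")
    case True
    then have "(\<lambda>x. p g x * \<psi> x) = (\<lambda>x. 0)" by auto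
    then show ?thesis using tempered_0[OF T] by simp
  next
    case False
    let ?A = "closure {x. p g x * \<psi> x \<noteq> 0}"
    have AS: "?A \<subseteq> S" unfolding S_def by (intro closure_mono) auto
    have cl: "closed {x::real^'d. \<forall>i. \<bar>real N * x $ i - of_int (g i)\<bar> \<le> 1}"
      by (intro closed_Collect_all closed_Collect_le continuous_intros)
    have Asub: "?A \<subseteq> {x. \<forall>i. \<bar>real N * x $ i - of_int (g i)\<bar> \<le> 1}"
    proof (intro closure_minimal[OF _ cl] subsetI CollectI allI)
      fix x i assume "x \<in> {x. p g x * \<psi> x \<noteq> 0}"
      then have "p g x \<noteq> 0" by auto
      then have "b (g i) (x $ i) \<noteq> 0" by (simp add: p_def)
      then show "\<bar>real N * x $ i - of_int (g i)\<bar> \<le> 1" using b0[of "x $ i" "g i"] by force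
    qed
    then have dx: "norm (x - y) \<le> 2 * ?d / real N" if "x \<in> ?A" "y \<in> ?A" for x y
    proof -
      have "\<bar>(x - y) $ i\<bar> \<le> 2 / real N" for i
      proof -
        have "\<bar>real N * x $ i - of_int (g i)\<bar> \<le> 1" "\<bar>real N * y $ i - of_int (g i)\<bar> \<le> 1"
          using that Asub by blast+
        then have "\<bar>real N * x $ i - real N * y $ i\<bar> \<le> 2" by linarith
        then have "real N * \<bar>x $ i - y $ i\<bar> \<le> 2" using N0 by (simp add: abs_mult flip: right_diff_distrib)
        then show ?thesis using N0 by (simp add: pos_le_divide_eq mult.commute)
      qed
      then have "(\<Sum>i\<in>UNIV. \<bar>(x - y) $ i\<bar>) \<le> (\<Sum>i\<in>(UNIV::'d set). 2 / real N)" by (intro sum_mono)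
      then show ?thesis using norm_le_l1_cart[of "x - y"] by (simp add: mult.commute)
    qed
    have "diameter ?A \<le> 2 * ?d / real N" using N0 by (intro diameter_le) (auto intro: dx)
    also have "\<dots> < \<delta>" using N N0 \<delta>(1) by (simp add: field_simps)
    finally obtain U where "U \<in> \<C>" "?A \<subseteq> U" using \<delta>(2)[OF AS] by blast
    moreover have "compact ?A" using compact_Int_closed[OF cS closed_closure] AS by (metis Int_absorb1)
    moreover have "smooth (\<lambda>x. p g x * \<psi> x)" by (intro smooth_mult sp \<psi>)
    ultimately show ?thesis unfolding \<C>_def by blast
  qed
  then have "T (\<lambda>x. \<Sum>g\<in>?G. p g x * \<psi> x) = 0" by (subst tempered_sum[OF T fG]) (auto intro: ss)
  then show ?thesis using dec by simp
qed

lemma tempered_cutoff_limit: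
  fixes \<eta> :: "real^'d \<Rightarrow> complex"
  assumes T: "tempered T" and \<eta>: "schwartz \<eta>" and z: "\<And>n. n \<ge> m \<Longrightarrow> T (\<lambda>x. cutoff n x * \<eta> x) = 0"
  shows "T \<eta> = 0"
proof -
  obtain C N where C: "\<And>\<psi>. schwartz \<psi> \<Longrightarrow> cmod (T \<psi>) \<le> C * schwartz_norm N \<psi>"
    using T unfolding tempered_def by blast
  obtain B where B: "\<And>n (x::real^'d). dsum N (cutoff n) x \<le> B" using cutoff_dsum_bound[of N] by blast
  obtain D where D: "D > 0" "\<And>x. (1 + norm x) ^ Suc N * dsum N \<eta> x \<le> D" using schwartz_dsum[OF \<eta>] by blast
  define E where "E = (1 + 2 ^ N * \<bar>B\<bar>) * D"
  have bound: "cmod (T \<eta>) \<le> \<bar>C\<bar> * (E / (1 + real n))" if "n \<ge> m" for n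
  proof -
    let ?u = "\<lambda>x. \<eta> x + (-1) * (cutoff n x * \<eta> x)"
    have sc: "schwartz (\<lambda>x. cutoff n x * \<eta> x)" by (intro schwartz_mult schwartz_cutoff \<eta>)
    have su: "schwartz ?u" by (intro schwartz_add schwartz_cmult sc \<eta>)
    have sm: "smooth \<eta>" "smooth (cutoff n :: real^'d \<Rightarrow> complex)" using \<eta> by (auto simp: schwartz_smooth smooth_cutoff)
    have "T ?u = T \<eta> + (-1) * T (\<lambda>x. cutoff n x * \<eta> x)"
      using T \<eta> sc schwartz_cmult[OF sc, of "-1"] unfolding tempered_def by metis
    then have "T \<eta> = T ?u" using z[OF that] by simp
    also have "cmod \<dots> \<le> C * schwartz_norm N ?u" by (rule C[OF su])
    also have "\<dots> \<le> \<bar>C\<bar> * schwartz_norm N ?u"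
    proof (intro mult_right_mono)
      show "0 \<le> schwartz_norm N ?u" using schwartz_norm_ge[OF su, of "[]" N 0] by (smt (verit) norm_ge_zero zero_le_mult_iff zero_le_power norm_zero list.size(3) le0)
    qed simp
    also have "\<dots> \<le> \<bar>C\<bar> * (E / (1 + real n))"
    proof (intro mult_left_mono schwartz_norm_le)
      fix js :: "'d list" and x :: "real^'d" assume js: "length js \<le> N"
      show "(1 + norm x) ^ N * cmod (pdiffs js ?u x) \<le> E / (1 + real n)"
      proof (cases "norm x < real n")
        case True
        have "pdiffs js ?u x = 0"
          by (rule pdiffs_eq_0[of "ball 0 (real n)"]) (use True in \<open>auto simp: cutoff_eq_1 less_imp_le\<close>)
        moreover have "E \<ge> 0" using D by (simp add: E_def)
        ultimately show ?thesis by simp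
      next
        case False
        have "cmod (pdiffs js (\<lambda>x. cutoff n x * \<eta> x) x) \<le> 2 ^ length js * dsum (length js) (cutoff n) x * dsum (length js) \<eta> x"
          by (rule pdiffs_mult_bound) (use sm in auto)
        also have "\<dots> \<le> 2 ^ N * \<bar>B\<bar> * dsum N \<eta> x"
          using js order.trans[OF dsum_mono[OF js, of "cutoff n" x] order.trans[OF B abs_ge_self]]
          by (intro mult_mono power_increasing dsum_mono) (auto simp: dsum_nonneg)
        finally have "cmod (pdiffs js ?u x) \<le> dsum N \<eta> x + 2 ^ N * \<bar>B\<bar> * dsum N \<eta> x"
          unfolding pdiffs_add[OF sm(1) smooth_cmult[OF smooth_mult[OF sm(2,1)]]] pdiffs_cmult[OF smooth_mult[OF sm(2,1)]]
          by (intro norm_triangle_le add_mono pdiffs_le_dsum js) (simp add: norm_mult)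
        then have "(1 + norm x) * ((1 + norm x) ^ N * cmod (pdiffs js ?u x)) \<le> (1 + norm x) * ((1 + norm x) ^ N * ((1 + 2 ^ N * \<bar>B\<bar>) * dsum N \<eta> x))"
          by (intro mult_left_mono) (auto simp: algebra_simps)
        also have "\<dots> = (1 + 2 ^ N * \<bar>B\<bar>) * ((1 + norm x) ^ Suc N * dsum N \<eta> x)" by simp
        also have "\<dots> \<le> E" unfolding E_def by (intro mult_left_mono D) auto
        finally have *: "(1 + norm x) * ((1 + norm x) ^ N * cmod (pdiffs js ?u x)) \<le> E" .
        have "(1 + real n) * ((1 + norm x) ^ N * cmod (pdiffs js ?u x)) \<le> (1 + norm x) * ((1 + norm x) ^ N * cmod (pdiffs js ?u x))"
          using False by (intro mult_right_mono) auto
        then show ?thesis using * by (simp add: pos_le_divide_eq mult.commute)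
      qed
    qed simp
    finally show ?thesis .
  qed
  have "(\<lambda>n. \<bar>C\<bar> * (E / (1 + real n))) \<longlonglongrightarrow> 0"
    using tendsto_mult_right_zero[OF LIMSEQ_Suc[OF lim_const_over_n[of E]], of "\<bar>C\<bar>"] by (simp add: add.commute)
  then have "cmod (T \<eta>) \<le> 0"
    by (rule LIMSEQ_le_const) (use bound in blast)
  then show ?thesis by simp
qed

lemma compact_support_cutoff:
  fixes T :: "('d::finite) distribution"
  assumes T: "tempered T" and c: "compact (dist_support T)"
  shows "\<exists>m. \<forall>\<psi>. schwartz \<psi> \<longrightarrow> T (\<lambda>x. cutoff m x * \<psi> x) = T \<psi>"
proof -
  obtain r where r: "\<And>x. x \<in> dist_support T \<Longrightarrow> norm x \<le> r" using compact_imp_bounded[OF c] unfolding bounded_iff by blast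
  obtain m :: nat where m: "r < real m" using reals_Archimedean2 by blast
  have "T (\<lambda>x. cutoff m x * \<psi> x) = T \<psi>" if \<psi>: "schwartz \<psi>" for \<psi>
  proof -
    let ?\<eta> = "\<lambda>x. \<psi> x + (-1) * (cutoff m x * \<psi> x)"
    have sc: "schwartz (\<lambda>x. cutoff m x * \<psi> x)" by (intro schwartz_mult schwartz_cutoff \<psi>)
    have s\<eta>: "schwartz ?\<eta>" by (intro schwartz_add schwartz_cmult sc \<psi>)
    have "T ?\<eta> = 0"
    proof (rule tempered_cutoff_limit[OF T s\<eta>])
      fix n :: nat
      show "T (\<lambda>x. cutoff n x * ?\<eta> x) = 0"
      proof (rule distribution_vanishes_off_support[OF T])
        show "smooth (\<lambda>x. cutoff n x * ?\<eta> x)" by (intro smooth_mult smooth_cutoff schwartz_smooth s\<eta>)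
        show "cutoff n x * ?\<eta> x = 0" if x: "norm x > real CARD('d) * (real n + 1)" for x
        proof -
          obtain i where "\<bar>x $ i\<bar> > real n + 1" using norm_gt_component[OF x] by blast
          then show ?thesis using cutoff_eq_0[of n x i] by simp
        qed
        have "closure {x. cutoff n x * ?\<eta> x \<noteq> 0} \<subseteq> - ball 0 (real m)"
          by (intro closure_minimal) (auto simp: cutoff_eq_1 less_imp_le)
        then show "closure {x. cutoff n x * ?\<eta> x \<noteq> 0} \<inter> dist_support T = {}"
          using r m by (force simp: dist_norm)
      qed
    qed
    moreover have "T ?\<eta> = T \<psi> + (-1) * T (\<lambda>x. cutoff m x * \<psi> x)"
      using T \<psi> sc schwartz_cmult[OF sc, of "-1"] unfolding tempered_def by metis
    ultimately show ?thesis by simp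
  qed
  then show ?thesis by blast
qed

subsection \<open>Integer translates\<close>

lemma sets_torus [measurable]: "torus \<in> sets borel"
  unfolding torus_def by measurable

lemma emeasure_torus: "emeasure lborel (torus :: (real^'d) set) = 1"
proof -
  let ?h = "(\<chi> i. 1/2) :: real^'d"
  have 1: "box (- ?h) ?h \<subseteq> torus" "torus \<subseteq> cbox (- ?h) ?h"
    by (auto simp: torus_def mem_box_cart less_imp_le)
  have p: "(\<Prod>b\<in>Basis. (?h - - ?h) \<bullet> b) = 1"
  proof (intro prod.neutral ballI)
    fix b :: "real^'d" assume "b \<in> Basis"
    then obtain i where "b = axis i 1" by (auto simp: Basis_vec_eq_range)
    then show "(?h - - ?h) \<bullet> b = 1" by (simp add: inner_axis)
  qed
  have c: "\<And>b. b \<in> Basis \<Longrightarrow> - ?h \<bullet> b \<le> ?h \<bullet> b"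
    by (auto simp: Basis_vec_eq_range inner_axis)
  have "emeasure lborel (box (- ?h) ?h) = 1" "emeasure lborel (cbox (- ?h) ?h) = 1"
    using c p by (simp_all add: emeasure_lborel_box emeasure_lborel_cbox)
  then show ?thesis
    using emeasure_mono[OF 1(1), of lborel] emeasure_mono[OF 1(2), of lborel] by (auto intro: antisym)
qed

lemma rvec_add: "rvec (a + b) = rvec a + rvec b" and rvec_minus: "rvec (- a) = - rvec a" and rvec_0 [simp]: "rvec 0 = 0"
  by (simp_all add: rvec_def vec_eq_iff)

lemma torus_translate_iff: "x - rvec k \<in> torus \<longleftrightarrow> k = (\<chi> i. \<lfloor>x $ i + 1/2\<rfloor>)"
proof -
  have "(- 1/2 \<le> y - of_int z \<and> y - of_int z < 1/2) \<longleftrightarrow> z = \<lfloor>y + 1/2\<rfloor>" for y :: real and z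
    by (auto simp: floor_eq_iff) linarith+
  then show ?thesis by (simp add: torus_def rvec_def vec_eq_iff)
qed

lemma nn_integral_tiling:
  fixes f :: "real^'d \<Rightarrow> ennreal"
  assumes [measurable]: "f \<in> borel_measurable borel"
  shows "(\<integral>\<^sup>+ x. f x \<partial>lborel) = (\<integral>\<^sup>+ k. (\<integral>\<^sup>+ t\<in>torus. f (t + rvec k) \<partial>lborel) \<partial>count_space UNIV)"
proof -
  have "(\<integral>\<^sup>+ t\<in>torus. f (t + rvec k) \<partial>lborel) = (\<integral>\<^sup>+ x. f x * indicator torus (x - rvec k) \<partial>lborel)" for k
    using nn_integral_translate[of "\<lambda>x. f x * indicator torus (x - rvec k)" "rvec k"] by (simp add: add.commute)
  then have "(\<integral>\<^sup>+ k. (\<integral>\<^sup>+ t\<in>torus. f (t + rvec k) \<partial>lborel) \<partial>count_space UNIV)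
     = (\<integral>\<^sup>+ x. (\<integral>\<^sup>+ k. f x * indicator torus (x - rvec k) \<partial>count_space UNIV) \<partial>lborel)"
    by (subst nn_integral_count_space_nn_integral) auto
  also have "\<dots> = (\<integral>\<^sup>+ x. f x \<partial>lborel)"
  proof (intro nn_integral_cong)
    fix x :: "real^'d"
    let ?k = "(\<chi> i. \<lfloor>x $ i + 1/2\<rfloor>) :: int^'d"
    have "(\<integral>\<^sup>+ k. f x * indicator torus (x - rvec k) \<partial>count_space UNIV) = (\<integral>\<^sup>+ k. f x * indicator {?k} k \<partial>count_space UNIV)"
      by (intro nn_integral_cong) (simp add: indicator_def torus_translate_iff)
    also have "\<dots> = f x" by (simp add: nn_integral_cmult_indicator)
    finally show "(\<integral>\<^sup>+ k. f x * indicator torus (x - rvec k) \<partial>count_space UNIV) = f x" .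
  qed
  finally show ?thesis by simp
qed

lemma torus_norm_le: "t \<in> torus \<Longrightarrow> norm (t::real^'d) \<le> real CARD('d)"
proof -
  assume t: "t \<in> torus"
  have "norm t \<le> (\<Sum>i\<in>UNIV. \<bar>t $ i\<bar>)" by (rule norm_le_l1_cart)
  also have "\<dots> \<le> (\<Sum>i\<in>(UNIV::'d set). 1)"
  proof (intro sum_mono)
    fix i show "\<bar>t $ i\<bar> \<le> 1" using t unfolding torus_def by (auto simp: abs_le_iff elim!: allE[of _ i])
  qed
  finally show ?thesis by simp
qed

lemma lattice_sum_decay:
  obtains C where "C < \<infinity>" "\<And>x::real^'d. (\<integral>\<^sup>+ k. ennreal (1 / (1 + norm (x - rvec k)) ^ (2 * CARD('d))) \<partial>count_space UNIV) \<le> C"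
proof
  let ?d = "CARD('d)"
  let ?w = "\<lambda>x::real^'d. 1 / (1 + norm x) ^ (2 * ?d)"
  let ?C = "ennreal ((1 + real ?d) ^ (2 * ?d)) * (\<integral>\<^sup>+ y. ennreal (?w y) \<partial>lborel)"
  have "(\<integral>\<^sup>+ y. ennreal (?w y) \<partial>lborel) < \<infinity>"
    using integrable_decay[where 'd='d] by (subst (asm) integrable_iff_bounded) simp
  then show "?C < \<infinity>" by (simp add: ennreal_mult_less_top)
  fix x :: "real^'d"
  have w: "?w y \<le> (1 + real ?d) ^ (2 * ?d) * ?w (y - t)" if "t \<in> torus" for y t
  proof -
    have "1 + norm (y - t) \<le> 1 + norm y + real ?d" using torus_norm_le[OF that] norm_triangle_ineq4[of y t] by linarith
    also have "\<dots> \<le> (1 + real ?d) * (1 + norm y)" by (simp add: algebra_simps)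
    finally have "(1 + norm (y - t)) ^ (2 * ?d) \<le> ((1 + real ?d) * (1 + norm y)) ^ (2 * ?d)"
      by (intro power_mono) auto
    then have *: "(1 + norm (y - t)) ^ (2 * ?d) \<le> (1 + real ?d) ^ (2 * ?d) * (1 + norm y) ^ (2 * ?d)"
      by (simp only: power_mult_distrib)
    have "0 < a \<Longrightarrow> 0 < b \<Longrightarrow> b \<le> c * a \<Longrightarrow> 1 / a \<le> c * (1 / b)" for a b c :: real
      by (simp add: field_simps)
    from this[OF _ _ *] show ?thesis by (simp add: zero_less_power add_pos_nonneg)
  qed
  have "(\<integral>\<^sup>+ k. ennreal (?w (x - rvec k)) \<partial>count_space UNIV)
      = (\<integral>\<^sup>+ k. (\<integral>\<^sup>+ t\<in>(torus :: (real^'d) set). ennreal (?w (x - rvec k)) \<partial>lborel) \<partial>count_space UNIV)"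
    by (simp add: nn_integral_cmult_indicator emeasure_torus)
  also have "\<dots> \<le> (\<integral>\<^sup>+ k. (\<integral>\<^sup>+ t\<in>torus. ennreal ((1 + real ?d) ^ (2 * ?d)) * ennreal (?w (x - (t + rvec k))) \<partial>lborel) \<partial>count_space UNIV)"
  proof (intro nn_integral_mono)
    fix k :: "int^'d" and t :: "real^'d"
    show "ennreal (?w (x - rvec k)) * indicator torus t \<le> ennreal ((1 + real ?d) ^ (2 * ?d)) * ennreal (?w (x - (t + rvec k))) * indicator torus t"
      using w[of t "x - rvec k"]
      by (cases "t \<in> torus") (auto simp: ennreal_mult[symmetric] algebra_simps intro!: ennreal_leI)
  qed
  also have "\<dots> = (\<integral>\<^sup>+ y. ennreal ((1 + real ?d) ^ (2 * ?d)) * ennreal (?w (x - y)) \<partial>lborel)"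
    by (rule nn_integral_tiling[symmetric]) measurable
  also have "\<dots> = ennreal ((1 + real ?d) ^ (2 * ?d)) * (\<integral>\<^sup>+ y. ennreal (?w (x - y)) \<partial>lborel)"
    by (rule nn_integral_cmult) measurable
  also have "(\<integral>\<^sup>+ y. ennreal (?w (x - y)) \<partial>lborel) = (\<integral>\<^sup>+ y. ennreal (?w (- x + y)) \<partial>lborel)"
    by (simp add: norm_minus_commute)
  also have "\<dots> = (\<integral>\<^sup>+ y. ennreal (?w y) \<partial>lborel)"
    by (rule nn_integral_translate) measurable
  finally show "(\<integral>\<^sup>+ k. ennreal (?w (x - rvec k)) \<partial>count_space UNIV) \<le> ?C" .
qed


lemma wt_Peetre: "wt s \<xi> \<le> 2 powr \<bar>s\<bar> * (wt s \<eta> * wt \<bar>s\<bar> (\<eta> - \<xi>))"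
proof -
  have *: "1 + (norm x)\<^sup>2 \<le> 2 * ((1 + (norm y)\<^sup>2) * (1 + (norm z)\<^sup>2))" if "norm x \<le> norm y + norm z" for x y z :: "real^'a"
  proof -
    have "(norm x)\<^sup>2 \<le> (norm y + norm z)\<^sup>2" using that by (intro power_mono) auto
    also have "\<dots> \<le> 2 * (norm y)\<^sup>2 + 2 * (norm z)\<^sup>2"
      using sum_squares_bound[of "norm y" "norm z"] by (simp add: power2_sum)
    finally show ?thesis by (simp add: algebra_simps) (smt (verit) mult_nonneg_nonneg zero_le_power2)
  qed
  have **: "wt s x \<le> 2 powr s * (wt s y * wt s z)" if "norm x \<le> norm y + norm z" "s \<ge> 0" for s and x y z :: "real^'a"
  proof -
    have "wt s x \<le> (2 * ((1 + (norm y)\<^sup>2) * (1 + (norm z)\<^sup>2))) powr s"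
      unfolding wt_def using that by (intro powr_mono2 *) auto
    then show ?thesis by (simp add: wt_def powr_mult)
  qed
  show ?thesis
  proof (cases "s \<ge> 0")
    case True
    have "norm \<xi> \<le> norm \<eta> + norm (\<eta> - \<xi>)" by (metis norm_triangle_sub norm_minus_commute)
    from **[OF this True] show ?thesis using True by simp
  next
    case False
    have "norm \<eta> \<le> norm \<xi> + norm (\<eta> - \<xi>)" by (metis norm_triangle_sub)
    from **[OF this, of "- s"] False
    have "wt (- s) \<eta> \<le> 2 powr \<bar>s\<bar> * (wt (- s) \<xi> * wt \<bar>s\<bar> (\<eta> - \<xi>))" by simp
    from mult_left_mono[OF this, of "wt s \<xi> * wt s \<eta>"]
    have "wt s \<xi> * (wt s \<eta> * wt (- s) \<eta>) \<le> 2 powr \<bar>s\<bar> * (wt s \<xi> * wt (- s) \<xi>) * (wt s \<eta> * wt \<bar>s\<bar> (\<eta> - \<xi>))"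
      by (simp add: mult_ac)
    then show ?thesis by (simp flip: wt_add)
  qed
qed

lemma ifourier_product_convolution:
  fixes \<theta> \<psi> :: "real^'d \<Rightarrow> complex"
  assumes \<theta>: "schwartz \<theta>" and \<psi>: "schwartz \<psi>"
  shows "ifourier (\<lambda>x. \<theta> x * fourier \<psi> x) \<eta> = (LINT \<xi>|lborel. \<psi> \<xi> * ifourier \<theta> (\<eta> - \<xi>))"
proof -
  have "ifourier (\<lambda>x. \<theta> x * fourier \<psi> x) \<eta> = (LINT y|lborel. \<theta> y * (LINT \<xi>|lborel. \<psi> \<xi> * ee (y \<bullet> (\<eta> - \<xi>))))"
  proof -
    have "fourier \<psi> y * ee (y \<bullet> \<eta>) = (LINT \<xi>|lborel. \<psi> \<xi> * ee (y \<bullet> (\<eta> - \<xi>)))" for y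
      unfolding fourier_ee
      by (subst integral_mult_left_zero[symmetric], intro Bochner_Integration.integral_cong refl)
        (simp add: inner_diff_right inner_commute mult.assoc flip: ee_add)
    then show ?thesis unfolding ifourier_ee[of "\<lambda>x. \<theta> x * fourier \<psi> x"] by (simp add: mult.assoc)
  qed
  also have "\<dots> = (LINT \<xi>|lborel. \<psi> \<xi> * (LINT y|lborel. \<theta> y * ee (y \<bullet> (\<eta> - \<xi>))))"
    by (rule Fubini_bounded_kernel) (use \<theta> \<psi> schwartz_integrable in auto)
  finally show ?thesis by (simp add: ifourier_ee)
qed

lemma localized_eq_convolution:
  fixes g :: "real^'d \<Rightarrow> complex"
  assumes g: "wL2 s g" and \<theta>: "schwartz \<theta>"
    and loc: "\<And>\<psi>. schwartz \<psi> \<Longrightarrow> of_hat g (\<lambda>x. \<theta> x * \<psi> x) = of_hat g \<psi>"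
  shows "AE \<xi> in lborel. g \<xi> = (LINT \<eta>|lborel. g \<eta> * ifourier \<theta> (\<eta> - \<xi>))"
proof -
  let ?p = "CARD('d) + nat \<lceil>\<bar>- s\<bar>\<rceil>"
  let ?T = "ifourier \<theta>"
  let ?w = "\<lambda>x::real^'d. (1 + norm x) ^ ?p"
  have w0: "?w x > 0" for x by (simp add: add_pos_nonneg)
  have wne: "complex_of_real (?w x) \<noteq> 0" for x using w0[of x] by (metis less_irrefl of_real_eq_0_iff)
  have sT: "schwartz ?T" using \<theta> by (rule schwartz_ifourier)
  obtain C where C: "C > 0" "\<And>x. cmod (?T x) \<le> C / ?w x" using schwartz_decay'[OF sT] by metis
  have [measurable]: "g \<in> borel_measurable borel" "?T \<in> borel_measurable borel"
    using g sT by (auto simp: wL2_def intro: schwartz_borel)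
  define f where "f \<eta> = g \<eta> * complex_of_real (1 / ?w \<eta>)" for \<eta>
  have f: "integrable lborel f" unfolding f_def
    by (intro integrable_wL2_mult[OF g] wL2_bounded_decay[where C=1]) (measurable, simp only: norm_of_real, simp)
  define k where "k \<eta> \<xi> = ?T (\<eta> - \<xi>) * complex_of_real (?w \<eta> / (C * ?w \<xi>))" for \<eta> \<xi>
  have k1: "cmod (k \<eta> \<xi>) \<le> 1" for \<eta> \<xi>
  proof -
    have "1 + norm \<eta> \<le> (1 + norm (\<eta> - \<xi>)) * (1 + norm \<xi>)"
      using norm_triangle_sub[of \<eta> \<xi>] by (simp add: algebra_simps) (smt (verit) mult_nonneg_nonneg norm_ge_zero)
    then have "?w \<eta> \<le> ((1 + norm (\<eta> - \<xi>)) * (1 + norm \<xi>)) ^ ?p" by (intro power_mono) auto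
    then have *: "?w \<eta> \<le> ?w (\<eta> - \<xi>) * ?w \<xi>" by (simp only: power_mult_distrib)
    have "cmod (k \<eta> \<xi>) = cmod (?T (\<eta> - \<xi>)) * (?w \<eta> / (C * ?w \<xi>))"
      unfolding k_def norm_mult norm_of_real using C(1) w0[of \<eta>] w0[of \<xi>] by simp
    also have "\<dots> \<le> (C / ?w (\<eta> - \<xi>)) * ((?w (\<eta> - \<xi>) * ?w \<xi>) / (C * ?w \<xi>))"
      using C(1) w0 by (intro mult_mono C(2) divide_right_mono *) (auto simp: less_imp_le)
    also have "\<dots> = 1"
    proof -
      have "1 + norm x \<noteq> 0" for x :: "real^'d" by (simp add: add_nonneg_eq_0_iff)
      then show ?thesis using C(1) by simp
    qed
    finally show ?thesis .
  qed
  have fk: "f \<eta> * k \<eta> \<xi> = g \<eta> * ?T (\<eta> - \<xi>) * complex_of_real (1 / (C * ?w \<xi>))" for \<eta> \<xi>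
    unfolding f_def k_def using wne[of \<eta>] by (simp del: of_real_power of_real_add)
  have [measurable]: "(\<lambda>(x, y). k x y) \<in> borel_measurable (borel \<Otimes>\<^sub>M borel)"
    unfolding k_def by measurable
  define G where "G \<xi> = (LINT \<eta>|lborel. g \<eta> * ?T (\<eta> - \<xi>))" for \<xi>
  have [measurable]: "G \<in> borel_measurable borel" unfolding G_def by measurable
  have G: "G \<xi> = complex_of_real (C * ?w \<xi>) * (LINT \<eta>|lborel. f \<eta> * k \<eta> \<xi>)" for \<xi>
  proof -
    have "complex_of_real (C * ?w \<xi>) \<noteq> 0" using C(1) w0[of \<xi>] by (metis less_irrefl mult_pos_pos of_real_eq_0_iff)
    then show ?thesis unfolding fk integral_mult_left_zero G_def by (simp del: of_real_power of_real_add of_real_mult)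
  qed
  define J where "J = (LINT \<eta>|lborel. cmod (f \<eta>))"
  have Gb: "cmod (G \<xi>) \<le> C * ?w \<xi> * J" for \<xi>
  proof -
    have "cmod (LINT \<eta>|lborel. f \<eta> * k \<eta> \<xi>) \<le> (LINT \<eta>|lborel. cmod (f \<eta>))"
    proof (rule order.trans[OF integral_norm_bound], rule integral_mono')
      show "cmod (f x * k x \<xi>) \<le> cmod (f x)" for x using k1[of x \<xi>] by (simp add: norm_mult mult_left_le)
    qed (use f in auto)
    then show ?thesis unfolding G J_def norm_mult norm_of_real using C(1) w0[of \<xi>] by (simp add: mult_left_mono abs_mult)
  qed
  have ip: "integrable lborel (\<lambda>\<xi>. \<psi> \<xi> * complex_of_real (?w \<xi>))" if \<psi>: "schwartz \<psi>" for \<psi> :: "real^'d \<Rightarrow> complex"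
  proof -
    have [measurable]: "\<psi> \<in> borel_measurable borel" using \<psi> by (rule schwartz_borel)
    obtain D where D: "\<And>x. cmod (\<psi> x) \<le> D / (1 + norm x) ^ (2 * CARD('d) + ?p)" using schwartz_decay'[OF \<psi>] by metis
    show ?thesis
    proof (rule integrable_bounded_decay)
      fix x :: "real^'d"
      have "cmod (\<psi> x * complex_of_real (?w x)) \<le> D / (1 + norm x) ^ (2 * CARD('d) + ?p) * ?w x"
        unfolding norm_mult norm_of_real abs_of_pos[OF w0] by (intro mult_right_mono D less_imp_le w0)
      also have "\<dots> = D / (1 + norm x) ^ (2 * CARD('d))" unfolding power_add[of _ "2 * CARD('d)" ?p] using w0[of x] by simp
      finally show "cmod (\<psi> x * complex_of_real (?w x)) \<le> D / (1 + norm x) ^ (2 * CARD('d))" .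
    qed measurable
  qed
  have iG: "integrable lborel (\<lambda>\<xi>. G \<xi> * \<psi> \<xi>)" if \<psi>: "schwartz \<psi>" for \<psi>
  proof (rule Bochner_Integration.integrable_bound[OF integrable_mult_right[OF ip[OF \<psi>], of "of_real (C * J)"]])
    show "(\<lambda>\<xi>. G \<xi> * \<psi> \<xi>) \<in> borel_measurable lborel" using schwartz_borel[OF \<psi>] by measurable
    have "cmod (G \<xi> * \<psi> \<xi>) \<le> cmod (of_real (C * J) * (\<psi> \<xi> * complex_of_real (?w \<xi>)))" for \<xi>
    proof -
      have "J \<ge> 0" unfolding J_def by simp
      then show ?thesis using mult_right_mono[OF Gb[of \<xi>] norm_ge_zero[of "\<psi> \<xi>"]] C(1) w0[of \<xi>]
        unfolding norm_mult norm_of_real by (simp add: mult_ac abs_mult)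
    qed
    then show "AE \<xi> in lborel. norm (G \<xi> * \<psi> \<xi>) \<le> norm (of_real (C * J) * (\<psi> \<xi> * complex_of_real (?w \<xi>)))" by simp
  qed
  have eq: "(LINT \<xi>|lborel. g \<xi> * \<psi> \<xi>) = (LINT \<xi>|lborel. G \<xi> * \<psi> \<xi>)" if \<psi>: "schwartz \<psi>" for \<psi>
  proof -
    have "(LINT \<xi>|lborel. g \<xi> * \<psi> \<xi>) = of_hat g (fourier \<psi>)"
      using \<psi> by (simp add: of_hat_def schwartz_fourier ifourier_fourier)
    also have "\<dots> = of_hat g (\<lambda>x. \<theta> x * fourier \<psi> x)" by (rule loc[symmetric]) (intro schwartz_fourier \<psi>)
    also have "\<dots> = (LINT \<eta>|lborel. g \<eta> * (LINT \<xi>|lborel. \<psi> \<xi> * ?T (\<eta> - \<xi>)))"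
      using schwartz_mult[OF \<theta> schwartz_fourier[OF \<psi>]]
      by (simp add: of_hat_def ifourier_product_convolution[OF \<theta> \<psi>])
    also have "\<dots> = (LINT \<eta>|lborel. f \<eta> * (LINT \<xi>|lborel. (of_real C * (\<psi> \<xi> * of_real (?w \<xi>))) * k \<eta> \<xi>))"
    proof (intro Bochner_Integration.integral_cong refl)
      fix \<eta>
      have e: "(of_real C * (\<psi> \<xi> * of_real (?w \<xi>))) * k \<eta> \<xi> = of_real (?w \<eta>) * (\<psi> \<xi> * ?T (\<eta> - \<xi>))" for \<xi>
        unfolding k_def using wne[of \<xi>] C(1) by (simp add: of_real_mult[of C] del: of_real_power of_real_add)
      show "g \<eta> * (LINT \<xi>|lborel. \<psi> \<xi> * ?T (\<eta> - \<xi>)) = f \<eta> * (LINT \<xi>|lborel. (of_real C * (\<psi> \<xi> * of_real (?w \<xi>))) * k \<eta> \<xi>)"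
        unfolding f_def e integral_mult_right_zero using wne[of \<eta>] by (simp del: of_real_power of_real_add)
    qed
    also have "\<dots> = (LINT \<xi>|lborel. (of_real C * (\<psi> \<xi> * of_real (?w \<xi>))) * (LINT \<eta>|lborel. f \<eta> * k \<eta> \<xi>))"
      by (rule Fubini_bounded_kernel[OF f integrable_mult_right[OF ip[OF \<psi>]]]) (use k1 in auto)
    also have "\<dots> = (LINT \<xi>|lborel. G \<xi> * \<psi> \<xi>)"
      unfolding G by (simp add: mult_ac)
    finally show ?thesis .
  qed
  have ig: "integrable lborel (\<lambda>\<xi>. g \<xi> * \<psi> \<xi>)" if "schwartz \<psi>" for \<psi>
    by (intro integrable_wL2_mult[OF g] schwartz_wL2 that)
  have "AE \<xi> in lborel. g \<xi> - G \<xi> = 0"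
    by (rule AE_eq_0_if_schwartz_integrals_0) (auto simp: left_diff_distrib ig iG eq)
  then show ?thesis by (simp add: G_def)
qed

definition bracket :: "real \<Rightarrow> (real^'d \<Rightarrow> complex) \<Rightarrow> real^'d \<Rightarrow> ennreal" where
  "bracket s g \<xi> = (\<integral>\<^sup>+ k. ennreal ((cmod (g (\<xi> + rvec k)))\<^sup>2 * wt s (\<xi> + rvec k)) \<partial>count_space UNIV)"

lemma AE_translates:
  fixes P :: "real^'d \<Rightarrow> bool"
  assumes "AE \<xi> in lborel. P \<xi>"
  shows "AE \<xi> in lborel. \<forall>k. P (\<xi> + rvec k)"
proof -
  have "AE \<xi> in lborel. P (\<xi> + rvec k)" for k
  proof -
    have "AE \<xi> in distr lborel borel ((+) (rvec k)). P \<xi>" unfolding lborel_distr_plus by (rule assms)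
    then have "AE \<xi> in lborel. P (rvec k + \<xi>)" by (rule AE_distrD[rotated]) measurable
    then show ?thesis by (simp add: add.commute)
  qed
  then show ?thesis unfolding AE_all_countable by blast
qed

lemma bracket_bound:
  fixes T :: "('d::finite) distribution"
  assumes T: "T \<in> Hs s" and c: "compact (dist_support T)"
  obtains C :: real where "C > 0" "AE \<xi> in lborel. bracket s (fhat T) \<xi> \<le> ennreal C"
proof -
  let ?g = "fhat T"
  let ?n = "nat \<lceil>\<bar>s\<bar>\<rceil>"
  let ?p = "CARD('d) + ?n"
  have g: "wL2 s ?g" and Tg: "of_hat ?g = T" using HsD[OF T] by auto
  have [measurable]: "?g \<in> borel_measurable borel" using g by (simp add: wL2_def)
  obtain m where m: "\<And>\<psi>. schwartz \<psi> \<Longrightarrow> T (\<lambda>x. cutoff m x * \<psi> x) = T \<psi>"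
    using compact_support_cutoff[OF _ c] T by (auto simp: Hs_def)
  let ?T = "ifourier (cutoff m) :: real^'d \<Rightarrow> complex"
  have sT: "schwartz ?T" by (intro schwartz_ifourier schwartz_cutoff)
  have [measurable]: "?T \<in> borel_measurable borel" using sT by (rule schwartz_borel)
  have conv: "AE \<xi> in lborel. ?g \<xi> = (LINT \<eta>|lborel. ?g \<eta> * ?T (\<eta> - \<xi>))"
    by (rule localized_eq_convolution[OF g schwartz_cutoff]) (simp add: Tg m)
  obtain D where D: "D > 0" "\<And>x. cmod (?T x) \<le> D / (1 + norm x) ^ (2 * ?p)" using schwartz_decay'[OF sT] by metis
  obtain L where L: "L < \<infinity>" "\<And>x::real^'d. (\<integral>\<^sup>+ k. ennreal (1 / (1 + norm (x - rvec k)) ^ (2 * CARD('d))) \<partial>count_space UNIV) \<le> L"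
    using lattice_sum_decay[where 'd='d] by blast
  let ?w = "\<lambda>x::real^'d. 1 / (1 + norm x) ^ ?p"
  let ?v = "\<lambda>x::real^'d. 1 / (1 + norm x) ^ (2 * CARD('d))"
  define I where "I = (\<integral>\<^sup>+ x. ennreal (?v x) \<partial>(lborel :: (real^'d) measure))"
  have I: "I < \<infinity>" unfolding I_def
    using integrable_decay[where 'd='d] by (subst (asm) integrable_iff_bounded) simp
  have w2: "?w x ^ 2 = 1 / (1 + norm x) ^ (2 * ?p)" for x by (simp add: power_divide mult.commute flip: power_mult)
  have wv: "?w x ^ 2 * wt \<bar>s\<bar> x \<le> ?v x" for x
  proof -
    have p: "0 < (1 + norm x) ^ (2 * ?n)" by (intro zero_less_power add_pos_nonneg) auto
    have "?w x ^ 2 * wt \<bar>s\<bar> x \<le> 1 / (1 + norm x) ^ (2 * ?p) * (1 + norm x) ^ (2 * ?n)"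
      unfolding w2 using wt_le_power[of "\<bar>s\<bar>" x] by (intro mult_left_mono) auto
    also have "\<dots> = ?v x" using p by (simp add: distrib_left power_add)
    finally show ?thesis .
  qed
  have wv': "?w x ^ 2 \<le> ?v x" for x
    unfolding w2 by (intro divide_left_mono power_increasing mult_pos_pos zero_less_power add_pos_nonneg) auto
  have gen: "ennreal x ^ 2 * ennreal w \<le> ennreal c * (ennreal a * ennreal v)"
    if "0 \<le> c" "0 \<le> a" "0 \<le> x" "x\<^sup>2 * w \<le> c * (a * v)" for c a v x w
    using that by (simp add: ennreal_power ennreal_mult'[symmetric] ennreal_leI)
  define K where "K = ennreal (D^2) * I * ennreal (2 powr \<bar>s\<bar>)"
  have point: "ennreal ((cmod (?g \<xi>))\<^sup>2 * wt s \<xi>) \<le> K * (\<integral>\<^sup>+ \<eta>. ennreal ((cmod (?g \<eta>))\<^sup>2 * wt s \<eta>) * ennreal (?v (\<eta> - \<xi>)) \<partial>lborel)"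
    if \<xi>: "?g \<xi> = (LINT \<eta>|lborel. ?g \<eta> * ?T (\<eta> - \<xi>))" for \<xi>
  proof -
    have "ennreal (cmod (?g \<xi>)) \<le> (\<integral>\<^sup>+ \<eta>. ennreal (cmod (?g \<eta> * ?T (\<eta> - \<xi>))) \<partial>lborel)"
    proof (cases "integrable lborel (\<lambda>\<eta>. ?g \<eta> * ?T (\<eta> - \<xi>))")
      case True
      then show ?thesis by (subst \<xi>) (rule integral_norm_bound_ennreal)
    next
      case False
      then have "?g \<xi> = 0" by (subst \<xi>) (rule not_integrable_integral_eq)
      then show ?thesis by simp
    qed
    also have "\<dots> \<le> (\<integral>\<^sup>+ \<eta>. ennreal D * (ennreal (cmod (?g \<eta>) * ?w (\<eta> - \<xi>)) * ennreal (?w (\<eta> - \<xi>))) \<partial>lborel)"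
    proof (intro nn_integral_mono)
      fix \<eta>
      have "cmod (?g \<eta> * ?T (\<eta> - \<xi>)) \<le> cmod (?g \<eta>) * (D * (?w (\<eta> - \<xi>) ^ 2))"
        unfolding norm_mult w2 using D(2)[of "\<eta> - \<xi>"] by (intro mult_left_mono) auto
      also have "\<dots> = D * ((cmod (?g \<eta>) * ?w (\<eta> - \<xi>)) * ?w (\<eta> - \<xi>))" by (simp add: power2_eq_square mult_ac)
      finally show "ennreal (cmod (?g \<eta> * ?T (\<eta> - \<xi>))) \<le> ennreal D * (ennreal (cmod (?g \<eta>) * ?w (\<eta> - \<xi>)) * ennreal (?w (\<eta> - \<xi>)))"
        using D(1) by (simp add: ennreal_mult[symmetric] ennreal_leI)
    qed
    also have "\<dots> = ennreal D * (\<integral>\<^sup>+ \<eta>. ennreal (cmod (?g \<eta>) * ?w (\<eta> - \<xi>)) * ennreal (?w (\<eta> - \<xi>)) \<partial>lborel)"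
      by (rule nn_integral_cmult) measurable
    finally have "ennreal (cmod (?g \<xi>)) ^ 2 \<le> (ennreal D * (\<integral>\<^sup>+ \<eta>. ennreal (cmod (?g \<eta>) * ?w (\<eta> - \<xi>)) * ennreal (?w (\<eta> - \<xi>)) \<partial>lborel)) ^ 2"
      by (intro power_mono) auto
    also have "\<dots> = ennreal (D^2) * (\<integral>\<^sup>+ \<eta>. ennreal (cmod (?g \<eta>) * ?w (\<eta> - \<xi>)) * ennreal (?w (\<eta> - \<xi>)) \<partial>lborel) ^ 2"
      using D(1) by (simp add: power_mult_distrib ennreal_power)
    also have "\<dots> \<le> ennreal (D^2) * ((\<integral>\<^sup>+ \<eta>. ennreal (cmod (?g \<eta>) * ?w (\<eta> - \<xi>)) ^ 2 \<partial>lborel) * (\<integral>\<^sup>+ \<eta>. ennreal (?w (\<eta> - \<xi>)) ^ 2 \<partial>lborel))"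
      by (intro mult_left_mono Cauchy_Schwarz_nn_integral) auto
    also have "(\<integral>\<^sup>+ \<eta>. ennreal (?w (\<eta> - \<xi>)) ^ 2 \<partial>lborel) \<le> I"
    proof -
      have "(\<integral>\<^sup>+ \<eta>. ennreal (?w (\<eta> - \<xi>)) ^ 2 \<partial>lborel) \<le> (\<integral>\<^sup>+ \<eta>. ennreal (?v (- \<xi> + \<eta>)) \<partial>lborel)"
        using wv' by (intro nn_integral_mono) (simp add: ennreal_power ennreal_leI)
      also have "\<dots> = I" unfolding I_def by (rule nn_integral_translate) measurable
      finally show ?thesis .
    qed
    finally have 1: "ennreal ((cmod (?g \<xi>))\<^sup>2) \<le> ennreal (D^2) * ((\<integral>\<^sup>+ \<eta>. ennreal (cmod (?g \<eta>) * ?w (\<eta> - \<xi>)) ^ 2 \<partial>lborel) * I)"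
      by (simp add: ennreal_power mult_left_mono)
    have "ennreal ((cmod (?g \<xi>))\<^sup>2 * wt s \<xi>) = ennreal ((cmod (?g \<xi>))\<^sup>2) * ennreal (wt s \<xi>)"
      by (simp add: ennreal_mult)
    also have "\<dots> \<le> ennreal (D^2) * ((\<integral>\<^sup>+ \<eta>. ennreal (cmod (?g \<eta>) * ?w (\<eta> - \<xi>)) ^ 2 \<partial>lborel) * I) * ennreal (wt s \<xi>)"
      by (rule mult_right_mono[OF 1]) simp
    also have "\<dots> = ennreal (D^2) * I * (\<integral>\<^sup>+ \<eta>. ennreal (cmod (?g \<eta>) * ?w (\<eta> - \<xi>)) ^ 2 * ennreal (wt s \<xi>) \<partial>lborel)"
      by (subst nn_integral_multc) (auto simp: mult_ac)
    also have "\<dots> \<le> ennreal (D^2) * I * (\<integral>\<^sup>+ \<eta>. ennreal (2 powr \<bar>s\<bar>) * (ennreal ((cmod (?g \<eta>))\<^sup>2 * wt s \<eta>) * ennreal (?v (\<eta> - \<xi>))) \<partial>lborel)"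
    proof (intro mult_left_mono nn_integral_mono)
      fix \<eta>
      have "(cmod (?g \<eta>) * ?w (\<eta> - \<xi>)) ^ 2 * wt s \<xi> \<le> (cmod (?g \<eta>) * ?w (\<eta> - \<xi>)) ^ 2 * (2 powr \<bar>s\<bar> * (wt s \<eta> * wt \<bar>s\<bar> (\<eta> - \<xi>)))"
        by (intro mult_left_mono wt_Peetre) auto
      also have "\<dots> = (2 powr \<bar>s\<bar> * ((cmod (?g \<eta>))\<^sup>2 * wt s \<eta>)) * (?w (\<eta> - \<xi>) ^ 2 * wt \<bar>s\<bar> (\<eta> - \<xi>))"
        by (simp add: power_mult_distrib power_divide mult_ac)
      also have "\<dots> \<le> (2 powr \<bar>s\<bar> * ((cmod (?g \<eta>))\<^sup>2 * wt s \<eta>)) * ?v (\<eta> - \<xi>)"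
        by (intro mult_left_mono wv) auto
      finally have "(cmod (?g \<eta>) * ?w (\<eta> - \<xi>)) ^ 2 * wt s \<xi> \<le> 2 powr \<bar>s\<bar> * (((cmod (?g \<eta>))\<^sup>2 * wt s \<eta>) * ?v (\<eta> - \<xi>))" by simp
      then show "ennreal (cmod (?g \<eta>) * ?w (\<eta> - \<xi>)) ^ 2 * ennreal (wt s \<xi>) \<le> ennreal (2 powr \<bar>s\<bar>) * (ennreal ((cmod (?g \<eta>))\<^sup>2 * wt s \<eta>) * ennreal (?v (\<eta> - \<xi>)))"
        by (intro gen) auto
    qed simp
    also have "\<dots> = K * (\<integral>\<^sup>+ \<eta>. ennreal ((cmod (?g \<eta>))\<^sup>2 * wt s \<eta>) * ennreal (?v (\<eta> - \<xi>)) \<partial>lborel)"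
      unfolding K_def by (subst nn_integral_cmult) (auto simp: mult_ac)
    finally show ?thesis .
  qed
  have "AE \<xi> in lborel. bracket s ?g \<xi> \<le> K * (L * Wn s ?g)"
    using AE_translates[OF conv]
  proof eventually_elim
    case (elim \<xi>)
    have "bracket s ?g \<xi> \<le> (\<integral>\<^sup>+ k. K * (\<integral>\<^sup>+ \<eta>. ennreal ((cmod (?g \<eta>))\<^sup>2 * wt s \<eta>) * ennreal (?v (\<eta> - (\<xi> + rvec k))) \<partial>lborel) \<partial>count_space UNIV)"
      unfolding bracket_def by (intro nn_integral_mono point) (use elim in auto)
    also have "\<dots> = K * (\<integral>\<^sup>+ k. (\<integral>\<^sup>+ \<eta>. ennreal ((cmod (?g \<eta>))\<^sup>2 * wt s \<eta>) * ennreal (?v (\<eta> - (\<xi> + rvec k))) \<partial>lborel) \<partial>count_space UNIV)"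
      by (rule nn_integral_cmult) simp
    also have "\<dots> = K * (\<integral>\<^sup>+ \<eta>. (\<integral>\<^sup>+ k. ennreal ((cmod (?g \<eta>))\<^sup>2 * wt s \<eta>) * ennreal (?v (\<eta> - (\<xi> + rvec k))) \<partial>count_space UNIV) \<partial>lborel)"
      by (subst nn_integral_count_space_nn_integral) auto
    also have "\<dots> = K * (\<integral>\<^sup>+ \<eta>. ennreal ((cmod (?g \<eta>))\<^sup>2 * wt s \<eta>) * (\<integral>\<^sup>+ k. ennreal (?v ((\<eta> - \<xi>) - rvec k)) \<partial>count_space UNIV) \<partial>lborel)"
      by (subst nn_integral_cmult) (auto simp: diff_diff_eq)
    also have "\<dots> \<le> K * (\<integral>\<^sup>+ \<eta>. ennreal ((cmod (?g \<eta>))\<^sup>2 * wt s \<eta>) * L \<partial>lborel)"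
      by (intro mult_left_mono nn_integral_mono L) auto
    also have "\<dots> = K * (L * Wn s ?g)"
      unfolding Wn_def by (subst nn_integral_multc) (auto simp: mult_ac)
    finally show ?case .
  qed
  moreover have "K * (L * Wn s ?g) < \<infinity>"
    using L I g by (auto simp: K_def wL2_def ennreal_mult_less_top)
  then obtain C where "K * (L * Wn s ?g) = ennreal C" "C \<ge> 0" by (metis ennreal_cases infinity_ennreal_def less_irrefl)
  ultimately have "AE \<xi> in lborel. bracket s ?g \<xi> \<le> ennreal C" by simp
  then have "AE \<xi> in lborel. bracket s ?g \<xi> \<le> ennreal (C + 1)"
    by eventually_elim (use \<open>C \<ge> 0\<close> in \<open>auto elim!: order.trans intro!: ennreal_leI\<close>)
  then show ?thesis using that[of "C + 1"] \<open>C \<ge> 0\<close> by simp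
qed

subsection \<open>Fourier series on the torus\<close>

definition tor :: "(real^'d) measure" where
  "tor = density lborel (indicator torus)"

lemma sets_tor [simp, measurable_cong]: "sets tor = sets borel" and space_tor [simp]: "space tor = UNIV"
  by (simp_all add: tor_def)

lemma nn_integral_tor:
  assumes [measurable]: "f \<in> borel_measurable borel"
  shows "(\<integral>\<^sup>+ x. f x \<partial>tor) = (\<integral>\<^sup>+ x\<in>torus. f x \<partial>lborel)"
  unfolding tor_def by (subst nn_integral_density) (auto simp: mult.commute)

lemma emeasure_tor_UNIV [simp]: "emeasure tor UNIV = 1"
  unfolding tor_def by (simp add: emeasure_density emeasure_torus)

interpretation tor: prob_space tor
  by standard simp

lemma AE_tor_torus: "AE x in tor. x \<in> torus"
  unfolding tor_def by (subst AE_density) (auto simp: indicator_def split: if_splits)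

lemma AE_tor: "AE x in lborel. P x \<Longrightarrow> AE x in tor. P x"
  unfolding tor_def by (subst AE_density) auto

lemma integral_tor:
  fixes f :: "real^'d \<Rightarrow> complex"
  assumes [measurable]: "f \<in> borel_measurable borel"
  shows "(LINT x|tor. f x) = (LINT x|lborel. indicator torus x *\<^sub>R f x)"
proof -
  have "(indicator torus :: real^'d \<Rightarrow> ennreal) = (\<lambda>x. ennreal (indicator torus x))" by (auto simp: indicator_def)
  then show ?thesis unfolding tor_def by (simp add: integral_density)
qed

lemma lborel_eq_tiling:
  "(lborel :: (real^'d) measure) = distr (count_space UNIV \<Otimes>\<^sub>M tor) borel (\<lambda>(k, t). t + rvec k)"
proof (rule measure_eqI)
  interpret C: sigma_finite_measure "count_space UNIV :: (int^'d) measure"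
    by (rule sigma_finite_measure_count_space)
  interpret P: pair_sigma_finite "count_space UNIV :: (int^'d) measure" "tor :: (real^'d) measure" ..
  have [measurable]: "(\<lambda>(k, t). t + rvec k) \<in> borel_measurable (count_space (UNIV :: (int^'d) set) \<Otimes>\<^sub>M tor)"
    by (rule measurable_pair_measure_countable1) auto
  show "emeasure lborel A = emeasure (distr (count_space UNIV \<Otimes>\<^sub>M tor) borel (\<lambda>(k, t). t + rvec k)) A"
    if "A \<in> sets lborel" for A :: "(real^'d) set"
  proof -
    have [measurable]: "A \<in> sets borel" using that by simp
    have "emeasure lborel A = (\<integral>\<^sup>+ x. indicator A x \<partial>lborel)" by simp
    also have "\<dots> = (\<integral>\<^sup>+ k. (\<integral>\<^sup>+ t. indicator A (t + rvec k) \<partial>tor) \<partial>count_space UNIV)"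
      by (subst nn_integral_tiling) (auto simp: nn_integral_tor)
    also have "\<dots> = (\<integral>\<^sup>+ z. indicator A (case z of (k, t) \<Rightarrow> t + rvec k) \<partial>(count_space UNIV \<Otimes>\<^sub>M tor))"
      by (subst tor.nn_integral_fst[symmetric]) auto
    also have "\<dots> = (\<integral>\<^sup>+ x. indicator A x \<partial>distr (count_space UNIV \<Otimes>\<^sub>M tor) borel (\<lambda>(k, t). t + rvec k))"
      by (subst nn_integral_distr) auto
    finally show ?thesis by simp
  qed
qed simp

lemma nn_integral_tiling_tor:
  fixes f :: "real^'d \<Rightarrow> ennreal"
  assumes [measurable]: "f \<in> borel_measurable borel"
  shows "(\<integral>\<^sup>+ x. f x \<partial>lborel) = (\<integral>\<^sup>+ t. (\<integral>\<^sup>+ k. f (t + rvec k) \<partial>count_space UNIV) \<partial>tor)"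
  by (subst nn_integral_tiling) (auto simp: nn_integral_tor nn_integral_count_space_nn_integral)

lemma
  fixes f :: "real^'d \<Rightarrow> complex"
  assumes f: "integrable lborel f"
  shows integral_tiling: "(LINT x|lborel. f x) = (LINT t|tor. (LINT k|count_space UNIV. f (t + rvec k)))"
    and AE_integrable_tiling: "AE t in tor. integrable (count_space UNIV) (\<lambda>k. f (t + rvec k))"
proof -
  interpret C: sigma_finite_measure "count_space UNIV :: (int^'d) measure"
    by (rule sigma_finite_measure_count_space)
  interpret P: pair_sigma_finite "count_space UNIV :: (int^'d) measure" "tor :: (real^'d) measure" ..
  have [measurable]: "f \<in> borel_measurable borel" using f by auto
  have [measurable]: "(\<lambda>(k, t). t + rvec k) \<in> borel_measurable (count_space (UNIV :: (int^'d) set) \<Otimes>\<^sub>M tor)"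
    by (rule measurable_pair_measure_countable1) auto
  have e: "(\<lambda>z. f (case z of (k, t) \<Rightarrow> t + rvec k)) = case_prod (\<lambda>k t. f (t + rvec k))" by auto
  have i: "integrable (count_space UNIV \<Otimes>\<^sub>M tor) (case_prod (\<lambda>k t. f (t + rvec k)))"
    using f by (subst (asm) lborel_eq_tiling) (auto simp: integrable_distr_eq e)
  show "AE t in tor. integrable (count_space UNIV) (\<lambda>k. f (t + rvec k))" by (rule P.AE_integrable_snd[OF i])
  have "(LINT x|lborel. f x) = integral\<^sup>L (count_space UNIV \<Otimes>\<^sub>M tor) (case_prod (\<lambda>k t. f (t + rvec k)))"
    by (subst lborel_eq_tiling) (auto simp: integral_distr e)
  also have "\<dots> = (LINT t|tor. (LINT k|count_space UNIV. f (t + rvec k)))"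
    by (rule P.integral_snd[OF i, symmetric])
  finally show "(LINT x|lborel. f x) = (LINT t|tor. (LINT k|count_space UNIV. f (t + rvec k)))" .
qed

inductive trig :: "(real^'d \<Rightarrow> complex) \<Rightarrow> bool" where
  char: "trig (\<lambda>\<eta>. c * ee (rvec k \<bullet> \<eta>))"
| add: "trig p \<Longrightarrow> trig q \<Longrightarrow> trig (\<lambda>\<eta>. p \<eta> + q \<eta>)"

lemma trig_mult: "trig p \<Longrightarrow> trig q \<Longrightarrow> trig (\<lambda>\<eta>. p \<eta> * q \<eta>)"
proof (induction p arbitrary: q rule: trig.induct)
  case (char c k)
  from char.prems show ?case
  proof (induction q rule: trig.induct)
    case (char c' k')
    have "(\<lambda>\<eta>. c * ee (rvec k \<bullet> \<eta>) * (c' * ee (rvec k' \<bullet> \<eta>))) = (\<lambda>\<eta>. (c * c') * ee (rvec (k + k') \<bullet> \<eta>))"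
      by (simp add: rvec_add inner_add_left ee_add mult_ac)
    then show ?case using trig.char by simp
  next
    case (add p q)
    then show ?case by (simp add: distrib_left trig.add)
  qed
next
  case (add p1 p2)
  then show ?case by (simp add: distrib_right trig.add)
qed

lemma trig_const: "trig (\<lambda>\<eta>. c)" using trig.char[of c 0] by simp

lemma trig_sum: "(\<And>i. i \<in> A \<Longrightarrow> trig (f i)) \<Longrightarrow> trig (\<lambda>\<eta>. \<Sum>i\<in>A. f i \<eta>)"
  by (induction A rule: infinite_finite_induct) (auto simp: trig_const trig.add)

lemma trig_continuous: "trig p \<Longrightarrow> continuous_on UNIV p"
  by (induction rule: trig.induct) (auto intro!: continuous_intros)

lemma trig_borel: "trig p \<Longrightarrow> p \<in> borel_measurable borel"
  by (intro borel_measurable_continuous_onI trig_continuous)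

lemma trig_bounded: "trig p \<Longrightarrow> \<exists>B. \<forall>\<eta>. cmod (p \<eta>) \<le> B"
proof (induction rule: trig.induct)
  case (char c k)
  then show ?case by (intro exI[of _ "cmod c"]) (simp add: norm_mult)
next
  case (add p q)
  then show ?case by (meson norm_triangle_le add_mono)
qed

lemma trig_finite_sum:
  assumes "trig p"
  shows "\<exists>F a. finite F \<and> (\<forall>F'. finite F' \<longrightarrow> F \<subseteq> F' \<longrightarrow> p = (\<lambda>\<eta>. \<Sum>k\<in>F'. a k * ee (rvec k \<bullet> \<eta>)))"
  using assms
proof (induction rule: trig.induct)
  case (char c k)
  have "(\<Sum>l\<in>F'. (if l = k then c else 0) * ee (rvec l \<bullet> \<eta>)) = c * ee (rvec k \<bullet> \<eta>)" if "finite F'" "{k} \<subseteq> F'" for F' \<eta>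
    using that by (simp add: if_distrib[of "\<lambda>x. x * _"] cong: if_cong)
  then show ?case by (intro exI[of _ "{k}"] exI[of _ "\<lambda>l. if l = k then c else 0"]) auto
next
  case (add p q)
  then obtain F a G b where F: "finite F" "\<And>F'. finite F' \<Longrightarrow> F \<subseteq> F' \<Longrightarrow> p = (\<lambda>\<eta>. \<Sum>k\<in>F'. a k * ee (rvec k \<bullet> \<eta>))"
    and G: "finite G" "\<And>F'. finite F' \<Longrightarrow> G \<subseteq> F' \<Longrightarrow> q = (\<lambda>\<eta>. \<Sum>k\<in>F'. b k * ee (rvec k \<bullet> \<eta>))" by blast
  have "(\<lambda>\<eta>. p \<eta> + q \<eta>) = (\<lambda>\<eta>. \<Sum>k\<in>F'. (a k + b k) * ee (rvec k \<bullet> \<eta>))" if "finite F'" "F \<union> G \<subseteq> F'" for F'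
    using F(2)[OF that(1)] G(2)[OF that(1)] that(2) by (simp add: distrib_right sum.distrib)
  then show ?case using F(1) G(1) by (intro exI[of _ "F \<union> G"] exI[of _ "\<lambda>k. a k + b k"]) auto
qed

lemma integral_ee_interval: "(LINT t|lborel. indicator {- 1/2..1/2} t *\<^sub>R ee (of_int n * t)) = (if n = 0 then 1 else 0)"
proof (cases "n = 0")
  case False
  let ?c = "2 * pi * \<i> * of_int n :: complex"
  have c: "?c \<noteq> 0" using False by simp
  have "(LINT t|lborel. indicator {- 1/2..1/2} t *\<^sub>R ee (of_int n * t)) = ee (of_int n * (1/2)) / ?c - ee (of_int n * (- 1/2)) / ?c"
  proof (rule integral_FTC_Icc)
    fix t :: real
    have "((\<lambda>t. exp (?c * of_real t)) has_vector_derivative ?c * exp (?c * of_real t)) (at t within {- 1/2..1/2})"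
      by (rule has_vector_derivative_real_field) (auto intro!: derivative_eq_intros)
    then have "((\<lambda>t. exp (?c * of_real t) / ?c) has_vector_derivative (?c * exp (?c * of_real t)) / ?c) (at t within {- 1/2..1/2})"
      by (rule has_vector_derivative_divide)
    then show "((\<lambda>t. ee (of_int n * t) / ?c) has_vector_derivative ee (of_int n * t)) (at t within {- 1/2..1/2})"
      using c by (simp add: ee_def mult_ac)
  qed (auto intro!: continuous_intros)
  also have "\<dots> = 0"
  proof -
    have a: "of_int n * (- 1/2) + of_int n = of_int n * (1/2 :: real)" by simp
    have "ee (of_int n * (1/2)) = ee (of_int n * (- 1/2))"
      using ee_add[of "of_int n * (- 1/2)" "of_int n"] unfolding a ee_int mult_1_right .
    then show ?thesis by simp
  qed
  finally show ?thesis using False by simp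
qed simp

lemma orthonormal_tor: "(LINT \<eta>|tor. ee (rvec k \<bullet> \<eta>)) = (if k = 0 then 1 else 0)"
proof -
  let ?f = "\<lambda>i t. indicator {- 1/2..1/2} t *\<^sub>R ee (of_int (k $ i) * t)"
  have e: "ee (rvec k \<bullet> \<eta>) = (\<Prod>i\<in>UNIV. ee (of_int (k $ i) * \<eta> $ i))" for \<eta>
  proof -
    have "ee (\<Sum>i\<in>A. a i) = (\<Prod>i\<in>A. ee (a i))" if "finite A" for a and A :: "'a set"
      using that by (induction A rule: finite_induct) (auto simp: ee_add)
    then show ?thesis by (simp add: inner_vec_def rvec_def)
  qed
  have int: "integrable lborel (?f i)" for i
    by (rule borel_integrable_compact) (auto intro!: continuous_intros)
  have ae: "AE \<eta> :: real^'a in lborel. \<eta> $ i \<noteq> 1/2" for i :: 'a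
  proof -
    have "negligible {\<eta> :: real^'a. \<eta> $ i = 1/2}"
      using negligible_standard_hyperplane[of "axis i 1 :: real^'a" "1/2"] by (simp add: inner_axis Basis_vec_eq_range)
    then have "AE \<eta> in lebesgue. \<eta> \<notin> {\<eta> :: real^'a. \<eta> $ i = 1/2}"
      using negligible_iff_null_sets AE_not_in by blast
    then show ?thesis by (simp add: AE_completion_iff)
  qed
  have "(LINT \<eta>|tor. ee (rvec k \<bullet> \<eta>)) = (LINT \<eta>|lborel. indicator torus \<eta> *\<^sub>R ee (rvec k \<bullet> \<eta>))"
    by (rule integral_tor) measurable
  also have "\<dots> = (LINT \<eta>|lborel. (\<Prod>i\<in>UNIV. ?f i (\<eta> $ i)))"
  proof (rule integral_cong_AE)
    have "AE \<eta> :: real^'a in lborel. \<forall>i\<in>UNIV. \<eta> $ i \<noteq> 1/2" using ae by (intro AE_finite_allI) auto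
    then show "AE \<eta> in lborel. indicator torus \<eta> *\<^sub>R ee (rvec k \<bullet> \<eta>) = (\<Prod>i\<in>UNIV. ?f i (\<eta> $ i))"
    proof eventually_elim
      case (elim \<eta>)
      show ?case
      proof (cases "\<eta> \<in> torus")
        case True
        then show ?thesis by (simp add: e torus_def less_imp_le)
      next
        case False
        then obtain i where "\<not> (- 1/2 \<le> \<eta> $ i \<and> \<eta> $ i < 1/2)" unfolding torus_def by blast
        then have "\<not> (- 1/2 \<le> \<eta> $ i \<and> \<eta> $ i \<le> 1/2)" using elim by (metis UNIV_I order.not_eq_order_implies_strict)
        then have "?f i (\<eta> $ i) = 0" by auto
        then show ?thesis using False by (metis (no_types, lifting) UNIV_I finite indicator_simps(2) prod_zero scaleR_zero_left)
      qed
    qed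
  qed measurable
  also have "\<dots> = (\<Prod>i\<in>UNIV. (LINT t|lborel. ?f i t))" by (rule integral_lborel_prod[OF int])
  also have "\<dots> = (if k = 0 then 1 else 0)"
    unfolding integral_ee_interval by (auto simp: vec_eq_iff prod_zero_iff)
  finally show ?thesis .
qed

definition tn :: "(real^'d \<Rightarrow> complex) \<Rightarrow> ennreal" where
  "tn f = (\<integral>\<^sup>+ \<eta>. ennreal ((cmod (f \<eta>))\<^sup>2) \<partial>tor)"

lemma cmod_add_square: "(cmod (a + b))\<^sup>2 \<le> 2 * (cmod a)\<^sup>2 + 2 * (cmod b)\<^sup>2"
proof -
  have "(cmod (a + b))\<^sup>2 \<le> (cmod a + cmod b)\<^sup>2" by (intro power_mono norm_triangle_ineq) auto
  also have "\<dots> \<le> 2 * (cmod a)\<^sup>2 + 2 * (cmod b)\<^sup>2"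
    using sum_squares_bound[of "cmod a" "cmod b"] by (simp add: power2_sum)
  finally show ?thesis .
qed

lemma tn_add:
  assumes [measurable]: "f \<in> borel_measurable borel" "g \<in> borel_measurable borel"
  shows "tn (\<lambda>\<eta>. f \<eta> + g \<eta>) \<le> 2 * tn f + 2 * tn g"
proof -
  have "tn (\<lambda>\<eta>. f \<eta> + g \<eta>) \<le> (\<integral>\<^sup>+ \<eta>. 2 * ennreal ((cmod (f \<eta>))\<^sup>2) + 2 * ennreal ((cmod (g \<eta>))\<^sup>2) \<partial>tor)"
    unfolding tn_def
  proof (intro nn_integral_mono)
    fix \<eta>
    have "ennreal ((cmod (f \<eta> + g \<eta>))\<^sup>2) \<le> ennreal (2 * (cmod (f \<eta>))\<^sup>2 + 2 * (cmod (g \<eta>))\<^sup>2)"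
      by (intro ennreal_leI cmod_add_square)
    then show "ennreal ((cmod (f \<eta> + g \<eta>))\<^sup>2) \<le> 2 * ennreal ((cmod (f \<eta>))\<^sup>2) + 2 * ennreal ((cmod (g \<eta>))\<^sup>2)"
      by (simp add: ennreal_plus ennreal_mult')
  qed
  also have "\<dots> = 2 * tn f + 2 * tn g"
    unfolding tn_def by (simp add: nn_integral_add nn_integral_cmult)
  finally show ?thesis .
qed

text \<open>That all of \<open>L\<^sup>2\<close> is reached: Stone-Weierstrass on the image of the torus in \<open>\<complex>\<^sup>d\<close> gives the
  continuous functions there, a Dynkin class argument the indicators, and dominated limits the rest.\<close>

definition apx :: "(real^'d \<Rightarrow> complex) \<Rightarrow> bool" where
  "apx f \<longleftrightarrow> f \<in> borel_measurable borel \<and> (\<forall>e>0. \<exists>p. trig p \<and> tn (\<lambda>\<eta>. f \<eta> - p \<eta>) \<le> ennreal e)"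

lemma apx_borel: "apx f \<Longrightarrow> f \<in> borel_measurable borel" by (simp add: apx_def)

lemma ennreal_four_quarters: "e > 0 \<Longrightarrow> 2 * ennreal (e / 4) + 2 * ennreal (e / 4) = ennreal e"
  using ennreal_mult'[of 2 "e / 4"] ennreal_plus[of "e / 2" "e / 2"] by simp

lemma apx_limit:
  assumes [measurable]: "f \<in> borel_measurable borel"
    and lim: "\<And>e. e > 0 \<Longrightarrow> \<exists>h. apx h \<and> tn (\<lambda>\<eta>. f \<eta> - h \<eta>) \<le> ennreal e"
  shows "apx f"
  unfolding apx_def
proof (intro conjI allI impI assms)
  fix e :: real assume e: "e > 0"
  obtain h where h: "apx h" "tn (\<lambda>\<eta>. f \<eta> - h \<eta>) \<le> ennreal (e / 4)" using lim[of "e/4"] e by auto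
  obtain p where p: "trig p" "tn (\<lambda>\<eta>. h \<eta> - p \<eta>) \<le> ennreal (e / 4)" using h(1) e unfolding apx_def by (metis divide_pos_pos zero_less_numeral)
  have [measurable]: "h \<in> borel_measurable borel" "p \<in> borel_measurable borel" using h p by (auto intro: apx_borel trig_borel)
  have "tn (\<lambda>\<eta>. f \<eta> - p \<eta>) = tn (\<lambda>\<eta>. (f \<eta> - h \<eta>) + (h \<eta> - p \<eta>))" by simp
  also have "\<dots> \<le> 2 * tn (\<lambda>\<eta>. f \<eta> - h \<eta>) + 2 * tn (\<lambda>\<eta>. h \<eta> - p \<eta>)" by (rule tn_add) measurable
  also have "\<dots> \<le> 2 * ennreal (e / 4) + 2 * ennreal (e / 4)" by (intro add_mono mult_left_mono h p) auto
  also have "\<dots> = ennreal e" using e by (rule ennreal_four_quarters)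
  finally show "\<exists>p. trig p \<and> tn (\<lambda>\<eta>. f \<eta> - p \<eta>) \<le> ennreal e" using p by auto
qed

lemma apx_trig: "trig p \<Longrightarrow> apx p"
  unfolding apx_def by (auto simp: trig_borel tn_def intro!: exI[of _ p])

lemma apx_add:
  assumes "apx f" "apx g" shows "apx (\<lambda>\<eta>. f \<eta> + g \<eta>)"
  unfolding apx_def
proof (intro conjI allI impI)
  have [measurable]: "f \<in> borel_measurable borel" "g \<in> borel_measurable borel" using assms by (auto intro: apx_borel)
  show "(\<lambda>\<eta>. f \<eta> + g \<eta>) \<in> borel_measurable borel" by measurable
  fix e :: real assume e: "e > 0"
  then have "e / 4 > 0" by simp
  obtain p where p: "trig p" "tn (\<lambda>\<eta>. f \<eta> - p \<eta>) \<le> ennreal (e / 4)" using assms(1) \<open>e / 4 > 0\<close> unfolding apx_def by blast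
  obtain q where q: "trig q" "tn (\<lambda>\<eta>. g \<eta> - q \<eta>) \<le> ennreal (e / 4)" using assms(2) \<open>e / 4 > 0\<close> unfolding apx_def by blast
  have [measurable]: "p \<in> borel_measurable borel" "q \<in> borel_measurable borel" using p q by (auto intro: trig_borel)
  have "tn (\<lambda>\<eta>. (f \<eta> + g \<eta>) - (p \<eta> + q \<eta>)) = tn (\<lambda>\<eta>. (f \<eta> - p \<eta>) + (g \<eta> - q \<eta>))" by (simp add: algebra_simps)
  also have "\<dots> \<le> 2 * tn (\<lambda>\<eta>. f \<eta> - p \<eta>) + 2 * tn (\<lambda>\<eta>. g \<eta> - q \<eta>)" by (rule tn_add) measurable
  also have "\<dots> \<le> 2 * ennreal (e / 4) + 2 * ennreal (e / 4)" by (intro add_mono mult_left_mono p q) auto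
  also have "\<dots> = ennreal e" using e by (rule ennreal_four_quarters)
  finally show "\<exists>p. trig p \<and> tn (\<lambda>\<eta>. f \<eta> + g \<eta> - p \<eta>) \<le> ennreal e" using trig.add[OF p(1) q(1)] by auto
qed

lemma apx_cmult:
  assumes "apx f" shows "apx (\<lambda>\<eta>. c * f \<eta>)"
  unfolding apx_def
proof (intro conjI allI impI)
  have [measurable]: "f \<in> borel_measurable borel" using assms by (auto intro: apx_borel)
  show "(\<lambda>\<eta>. c * f \<eta>) \<in> borel_measurable borel" by measurable
  fix e :: real assume e: "e > 0"
  define r where "r = e / (1 + (cmod c)\<^sup>2)"
  have r: "r > 0" using e by (simp add: r_def add_pos_nonneg)
  obtain p where p: "trig p" "tn (\<lambda>\<eta>. f \<eta> - p \<eta>) \<le> ennreal r" using assms r unfolding apx_def by blast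
  have [measurable]: "p \<in> borel_measurable borel" using p by (auto intro: trig_borel)
  have "tn (\<lambda>\<eta>. c * f \<eta> - c * p \<eta>) = ennreal ((cmod c)\<^sup>2) * tn (\<lambda>\<eta>. f \<eta> - p \<eta>)"
    unfolding tn_def by (subst nn_integral_cmult[symmetric])
      (auto simp: ennreal_mult'[symmetric] norm_mult power_mult_distrib simp flip: right_diff_distrib)
  also have "\<dots> \<le> ennreal ((cmod c)\<^sup>2) * ennreal r" by (intro mult_left_mono p) auto
  also have "\<dots> \<le> ennreal e"
  proof -
    have "(cmod c)\<^sup>2 * r \<le> e" using e by (simp add: r_def pos_divide_le_eq add_pos_nonneg algebra_simps)
    then show ?thesis using r by (simp add: ennreal_mult'[symmetric] ennreal_leI)
  qed
  finally show "\<exists>p. trig p \<and> tn (\<lambda>\<eta>. c * f \<eta> - p \<eta>) \<le> ennreal e"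
    using trig_mult[OF trig_const p(1), of c] by auto
qed

lemma apx_sum: "(\<And>i. i \<in> A \<Longrightarrow> apx (f i)) \<Longrightarrow> apx (\<lambda>\<eta>. \<Sum>i\<in>A. f i \<eta>)"
  by (induction A rule: infinite_finite_induct) (auto simp: apx_trig trig_const apx_add)

lemma apx_dominated_limit:
  fixes w :: "real^'d \<Rightarrow> ennreal"
  assumes h: "\<And>n. apx (h n)" and [measurable]: "f \<in> borel_measurable borel" "w \<in> borel_measurable borel"
    and lim: "AE \<eta> in tor. (\<lambda>n. h n \<eta>) \<longlonglongrightarrow> f \<eta>"
    and bound: "\<And>n. AE \<eta> in tor. ennreal ((cmod (f \<eta> - h n \<eta>))\<^sup>2) \<le> w \<eta>" and w: "(\<integral>\<^sup>+ \<eta>. w \<eta> \<partial>tor) < \<infinity>"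
  shows "apx f"
proof (rule apx_limit)
  have [measurable]: "h n \<in> borel_measurable borel" for n using h by (rule apx_borel)
  fix e :: real assume e: "e > 0"
  have "(\<lambda>n. (\<integral>\<^sup>+ \<eta>. ennreal ((cmod (f \<eta> - h n \<eta>))\<^sup>2) \<partial>tor)) \<longlonglongrightarrow> (\<integral>\<^sup>+ \<eta>. 0 \<partial>(tor :: (real^'d) measure))"
  proof (rule nn_integral_dominated_convergence[OF _ _ _ bound w])
    show "AE \<eta> in tor. (\<lambda>n. ennreal ((cmod (f \<eta> - h n \<eta>))\<^sup>2)) \<longlonglongrightarrow> 0"
      using lim
    proof eventually_elim
      case (elim \<eta>)
      have "(\<lambda>n. ennreal ((cmod (f \<eta> - h n \<eta>))\<^sup>2)) \<longlonglongrightarrow> ennreal ((cmod (f \<eta> - f \<eta>))\<^sup>2)"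
        by (intro tendsto_intros elim)
      then show ?case by simp
    qed
  qed auto
  then have "(\<lambda>n. tn (\<lambda>\<eta>. f \<eta> - h n \<eta>)) \<longlonglongrightarrow> 0" by (simp add: tn_def)
  moreover have "0 < ennreal e" using e by simp
  ultimately have "\<forall>\<^sub>F n in sequentially. tn (\<lambda>\<eta>. f \<eta> - h n \<eta>) < ennreal e" by (rule order_tendstoD(2))
  then obtain n where "tn (\<lambda>\<eta>. f \<eta> - h n \<eta>) < ennreal e" by (meson eventually_happens sequentially_bot)
  then show "\<exists>h. apx h \<and> tn (\<lambda>\<eta>. f \<eta> - h \<eta>) \<le> ennreal e" using h by (auto intro: less_imp_le)
qed measurable

definition tormap :: "real^'d \<Rightarrow> complex^'d" where "tormap \<eta> = (\<chi> i. ee (\<eta> $ i))"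

lemma continuous_tormap: "continuous_on UNIV tormap"
  unfolding tormap_def by (intro continuous_intros)

lemma tormap_borel [measurable]: "tormap \<in> borel_measurable borel"
  by (intro borel_measurable_continuous_onI continuous_tormap)

lemma trig_ee_coord: "trig (\<lambda>\<eta>. ee (\<eta> $ i))" "trig (\<lambda>\<eta>. ee (- (\<eta> $ i)))"
proof -
  have r: "rvec (axis i 1) = axis i 1" by (simp add: rvec_def axis_def vec_eq_iff)
  show "trig (\<lambda>\<eta>. ee (\<eta> $ i))" using trig.char[of 1 "axis i 1"] by (simp add: r inner_axis')
  show "trig (\<lambda>\<eta>. ee (- (\<eta> $ i)))" using trig.char[of 1 "- axis i 1"] by (simp add: rvec_minus r inner_axis')
qed

lemma trig_polynomial:
  fixes g :: "complex^'d \<Rightarrow> real"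
  assumes "real_polynomial_function g"
  shows "trig (\<lambda>\<eta>. complex_of_real (g (tormap \<eta>)))"
  using assms
proof (induction g rule: real_polynomial_function.induct)
  case (linear f)
  interpret bounded_linear f by fact
  have fe: "f z = (\<Sum>b\<in>Basis. (z \<bullet> b) * f b)" for z
    by (subst (1) euclidean_representation[of z, symmetric]) (simp add: sum scaleR)
  have "trig (\<lambda>\<eta>. complex_of_real (tormap \<eta> \<bullet> b))" if "b \<in> Basis" for b :: "complex^'d"
  proof -
    from that obtain i c where b: "b = axis i c" by (auto simp: Basis_vec_def)
    have "tormap \<eta> \<bullet> b = ee (\<eta> $ i) \<bullet> c" for \<eta> by (simp add: b tormap_def inner_axis)
    moreover have "complex_of_real (z \<bullet> c) = (cnj c / 2) * z + (c / 2) * cnj z" for z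
      by (simp add: complex_eq_iff inner_complex_def field_simps)
    ultimately have eq: "(\<lambda>\<eta>. complex_of_real (tormap \<eta> \<bullet> b)) = (\<lambda>\<eta>. (cnj c / 2) * ee (\<eta> $ i) + (c / 2) * ee (- (\<eta> $ i)))"
      by (simp only: cnj_ee)
    show ?thesis unfolding eq
      by (rule trig.add[OF trig_mult[OF trig_const trig_ee_coord(1)] trig_mult[OF trig_const trig_ee_coord(2)]])
  qed
  then have "trig (\<lambda>\<eta>. \<Sum>b\<in>Basis. complex_of_real (f b) * complex_of_real (tormap \<eta> \<bullet> b))"
    by (intro trig_sum trig_mult[OF trig_const])
  moreover have "(\<lambda>\<eta>. complex_of_real (f (tormap \<eta>))) = (\<lambda>\<eta>. \<Sum>b\<in>Basis. complex_of_real (f b) * complex_of_real (tormap \<eta> \<bullet> b))"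
    by (subst fe) (simp add: mult.commute)
  ultimately show ?case by simp
qed (auto simp: trig_const trig.add trig_mult)

lemma apx_continuous_tormap:
  fixes f :: "complex^'d \<Rightarrow> real"
  assumes f: "continuous_on UNIV f"
  shows "apx (\<lambda>\<eta>. complex_of_real (f (tormap \<eta>)))"
  unfolding apx_def
proof (intro conjI allI impI)
  have [measurable]: "f \<in> borel_measurable borel" using f by (rule borel_measurable_continuous_onI)
  show "(\<lambda>\<eta>. complex_of_real (f (tormap \<eta>))) \<in> borel_measurable borel" by measurable
  let ?S = "{z :: complex^'d. \<forall>i. cmod (z $ i) = 1}"
  have "bounded ?S"
    unfolding bounded_iff
  proof (intro exI ballI)
    fix z assume "z \<in> ?S"
    then show "norm z \<le> real CARD('d)" unfolding norm_vec_def by (intro order.trans[OF L2_set_le_sum]) auto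
  qed
  moreover have "closed ?S" by (intro closed_Collect_all closed_Collect_eq continuous_intros)
  ultimately have S: "compact ?S" by (simp add: compact_eq_bounded_closed)
  fix e :: real assume e: "e > 0"
  obtain g where g: "real_polynomial_function g" "\<And>z. z \<in> ?S \<Longrightarrow> \<bar>f z - g z\<bar> < sqrt e"
    using Stone_Weierstrass_real_polynomial_function[OF S continuous_on_subset[OF f], of "sqrt e"] e by auto
  have "tn (\<lambda>\<eta>. complex_of_real (f (tormap \<eta>)) - complex_of_real (g (tormap \<eta>))) \<le> (\<integral>\<^sup>+ \<eta>. ennreal e \<partial>(tor :: (real^'d) measure))"
    unfolding tn_def
  proof (intro nn_integral_mono ennreal_leI)
    fix \<eta> :: "real^'d"
    have "tormap \<eta> \<in> ?S" by (simp add: tormap_def)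
    then have "\<bar>f (tormap \<eta>) - g (tormap \<eta>)\<bar>\<^sup>2 \<le> (sqrt e)\<^sup>2" using g(2) by (intro power_mono) (auto intro: less_imp_le)
    then show "(cmod (complex_of_real (f (tormap \<eta>)) - complex_of_real (g (tormap \<eta>))))\<^sup>2 \<le> e"
      using e by (simp flip: of_real_diff)
  qed
  also have "\<dots> = ennreal e" by simp
  finally show "\<exists>p. trig p \<and> tn (\<lambda>\<eta>. complex_of_real (f (tormap \<eta>)) - p \<eta>) \<le> ennreal e"
    using trig_polynomial[OF g(1)] by blast
qed

lemma apx_indicator_limit:
  fixes A :: "(real^'d) set"
  assumes "\<And>n. apx (h n)" "A \<in> sets borel" "\<And>\<eta>. (\<lambda>n. h n \<eta>) \<longlonglongrightarrow> indicator A \<eta>"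
    "\<And>n \<eta>. cmod (h n \<eta>) \<le> 1"
  shows "apx (indicator A :: real^'d \<Rightarrow> complex)"
proof (rule apx_dominated_limit[where h=h and w="\<lambda>_. ennreal 4"])
  have "cmod (indicator A \<eta> - h n \<eta>) \<le> 2" for n \<eta>
    using norm_triangle_ineq4[of "indicator A \<eta>" "h n \<eta>"] assms(4)[of n \<eta>] by (auto simp: indicator_def split: if_splits)
  then have "(cmod (indicator A \<eta> - h n \<eta>))\<^sup>2 \<le> 2\<^sup>2" for n \<eta> by (intro power_mono) auto
  then show "AE \<eta> in tor. ennreal ((cmod (indicator A \<eta> - h n \<eta>))\<^sup>2) \<le> ennreal 4" for n
    by (intro AE_I2 ennreal_leI) simp
qed (use assms in auto)

lemma apx_indicator_tormap:
  fixes A :: "(complex^'d) set"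
  assumes "A \<in> sets borel"
  shows "apx (indicator (tormap -` A) :: real^'d \<Rightarrow> complex)"
proof -
  have "Int_stable {S :: (complex^'d) set. open S}" by (auto simp: Int_stable_def)
  moreover have "{S :: (complex^'d) set. open S} \<subseteq> Pow UNIV" by auto
  ultimately show ?thesis using assms unfolding sets_borel
  proof (induction A rule: sigma_sets_induct_disjoint)
    case (basic A)
    then have A: "open A" by simp
    show ?case
    proof (cases "A = UNIV")
      case True
      then have "(indicator (tormap -` A) :: real^'d \<Rightarrow> complex) = (\<lambda>_. 1)" by auto
      then show ?thesis by (simp add: apx_trig trig_const)
    next
      case False
      define f where "f n z = min 1 (real n * infdist z (- A))" for n and z :: "complex^'d"
      show ?thesis
      proof (rule apx_indicator_limit[where h="\<lambda>n \<eta>. complex_of_real (f n (tormap \<eta>))"])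
        show "apx (\<lambda>\<eta>. complex_of_real (f n (tormap \<eta>)))" for n
          unfolding f_def[abs_def] by (intro apx_continuous_tormap continuous_intros)
        show "tormap -` A \<in> sets borel"
          using measurable_sets_borel[OF tormap_borel borel_open[OF A]] by simp
        show "cmod (complex_of_real (f n (tormap \<eta>))) \<le> 1" for n \<eta>
          by (simp add: f_def infdist_nonneg)
        fix \<eta> :: "real^'d"
        show "(\<lambda>n. complex_of_real (f n (tormap \<eta>))) \<longlonglongrightarrow> indicator (tormap -` A) \<eta>"
        proof (cases "tormap \<eta> \<in> A")
          case True
          have "infdist (tormap \<eta>) (- A) \<noteq> 0"
            using in_closed_iff_infdist_zero[of "- A" "tormap \<eta>"] A False True by auto
          then have i: "infdist (tormap \<eta>) (- A) > 0" using infdist_nonneg[of "tormap \<eta>" "- A"] by linarith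
          obtain N where N: "1 / infdist (tormap \<eta>) (- A) < real N" using reals_Archimedean2 by blast
          have "\<forall>\<^sub>F n in sequentially. complex_of_real (f n (tormap \<eta>)) = 1"
            using eventually_ge_at_top[of N]
          proof eventually_elim
            case (elim n)
            then have "1 / infdist (tormap \<eta>) (- A) < real n" using N by linarith
            then have "1 < real n * infdist (tormap \<eta>) (- A)" using i by (simp add: pos_divide_less_eq)
            then show ?case by (simp add: f_def)
          qed
          then show ?thesis using True by (simp add: tendsto_eventually)
        next
          case False
          then show ?thesis by (simp add: f_def)
        qed
      qed
    qed
  next
    case empty
    then show ?case by (simp add: indicator_def[abs_def] apx_trig trig_const)
  next
    case (compl A)
    have "(indicator (tormap -` (UNIV - A)) :: real^'d \<Rightarrow> complex) = (\<lambda>\<eta>. 1 + (-1) * indicator (tormap -` A) \<eta>)"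
      by (auto simp: indicator_def)
    then show ?case using apx_add[OF apx_trig[OF trig_const[of 1]] apx_cmult[OF compl(2), of "-1"]] by simp
  next
    case (union A)
    have d: "disjoint_family (\<lambda>i. tormap -` A i)" using union(1) by (auto simp: disjoint_family_on_def)
    show ?case
    proof (rule apx_indicator_limit[where h="\<lambda>n \<eta>. \<Sum>i<n. indicator (tormap -` A i) \<eta>"])
      show "apx (\<lambda>\<eta>. \<Sum>i<n. indicator (tormap -` A i) \<eta>)" for n by (intro apx_sum union)
      have "(\<Union>i. A i) \<in> sets borel" using union(2) unfolding sets_borel by (intro sigma_sets.Union) auto
      then show "tormap -` (\<Union>i. A i) \<in> sets borel"
        using measurable_sets_borel[OF tormap_borel] by blast
      fix \<eta> :: "real^'d"
      have *: "(\<Sum>i<n. indicator (tormap -` A i) \<eta> :: complex) = indicator (\<Union>i<n. tormap -` A i) \<eta>" for n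
        using d by (subst indicator_UN_disjoint) (auto simp: disjoint_family_on_def)
      show "cmod (\<Sum>i<n. indicator (tormap -` A i) \<eta>) \<le> 1" for n
        unfolding * by (simp add: indicator_def)
      show "(\<lambda>n. \<Sum>i<n. indicator (tormap -` A i) \<eta> :: complex) \<longlonglongrightarrow> indicator (tormap -` (\<Union>i. A i)) \<eta>"
        unfolding * vimage_UN by (rule LIMSEQ_indicator_UN)
    qed
  qed
qed

text \<open>The boundary case \<open>Re z\<^sub>i = - 1\<close> goes to \<open>- 1/2\<close>, which belongs to the half-open torus, whereas \<open>1/2\<close> does not.\<close>

definition tormap_inv :: "complex^'d \<Rightarrow> real^'d" where
  "tormap_inv z = (\<chi> i. (if Im (z $ i) < 0 \<or> Re (z $ i) = - 1 then - 1 else 1) * arccos (max (-1) (min 1 (Re (z $ i)))) / (2 * pi))"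

lemma tormap_inv_borel [measurable]: "tormap_inv \<in> borel_measurable borel"
proof -
  have [measurable]: "(\<lambda>x. arccos (max (-1) (min 1 x))) \<in> borel_measurable borel"
    by (intro borel_measurable_continuous_onI continuous_intros) auto
  have "(\<lambda>z. tormap_inv z $ i) \<in> borel_measurable borel" for i :: 'a
  proof -
    have [measurable]: "(\<lambda>z::complex^'a. z $ i) \<in> borel_measurable borel"
      by (intro borel_measurable_continuous_onI continuous_intros)
    show ?thesis unfolding tormap_inv_def vec_lambda_beta by measurable
  qed
  then show ?thesis
    by (subst borel_measurable_euclidean_space) (auto simp: Basis_vec_eq_range inner_axis)
qed

lemma tormap_inv: 
  fixes \<eta> :: "real^'d"
  assumes "\<eta> \<in> torus" shows "tormap_inv (tormap \<eta>) = \<eta>"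
proof -
  have "(if Im (ee t) < 0 \<or> Re (ee t) = - 1 then - 1 else 1) * arccos (max (-1) (min 1 (Re (ee t)))) / (2 * pi) = t"
    if t: "- 1/2 \<le> t" "t < 1/2" for t
  proof -
    have m: "max (-1) (min 1 (Re (ee t))) = cos (2 * pi * t)" by (simp add: ee_eq_cis)
    have b: "- pi \<le> 2 * pi * t" "2 * pi * t < pi"
      using mult_left_mono[OF t(1), of "2 * pi"] mult_strict_left_mono[OF t(2), of "2 * pi"] by auto
    consider "t \<ge> 0" | "t = - 1/2" | "t < 0" "t \<noteq> - 1/2" by linarith
    then show ?thesis
    proof cases
      case 1
      have "sin (2 * pi * t) \<ge> 0" using 1 b by (intro sin_ge_zero) auto
      moreover have "cos (2 * pi * t) \<noteq> - 1"
      proof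
        assume "cos (2 * pi * t) = - 1"
        then have "arccos (cos (2 * pi * t)) = pi" by simp
        then show False using 1 b by (subst (asm) arccos_cos) auto
      qed
      moreover have "arccos (cos (2 * pi * t)) = 2 * pi * t" using 1 b by (intro arccos_cos) auto
      ultimately show ?thesis unfolding m by (simp add: ee_eq_cis)
    next
      case 2
      then have "cos (2 * pi * t) = - 1" by simp
      then show ?thesis unfolding m using 2 by (simp add: ee_eq_cis)
    next
      case 3
      have "- pi < 2 * pi * t"
        using mult_strict_left_mono[of "-1/2" t "2 * pi"] 3 t by auto
      then have "sin (2 * pi * t) < 0" using sin_gt_zero[of "- (2 * pi * t)"] 3 by (simp add: mult_less_0_iff)
      moreover have "arccos (cos (2 * pi * t)) = - (2 * pi * t)" using 3 b by (intro arccos_cos2) (auto simp: mult_le_0_iff)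
      ultimately show ?thesis unfolding m by (simp add: ee_eq_cis)
    qed
  qed
  then show ?thesis using assms by (simp add: tormap_inv_def tormap_def torus_def vec_eq_iff)
qed

lemma apx_cong_AE:
  assumes f: "apx f" and [measurable]: "g \<in> borel_measurable borel" and ae: "AE \<eta> in tor. f \<eta> = g \<eta>"
  shows "apx g"
proof (rule apx_limit)
  fix e :: real assume "e > 0"
  have [measurable]: "f \<in> borel_measurable borel" using f by (rule apx_borel)
  have "tn (\<lambda>\<eta>. g \<eta> - f \<eta>) = 0" unfolding tn_def using ae by (subst nn_integral_0_iff_AE) (auto elim!: eventually_mono)
  then show "\<exists>h. apx h \<and> tn (\<lambda>\<eta>. g \<eta> - h \<eta>) \<le> ennreal e" using f by auto
qed measurable

lemma apx_indicator:
  fixes B :: "(real^'d) set"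
  assumes B: "B \<in> sets borel"
  shows "apx (indicator B :: real^'d \<Rightarrow> complex)"
proof (rule apx_cong_AE)
  have "tormap_inv -` B \<in> sets (borel :: (complex^'d) measure)" using measurable_sets_borel[OF tormap_inv_borel B] by simp
  then show "apx (indicator (tormap -` (tormap_inv -` B)) :: real^'d \<Rightarrow> complex)" by (rule apx_indicator_tormap)
  show "AE \<eta> in tor. indicator (tormap -` (tormap_inv -` B)) \<eta> = (indicator B \<eta> :: complex)"
    using AE_tor_torus by eventually_elim (simp add: indicator_def tormap_inv)
qed (use B in measurable)

lemma apx_tn_finite:
  assumes [measurable]: "f \<in> borel_measurable borel" and fin: "tn f < \<infinity>"
  shows "apx (f :: real^'d \<Rightarrow> complex)"
proof -
  obtain s where s: "\<And>i. simple_function borel (s i)" "\<And>x. (\<lambda>i. s i x) \<longlonglongrightarrow> f x" "\<And>i x. dist (s i x) 0 \<le> 2 * dist (f x) 0"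
    using borel_measurable_implies_sequence_metric[OF assms(1), of 0] by auto
  have "apx (s i)" for i
  proof -
    have fin: "finite (range (s i))" using s(1)[of i] by (auto simp: simple_function_def)
    have eq: "s i = (\<lambda>x. \<Sum>y\<in>range (s i). y * indicator (s i -` {y}) x)"
    proof
      fix x
      have "(\<Sum>y\<in>range (s i). y * indicator (s i -` {y}) x) = (\<Sum>y\<in>range (s i). if y = s i x then y else 0)"
        by (rule sum.cong) auto
      then show "s i x = (\<Sum>y\<in>range (s i). y * indicator (s i -` {y}) x)" using fin by simp
    qed
    have "s i -` {y} \<in> sets borel" for y
      using simple_functionD(2)[OF s(1), of i "{y}"] by simp
    then have "apx (\<lambda>x. \<Sum>y\<in>range (s i). y * indicator (s i -` {y}) x)"
      by (intro apx_sum apx_cmult apx_indicator)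
    then show ?thesis using eq by simp
  qed
  then show ?thesis
  proof (rule apx_dominated_limit[where h=s and w="\<lambda>\<eta>. 9 * ennreal ((cmod (f \<eta>))\<^sup>2)"])
    show "(\<lambda>\<eta>. 9 * ennreal ((cmod (f \<eta>))\<^sup>2)) \<in> borel_measurable borel" by measurable
    have "cmod (f \<eta> - s n \<eta>) \<le> 3 * cmod (f \<eta>)" for n \<eta>
      using norm_triangle_ineq4[of "f \<eta>" "s n \<eta>"] s(3)[of n \<eta>] by simp
    then have "(cmod (f \<eta> - s n \<eta>))\<^sup>2 \<le> (3 * cmod (f \<eta>))\<^sup>2" for n \<eta> by (intro power_mono) auto
    then have "(cmod (f \<eta> - s n \<eta>))\<^sup>2 \<le> 9 * (cmod (f \<eta>))\<^sup>2" for n \<eta> by (simp add: power_mult_distrib)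
    from ennreal_leI[OF this] show "AE \<eta> in tor. ennreal ((cmod (f \<eta> - s n \<eta>))\<^sup>2) \<le> 9 * ennreal ((cmod (f \<eta>))\<^sup>2)" for n
      by (intro AE_I2) (simp add: ennreal_mult')
    show "(\<integral>\<^sup>+ \<eta>. 9 * ennreal ((cmod (f \<eta>))\<^sup>2) \<partial>tor) < \<infinity>"
      using fin by (simp add: nn_integral_cmult tn_def ennreal_mult_less_top)
  qed (use s in auto)
qed

lemma integrable_tn:
  assumes [measurable]: "f \<in> borel_measurable borel" and "tn f < \<infinity>"
  shows "integrable tor (\<lambda>\<eta>. (cmod (f \<eta>))\<^sup>2)" "integrable tor f"
proof -
  show 1: "integrable tor (\<lambda>\<eta>. (cmod (f \<eta>))\<^sup>2)"
    using assms(2) by (intro integrableI_bounded) (simp_all add: tn_def)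
  show "integrable tor f"
  proof (rule Bochner_Integration.integrable_bound)
    show "integrable tor (\<lambda>\<eta>. 1 + (cmod (f \<eta>))\<^sup>2)" using 1 by simp
    have "2 * cmod (f \<eta>) \<le> 1 + (cmod (f \<eta>))\<^sup>2" for \<eta>
      using sum_squares_bound[of 1 "cmod (f \<eta>)"] by simp
    then have "cmod (f \<eta>) \<le> 1 + (cmod (f \<eta>))\<^sup>2" for \<eta>
      using norm_ge_zero[of "f \<eta>"] by (smt (verit))
    then show "AE \<eta> in tor. norm (f \<eta>) \<le> norm (1 + (cmod (f \<eta>))\<^sup>2)" by auto
  qed measurable
qed

definition fcoef :: "(real^'d \<Rightarrow> complex) \<Rightarrow> int^'d \<Rightarrow> complex" where
  "fcoef G k = (LINT \<eta>|tor. G \<eta> * ee (- (rvec k \<bullet> \<eta>)))"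

lemma integral_tor_ee: "(LINT \<eta>|tor. ee (rvec k \<bullet> \<eta>) * ee (- (rvec l \<bullet> \<eta>))) = (if k = l then 1 else 0)"
proof -
  have "ee (rvec k \<bullet> \<eta>) * ee (- (rvec l \<bullet> \<eta>)) = ee (rvec (k - l) \<bullet> \<eta>)" for \<eta>
    using rvec_add[of k "- l"] by (simp add: rvec_minus inner_diff_left flip: ee_add)
  then show ?thesis using orthonormal_tor[of "k - l"] by simp
qed

lemma fcoef_remainder:
  assumes [measurable]: "G \<in> borel_measurable borel" and G: "tn G < \<infinity>" and F: "finite F" and l: "l \<in> F"
  shows "(LINT \<eta>|tor. (G \<eta> - (\<Sum>k\<in>F. fcoef G k * ee (rvec k \<bullet> \<eta>))) * ee (- (rvec l \<bullet> \<eta>))) = 0"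
proof -
  have i1: "integrable tor (\<lambda>\<eta>. G \<eta> * ee (- (rvec l \<bullet> \<eta>)))"
    by (intro integrable_mult_ee integrable_tn G) measurable
  have i2: "integrable tor (\<lambda>\<eta>. ee (rvec k \<bullet> \<eta>) * ee (- (rvec l \<bullet> \<eta>)))" for k
    by (rule tor.integrable_const_bound[where B=1]) (auto simp: norm_mult)
  have "(LINT \<eta>|tor. (G \<eta> - (\<Sum>k\<in>F. fcoef G k * ee (rvec k \<bullet> \<eta>))) * ee (- (rvec l \<bullet> \<eta>)))
     = (LINT \<eta>|tor. G \<eta> * ee (- (rvec l \<bullet> \<eta>)) - (\<Sum>k\<in>F. fcoef G k * (ee (rvec k \<bullet> \<eta>) * ee (- (rvec l \<bullet> \<eta>)))))"
    by (simp add: left_diff_distrib sum_distrib_right mult.assoc)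
  also have "\<dots> = fcoef G l - (\<Sum>k\<in>F. fcoef G k * (LINT \<eta>|tor. ee (rvec k \<bullet> \<eta>) * ee (- (rvec l \<bullet> \<eta>))))"
    using i1 i2 by (subst Bochner_Integration.integral_diff) (auto simp: fcoef_def intro!: Bochner_Integration.integrable_sum)
  also have "\<dots> = fcoef G l - (\<Sum>k\<in>F. if k = l then fcoef G l else 0)"
    unfolding integral_tor_ee by (intro arg_cong2[of _ _ _ _ minus] sum.cong refl) auto
  also have "\<dots> = 0" using F l by simp
  finally show ?thesis .
qed

lemma best_approximation:
  fixes G :: "real^'d \<Rightarrow> complex"
  assumes [measurable]: "G \<in> borel_measurable borel" and G: "tn G < \<infinity>" and F: "finite F"
  shows "tn (\<lambda>\<eta>. G \<eta> - (\<Sum>k\<in>F. fcoef G k * ee (rvec k \<bullet> \<eta>))) \<le> tn (\<lambda>\<eta>. G \<eta> - (\<Sum>k\<in>F. a k * ee (rvec k \<bullet> \<eta>)))"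
proof -
  define D where "D \<eta> = G \<eta> - (\<Sum>k\<in>F. fcoef G k * ee (rvec k \<bullet> \<eta>))" for \<eta>
  define q where "q \<eta> = (\<Sum>k\<in>F. (fcoef G k - a k) * ee (rvec k \<bullet> \<eta>))" for \<eta>
  have [measurable]: "D \<in> borel_measurable borel" "q \<in> borel_measurable borel" unfolding D_def q_def by measurable
  have tr: "trig (\<lambda>\<eta>. \<Sum>k\<in>F. b k * ee (rvec k \<bullet> \<eta>))" for b by (intro trig_sum trig.char)
  have tnt: "tn p < \<infinity>" if tp: "trig p" for p :: "real^'d \<Rightarrow> complex"
  proof -
    obtain B where B: "\<And>\<eta>. cmod (p \<eta>) \<le> B" using trig_bounded[OF tp] by blast
    have "tn p \<le> (\<integral>\<^sup>+ \<eta>. ennreal (B^2) \<partial>(tor :: (real^'d) measure))"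
      unfolding tn_def by (intro nn_integral_mono ennreal_leI power_mono B) auto
    also have "\<dots> < \<infinity>" by simp
    finally show ?thesis .
  qed
  have fin: "tn (\<lambda>\<eta>. G \<eta> + p \<eta>) < \<infinity>" if "trig p" for p :: "real^'d \<Rightarrow> complex"
  proof -
    have "tn (\<lambda>\<eta>. G \<eta> + p \<eta>) \<le> 2 * tn G + 2 * tn p" using trig_borel[OF that] by (intro tn_add) auto
    also have "\<dots> < \<infinity>" using G tnt[OF that] by (simp add: ennreal_mult_less_top)
    finally show ?thesis .
  qed
  have finD: "tn D < \<infinity>"
    using fin[OF tr[of "\<lambda>k. - fcoef G k"]] by (simp add: D_def[abs_def] sum_negf)
  have tq: "trig q" unfolding q_def by (rule tr)
  have iD: "integrable tor (\<lambda>\<eta>. (cmod (D \<eta>))\<^sup>2)" "integrable tor D" by (intro integrable_tn finD; measurable)+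
  have iq: "integrable tor (\<lambda>\<eta>. (cmod (q \<eta>))\<^sup>2)" by (intro integrable_tn tnt tq) measurable
  have ce: "cnj (q \<eta>) = (\<Sum>k\<in>F. cnj (fcoef G k - a k) * ee (- (rvec k \<bullet> \<eta>)))" for \<eta>
    by (simp add: q_def cnj_sum cnj_ee)
  have iDe: "integrable tor (\<lambda>\<eta>. D \<eta> * ee (- (rvec k \<bullet> \<eta>)))" for k by (intro integrable_mult_ee iD) measurable
  have Dq: "D \<eta> * cnj (q \<eta>) = (\<Sum>k\<in>F. cnj (fcoef G k - a k) * (D \<eta> * ee (- (rvec k \<bullet> \<eta>))))" for \<eta>
    unfolding ce sum_distrib_left by (intro sum.cong refl) (simp only: mult.left_commute)
  have iDq: "integrable tor (\<lambda>\<eta>. D \<eta> * cnj (q \<eta>))"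
    unfolding Dq by (intro Bochner_Integration.integrable_sum integrable_mult_right iDe)
  have "(LINT \<eta>|tor. D \<eta> * cnj (q \<eta>)) = (\<Sum>k\<in>F. cnj (fcoef G k - a k) * (LINT \<eta>|tor. D \<eta> * ee (- (rvec k \<bullet> \<eta>))))"
    unfolding Dq by (subst Bochner_Integration.integral_sum) (auto intro: integrable_mult_right iDe)
  also have "\<dots> = 0"
    using fcoef_remainder[OF _ G F] by (intro sum.neutral ballI) (simp add: D_def)
  finally have orth: "(LINT \<eta>|tor. D \<eta> * cnj (q \<eta>)) = 0" .
  have sq: "(cmod (D \<eta> + q \<eta>))\<^sup>2 = (cmod (D \<eta>))\<^sup>2 + (2 * Re (D \<eta> * cnj (q \<eta>)) + (cmod (q \<eta>))\<^sup>2)" for \<eta>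
    unfolding cmod_power2 by (simp add: power2_eq_square algebra_simps)
  have iR: "integrable tor (\<lambda>\<eta>. 2 * Re (D \<eta> * cnj (q \<eta>)))" using iDq by (intro integrable_mult_right integrable_Re)
  have i2: "integrable tor (\<lambda>\<eta>. (cmod (D \<eta> + q \<eta>))\<^sup>2)"
    unfolding sq by (intro Bochner_Integration.integrable_add iD iR iq)
  have "(LINT \<eta>|tor. (cmod (D \<eta> + q \<eta>))\<^sup>2) = (LINT \<eta>|tor. (cmod (D \<eta>))\<^sup>2) + ((LINT \<eta>|tor. 2 * Re (D \<eta> * cnj (q \<eta>))) + (LINT \<eta>|tor. (cmod (q \<eta>))\<^sup>2))"
    unfolding sq using iD(1) iR iq by (simp add: Bochner_Integration.integral_add)
  also have "(LINT \<eta>|tor. 2 * Re (D \<eta> * cnj (q \<eta>))) = 0"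
    by (simp only: integral_mult_right_zero integral_Re[OF iDq] orth) simp
  finally have le: "(LINT \<eta>|tor. (cmod (D \<eta>))\<^sup>2) \<le> (LINT \<eta>|tor. (cmod (D \<eta> + q \<eta>))\<^sup>2)" by simp
  have "tn D = ennreal (LINT \<eta>|tor. (cmod (D \<eta>))\<^sup>2)" unfolding tn_def by (rule nn_integral_eq_integral[OF iD(1)]) simp
  also have "\<dots> \<le> ennreal (LINT \<eta>|tor. (cmod (D \<eta> + q \<eta>))\<^sup>2)" using le by (rule ennreal_leI)
  also have "\<dots> = tn (\<lambda>\<eta>. D \<eta> + q \<eta>)" unfolding tn_def by (rule nn_integral_eq_integral[OF i2, symmetric]) simp
  also have "(\<lambda>\<eta>. D \<eta> + q \<eta>) = (\<lambda>\<eta>. G \<eta> - (\<Sum>k\<in>F. a k * ee (rvec k \<bullet> \<eta>)))"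
    by (simp add: D_def q_def left_diff_distrib sum_subtractf)
  finally show ?thesis by (simp add: D_def[abs_def])
qed

lemma fourier_series_L2:
  assumes [measurable]: "G \<in> borel_measurable borel" and G: "tn G < \<infinity>"
  shows "((\<lambda>F. tn (\<lambda>\<eta>. G \<eta> - (\<Sum>k\<in>F. fcoef G k * ee (rvec k \<bullet> \<eta>)))) \<longlongrightarrow> 0) (finite_subsets_at_top UNIV)"
proof (rule order_tendstoI)
  fix e :: ennreal assume "0 < e"
  then obtain z where z: "0 < z" "z < e" using dense by blast
  then obtain r :: real where r: "0 < ennreal r" "ennreal r < e" by (cases z rule: ennreal_cases) auto
  then have r0: "r > 0" by simp
  obtain p where p: "trig p" "tn (\<lambda>\<eta>. G \<eta> - p \<eta>) \<le> ennreal r"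
    using apx_tn_finite[OF assms] r0 unfolding apx_def by blast
  obtain F a where F: "finite F" "\<And>F'. finite F' \<Longrightarrow> F \<subseteq> F' \<Longrightarrow> p = (\<lambda>\<eta>. \<Sum>k\<in>F'. a k * ee (rvec k \<bullet> \<eta>))"
    using trig_finite_sum[OF p(1)] by blast
  have "tn (\<lambda>\<eta>. G \<eta> - (\<Sum>k\<in>F'. fcoef G k * ee (rvec k \<bullet> \<eta>))) < e" if F': "finite F'" "F \<subseteq> F'" for F'
  proof -
    have "tn (\<lambda>\<eta>. G \<eta> - (\<Sum>k\<in>F'. fcoef G k * ee (rvec k \<bullet> \<eta>))) \<le> tn (\<lambda>\<eta>. G \<eta> - (\<Sum>k\<in>F'. a k * ee (rvec k \<bullet> \<eta>)))"
      by (rule best_approximation[OF assms F'(1)])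
    also have "\<dots> = tn (\<lambda>\<eta>. G \<eta> - p \<eta>)" using F(2)[OF F'] by simp
    finally show ?thesis using p(2) r(2) by (meson order.strict_trans1 order.trans)
  qed
  then show "\<forall>\<^sub>F F in finite_subsets_at_top UNIV. tn (\<lambda>\<eta>. G \<eta> - (\<Sum>k\<in>F. fcoef G k * ee (rvec k \<bullet> \<eta>))) < e"
    unfolding eventually_finite_subsets_at_top using F(1) by blast
qed simp

subsection \<open>Periodization\<close>

lemma borel_measurable_cnj' [measurable]:
  assumes "f \<in> borel_measurable M" shows "(\<lambda>x. cnj (f x)) \<in> borel_measurable M"
proof -
  have "cnj \<in> borel_measurable borel" by (intro borel_measurable_continuous_onI continuous_intros)
  from measurable_compose[OF assms this] show ?thesis .
qed

definition periodize :: "(real^'d \<Rightarrow> complex) \<Rightarrow> real^'d \<Rightarrow> complex" where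
  "periodize H \<eta> = (LINT k|count_space UNIV. H (\<eta> + rvec k))"

lemma bij_add_int: "bij ((+) (l :: int^'d))"
  by (rule bijI) (auto simp: inj_on_def intro: surjI[where f="\<lambda>k. k - l"])

lemma periodize_shift: "periodize H (\<eta> + rvec l) = periodize H \<eta>"
  unfolding periodize_def
  using integral_bij_count_space[of "(+) l" UNIV UNIV "\<lambda>k. H (\<eta> + rvec k)"] bij_add_int[of l]
  by (simp add: rvec_add add.assoc)

lemma ee_shift: "ee (rvec k \<bullet> (\<eta> + rvec l)) = ee (rvec k \<bullet> \<eta>)"
proof -
  have "rvec k \<bullet> rvec l = of_int (\<Sum>i\<in>UNIV. k $ i * l $ i)" by (simp add: rvec_def inner_vec_def)
  then show ?thesis by (simp only: inner_add_right ee_add ee_int mult_1_right)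
qed

lemma bracket_borel [measurable]:
  assumes [measurable]: "g \<in> borel_measurable borel"
  shows "bracket s g \<in> borel_measurable borel"
proof -
  interpret C: sigma_finite_measure "count_space UNIV :: (int^'a) measure"
    by (rule sigma_finite_measure_count_space)
  have "(\<lambda>(\<xi>, k). ennreal ((cmod (g (\<xi> + rvec k)))\<^sup>2 * wt s (\<xi> + rvec k))) \<in> borel_measurable (borel \<Otimes>\<^sub>M count_space (UNIV :: (int^'a) set))"
    by (subst measurable_pair_swap_iff, rule measurable_pair_measure_countable1) auto
  from C.borel_measurable_nn_integral_fst[OF this] show ?thesis by (simp add: bracket_def[abs_def])
qed

lemma periodize_borel [measurable]:
  assumes [measurable]: "H \<in> borel_measurable borel"
  shows "periodize H \<in> borel_measurable borel"
proof -
  interpret C: sigma_finite_measure "count_space UNIV :: (int^'a) measure"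
    by (rule sigma_finite_measure_count_space)
  have "(\<lambda>(\<xi>, k). H (\<xi> + rvec k)) \<in> borel_measurable (borel \<Otimes>\<^sub>M count_space (UNIV :: (int^'a) set))"
    by (subst measurable_pair_swap_iff, rule measurable_pair_measure_countable1) auto
  from C.borel_measurable_lebesgue_integral[OF this] show ?thesis by (simp add: periodize_def[abs_def])
qed

lemma Wn_eq_bracket:
  assumes [measurable]: "g \<in> borel_measurable borel"
  shows "Wn s g = (\<integral>\<^sup>+ \<eta>. bracket s g \<eta> \<partial>tor)"
  unfolding Wn_def bracket_def by (rule nn_integral_tiling_tor) measurable

lemma Wn_periodic_mult:
  assumes [measurable]: "g \<in> borel_measurable borel" "u \<in> borel_measurable borel" and u: "\<And>\<eta> l. u (\<eta> + rvec l) = u \<eta>"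
  shows "Wn s (\<lambda>\<eta>. g \<eta> * u \<eta>) = (\<integral>\<^sup>+ \<eta>. bracket s g \<eta> * ennreal ((cmod (u \<eta>))\<^sup>2) \<partial>tor)"
proof -
  have "bracket s (\<lambda>\<eta>. g \<eta> * u \<eta>) \<eta> = bracket s g \<eta> * ennreal ((cmod (u \<eta>))\<^sup>2)" for \<eta>
    unfolding bracket_def u
    by (subst nn_integral_multc[symmetric]) (auto intro!: nn_integral_cong simp: norm_mult power_mult_distrib mult_ac simp flip: ennreal_mult)
  moreover have "Wn s (\<lambda>\<eta>. g \<eta> * u \<eta>) = (\<integral>\<^sup>+ \<eta>. bracket s (\<lambda>\<eta>. g \<eta> * u \<eta>) \<eta> \<partial>tor)"
    by (rule Wn_eq_bracket) measurable
  ultimately show ?thesis by simp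
qed

lemma Wn_periodic_mult_le:
  assumes [measurable]: "g \<in> borel_measurable borel" "u \<in> borel_measurable borel" and u: "\<And>\<eta> l. u (\<eta> + rvec l) = u \<eta>"
    and B: "AE \<eta> in lborel. bracket s g \<eta> \<le> ennreal B"
  shows "Wn s (\<lambda>\<eta>. g \<eta> * u \<eta>) \<le> ennreal B * tn u"
proof -
  have "Wn s (\<lambda>\<eta>. g \<eta> * u \<eta>) \<le> (\<integral>\<^sup>+ \<eta>. ennreal B * ennreal ((cmod (u \<eta>))\<^sup>2) \<partial>tor)"
    unfolding Wn_periodic_mult[OF assms(1-3)] using AE_tor[OF B]
    by (intro nn_integral_mono_AE) (auto elim!: eventually_mono intro!: mult_right_mono)
  also have "\<dots> = ennreal B * tn u" unfolding tn_def by (rule nn_integral_cmult) measurable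
  finally show ?thesis .
qed

lemma periodize_CS:
  fixes F q :: "real^'d \<Rightarrow> complex"
  shows "(\<integral>\<^sup>+ k\<in>K. ennreal (cmod (F (\<eta> + rvec k) * q (\<eta> + rvec k))) \<partial>count_space UNIV)\<^sup>2
    \<le> (\<integral>\<^sup>+ k\<in>K. ennreal ((cmod (F (\<eta> + rvec k)))\<^sup>2 * wt s (\<eta> + rvec k)) \<partial>count_space UNIV) * bracket (- s) q \<eta>"
proof -
  let ?f = "\<lambda>k. ennreal (cmod (F (\<eta> + rvec k)) * wt (s/2) (\<eta> + rvec k)) * indicator K k"
  let ?g = "\<lambda>k. ennreal (cmod (q (\<eta> + rvec k)) * wt (- s/2) (\<eta> + rvec k))"
  have "ennreal (cmod (F (\<eta> + rvec k) * q (\<eta> + rvec k))) * indicator K k = ?f k * ?g k" for k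
  proof -
    have "wt (s/2) (\<eta> + rvec k) * wt (- s/2) (\<eta> + rvec k) = 1" by (simp flip: wt_add)
    then have "cmod (F (\<eta> + rvec k) * q (\<eta> + rvec k)) = (cmod (F (\<eta> + rvec k)) * wt (s/2) (\<eta> + rvec k)) * (cmod (q (\<eta> + rvec k)) * wt (- s/2) (\<eta> + rvec k))"
      by (simp add: norm_mult algebra_simps)
    then show ?thesis by (simp add: ennreal_mult mult_ac)
  qed
  moreover have sq: "ennreal (cmod (h \<xi>) * wt (r/2) \<xi>) ^ 2 = ennreal ((cmod (h \<xi>))\<^sup>2 * wt r \<xi>)" for h :: "real^'d \<Rightarrow> complex" and r \<xi>
    by (simp add: ennreal_power power_mult_distrib power2_eq_square[of "wt _ _"] flip: wt_add)
  have "(?f k)\<^sup>2 = ennreal ((cmod (F (\<eta> + rvec k)))\<^sup>2 * wt s (\<eta> + rvec k)) * indicator K k" for k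
    unfolding power_mult_distrib sq by (auto simp: indicator_def)
  moreover have "(\<integral>\<^sup>+ k. ?f k * ?g k \<partial>count_space UNIV)\<^sup>2 \<le> (\<integral>\<^sup>+ k. (?f k)\<^sup>2 \<partial>count_space UNIV) * (\<integral>\<^sup>+ k. (?g k)\<^sup>2 \<partial>count_space UNIV)"
    by (rule Cauchy_Schwarz_nn_integral) auto
  ultimately show ?thesis
    using sq[where h=q and r="- s"] by (simp add: bracket_def)
qed

lemma norm_integral_count_le: 
  fixes f :: "'k \<Rightarrow> complex"
  shows "ennreal (cmod (LINT k|count_space UNIV. f k)) \<le> (\<integral>\<^sup>+ k. ennreal (cmod (f k)) \<partial>count_space UNIV)"
proof (cases "integrable (count_space UNIV) f")
  case True then show ?thesis by (rule integral_norm_bound_ennreal)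
qed (simp add: not_integrable_integral_eq)

lemma periodize_bound:
  "ennreal ((cmod (periodize (\<lambda>\<xi>. F \<xi> * cnj (q \<xi>)) \<eta>))\<^sup>2) \<le> bracket s F \<eta> * bracket (- s) q \<eta>"
proof -
  have "ennreal (cmod (periodize (\<lambda>\<xi>. F \<xi> * cnj (q \<xi>)) \<eta>)) \<le> (\<integral>\<^sup>+ k\<in>UNIV. ennreal (cmod (F (\<eta> + rvec k) * q (\<eta> + rvec k))) \<partial>count_space UNIV)"
    using norm_integral_count_le[of "\<lambda>k. F (\<eta> + rvec k) * cnj (q (\<eta> + rvec k))"] by (simp add: periodize_def norm_mult)
  then have "ennreal (cmod (periodize (\<lambda>\<xi>. F \<xi> * cnj (q \<xi>)) \<eta>)) ^ 2 \<le> (\<integral>\<^sup>+ k\<in>UNIV. ennreal (cmod (F (\<eta> + rvec k) * q (\<eta> + rvec k))) \<partial>count_space UNIV) ^ 2"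
    by (intro power_mono) auto
  also have "\<dots> \<le> bracket s F \<eta> * bracket (- s) q \<eta>"
    using periodize_CS[where K=UNIV] by (simp add: bracket_def)
  finally show ?thesis by (simp add: ennreal_power)
qed

lemma tn_periodize:
  assumes F: "wL2 s F" and [measurable]: "q \<in> borel_measurable borel" and B: "AE \<eta> in lborel. bracket (- s) q \<eta> \<le> ennreal B"
  shows "tn (periodize (\<lambda>\<xi>. F \<xi> * cnj (q \<xi>))) < \<infinity>"
proof -
  have [measurable]: "F \<in> borel_measurable borel" using F by (simp add: wL2_def)
  have "tn (periodize (\<lambda>\<xi>. F \<xi> * cnj (q \<xi>))) \<le> (\<integral>\<^sup>+ \<eta>. bracket s F \<eta> * ennreal B \<partial>tor)"
    unfolding tn_def
  proof (rule nn_integral_mono_AE)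
    show "AE \<eta> in tor. ennreal ((cmod (periodize (\<lambda>\<xi>. F \<xi> * cnj (q \<xi>)) \<eta>))\<^sup>2) \<le> bracket s F \<eta> * ennreal B"
      using AE_tor[OF B]
    proof eventually_elim
      case (elim \<eta>)
      show ?case by (rule order.trans[OF periodize_bound mult_left_mono[OF elim]]) simp
    qed
  qed
  also have "\<dots> = Wn s F * ennreal B" by (subst nn_integral_multc) (auto simp: Wn_eq_bracket)
  also have "\<dots> < \<infinity>" using F by (simp add: wL2_def ennreal_mult_less_top)
  finally show ?thesis .
qed

lemma fcoef_periodize:
  assumes "integrable lborel H"
  shows "fcoef (periodize H) k = (LINT \<eta>|lborel. H \<eta> * ee (- (rvec k \<bullet> \<eta>)))"
proof -
  have "integrable lborel (\<lambda>\<eta>. H \<eta> * ee (- (rvec k \<bullet> \<eta>)))" by (intro integrable_mult_ee assms) measurable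
  then have "(LINT \<eta>|lborel. H \<eta> * ee (- (rvec k \<bullet> \<eta>)))
     = (LINT t|tor. (LINT l|count_space UNIV. H (t + rvec l) * ee (- (rvec k \<bullet> (t + rvec l)))))"
    by (rule integral_tiling)
  also have "\<dots> = (LINT t|tor. (LINT l|count_space UNIV. H (t + rvec l) * ee (- (rvec k \<bullet> t))))"
    using ee_shift[of "- k"] by (simp add: rvec_minus)
  also have "\<dots> = fcoef (periodize H) k" by (simp add: fcoef_def periodize_def)
  finally show ?thesis by simp
qed

lemma partial_sums_converge:
  assumes F: "wL2 s F" and p[measurable]: "p \<in> borel_measurable borel" and q: "wL2 (- s) q"
    and B1: "AE \<eta> in lborel. bracket s p \<eta> \<le> ennreal B1" and B2: "AE \<eta> in lborel. bracket (- s) q \<eta> \<le> ennreal B2"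
  defines "G \<equiv> periodize (\<lambda>\<xi>. F \<xi> * cnj (q \<xi>))"
  shows "((\<lambda>A. Wn s (\<lambda>\<eta>. p \<eta> * (G \<eta> - (\<Sum>k\<in>A. fcoef G k * ee (rvec k \<bullet> \<eta>))))) \<longlongrightarrow> 0) (finite_subsets_at_top UNIV)"
    and "wL2 s (\<lambda>\<eta>. p \<eta> * G \<eta>)"
proof -
  have [measurable]: "F \<in> borel_measurable borel" "q \<in> borel_measurable borel" using F q by (auto simp: wL2_def)
  have [measurable]: "G \<in> borel_measurable borel" unfolding G_def by measurable
  have G: "tn G < \<infinity>" unfolding G_def using F B2 by (intro tn_periodize) auto
  have sh: "G (\<eta> + rvec l) = G \<eta>" for \<eta> l unfolding G_def by (rule periodize_shift)
  show "((\<lambda>A. Wn s (\<lambda>\<eta>. p \<eta> * (G \<eta> - (\<Sum>k\<in>A. fcoef G k * ee (rvec k \<bullet> \<eta>))))) \<longlongrightarrow> 0) (finite_subsets_at_top UNIV)"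
  proof (rule tendsto_sandwich[OF _ _ tendsto_const])
    show "\<forall>\<^sub>F A in finite_subsets_at_top UNIV. Wn s (\<lambda>\<eta>. p \<eta> * (G \<eta> - (\<Sum>k\<in>A. fcoef G k * ee (rvec k \<bullet> \<eta>))))
       \<le> ennreal B1 * tn (\<lambda>\<eta>. G \<eta> - (\<Sum>k\<in>A. fcoef G k * ee (rvec k \<bullet> \<eta>)))"
      by (intro always_eventually allI Wn_periodic_mult_le B1) (auto simp: sh ee_shift)
    show "((\<lambda>A. ennreal B1 * tn (\<lambda>\<eta>. G \<eta> - (\<Sum>k\<in>A. fcoef G k * ee (rvec k \<bullet> \<eta>)))) \<longlongrightarrow> 0) (finite_subsets_at_top UNIV)"
      using ennreal_tendsto_cmult[OF _ fourier_series_L2[OF _ G], of "ennreal B1"] by simp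
  qed simp
  have "Wn s (\<lambda>\<eta>. p \<eta> * G \<eta>) \<le> ennreal B1 * tn G" by (rule Wn_periodic_mult_le[OF _ _ sh B1]) measurable
  also have "\<dots> < \<infinity>" using G by (simp add: ennreal_mult_less_top)
  finally show "wL2 s (\<lambda>\<eta>. p \<eta> * G \<eta>)" by (simp add: wL2_def)
qed

subsection \<open>The approximation estimate\<close>

lemma rpow_nonneg [simp]: "0 \<le> rpow x a"
  by (simp add: rpow_def)

lemma rpow_borel [measurable]: "f \<in> borel_measurable M \<Longrightarrow> (\<lambda>x. rpow (f x) a) \<in> borel_measurable M"
  by (cases "a = 0") (simp_all add: rpow_def)

lemma rpow_mult: "0 \<le> x \<Longrightarrow> 0 \<le> y \<Longrightarrow> rpow (x * y) a = rpow x a * rpow y a"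
  by (simp add: rpow_def powr_mult)

lemma rpow_mono: "0 \<le> x \<Longrightarrow> x \<le> y \<Longrightarrow> 0 \<le> a \<Longrightarrow> rpow x a \<le> rpow y a"
  by (auto simp: rpow_def intro: powr_mono2)

lemma rpow_square: "(rpow x a)\<^sup>2 = rpow x (2 * a)"
  by (simp add: rpow_def power2_eq_square flip: powr_add)

lemma power2_powr: "0 < x \<Longrightarrow> (x\<^sup>2) powr t = x powr (2 * t)" for x :: real
  by (metis powr_numeral powr_powr less_imp_le)

lemma rpow_norm_le_wt:
  assumes "0 \<le> t" shows "rpow (norm \<xi>) (2 * t) \<le> wt t \<xi>"
proof (cases "t = 0 \<or> norm \<xi> = 0")
  case True
  then show ?thesis by (auto simp: rpow_def)
next
  case False
  then have "rpow (norm \<xi>) (2 * t) = ((norm \<xi>)\<^sup>2) powr t"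
    by (simp add: rpow_def power2_powr)
  also have "\<dots> \<le> wt t \<xi>" unfolding wt_def using assms by (intro powr_mono2) auto
  finally show ?thesis .
qed

lemma wt_le_rpow:
  assumes "1/2 \<le> norm \<xi>" "0 \<le> t"
  shows "wt t \<xi> \<le> 5 powr t * rpow (norm \<xi>) (2 * t)"
proof -
  have "(1/2)\<^sup>2 \<le> (norm \<xi>)\<^sup>2" using assms(1) by (intro power_mono) auto
  then have "1 + (norm \<xi>)\<^sup>2 \<le> 5 * (norm \<xi>)\<^sup>2" by (simp add: power2_eq_square)
  then have "wt t \<xi> \<le> (5 * (norm \<xi>)\<^sup>2) powr t" unfolding wt_def using assms(2) by (intro powr_mono2) auto
  also have "\<dots> = 5 powr t * ((norm \<xi>)\<^sup>2) powr t" by (simp add: powr_mult)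
  also have "((norm \<xi>)\<^sup>2) powr t = rpow (norm \<xi>) (2 * t)"
  proof -
    have "norm \<xi> > 0" using assms(1) by linarith
    then have "((norm \<xi>)\<^sup>2) powr t = norm \<xi> powr (2 * t)" by (rule power2_powr)
    then show ?thesis using \<open>norm \<xi> > 0\<close> by (simp add: rpow_def)
  qed
  finally show ?thesis .
qed

lemma torus_shift_norm_ge:
  fixes \<eta> :: "real^'d"
  assumes "\<eta> \<in> torus" "l \<noteq> 0"
  shows "1/2 \<le> norm (\<eta> + rvec l)"
proof -
  obtain i where i: "l $ i \<noteq> 0" using assms(2) by (auto simp: vec_eq_iff)
  then have "\<bar>real_of_int (l $ i)\<bar> \<ge> 1" by linarith
  moreover have "\<bar>\<eta> $ i\<bar> \<le> 1/2" using assms(1) unfolding torus_def by (auto simp: abs_le_iff elim!: allE[of _ i])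
  ultimately have "1/2 \<le> \<bar>\<eta> $ i + real_of_int (l $ i)\<bar>" by linarith
  then have "1/2 \<le> \<bar>(\<eta> + rvec l) $ i\<bar>" by (simp add: rvec_def)
  then show ?thesis using component_le_norm_cart[of "\<eta> + rvec l" i] by linarith
qed

lemma bracket_ge: "ennreal ((cmod (g \<eta>))\<^sup>2 * wt s \<eta>) \<le> bracket s g \<eta>"
  unfolding bracket_def
  using nn_integral_ge_point[of 0 UNIV "\<lambda>k. ennreal ((cmod (g (\<eta> + rvec k)))\<^sup>2 * wt s (\<eta> + rvec k))"] by simp

lemma nn_integral_count_split_0:
  fixes h :: "int^'d \<Rightarrow> ennreal"
  shows "(\<integral>\<^sup>+ l. h l \<partial>count_space UNIV) = h 0 + (\<integral>\<^sup>+ l\<in>-{0}. h l \<partial>count_space UNIV)"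
proof -
  have "(\<integral>\<^sup>+ l. h l \<partial>count_space UNIV) = (\<integral>\<^sup>+ l. h 0 * indicator {0} l + h l * indicator (-{0}) l \<partial>count_space UNIV)"
    by (intro nn_integral_cong) (auto simp: indicator_def)
  also have "\<dots> = (\<integral>\<^sup>+ l. h 0 * indicator {0::int^'d} l \<partial>count_space UNIV) + (\<integral>\<^sup>+ l\<in>-{0}. h l \<partial>count_space UNIV)"
    by (rule nn_integral_add) auto
  also have "(\<integral>\<^sup>+ l. h 0 * indicator {0::int^'d} l \<partial>count_space UNIV) = h 0" by (simp add: nn_integral_cmult_indicator)
  finally show ?thesis .
qed

lemma periodize_remainder:
  fixes F q :: "real^'d \<Rightarrow> complex"
  assumes int: "integrable (count_space UNIV) (\<lambda>k. F (\<eta> + rvec k) * cnj (q (\<eta> + rvec k)))"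
    and q: "bracket (- s) q \<eta> \<le> ennreal B2"
  shows "ennreal ((cmod (periodize (\<lambda>\<xi>. F \<xi> * cnj (q \<xi>)) \<eta> - F \<eta> * cnj (q \<eta>)))\<^sup>2)
     \<le> (\<integral>\<^sup>+ k\<in>-{0}. ennreal ((cmod (F (\<eta> + rvec k)))\<^sup>2 * wt s (\<eta> + rvec k)) \<partial>count_space UNIV) * ennreal B2"
proof -
  let ?H = "\<lambda>k. F (\<eta> + rvec k) * cnj (q (\<eta> + rvec k))"
  have i0: "integrable (count_space UNIV) (\<lambda>k. indicator {0::int^'d} k *\<^sub>R ?H 0)" by simp
  have "periodize (\<lambda>\<xi>. F \<xi> * cnj (q \<xi>)) \<eta> - F \<eta> * cnj (q \<eta>) = (LINT k|count_space UNIV. ?H k) - (LINT k|count_space UNIV. indicator {0::int^'d} k *\<^sub>R ?H 0)"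
    by (simp add: periodize_def)
  also have "\<dots> = (LINT k|count_space UNIV. ?H k - indicator {0::int^'d} k *\<^sub>R ?H 0)"
    by (rule Bochner_Integration.integral_diff[OF int i0, symmetric])
  finally have "ennreal (cmod (periodize (\<lambda>\<xi>. F \<xi> * cnj (q \<xi>)) \<eta> - F \<eta> * cnj (q \<eta>))) \<le> (\<integral>\<^sup>+ k. ennreal (cmod (?H k - indicator {0::int^'d} k *\<^sub>R ?H 0)) \<partial>count_space UNIV)"
    by (simp only: norm_integral_count_le)
  also have "\<dots> = (\<integral>\<^sup>+ k\<in>-{0}. ennreal (cmod (F (\<eta> + rvec k) * q (\<eta> + rvec k))) \<partial>count_space UNIV)"
    by (intro nn_integral_cong) (auto simp: indicator_def norm_mult)
  finally have "ennreal (cmod (periodize (\<lambda>\<xi>. F \<xi> * cnj (q \<xi>)) \<eta> - F \<eta> * cnj (q \<eta>))) ^ 2 \<le> (\<integral>\<^sup>+ k\<in>-{0}. ennreal (cmod (F (\<eta> + rvec k) * q (\<eta> + rvec k))) \<partial>count_space UNIV) ^ 2"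
    by (intro power_mono) auto
  also have "\<dots> \<le> (\<integral>\<^sup>+ k\<in>-{0}. ennreal ((cmod (F (\<eta> + rvec k)))\<^sup>2 * wt s (\<eta> + rvec k)) \<partial>count_space UNIV) * bracket (- s) q \<eta>"
    by (rule periodize_CS)
  also have "\<dots> \<le> (\<integral>\<^sup>+ k\<in>-{0}. ennreal ((cmod (F (\<eta> + rvec k)))\<^sup>2 * wt s (\<eta> + rvec k)) \<partial>count_space UNIV) * ennreal B2"
    using q by (rule mult_left_mono) simp
  finally show ?thesis by (simp add: ennreal_power)
qed

lemma torus_estimate:
  fixes F p q :: "real^'d \<Rightarrow> complex"
  assumes r: "0 \<le> r" "r \<le> s" "s \<le> n" and pos: "0 \<le> C1" "0 \<le> C2" "0 \<le> B1" "0 \<le> B2" and \<eta>: "\<eta> \<in> torus"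
    and int: "integrable (count_space UNIV) (\<lambda>k. F (\<eta> + rvec k) * cnj (q (\<eta> + rvec k)))"
    and p: "bracket s p \<eta> \<le> ennreal B1" and q: "bracket (- s) q \<eta> \<le> ennreal B2"
    and A1: "cmod (1 - cnj (q \<eta>) * p \<eta>) \<le> C1 * rpow (norm \<eta>) n"
    and A2: "(\<integral>\<^sup>+ k\<in>-{0}. ennreal (wt s (\<eta> + rvec k) * (cmod (p (\<eta> + rvec k)))\<^sup>2) \<partial>count_space UNIV) \<le> ennreal (C2 * rpow (norm \<eta>) (2 * n))"
    and K: "wt n \<eta> \<le> K"
  defines "J \<equiv> 5 powr n" and "G \<equiv> periodize (\<lambda>\<xi>. F \<xi> * cnj (q \<xi>)) \<eta>"
  shows "(\<integral>\<^sup>+ l. ennreal (rpow (norm (\<eta> + rvec l)) (2 * r) * (cmod (F (\<eta> + rvec l) - p (\<eta> + rvec l) * G))\<^sup>2) \<partial>count_space UNIV)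
    \<le> ennreal (2 * K * C1\<^sup>2 + 4 * C2 * B2 * K + (2 * K * B1 + 4 * C2 * K) * (J * B2) + 2 * J) *
      (\<integral>\<^sup>+ l. ennreal (rpow (norm (\<eta> + rvec l)) (2 * n) * (cmod (F (\<eta> + rvec l)))\<^sup>2) \<partial>count_space UNIV)"
proof -
  have n: "0 \<le> n" using r by simp
  have J: "J > 0" by (simp add: J_def)
  have K0: "K \<ge> 0" using K wt_pos[of n \<eta>] by linarith
  let ?w = "rpow (norm \<eta>) (2 * n)"
  define a where "a = ?w * (cmod (F \<eta>))\<^sup>2"
  define \<rho> where "\<rho> = (cmod (G - F \<eta> * cnj (q \<eta>)))\<^sup>2"
  define S where "S = (\<integral>\<^sup>+ l\<in>-{0}. ennreal (rpow (norm (\<eta> + rvec l)) (2 * n) * (cmod (F (\<eta> + rvec l)))\<^sup>2) \<partial>count_space UNIV)"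
  have a0: "a \<ge> 0" "\<rho> \<ge> 0" by (simp_all add: a_def \<rho>_def)
  have wr: "rpow (norm \<xi>) (2 * r) \<le> wt s \<xi>" "rpow (norm \<xi>) (2 * r) \<le> wt n \<xi>" "rpow (norm \<xi>) (2 * n) \<le> wt n \<xi>" for \<xi> :: "real^'d"
    using rpow_norm_le_wt[of r \<xi>] rpow_norm_le_wt[of n \<xi>] wt_mono[of r s \<xi>] wt_mono[of r n \<xi>] r n by auto
  have far: "wt n (\<eta> + rvec l) \<le> J * rpow (norm (\<eta> + rvec l)) (2 * n)" if "l \<noteq> 0" for l
    unfolding J_def by (rule wt_le_rpow[OF torus_shift_norm_ge[OF \<eta> that] n])
  have p2: "(cmod (p \<eta>))\<^sup>2 \<le> B1"
  proof -
    have "ennreal ((cmod (p \<eta>))\<^sup>2 * wt s \<eta>) \<le> ennreal B1" using bracket_ge[of p \<eta> s] p by (rule order.trans)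
    then have "(cmod (p \<eta>))\<^sup>2 * wt s \<eta> \<le> B1" using pos by simp
    moreover have "1 \<le> wt s \<eta>" using wt_mono[of 0 s \<eta>] r by simp
    then have "(cmod (p \<eta>))\<^sup>2 * 1 \<le> (cmod (p \<eta>))\<^sup>2 * wt s \<eta>" by (rule mult_left_mono) simp
    ultimately show ?thesis by simp
  qed
  have q2: "(cmod (q \<eta>))\<^sup>2 \<le> B2 * K"
  proof -
    have "ennreal ((cmod (q \<eta>))\<^sup>2 * wt (- s) \<eta>) \<le> ennreal B2" using bracket_ge[of q \<eta> "- s"] q by (rule order.trans)
    then have "(cmod (q \<eta>))\<^sup>2 * wt (- s) \<eta> \<le> B2" using pos by simp
    then have "((cmod (q \<eta>))\<^sup>2 * wt (- s) \<eta>) * wt s \<eta> \<le> B2 * K"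
      using wt_mono[of s n \<eta>] K r pos by (intro mult_mono) auto
    moreover have "wt (- s) \<eta> * wt s \<eta> = 1" by (simp flip: wt_add)
    ultimately show ?thesis by (simp add: mult.assoc)
  qed
  have rho: "ennreal \<rho> \<le> ennreal (J * B2) * S"
  proof -
    have "(\<integral>\<^sup>+ k\<in>-{0}. ennreal ((cmod (F (\<eta> + rvec k)))\<^sup>2 * wt s (\<eta> + rvec k)) \<partial>count_space UNIV)
       \<le> (\<integral>\<^sup>+ k. ennreal J * (ennreal (rpow (norm (\<eta> + rvec k)) (2 * n) * (cmod (F (\<eta> + rvec k)))\<^sup>2) * indicator (-{0}) k) \<partial>count_space UNIV)"
    proof (intro nn_integral_mono)
      fix k :: "int^'d"
      show "ennreal ((cmod (F (\<eta> + rvec k)))\<^sup>2 * wt s (\<eta> + rvec k)) * indicator (-{0}) k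
         \<le> ennreal J * (ennreal (rpow (norm (\<eta> + rvec k)) (2 * n) * (cmod (F (\<eta> + rvec k)))\<^sup>2) * indicator (-{0}) k)"
      proof (cases "k = 0")
        case False
        have "wt s (\<eta> + rvec k) \<le> J * rpow (norm (\<eta> + rvec k)) (2 * n)"
          using far[OF False] wt_mono[OF r(3), of "\<eta> + rvec k"] by linarith
        then have "(cmod (F (\<eta> + rvec k)))\<^sup>2 * wt s (\<eta> + rvec k) \<le> (cmod (F (\<eta> + rvec k)))\<^sup>2 * (J * rpow (norm (\<eta> + rvec k)) (2 * n))"
          by (rule mult_left_mono) simp
        then have "ennreal ((cmod (F (\<eta> + rvec k)))\<^sup>2 * wt s (\<eta> + rvec k)) \<le> ennreal (J * (rpow (norm (\<eta> + rvec k)) (2 * n) * (cmod (F (\<eta> + rvec k)))\<^sup>2))"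
          by (intro ennreal_leI) (simp add: mult_ac)
        then show ?thesis using False J by (simp add: ennreal_mult')
      qed simp
    qed
    also have "\<dots> = ennreal J * S" unfolding S_def by (rule nn_integral_cmult) simp
    finally have "(\<integral>\<^sup>+ k\<in>-{0}. ennreal ((cmod (F (\<eta> + rvec k)))\<^sup>2 * wt s (\<eta> + rvec k)) \<partial>count_space UNIV) * ennreal B2 \<le> (ennreal J * S) * ennreal B2"
      by (rule mult_right_mono) simp
    with periodize_remainder[OF int q] have "ennreal \<rho> \<le> (ennreal J * S) * ennreal B2"
      unfolding \<rho>_def G_def by (rule order.trans)
    then show ?thesis using J pos by (simp add: ennreal_mult mult_ac)
  qed
  have T0: "rpow (norm \<eta>) (2 * r) * (cmod (F \<eta> - p \<eta> * G))\<^sup>2 \<le> 2 * K * C1\<^sup>2 * a + 2 * K * B1 * \<rho>"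
  proof -
    have "F \<eta> - p \<eta> * G = F \<eta> * (1 - cnj (q \<eta>) * p \<eta>) + (- p \<eta>) * (G - F \<eta> * cnj (q \<eta>))" by (simp add: algebra_simps)
    then have "(cmod (F \<eta> - p \<eta> * G))\<^sup>2 \<le> 2 * (cmod (F \<eta> * (1 - cnj (q \<eta>) * p \<eta>)))\<^sup>2 + 2 * (cmod ((- p \<eta>) * (G - F \<eta> * cnj (q \<eta>))))\<^sup>2"
      by (simp only: cmod_add_square)
    also have "\<dots> = 2 * ((cmod (F \<eta>))\<^sup>2 * (cmod (1 - cnj (q \<eta>) * p \<eta>))\<^sup>2) + 2 * ((cmod (p \<eta>))\<^sup>2 * \<rho>)"
      by (simp add: norm_mult power_mult_distrib \<rho>_def)
    also have "\<dots> \<le> 2 * ((cmod (F \<eta>))\<^sup>2 * (C1 * rpow (norm \<eta>) n)\<^sup>2) + 2 * (B1 * \<rho>)"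
      using a0 by (intro add_mono mult_left_mono mult_right_mono power_mono A1 p2) auto
    also have "\<dots> = 2 * C1\<^sup>2 * a + 2 * B1 * \<rho>" by (simp add: power_mult_distrib rpow_square a_def mult_ac)
    finally have "rpow (norm \<eta>) (2 * r) * (cmod (F \<eta> - p \<eta> * G))\<^sup>2 \<le> K * (2 * C1\<^sup>2 * a + 2 * B1 * \<rho>)"
      using wr(2)[of \<eta>] K K0 by (intro mult_mono) auto
    then show ?thesis by (simp add: algebra_simps)
  qed
  have G2: "(cmod G)\<^sup>2 * ?w \<le> 2 * (B2 * K) * a + 2 * K * \<rho>"
  proof -
    have "(cmod G)\<^sup>2 = (cmod (F \<eta> * cnj (q \<eta>) + (G - F \<eta> * cnj (q \<eta>))))\<^sup>2" by simp
    also have "\<dots> \<le> 2 * (cmod (F \<eta> * cnj (q \<eta>)))\<^sup>2 + 2 * \<rho>" unfolding \<rho>_def by (rule cmod_add_square)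
    also have "\<dots> = 2 * ((cmod (F \<eta>))\<^sup>2 * (cmod (q \<eta>))\<^sup>2) + 2 * \<rho>" by (simp add: norm_mult power_mult_distrib)
    also have "\<dots> \<le> 2 * ((cmod (F \<eta>))\<^sup>2 * (B2 * K)) + 2 * \<rho>" by (intro add_mono mult_left_mono q2) auto
    finally have "(cmod G)\<^sup>2 * ?w \<le> (2 * ((cmod (F \<eta>))\<^sup>2 * (B2 * K)) + 2 * \<rho>) * ?w" by (rule mult_right_mono) simp
    also have "\<dots> = 2 * (B2 * K) * a + 2 * (?w * \<rho>)" by (simp add: a_def algebra_simps)
    also have "\<dots> \<le> 2 * (B2 * K) * a + 2 * (K * \<rho>)"
      using wr(3)[of \<eta>] K a0 K0 pos by (intro add_mono mult_left_mono mult_right_mono) auto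
    finally show ?thesis by simp
  qed
  have T1: "(\<integral>\<^sup>+ l\<in>-{0}. ennreal (rpow (norm (\<eta> + rvec l)) (2 * r) * (cmod (F (\<eta> + rvec l) - p (\<eta> + rvec l) * G))\<^sup>2) \<partial>count_space UNIV)
     \<le> ennreal (2 * J) * S + ennreal (2 * C2 * ((cmod G)\<^sup>2 * ?w))"
  proof -
    have "(\<integral>\<^sup>+ l\<in>-{0}. ennreal (rpow (norm (\<eta> + rvec l)) (2 * r) * (cmod (F (\<eta> + rvec l) - p (\<eta> + rvec l) * G))\<^sup>2) \<partial>count_space UNIV)
      \<le> (\<integral>\<^sup>+ l. ennreal (2 * J) * (ennreal (rpow (norm (\<eta> + rvec l)) (2 * n) * (cmod (F (\<eta> + rvec l)))\<^sup>2) * indicator (-{0}) l)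
         + ennreal (2 * (cmod G)\<^sup>2) * (ennreal (wt s (\<eta> + rvec l) * (cmod (p (\<eta> + rvec l)))\<^sup>2) * indicator (-{0}) l) \<partial>count_space UNIV)"
    proof (intro nn_integral_mono)
      fix l :: "int^'d"
      let ?x = "\<eta> + rvec l"
      show "ennreal (rpow (norm ?x) (2 * r) * (cmod (F ?x - p ?x * G))\<^sup>2) * indicator (-{0}) l
        \<le> ennreal (2 * J) * (ennreal (rpow (norm ?x) (2 * n) * (cmod (F ?x))\<^sup>2) * indicator (-{0}) l)
         + ennreal (2 * (cmod G)\<^sup>2) * (ennreal (wt s ?x * (cmod (p ?x))\<^sup>2) * indicator (-{0}) l)"
      proof (cases "l = 0")
        case False
        have "(cmod (F ?x - p ?x * G))\<^sup>2 \<le> 2 * (cmod (F ?x))\<^sup>2 + 2 * (cmod (- (p ?x * G)))\<^sup>2"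
          using cmod_add_square[of "F ?x" "- (p ?x * G)"] by simp
        then have "rpow (norm ?x) (2 * r) * (cmod (F ?x - p ?x * G))\<^sup>2 \<le> rpow (norm ?x) (2 * r) * (2 * (cmod (F ?x))\<^sup>2 + 2 * (cmod (- (p ?x * G)))\<^sup>2)"
          by (rule mult_left_mono) simp
        also have "\<dots> = rpow (norm ?x) (2 * r) * (2 * (cmod (F ?x))\<^sup>2) + rpow (norm ?x) (2 * r) * (2 * ((cmod (p ?x))\<^sup>2 * (cmod G)\<^sup>2))"
          by (simp add: norm_mult power_mult_distrib distrib_left)
        also have "\<dots> \<le> (J * rpow (norm ?x) (2 * n)) * (2 * (cmod (F ?x))\<^sup>2) + wt s ?x * (2 * ((cmod (p ?x))\<^sup>2 * (cmod G)\<^sup>2))"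
          using wr(1)[of ?x] wr(2)[of ?x] far[OF False] by (intro add_mono mult_right_mono) auto
        also have "\<dots> = (2 * J) * (rpow (norm ?x) (2 * n) * (cmod (F ?x))\<^sup>2) + (2 * (cmod G)\<^sup>2) * (wt s ?x * (cmod (p ?x))\<^sup>2)"
          by (simp add: mult_ac)
        finally have "ennreal (rpow (norm ?x) (2 * r) * (cmod (F ?x - p ?x * G))\<^sup>2)
           \<le> ennreal ((2 * J) * (rpow (norm ?x) (2 * n) * (cmod (F ?x))\<^sup>2) + (2 * (cmod G)\<^sup>2) * (wt s ?x * (cmod (p ?x))\<^sup>2))"
          by (rule ennreal_leI)
        also have "\<dots> = ennreal (2 * J) * ennreal (rpow (norm ?x) (2 * n) * (cmod (F ?x))\<^sup>2) + ennreal (2 * (cmod G)\<^sup>2) * ennreal (wt s ?x * (cmod (p ?x))\<^sup>2)"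
          using J by (subst ennreal_plus, simp, simp, subst ennreal_mult, simp, simp, subst ennreal_mult) simp_all
        finally show ?thesis using False by simp
      qed simp
    qed
    also have "\<dots> = ennreal (2 * J) * S + ennreal (2 * (cmod G)\<^sup>2) * (\<integral>\<^sup>+ l\<in>-{0}. ennreal (wt s (\<eta> + rvec l) * (cmod (p (\<eta> + rvec l)))\<^sup>2) \<partial>count_space UNIV)"
      unfolding S_def by (simp add: nn_integral_add nn_integral_cmult)
    also have "\<dots> \<le> ennreal (2 * J) * S + ennreal (2 * (cmod G)\<^sup>2) * ennreal (C2 * ?w)"
      by (intro add_mono mult_left_mono A2) auto
    also have "ennreal (2 * (cmod G)\<^sup>2) * ennreal (C2 * ?w) = ennreal (2 * C2 * ((cmod G)\<^sup>2 * ?w))"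
      using pos by (simp add: ennreal_mult[symmetric] mult_ac)
    finally show ?thesis .
  qed
  define c1 where "c1 = 2 * K * C1\<^sup>2 + 4 * C2 * B2 * K"
  define c2 where "c2 = 2 * K * B1 + 4 * C2 * K"
  define C where "C = c1 + c2 * (J * B2) + 2 * J"
  have c0: "0 \<le> c1" "0 \<le> c2" unfolding c1_def c2_def using K0 pos by auto
  then have c: "0 \<le> c1" "0 \<le> c2" "0 \<le> c2 * (J * B2)" "0 \<le> 2 * J" using pos J by auto
  have "(\<integral>\<^sup>+ l. ennreal (rpow (norm (\<eta> + rvec l)) (2 * r) * (cmod (F (\<eta> + rvec l) - p (\<eta> + rvec l) * G))\<^sup>2) \<partial>count_space UNIV)
    = ennreal (rpow (norm \<eta>) (2 * r) * (cmod (F \<eta> - p \<eta> * G))\<^sup>2)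
     + (\<integral>\<^sup>+ l\<in>-{0}. ennreal (rpow (norm (\<eta> + rvec l)) (2 * r) * (cmod (F (\<eta> + rvec l) - p (\<eta> + rvec l) * G))\<^sup>2) \<partial>count_space UNIV)"
    by (subst nn_integral_count_split_0) simp
  also have "\<dots> \<le> ennreal (2 * K * C1\<^sup>2 * a + 2 * K * B1 * \<rho>) + (ennreal (2 * J) * S + ennreal (2 * C2 * ((cmod G)\<^sup>2 * ?w)))"
    by (intro add_mono ennreal_leI T0 T1)
  also have "\<dots> \<le> ennreal (2 * K * C1\<^sup>2 * a + 2 * K * B1 * \<rho>) + (ennreal (2 * J) * S + ennreal (2 * C2 * (2 * (B2 * K) * a + 2 * K * \<rho>)))"
    using pos by (intro add_mono order_refl ennreal_leI mult_left_mono G2) auto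
  also have "\<dots> = ennreal ((2 * K * C1\<^sup>2 * a + 2 * K * B1 * \<rho>) + 2 * C2 * (2 * (B2 * K) * a + 2 * K * \<rho>)) + ennreal (2 * J) * S"
    using pos K0 a0 by (subst ennreal_plus) (auto simp: ac_simps)
  also have "(2 * K * C1\<^sup>2 * a + 2 * K * B1 * \<rho>) + 2 * C2 * (2 * (B2 * K) * a + 2 * K * \<rho>) = c1 * a + c2 * \<rho>"
    unfolding c1_def c2_def by (simp add: algebra_simps)
  also have "ennreal (c1 * a + c2 * \<rho>) = ennreal c1 * ennreal a + ennreal c2 * ennreal \<rho>"
    using c a0 by (subst ennreal_plus, simp, simp, subst ennreal_mult, simp, simp, subst ennreal_mult) simp_all
  also have "ennreal c1 * ennreal a + ennreal c2 * ennreal \<rho> + ennreal (2 * J) * S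
     \<le> ennreal c1 * ennreal a + ennreal c2 * (ennreal (J * B2) * S) + ennreal (2 * J) * S"
    by (intro add_mono mult_left_mono rho order_refl) auto
  also have "\<dots> = ennreal c1 * ennreal a + ennreal (c2 * (J * B2) + 2 * J) * S"
  proof -
    have "ennreal (c2 * (J * B2) + 2 * J) = ennreal c2 * ennreal (J * B2) + ennreal (2 * J)"
      by (subst ennreal_plus[OF c(3,4)]) (simp only: ennreal_mult'[OF c(2)])
    then show ?thesis by (simp only: distrib_right mult.assoc add.assoc)
  qed
  also have "\<dots> \<le> ennreal C * ennreal a + ennreal C * S"
    by (rule add_mono[OF mult_right_mono[OF ennreal_leI] mult_right_mono[OF ennreal_leI]])
      (use c in \<open>auto simp: C_def\<close>)
  also have "\<dots> = ennreal C * (ennreal a + S)" by (simp add: distrib_left)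
  also have "ennreal a + S = (\<integral>\<^sup>+ l. ennreal (rpow (norm (\<eta> + rvec l)) (2 * n) * (cmod (F (\<eta> + rvec l)))\<^sup>2) \<partial>count_space UNIV)"
    unfolding a_def S_def by (subst (2) nn_integral_count_split_0) simp
  finally show ?thesis unfolding C_def c1_def c2_def .
qed

lemma wL2_mono: "s \<le> n \<Longrightarrow> wL2 n g \<Longrightarrow> wL2 s g"
  unfolding wL2_def Wn_def
  by (auto elim!: order.strict_trans1[rotated] intro!: nn_integral_mono ennreal_leI mult_left_mono wt_mono)

lemma wL2_cnj: "wL2 s g \<Longrightarrow> wL2 s (\<lambda>\<xi>. cnj (g \<xi>))"
  unfolding wL2_def Wn_def by auto

lemma core_estimate:
  fixes p q :: "real^'d \<Rightarrow> complex"
  assumes r: "0 \<le> r" "r \<le> s" "s \<le> n" and pos: "0 \<le> C1" "0 \<le> C2" "0 \<le> B1" "0 \<le> B2"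
    and [measurable]: "p \<in> borel_measurable borel" and q: "wL2 (- s) q"
    and B1: "AE \<eta> in lborel. bracket s p \<eta> \<le> ennreal B1" and B2: "AE \<eta> in lborel. bracket (- s) q \<eta> \<le> ennreal B2"
    and A1: "\<And>\<eta>. \<eta> \<in> torus \<Longrightarrow> cmod (1 - cnj (q \<eta>) * p \<eta>) \<le> C1 * rpow (norm \<eta>) n"
    and A2: "\<And>\<eta>. \<eta> \<in> torus \<Longrightarrow> (\<integral>\<^sup>+ k\<in>-{0}. ennreal (wt s (\<eta> + rvec k) * (cmod (p (\<eta> + rvec k)))\<^sup>2) \<partial>count_space UNIV) \<le> ennreal (C2 * rpow (norm \<eta>) (2 * n))"
  shows "\<exists>C>0. \<forall>F. wL2 n F \<longrightarrow>
     (\<integral>\<^sup>+ \<xi>. ennreal (rpow (norm \<xi>) (2 * r) * (cmod (F \<xi> - p \<xi> * periodize (\<lambda>\<xi>. F \<xi> * cnj (q \<xi>)) \<xi>))\<^sup>2) \<partial>lborel)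
     \<le> ennreal C * (\<integral>\<^sup>+ \<xi>. ennreal (rpow (norm \<xi>) (2 * n) * (cmod (F \<xi>))\<^sup>2) \<partial>lborel)"
proof -
  define K where "K = (1 + (real CARD('d))\<^sup>2) powr n"
  have n: "0 \<le> n" using r by simp
  have K: "wt n \<eta> \<le> K" if "\<eta> \<in> torus" for \<eta> :: "real^'d"
    unfolding wt_def K_def using torus_norm_le[OF that] n by (intro powr_mono2 add_mono power_mono) auto
  define C where "C = 2 * K * C1\<^sup>2 + 4 * C2 * B2 * K + (2 * K * B1 + 4 * C2 * K) * (5 powr n * B2) + 2 * 5 powr n"
  have K0: "0 \<le> K" by (simp add: K_def)
  have C: "C > 0" unfolding C_def by (intro add_nonneg_pos add_nonneg_nonneg mult_nonneg_nonneg pos K0) auto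
  have [measurable]: "q \<in> borel_measurable borel" using q by (simp add: wL2_def)
  show ?thesis
  proof (intro exI[of _ C] conjI allI impI C)
    fix F :: "real^'d \<Rightarrow> complex" assume F: "wL2 n F"
    have [measurable]: "F \<in> borel_measurable borel" using F by (simp add: wL2_def)
    let ?G = "periodize (\<lambda>\<xi>. F \<xi> * cnj (q \<xi>))"
    have "integrable lborel (\<lambda>\<xi>. F \<xi> * cnj (q \<xi>))"
      using wL2_mono[OF r(3) F] wL2_cnj[OF q] by (rule integrable_wL2_mult)
    then have int: "AE \<eta> in tor. integrable (count_space UNIV) (\<lambda>k. F (\<eta> + rvec k) * cnj (q (\<eta> + rvec k)))"
      by (rule AE_integrable_tiling)
    have "(\<integral>\<^sup>+ \<xi>. ennreal (rpow (norm \<xi>) (2 * r) * (cmod (F \<xi> - p \<xi> * ?G \<xi>))\<^sup>2) \<partial>lborel)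
      = (\<integral>\<^sup>+ \<eta>. (\<integral>\<^sup>+ l. ennreal (rpow (norm (\<eta> + rvec l)) (2 * r) * (cmod (F (\<eta> + rvec l) - p (\<eta> + rvec l) * ?G \<eta>))\<^sup>2) \<partial>count_space UNIV) \<partial>tor)"
      by (subst nn_integral_tiling_tor) (auto simp: periodize_shift)
    also have "\<dots> \<le> (\<integral>\<^sup>+ \<eta>. ennreal C * (\<integral>\<^sup>+ l. ennreal (rpow (norm (\<eta> + rvec l)) (2 * n) * (cmod (F (\<eta> + rvec l)))\<^sup>2) \<partial>count_space UNIV) \<partial>tor)"
    proof (rule nn_integral_mono_AE)
      show "AE \<eta> in tor. (\<integral>\<^sup>+ l. ennreal (rpow (norm (\<eta> + rvec l)) (2 * r) * (cmod (F (\<eta> + rvec l) - p (\<eta> + rvec l) * ?G \<eta>))\<^sup>2) \<partial>count_space UNIV)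
        \<le> ennreal C * (\<integral>\<^sup>+ l. ennreal (rpow (norm (\<eta> + rvec l)) (2 * n) * (cmod (F (\<eta> + rvec l)))\<^sup>2) \<partial>count_space UNIV)"
        using int AE_tor[OF B1] AE_tor[OF B2] AE_tor_torus
      proof eventually_elim
        case (elim \<eta>)
        show ?case unfolding C_def
          by (rule torus_estimate[OF r pos elim(4) elim(1) elim(2) elim(3) A1 A2 K]) (rule elim(4))+
      qed
    qed
    also have "\<dots> = ennreal C * (\<integral>\<^sup>+ \<eta>. (\<integral>\<^sup>+ l. ennreal (rpow (norm (\<eta> + rvec l)) (2 * n) * (cmod (F (\<eta> + rvec l)))\<^sup>2) \<partial>count_space UNIV) \<partial>tor)"
    proof (rule nn_integral_cmult)
      interpret CC: sigma_finite_measure "count_space UNIV :: (int^'d) measure"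
        by (rule sigma_finite_measure_count_space)
      have "(\<lambda>(\<eta>, l). ennreal (rpow (norm (\<eta> + rvec l)) (2 * n) * (cmod (F (\<eta> + rvec l)))\<^sup>2)) \<in> borel_measurable (tor \<Otimes>\<^sub>M count_space (UNIV :: (int^'d) set))"
        by (subst measurable_pair_swap_iff, rule measurable_pair_measure_countable1) auto
      from CC.borel_measurable_nn_integral_fst[OF this]
      show "(\<lambda>\<eta>. (\<integral>\<^sup>+ l. ennreal (rpow (norm (\<eta> + rvec l)) (2 * n) * (cmod (F (\<eta> + rvec l)))\<^sup>2) \<partial>count_space UNIV)) \<in> borel_measurable tor" by simp
    qed
    also have "\<dots> = ennreal C * (\<integral>\<^sup>+ \<xi>. ennreal (rpow (norm \<xi>) (2 * n) * (cmod (F \<xi>))\<^sup>2) \<partial>lborel)"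
      by (subst nn_integral_tiling_tor) auto
    finally show "(\<integral>\<^sup>+ \<xi>. ennreal (rpow (norm \<xi>) (2 * r) * (cmod (F \<xi> - p \<xi> * ?G \<xi>))\<^sup>2) \<partial>lborel)
       \<le> ennreal C * (\<integral>\<^sup>+ \<xi>. ennreal (rpow (norm \<xi>) (2 * n) * (cmod (F \<xi>))\<^sup>2) \<partial>lborel)" .
  qed
qed

subsection \<open>The quasi-projection operators\<close>

lemma mat_powi_cancel:
  assumes "invertible (rmat M)"
  shows "mat_powi (transpose (rmat M)) j *v (mat_powi (transpose (rmat M)) (- j) *v \<xi>) = \<xi>"
  using mat_powi_inverse[OF transpose_invertible[OF assms], of j]
  by (simp_all add: matrix_vector_mul_assoc)

lemma det_mat_powi_transpose:
  assumes "invertible (rmat M)"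
  shows "\<bar>det (mat_powi (transpose (rmat M)) j)\<bar> = real_of_int \<bar>det M\<bar> powr of_int j"
  using det_mat_powi[OF transpose_invertible[OF assms], of j] by (simp add: det_rmat)

lemma fhat_borel: "T \<in> Hs s \<Longrightarrow> fhat T \<in> borel_measurable borel"
  using HsD(1) by (auto simp: wL2_def)

lemma det_pos:
  assumes "invertible (rmat M)" shows "0 < real_of_int \<bar>det M\<bar>"
  using assms by (simp add: invertible_det_nz det_rmat)

lemma pairing_dilate:
  fixes j :: int
  assumes M: "invertible (rmat M)" and f: "f \<in> Hs s" and \<phi>': "\<phi>' \<in> Hs (- s)"
  defines "F \<equiv> \<lambda>\<eta>. fhat f (mat_powi (transpose (rmat M)) j *v \<eta>)"
  shows "pairing f (dilate M \<phi>' j k)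
    = of_real (real_of_int \<bar>det M\<bar> powr (real_of_int j / 2)) * fcoef (periodize (\<lambda>\<xi>. F \<xi> * cnj (fhat \<phi>' \<xi>))) k"
proof -
  let ?m = "real_of_int \<bar>det M\<bar>" and ?q = "fhat \<phi>'"
  let ?B = "mat_powi (transpose (rmat M)) j" and ?B' = "mat_powi (transpose (rmat M)) (- j)"
  have m: "0 < ?m" using det_pos[OF M] .
  have q: "wL2 (- s) ?q" and \<phi>'q: "of_hat ?q = \<phi>'" using HsD[OF \<phi>'] by auto
  have fs: "wL2 s (fhat f)" using HsD(1)[OF f] .
  have [measurable]: "?q \<in> borel_measurable borel" "fhat f \<in> borel_measurable borel"
    using fhat_borel f \<phi>' by auto
  have F: "wL2 s F" unfolding F_def by (intro wL2_matrix invertible_mat_powi transpose_invertible M fs)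
  have [measurable]: "F \<in> borel_measurable borel" using F by (simp add: wL2_def)
  have d: "dilate M \<phi>' j k = of_hat (dil_hat M ?q j k)" using dilate_of_hat[OF M q] \<phi>'q by simp
  have wd: "wL2 (- s) (dil_hat M ?q j k)" by (rule wL2_dil_hat[OF M q])
  have [measurable]: "dil_hat M ?q j k \<in> borel_measurable borel" using wd by (simp add: wL2_def)
  have [measurable]: "fhat (of_hat (dil_hat M ?q j k)) \<in> borel_measurable borel" using fhat_borel[OF of_hat_Hs[OF wd]] .
  define U where "U \<eta> = of_real (?m powr (- real_of_int j / 2)) * (F \<eta> * cnj (?q \<eta>) * ee (- (rvec k \<bullet> \<eta>)))" for \<eta>
  have [measurable]: "U \<in> borel_measurable borel" unfolding U_def by measurable
  have "pairing f (dilate M \<phi>' j k) = (LINT \<xi>|lborel. fhat f \<xi> * cnj (dil_hat M ?q j k \<xi>))"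
    unfolding pairing_def d by (intro integral_cong_AE) (use fhat_of_hat[OF wd] in auto)
  also have "\<dots> = (LINT \<xi>|lborel. U (?B' *v \<xi>))"
    by (intro Bochner_Integration.integral_cong refl)
      (simp add: U_def F_def dil_hat_def mat_powi_cancel[OF M] cnj_ee mult_ac)
  also have "\<dots> = (1 / \<bar>det ?B'\<bar>) *\<^sub>R (LINT \<eta>|lborel. U \<eta>)"
    by (rule integral_matrix[OF invertible_mat_powi[OF transpose_invertible[OF M]]]) measurable
  also have "1 / \<bar>det ?B'\<bar> = ?m powr real_of_int j"
    unfolding det_mat_powi_transpose[OF M] using m by (simp add: powr_minus divide_inverse)
  also have "(LINT \<eta>|lborel. U \<eta>) = of_real (?m powr (- real_of_int j / 2)) * fcoef (periodize (\<lambda>\<xi>. F \<xi> * cnj (?q \<xi>))) k"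
    unfolding U_def by (subst fcoef_periodize) (auto intro: integrable_wL2_mult[OF F wL2_cnj[OF q]])
  finally have "pairing f (dilate M \<phi>' j k) = of_real (?m powr real_of_int j * ?m powr (- real_of_int j / 2)) * fcoef (periodize (\<lambda>\<xi>. F \<xi> * cnj (?q \<xi>))) k"
    by (simp add: scaleR_conv_of_real mult.assoc)
  also have "?m powr real_of_int j * ?m powr (- real_of_int j / 2) = ?m powr (real_of_int j / 2)"
    by (simp flip: powr_add)
  finally show ?thesis .
qed

lemma quasi_proj_term_of_hat:
  fixes j :: int
  assumes M: "invertible (rmat M)" and f: "f \<in> Hs s" and \<phi>: "\<phi> \<in> Hs s" and \<phi>': "\<phi>' \<in> Hs (- s)"
  defines "F \<equiv> \<lambda>\<eta>. fhat f (mat_powi (transpose (rmat M)) j *v \<eta>)"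
  defines "B' \<equiv> mat_powi (transpose (rmat M)) (- j)"
  shows "quasi_proj_term M \<phi> \<phi>' j f k
     = of_hat (\<lambda>\<xi>. fhat \<phi> (B' *v \<xi>) * (fcoef (periodize (\<lambda>\<xi>. F \<xi> * cnj (fhat \<phi>' \<xi>))) k * ee (rvec k \<bullet> (B' *v \<xi>))))"
proof -
  let ?m = "real_of_int \<bar>det M\<bar>"
  have m: "0 < ?m" using det_pos[OF M] .
  have d: "dilate M \<phi> j k = of_hat (dil_hat M (fhat \<phi>) j k)"
    using dilate_of_hat[OF M HsD(1)[OF \<phi>]] HsD(2)[OF \<phi>] by simp
  have e: "?m powr (real_of_int j / 2) * ?m powr (- real_of_int j / 2) = 1"
    using m by (simp flip: powr_add)
  have "of_real (?m powr (real_of_int j / 2)) * c * dil_hat M (fhat \<phi>) j k \<xi>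
     = of_real (?m powr (real_of_int j / 2) * ?m powr (- real_of_int j / 2)) * (fhat \<phi> (B' *v \<xi>) * (c * ee (rvec k \<bullet> (B' *v \<xi>))))" for c \<xi>
    by (simp add: dil_hat_def B'_def mult_ac)
  then have h: "of_real (?m powr (real_of_int j / 2)) * c * dil_hat M (fhat \<phi>) j k \<xi> = fhat \<phi> (B' *v \<xi>) * (c * ee (rvec k \<bullet> (B' *v \<xi>)))" for c \<xi>
    unfolding e by simp
  show ?thesis
    unfolding quasi_proj_term_def pairing_dilate[OF M f \<phi>'] d of_hat_cmult h F_def ..
qed

lemma Hs_has_sum_unique:
  assumes "Hs_has_sum s a S" "Hs_has_sum s a S'"
  shows "S = S'"
proof -
  have a: "wL2 s (fhat (a k))" "a k = of_hat (fhat (a k))" for k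
    using assms(1) HsD unfolding Hs_has_sum_def by blast+
  have S: "wL2 s (fhat S)" "S = of_hat (fhat S)" "wL2 s (fhat S')" "S' = of_hat (fhat S')"
    using assms HsD unfolding Hs_has_sum_def by blast+
  let ?A = "\<lambda>F \<xi>. \<Sum>k\<in>F. fhat (a k) \<xi>"
  have A: "wL2 s (?A F)" for F by (intro wL2_sum a)
  have sum: "(\<Sum>k\<in>F. a k \<psi>) = of_hat (?A F) \<psi>" for F \<psi>
    using fun_cong[OF of_hat_sum[of F s "\<lambda>k. fhat (a k)", OF a(1)], of \<psi>] a(2) by simp
  have N: "Hs_norm2 s (\<lambda>\<psi>. T \<psi> - (\<Sum>k\<in>F. a k \<psi>)) = Wn s (\<lambda>\<xi>. fhat T \<xi> - ?A F \<xi>)"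
    if "wL2 s (fhat T)" "T = of_hat (fhat T)" for T F
  proof -
    have "(\<lambda>\<psi>. T \<psi> - (\<Sum>k\<in>F. a k \<psi>)) = of_hat (\<lambda>\<xi>. fhat T \<xi> - ?A F \<xi>)"
      unfolding sum of_hat_diff[OF that(1) A, symmetric] using that(2) by simp
    then show ?thesis using Hs_norm2_of_hat[OF wL2_diff[OF that(1) A]] by simp
  qed
  have lim: "((\<lambda>F. Wn s (\<lambda>\<xi>. fhat S \<xi> - ?A F \<xi>)) \<longlongrightarrow> 0) (finite_subsets_at_top UNIV)"
    "((\<lambda>F. Wn s (\<lambda>\<xi>. fhat S' \<xi> - ?A F \<xi>)) \<longlongrightarrow> 0) (finite_subsets_at_top UNIV)"
    using assms unfolding Hs_has_sum_def N[OF S(1,2)] N[OF S(3,4)] by blast+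
  have [measurable]: "fhat S \<in> borel_measurable borel" "fhat S' \<in> borel_measurable borel" "?A F \<in> borel_measurable borel" for F
    using S A by (auto simp: wL2_def)
  have "Wn s (\<lambda>\<xi>. fhat S \<xi> - fhat S' \<xi>) \<le> 0"
  proof (rule tendsto_lowerbound)
    show "((\<lambda>F. 2 * Wn s (\<lambda>\<xi>. fhat S \<xi> - ?A F \<xi>) + 2 * Wn s (\<lambda>\<xi>. fhat S' \<xi> - ?A F \<xi>)) \<longlongrightarrow> 0) (finite_subsets_at_top UNIV)"
      using tendsto_add[OF ennreal_tendsto_cmult[OF _ lim(1), of 2] ennreal_tendsto_cmult[OF _ lim(2), of 2]] by simp
    show "\<forall>\<^sub>F F in finite_subsets_at_top UNIV. Wn s (\<lambda>\<xi>. fhat S \<xi> - fhat S' \<xi>)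
       \<le> 2 * Wn s (\<lambda>\<xi>. fhat S \<xi> - ?A F \<xi>) + 2 * Wn s (\<lambda>\<xi>. fhat S' \<xi> - ?A F \<xi>)"
    proof (intro always_eventually allI)
      fix F
      have "Wn s (\<lambda>\<xi>. fhat S \<xi> - fhat S' \<xi>) = Wn s (\<lambda>\<xi>. (fhat S \<xi> - ?A F \<xi>) + (-1) * (fhat S' \<xi> - ?A F \<xi>))" by simp
      also have "\<dots> \<le> 2 * Wn s (\<lambda>\<xi>. fhat S \<xi> - ?A F \<xi>) + 2 * Wn s (\<lambda>\<xi>. (-1) * (fhat S' \<xi> - ?A F \<xi>))"
        by (rule Wn_add_le) measurable
      also have "Wn s (\<lambda>\<xi>. (-1) * (fhat S' \<xi> - ?A F \<xi>)) = Wn s (\<lambda>\<xi>. fhat S' \<xi> - ?A F \<xi>)"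
        by (subst Wn_cmult) auto
      finally show "Wn s (\<lambda>\<xi>. fhat S \<xi> - fhat S' \<xi>)
       \<le> 2 * Wn s (\<lambda>\<xi>. fhat S \<xi> - ?A F \<xi>) + 2 * Wn s (\<lambda>\<xi>. fhat S' \<xi> - ?A F \<xi>)" .
    qed
  qed simp
  then have "AE \<xi> in lborel. ennreal ((cmod (fhat S \<xi> - fhat S' \<xi>))\<^sup>2 * wt s \<xi>) = 0"
    unfolding Wn_def by (subst (asm) le_zero_eq, subst (asm) nn_integral_0_iff_AE) auto
  then have "AE \<xi> in lborel. fhat S \<xi> = fhat S' \<xi>"
  proof eventually_elim
    case (elim \<xi>)
    then show ?case using wt_pos[of s \<xi>] by (auto simp: ennreal_eq_0_iff mult_le_0_iff)
  qed
  then have "of_hat (fhat S) = of_hat (fhat S')" by (rule of_hat_cong_AE) measurable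
  then show ?thesis using S by simp
qed

lemma quasi_proj_has_sum:
  fixes j :: int
  assumes M: "invertible (rmat M)" and f: "f \<in> Hs s" and \<phi>: "\<phi> \<in> Hs s" and \<phi>': "\<phi>' \<in> Hs (- s)"
    and B1: "AE \<eta> in lborel. bracket s (fhat \<phi>) \<eta> \<le> ennreal B1" and B2: "AE \<eta> in lborel. bracket (- s) (fhat \<phi>') \<eta> \<le> ennreal B2"
  defines "F \<equiv> \<lambda>\<eta>. fhat f (mat_powi (transpose (rmat M)) j *v \<eta>)"
  defines "B' \<equiv> mat_powi (transpose (rmat M)) (- j)"
  defines "G \<equiv> periodize (\<lambda>\<xi>. F \<xi> * cnj (fhat \<phi>' \<xi>))"
  shows "Hs_has_sum s (quasi_proj_term M \<phi> \<phi>' j f) (of_hat (\<lambda>\<xi>. fhat \<phi> (B' *v \<xi>) * G (B' *v \<xi>)))"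
    and "wL2 s (\<lambda>\<xi>. fhat \<phi> (B' *v \<xi>) * G (B' *v \<xi>))"
proof -
  let ?p = "fhat \<phi>" and ?q = "fhat \<phi>'"
  have p: "wL2 s ?p" and q: "wL2 (- s) ?q" and fs: "wL2 s (fhat f)" using HsD(1) \<phi> \<phi>' f by auto
  have inv: "invertible (mat_powi (transpose (rmat M)) i)" for i by (intro invertible_mat_powi transpose_invertible M)
  have F: "wL2 s F" unfolding F_def by (intro wL2_matrix inv fs)
  have [measurable]: "?p \<in> borel_measurable borel" "?q \<in> borel_measurable borel" "F \<in> borel_measurable borel"
    using p q F by (auto simp: wL2_def)
  have [measurable]: "G \<in> borel_measurable borel" unfolding G_def by measurable
  note conv = partial_sums_converge[OF F _ q B1 B2, folded G_def, simplified]
  have pG: "wL2 s (\<lambda>\<eta>. ?p \<eta> * G \<eta>)" by (rule conv(2)) measurable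
  show w: "wL2 s (\<lambda>\<xi>. ?p (B' *v \<xi>) * G (B' *v \<xi>))"
    unfolding B'_def using wL2_matrix[OF inv pG] .
  let ?t = "\<lambda>k \<eta>. ?p \<eta> * (fcoef G k * ee (rvec k \<bullet> \<eta>))"
  have t: "wL2 s (\<lambda>\<xi>. ?t k (B' *v \<xi>))" for k
  proof -
    have "wL2 s (?t k)"
      using wL2_cmult[OF wL2_mult_bounded[OF p, of "\<lambda>\<eta>. ee (rvec k \<bullet> \<eta>)"], of "fcoef G k"] by (simp add: mult_ac)
    then show ?thesis unfolding B'_def by (rule wL2_matrix[OF inv])
  qed
  have tm: "quasi_proj_term M \<phi> \<phi>' j f k = of_hat (\<lambda>\<xi>. ?t k (B' *v \<xi>))" for k
    using quasi_proj_term_of_hat[OF M f \<phi> \<phi>', of j k] unfolding G_def F_def B'_def .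
  obtain C :: real where C: "\<forall>g \<in> borel_measurable borel. Wn s (\<lambda>\<xi>. g (B' *v \<xi>)) \<le> ennreal C * Wn s g"
    using Wn_matrix[OF inv[of "- j"], of s] unfolding B'_def by (rule exE)
  let ?D = "\<lambda>A \<eta>. ?p \<eta> * (G \<eta> - (\<Sum>k\<in>A. fcoef G k * ee (rvec k \<bullet> \<eta>)))"
  have N: "Hs_norm2 s (\<lambda>\<psi>. of_hat (\<lambda>\<xi>. ?p (B' *v \<xi>) * G (B' *v \<xi>)) \<psi> - (\<Sum>k\<in>A. quasi_proj_term M \<phi> \<phi>' j f k \<psi>)) \<le> ennreal C * Wn s (?D A)" for A
  proof -
    have "(\<Sum>k\<in>A. quasi_proj_term M \<phi> \<phi>' j f k \<psi>) = of_hat (\<lambda>\<xi>. \<Sum>k\<in>A. ?t k (B' *v \<xi>)) \<psi>" for \<psi>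
      unfolding tm using fun_cong[OF of_hat_sum[of A s "\<lambda>k \<xi>. ?t k (B' *v \<xi>)", OF t], of \<psi>] by simp
    then have "(\<lambda>\<psi>. of_hat (\<lambda>\<xi>. ?p (B' *v \<xi>) * G (B' *v \<xi>)) \<psi> - (\<Sum>k\<in>A. quasi_proj_term M \<phi> \<phi>' j f k \<psi>))
      = of_hat (\<lambda>\<xi>. ?p (B' *v \<xi>) * G (B' *v \<xi>) - (\<Sum>k\<in>A. ?t k (B' *v \<xi>)))"
      by (simp only: of_hat_diff[OF w wL2_sum[of A s "\<lambda>k \<xi>. ?t k (B' *v \<xi>)", OF t]])
    then have "Hs_norm2 s (\<lambda>\<psi>. of_hat (\<lambda>\<xi>. ?p (B' *v \<xi>) * G (B' *v \<xi>)) \<psi> - (\<Sum>k\<in>A. quasi_proj_term M \<phi> \<phi>' j f k \<psi>))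
       = Wn s (\<lambda>\<xi>. ?p (B' *v \<xi>) * G (B' *v \<xi>) - (\<Sum>k\<in>A. ?t k (B' *v \<xi>)))"
      using Hs_norm2_of_hat[OF wL2_diff[OF w wL2_sum[of A s "\<lambda>k \<xi>. ?t k (B' *v \<xi>)", OF t]]] by simp
    also have "\<dots> = Wn s (\<lambda>\<xi>. ?D A (B' *v \<xi>))" by (simp add: right_diff_distrib sum_distrib_left)
    also have "\<dots> \<le> ennreal C * Wn s (?D A)" by (rule bspec[OF C]) measurable
    finally show ?thesis .
  qed
  show "Hs_has_sum s (quasi_proj_term M \<phi> \<phi>' j f) (of_hat (\<lambda>\<xi>. ?p (B' *v \<xi>) * G (B' *v \<xi>)))"
    unfolding Hs_has_sum_def
  proof (intro conjI allI)
    show "quasi_proj_term M \<phi> \<phi>' j f k \<in> Hs s" for k unfolding tm by (rule of_hat_Hs[OF t])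
    show "of_hat (\<lambda>\<xi>. ?p (B' *v \<xi>) * G (B' *v \<xi>)) \<in> Hs s" by (rule of_hat_Hs[OF w])
    have "((\<lambda>A. Wn s (?D A)) \<longlongrightarrow> 0) (finite_subsets_at_top UNIV)" by (rule conv(1)) measurable
    then have "((\<lambda>A. ennreal C * Wn s (?D A)) \<longlongrightarrow> 0) (finite_subsets_at_top UNIV)"
      using ennreal_tendsto_cmult[of "ennreal C"] by fastforce
    then show "((\<lambda>A. Hs_norm2 s (\<lambda>\<psi>. of_hat (\<lambda>\<xi>. ?p (B' *v \<xi>) * G (B' *v \<xi>)) \<psi> - (\<Sum>k\<in>A. quasi_proj_term M \<phi> \<phi>' j f k \<psi>))) \<longlongrightarrow> 0) (finite_subsets_at_top UNIV)"
      by (rule tendsto_sandwich[OF _ _ tendsto_const, rotated 2]) (auto intro!: always_eventually N)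
  qed
qed

lemma quasi_proj_eq: "Hs_has_sum s (quasi_proj_term M \<phi> \<phi>' j f) S \<Longrightarrow> quasi_proj s M \<phi> \<phi>' j f = S"
  unfolding quasi_proj_def by (rule the_equality) (auto intro: Hs_has_sum_unique)

lemma Hs_seminorm2_of_hat:
  assumes "wL2 s g"
  shows "Hs_seminorm2 r (of_hat g) = (\<integral>\<^sup>+ \<xi>. ennreal (rpow (norm \<xi>) (2 * r) * (cmod (g \<xi>))\<^sup>2) \<partial>lborel)"
  unfolding Hs_seminorm2_def
  by (intro nn_integral_cong_AE) (use fhat_of_hat[OF assms] in \<open>auto elim!: eventually_mono\<close>)

lemma seminorm_matrix_le:
  fixes B :: "real^'d^'d"
  assumes B: "invertible B" and t: "0 \<le> t" and [measurable]: "g \<in> borel_measurable borel"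
  shows "(\<integral>\<^sup>+ \<xi>. ennreal (rpow (norm (B *v \<xi>)) t * (cmod (g \<xi>))\<^sup>2) \<partial>lborel)
     \<le> ennreal (rpow (mat_opnorm B) t) * (\<integral>\<^sup>+ \<xi>. ennreal (rpow (norm \<xi>) t * (cmod (g \<xi>))\<^sup>2) \<partial>lborel)"
proof -
  have o: "0 \<le> mat_opnorm B" unfolding mat_opnorm_def by (rule onorm_pos_le) simp
  have "rpow (norm (B *v \<xi>)) t * (cmod (g \<xi>))\<^sup>2 \<le> rpow (mat_opnorm B) t * (rpow (norm \<xi>) t * (cmod (g \<xi>))\<^sup>2)" for \<xi>
  proof -
    have "norm (B *v \<xi>) \<le> mat_opnorm B * norm \<xi>" unfolding mat_opnorm_def by (rule onorm) simp
    then have "rpow (norm (B *v \<xi>)) t \<le> rpow (mat_opnorm B * norm \<xi>) t" using t by (intro rpow_mono) auto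
    also have "\<dots> = rpow (mat_opnorm B) t * rpow (norm \<xi>) t" using o by (simp add: rpow_mult)
    finally show ?thesis by (simp add: mult_right_mono flip: mult.assoc)
  qed
  from ennreal_leI[OF this]
  have "(\<integral>\<^sup>+ \<xi>. ennreal (rpow (norm (B *v \<xi>)) t * (cmod (g \<xi>))\<^sup>2) \<partial>lborel)
     \<le> (\<integral>\<^sup>+ \<xi>. ennreal (rpow (mat_opnorm B) t) * ennreal (rpow (norm \<xi>) t * (cmod (g \<xi>))\<^sup>2) \<partial>lborel)"
    by (intro nn_integral_mono) (simp add: ennreal_mult')
  also have "\<dots> = ennreal (rpow (mat_opnorm B) t) * (\<integral>\<^sup>+ \<xi>. ennreal (rpow (norm \<xi>) t * (cmod (g \<xi>))\<^sup>2) \<partial>lborel)"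
    by (rule nn_integral_cmult) measurable
  finally show ?thesis .
qed

lemma summable_bound_nn_integral:
  fixes h :: "'k \<Rightarrow> real"
  assumes "h summable_on (UNIV - {a})" "infsum h (UNIV - {a}) \<le> c" and h: "\<And>k. 0 \<le> h k"
  shows "(\<integral>\<^sup>+ k\<in>-{a}. ennreal (h k) \<partial>count_space UNIV) \<le> ennreal c"
proof -
  have "(\<lambda>k. norm (h k)) summable_on (UNIV - {a})" using assms(1) h by simp
  then have s: "Infinite_Set_Sum.abs_summable_on h (UNIV - {a})" by (rule abs_summable_equivalent[THEN iffD1])
  have "(\<integral>\<^sup>+ k\<in>-{a}. ennreal (h k) \<partial>count_space UNIV) = (\<integral>\<^sup>+ k. ennreal (h k) \<partial>count_space (UNIV - {a}))"
    by (simp add: nn_integral_count_space_indicator Compl_eq_Diff_UNIV)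
  also have "\<dots> = ennreal (infsetsum h (UNIV - {a}))" by (rule nn_integral_conv_infsetsum[OF s h])
  also have "\<dots> = ennreal (infsum h (UNIV - {a}))" using infsetsum_infsum[OF s] by simp
  finally show ?thesis using assms(2) by (simp add: ennreal_leI)
qed

theorem theorem3p2:
  fixes M :: "int^'d^'d" and s :: real and \<phi> \<phi>' :: "'d distribution"
  assumes "dilation_matrix M"
    and "s \<ge> 0"
    and "\<phi> \<in> Hs s" and "\<phi>' \<in> Hs (- s)"
    and "compact (dist_support \<phi>)" and "compact (dist_support \<phi>')"
  shows
    "(\<forall>j. (\<forall>k. dilate M \<phi> j k \<in> Hs s \<and> dilate M \<phi>' j k \<in> Hs (- s)) \<and>
          (\<forall>f\<in>Hs s. Hs_has_sum s (quasi_proj_term M \<phi> \<phi>' j f) (quasi_proj s M \<phi> \<phi>' j f))) \<and>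
     (\<forall>(n::real) C\<^sub>1 C\<^sub>2.
        n \<ge> s \<and> C\<^sub>1 > 0 \<and> C\<^sub>2 > 0 \<and>
        (\<forall>\<xi>\<in>torus. cmod (1 - cnj (fhat \<phi>' \<xi>) * fhat \<phi> \<xi>) \<le> C\<^sub>1 * rpow (norm \<xi>) n) \<and>
        (\<forall>\<xi>\<in>torus.
           (\<lambda>k. (1 + (norm (\<xi> + rvec k))\<^sup>2) powr s * (cmod (fhat \<phi> (\<xi> + rvec k)))\<^sup>2)
             summable_on (UNIV - {0}) \<and>
           (\<Sum>\<^sub>\<infinity>k\<in>UNIV - {0}. (1 + (norm (\<xi> + rvec k))\<^sup>2) powr s * (cmod (fhat \<phi> (\<xi> + rvec k)))\<^sup>2)
             \<le> C\<^sub>2 * rpow (norm \<xi>) (2 * n))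
        \<longrightarrow>
        (\<forall>r. 0 \<le> r \<and> r \<le> s \<longrightarrow>
          (\<exists>C>0. \<forall>f\<in>Hs n. \<forall>j.
             Hs_seminorm2 r (\<lambda>\<psi>. f \<psi> - quasi_proj s M \<phi> \<phi>' j f \<psi>)
             \<le> ennreal (C * rpow (mat_opnorm (mat_powi (transpose (rmat M)) j)) (2 * r)
                          * rpow (mat_opnorm (mat_powi (transpose (rmat M)) (- j))) (2 * n))
               * Hs_seminorm2 n f)))"
proof -
  let ?p = "fhat \<phi>" and ?q = "fhat \<phi>'" and ?P = "mat_powi (transpose (rmat M))"
  have M: "invertible (rmat M)" using assms(1) by (rule dilation_invertible)
  have inv: "invertible (?P i)" for i by (intro invertible_mat_powi transpose_invertible M)
  have p: "wL2 s ?p" and q: "wL2 (- s) ?q" using HsD(1) assms by auto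
  have [measurable]: "?p \<in> borel_measurable borel" "?q \<in> borel_measurable borel" using p q by (auto simp: wL2_def)
  obtain B1 where B1: "B1 > 0" "AE \<eta> in lborel. bracket s ?p \<eta> \<le> ennreal B1" using bracket_bound[OF assms(3,5)] by blast
  obtain B2 where B2: "B2 > 0" "AE \<eta> in lborel. bracket (- s) ?q \<eta> \<le> ennreal B2" using bracket_bound[OF assms(4,6)] by blast
  define F where "F j f \<eta> = fhat f (?P j *v \<eta>)" for j f \<eta>
  define G where "G j f = periodize (\<lambda>\<xi>. F j f \<xi> * cnj (?q \<xi>))" for j f
  define Q where "Q j f \<xi> = ?p (?P (- j) *v \<xi>) * G j f (?P (- j) *v \<xi>)" for j f \<xi>
  have sum: "Hs_has_sum s (quasi_proj_term M \<phi> \<phi>' j f) (of_hat (Q j f))" and Q: "wL2 s (Q j f)" if "f \<in> Hs s" for j f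
    using quasi_proj_has_sum[OF M that assms(3,4) B1(2) B2(2), of j] unfolding Q_def[abs_def] G_def F_def by auto
  have dil: "dilate M T j k \<in> Hs t" if "T \<in> Hs t" for T t j k
    using dilate_of_hat[OF M HsD(1)[OF that], of j k] of_hat_Hs[OF wL2_dil_hat[OF M HsD(1)[OF that]]] HsD(2)[OF that] by simp
  have first: "\<forall>j. (\<forall>k. dilate M \<phi> j k \<in> Hs s \<and> dilate M \<phi>' j k \<in> Hs (- s)) \<and>
          (\<forall>f\<in>Hs s. Hs_has_sum s (quasi_proj_term M \<phi> \<phi>' j f) (quasi_proj s M \<phi> \<phi>' j f))"
    using sum quasi_proj_eq dil assms(3,4) by metis
  have second: "\<exists>C>0. \<forall>f\<in>Hs n. \<forall>j.
             Hs_seminorm2 r (\<lambda>\<psi>. f \<psi> - quasi_proj s M \<phi> \<phi>' j f \<psi>)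
             \<le> ennreal (C * rpow (mat_opnorm (?P j)) (2 * r) * rpow (mat_opnorm (?P (- j))) (2 * n)) * Hs_seminorm2 n f"
    if n: "n \<ge> s" and C: "C\<^sub>1 > 0" "C\<^sub>2 > 0"
      and A1: "\<forall>\<xi>\<in>torus. cmod (1 - cnj (?q \<xi>) * ?p \<xi>) \<le> C\<^sub>1 * rpow (norm \<xi>) n"
      and A2: "\<forall>\<xi>\<in>torus.
           (\<lambda>k. (1 + (norm (\<xi> + rvec k))\<^sup>2) powr s * (cmod (?p (\<xi> + rvec k)))\<^sup>2) summable_on (UNIV - {0}) \<and>
           (\<Sum>\<^sub>\<infinity>k\<in>UNIV - {0}. (1 + (norm (\<xi> + rvec k))\<^sup>2) powr s * (cmod (?p (\<xi> + rvec k)))\<^sup>2) \<le> C\<^sub>2 * rpow (norm \<xi>) (2 * n)"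
      and r: "0 \<le> r" "r \<le> s" for n C\<^sub>1 C\<^sub>2 r
  proof -
    have A2': "(\<integral>\<^sup>+ k\<in>-{0}. ennreal (wt s (\<eta> + rvec k) * (cmod (?p (\<eta> + rvec k)))\<^sup>2) \<partial>count_space UNIV) \<le> ennreal (C\<^sub>2 * rpow (norm \<eta>) (2 * n))"
      if "\<eta> \<in> torus" for \<eta>
      using A2 that by (intro summable_bound_nn_integral) (auto simp: wt_def)
    obtain C where C0: "C > 0" and core: "\<And>F. wL2 n F \<Longrightarrow>
       (\<integral>\<^sup>+ \<xi>. ennreal (rpow (norm \<xi>) (2 * r) * (cmod (F \<xi> - ?p \<xi> * periodize (\<lambda>\<xi>. F \<xi> * cnj (?q \<xi>)) \<xi>))\<^sup>2) \<partial>lborel)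
       \<le> ennreal C * (\<integral>\<^sup>+ \<xi>. ennreal (rpow (norm \<xi>) (2 * n) * (cmod (F \<xi>))\<^sup>2) \<partial>lborel)"
      using core_estimate[of r s n C\<^sub>1 C\<^sub>2 B1 B2 ?p ?q] r n C B1 B2 q A1 A2' by auto
    have n0: "0 \<le> n" using r n by simp
    show ?thesis
    proof (intro exI[of _ C] conjI C0 ballI allI)
      fix f :: "'d distribution" and j :: int assume f: "f \<in> Hs n"
      have fn: "wL2 n (fhat f)" and ff: "of_hat (fhat f) = f" using HsD[OF f] by auto
      have fs: "wL2 s (fhat f)" by (rule wL2_mono[OF n fn])
      have fHs: "f \<in> Hs s" using of_hat_Hs[OF fs] ff by simp
      have Fn: "wL2 n (F j f)" unfolding F_def[abs_def] by (rule wL2_matrix[OF inv fn])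
      have [measurable]: "fhat f \<in> borel_measurable borel" "F j f \<in> borel_measurable borel" using fn Fn by (auto simp: wL2_def)
      have [measurable]: "G j f \<in> borel_measurable borel" unfolding G_def by measurable
      let ?d = "\<bar>det (?P (- j))\<bar>"
      have d: "?d > 0" using inv[of "- j"] by (simp add: invertible_det_nz)
      have "(\<lambda>\<psi>. f \<psi> - quasi_proj s M \<phi> \<phi>' j f \<psi>) = of_hat (\<lambda>\<xi>. fhat f \<xi> - Q j f \<xi>)"
        unfolding quasi_proj_eq[OF sum[OF fHs]] of_hat_diff[OF fs Q[OF fHs], symmetric] using ff by simp
      then have "Hs_seminorm2 r (\<lambda>\<psi>. f \<psi> - quasi_proj s M \<phi> \<phi>' j f \<psi>)
         = (\<integral>\<^sup>+ \<xi>. ennreal (rpow (norm \<xi>) (2 * r) * (cmod (fhat f \<xi> - Q j f \<xi>))\<^sup>2) \<partial>lborel)"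
        using Hs_seminorm2_of_hat[OF wL2_diff[OF fs Q[OF fHs]]] by simp
      also have "\<dots> = (\<integral>\<^sup>+ \<xi>. (\<lambda>\<eta>. ennreal (rpow (norm (?P j *v \<eta>)) (2 * r) * (cmod (F j f \<eta> - ?p \<eta> * G j f \<eta>))\<^sup>2)) (?P (- j) *v \<xi>) \<partial>lborel)"
        by (simp add: F_def Q_def mat_powi_cancel[OF M])
      also have "\<dots> = ennreal (1 / ?d) * (\<integral>\<^sup>+ \<eta>. ennreal (rpow (norm (?P j *v \<eta>)) (2 * r) * (cmod (F j f \<eta> - ?p \<eta> * G j f \<eta>))\<^sup>2) \<partial>lborel)"
        by (rule nn_integral_matrix[OF inv]) measurable
      also have "\<dots> \<le> ennreal (1 / ?d) * (ennreal (rpow (mat_opnorm (?P j)) (2 * r)) * (\<integral>\<^sup>+ \<eta>. ennreal (rpow (norm \<eta>) (2 * r) * (cmod (F j f \<eta> - ?p \<eta> * G j f \<eta>))\<^sup>2) \<partial>lborel))"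
        using r by (intro mult_left_mono seminorm_matrix_le inv) auto
      also have "\<dots> \<le> ennreal (1 / ?d) * (ennreal (rpow (mat_opnorm (?P j)) (2 * r)) * (ennreal C * (\<integral>\<^sup>+ \<eta>. ennreal (rpow (norm \<eta>) (2 * n) * (cmod (F j f \<eta>))\<^sup>2) \<partial>lborel)))"
        using core[OF Fn] unfolding G_def by (intro mult_left_mono) auto
      also have "\<dots> = ennreal (rpow (mat_opnorm (?P j)) (2 * r)) * (ennreal C * (ennreal (1 / ?d) * (\<integral>\<^sup>+ \<eta>. ennreal (rpow (norm \<eta>) (2 * n) * (cmod (F j f \<eta>))\<^sup>2) \<partial>lborel)))"
        by (simp only: mult_ac)
      also have "ennreal (1 / ?d) * (\<integral>\<^sup>+ \<eta>. ennreal (rpow (norm \<eta>) (2 * n) * (cmod (F j f \<eta>))\<^sup>2) \<partial>lborel)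
         = (\<integral>\<^sup>+ \<xi>. (\<lambda>\<eta>. ennreal (rpow (norm \<eta>) (2 * n) * (cmod (F j f \<eta>))\<^sup>2)) (?P (- j) *v \<xi>) \<partial>lborel)"
        by (rule nn_integral_matrix[OF inv, symmetric]) measurable
      also have "\<dots> = (\<integral>\<^sup>+ \<xi>. ennreal (rpow (norm (?P (- j) *v \<xi>)) (2 * n) * (cmod (fhat f \<xi>))\<^sup>2) \<partial>lborel)"
        by (simp add: F_def mat_powi_cancel[OF M])
      also have "ennreal (rpow (mat_opnorm (?P j)) (2 * r)) * (ennreal C * \<dots>)
         \<le> ennreal (rpow (mat_opnorm (?P j)) (2 * r)) * (ennreal C * (ennreal (rpow (mat_opnorm (?P (- j))) (2 * n)) * Hs_seminorm2 n f))"
        unfolding Hs_seminorm2_def using n0 by (intro mult_left_mono seminorm_matrix_le inv) auto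
      also have "\<dots> = ennreal (C * rpow (mat_opnorm (?P j)) (2 * r) * rpow (mat_opnorm (?P (- j))) (2 * n)) * Hs_seminorm2 n f"
        using C0 by (simp add: ennreal_mult mult_ac)
      finally show "Hs_seminorm2 r (\<lambda>\<psi>. f \<psi> - quasi_proj s M \<phi> \<phi>' j f \<psi>)
             \<le> ennreal (C * rpow (mat_opnorm (?P j)) (2 * r) * rpow (mat_opnorm (?P (- j))) (2 * n)) * Hs_seminorm2 n f" .
    qed
  qed
  show ?thesis using first second by blast
qed

end
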